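(* Fix $N\ge1$ and the index valences $\varsigma=(2,\ldots,2)$ of length $2N$. For any $\hat\alpha\in\mathrm{LP}_\varsigma$, the function $\mathcal{Z}_{\hat\alpha}:\mathfrak{X}_{2N}\to\mathbb{R}_{>0}$ satisfies the following, with $\kappa=4$ and $H=1$. (1) Partial differential equations of third order: for all $j\in\{1,\ldots,2N\}$, $$\left[\frac{\partial^3}{\partial y_j^3}-\frac{16}{\kappa}\mathcal{L}^{(j)}_{-2}\frac{\partial}{\partial y_j}+\frac{8(8-\kappa)}{\kappa^2}\mathcal{L}^{(j)}_{-3}\right]\mathcal{Z}_{\hat\alpha}(y_1,\ldots,y_{2N})=0,$$ where $$\mathcal{L}^{(j)}_{-2}=\sum_{i\ne j}\left(\frac{H}{(y_i-y_j)^2}-\frac{1}{y_i-y_j}\frac{\partial}{\partial y_i}\right),\qquad \mathcal{L}^{(j)}_{-3}=\sum_{i\ne j}\left(\frac{2H}{(y_i-y_j)^3}-\frac{1}{(y_i-y_j)^2}\frac{\partial}{\partial y_i}\right).$$ (2) M\"obius covariance: for all M\"obius maps $\varphi$ of $\mathbb{H}$ such that $\varphi(y_1)<\cdots<\varphi(y_{2N})$, $$\mathcal{Z}_{\hat\alpha}(y_1,\ldots,y_{2N})=\prod_{i=1}^{2N}\varphi'(y_i)^H\times\mathcal{Z}_{\hat\alpha}(\varphi(y_1),\ldots,\varphi(y_{2N})).$$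
   Context: Planar link patterns: for $\varsigma=(s_1,\ldots,s_p)\in\mathbb{Z}_{>0}^p$ with $\sum s_i=2\ell$ even, $\mathrm{LP}_\varsigma$ is the set of collections (multisets) of $\ell$ links $\{c,d\}$ between distinct indices in $\{1,\ldots,p\}$ such that each index $i$ is an endpoint of exactly $s_i$ links and the links can be drawn as curves in a simply connected domain with $p$ marked boundary points (in counterclockwise order) without intersecting except at common endpoints. $\mathrm{PP}_n=\mathrm{LP}_{(1,\ldots,1)}$ (length $2n$) is the set of planar pair partitions of $\{1,\ldots,2n\}$. The map $\tau:\mathrm{LP}_\varsigma\to\mathrm{PP}_\ell$ splits, for each $j$, the $j$th point into $s_j$ consecutive distinct points and attaches to them, in the planar way, the $s_j$ links ending at $j$, so that each new point has valence one. Dyck paths: $\mathrm{DP}_n$ is the set of Dyck paths of $2n$ steps. Write $\alpha\in\mathrm{PP}_n$ as $\{\{a_1,b_1\},\ldots,\{a_n,b_n\}\}$ with $a_1<\cdots<a_n$ and $a_i<b_i$; it is identified with the Dyck path with up-steps at $k\in\{a_1,\ldots,a_n\}$ and down-steps at $k\in\{b_1,\ldots,b_n\}$ (a bijection $\mathrm{PP}_n\leftrightarrow\mathrm{DP}_n$). Let $\mathcal{M}_{\alpha,\beta}=1$ if there is a permutation $\sigma$ with $\beta=\{\{a_1,b_{\sigma(1)}\},\ldots,\{a_n,b_{\sigma(n)}\}\}$, and $0$ otherwise; the matrix $\mathcal{M}$ on $\mathrm{PP}_n$ is invertible. Partition functions ($\kappa=4$): $\mathfrak{X}_m=\{(x_1,\ldots,x_m)\in\mathbb{R}^m:x_1<\cdots<x_m\}$.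 For $\alpha\in\mathrm{DP}_n$, $\mathcal{U}_\alpha(x_1,\ldots,x_{2n})=\prod_{1\le i<j\le2n}(x_j-x_i)^{\frac12\vartheta_\alpha(i,j)}$, with $\vartheta_\alpha(i,j)=+1$ if $i,j\in\{a_1,\ldots,a_n\}$ or $i,j\in\{b_1,\ldots,b_n\}$ and $-1$ otherwise. The pure partition functions for multiple $\mathrm{SLE}_4$ are $\mathcal{Z}_\alpha=\sum_{\beta\in\mathrm{DP}_n}\mathcal{M}^{-1}_{\alpha,\beta}\mathcal{U}_\beta$, $\alpha\in\mathrm{PP}_n$; they are positive. For $\hat\alpha\in\mathrm{LP}_{(2,\ldots,2)}$ (length $2N$), with $\alpha=\tau(\hat\alpha)\in\mathrm{PP}_{2N}$ and $y_1<\cdots<y_{2N}$, $$\mathcal{Z}_{\hat\alpha}(y_1,\ldots,y_{2N})=\lim_{\substack{x_{2j-1},x_{2j}\to y_j\\ \forall 1\le j\le2N}}\frac{\mathcal{Z}_\alpha(x_1,\ldots,x_{4N})}{\prod_{j=1}^{2N}(x_{2j}-x_{2j-1})^{1/2}},\qquad x_1<\cdots<x_{4N}$$ (the limit exists). *)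

theory Defs
  imports "HOL-Analysis.Analysis"
begin

text \<open>Vectors of length $m$ are functions on \<^typ>\<open>nat\<close>, of which only the coordinates
  $1, \dots, m$ matter; all indices start at $1$.\<close>

section \<open>Link patterns\<close>

type_synonym link_pattern = "nat set multiset"

text \<open>The simply connected domain is the upper half-plane, with marked points
  $1 < 2 < \dots < p$ on the real line (in counterclockwise order). The pair \<open>(e, k)\<close> with
  \<open>k < count L e\<close> stands for the \<open>k\<close>-th copy of the link \<open>e\<close> in the multiset \<open>L\<close>.\<close>

definition planar_links :: "link_pattern \<Rightarrow> bool" where
  "planar_links L \<longleftrightarrow>
    (\<exists>\<gamma> :: nat set \<times> nat \<Rightarrow> real \<Rightarrow> complex.
      (\<forall>e k. k < count L e \<longrightarrow>
        arc (\<gamma> (e, k)) \<and>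
        {pathstart (\<gamma> (e, k)), pathfinish (\<gamma> (e, k))} = of_nat ` e \<and>
        (\<forall>t\<in>{0<..<1}. Im (\<gamma> (e, k) t) > 0)) \<and>
      (\<forall>e k e' k'. k < count L e \<longrightarrow> k' < count L e' \<longrightarrow> (e, k) \<noteq> (e', k') \<longrightarrow>
        path_image (\<gamma> (e, k)) \<inter> path_image (\<gamma> (e', k')) \<subseteq> of_nat ` (e \<inter> e')))"

text \<open>The valence $s_i$ is \<open>s ! (i - 1)\<close>.\<close>

definition link_patterns :: "nat list \<Rightarrow> link_pattern set" where
  "link_patterns s = {L.
     2 * size L = sum_list s \<and>
     (\<forall>e\<in>#L. \<exists>c\<in>{1..length s}. \<exists>d\<in>{1..length s}. c \<noteq> d \<and> e = {c, d}) \<and>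
     (\<forall>i\<in>{1..length s}. size {#e \<in># L. i \<in> e#} = s ! (i - 1)) \<and>
     planar_links L}"

definition pair_partitions :: "nat \<Rightarrow> link_pattern set" where
  "pair_partitions n = link_patterns (replicate (2 * n) 1)"

text \<open>\<open>parent s k\<close> is the point of the original pattern from which the \<open>k\<close>-th point arises
  after the \<open>j\<close>-th point has been split into $s_j$ consecutive points, for all \<open>j\<close>.\<close>

definition parent :: "nat list \<Rightarrow> nat \<Rightarrow> nat" where
  "parent s k = (LEAST j. k \<le> sum_list (take j s))"

text \<open>The map $\tau$: the planar way of attaching the links of \<open>L\<close> to the split points, one link
  per point, is unique.\<close>

definition split_pattern :: "nat list \<Rightarrow> link_pattern \<Rightarrow> link_pattern" where
  "split_pattern s L =
    (THE \<alpha>. \<alpha> \<in> pair_partitions (sum_list s div 2) \<and> image_mset (\<lambda>e. parent s ` e) \<alpha> = L)"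

section \<open>The incidence matrix\<close>

text \<open>\<open>pairs_repr n \<alpha> a b\<close>: $\alpha = \{\{a_1,b_1\},\dots,\{a_n,b_n\}\}$ with $a_1<\dots<a_n$ and
  $a_i<b_i$. For \<open>\<alpha>\<close> in \<open>pair_partitions n\<close>, this determines \<open>a\<close> and \<open>b\<close> on $\{1,\dots,n\}$.\<close>

definition pairs_repr :: "nat \<Rightarrow> link_pattern \<Rightarrow> (nat \<Rightarrow> nat) \<Rightarrow> (nat \<Rightarrow> nat) \<Rightarrow> bool" where
  "pairs_repr n \<alpha> a b \<longleftrightarrow>
     strict_mono_on {1..n} a \<and> (\<forall>i\<in>{1..n}. a i < b i) \<and>
     \<alpha> = {#{a i, b i}. i \<in># mset_set {1..n}#}"

definition incidence :: "nat \<Rightarrow> link_pattern \<Rightarrow> link_pattern \<Rightarrow> real" where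
  "incidence n \<alpha> \<beta> =
    (if \<exists>a b \<sigma>. pairs_repr n \<alpha> a b \<and> \<sigma> permutes {1..n} \<and>
          \<beta> = {#{a i, b (\<sigma> i)}. i \<in># mset_set {1..n}#}
     then 1 else 0)"

definition incidence_inv :: "nat \<Rightarrow> link_pattern \<Rightarrow> link_pattern \<Rightarrow> real" where
  "incidence_inv n =
    (THE K.
      (\<forall>\<alpha>\<in>pair_partitions n. \<forall>\<beta>\<in>pair_partitions n.
        (\<Sum>\<gamma>\<in>pair_partitions n. K \<alpha> \<gamma> * incidence n \<gamma> \<beta>) = (if \<alpha> = \<beta> then 1 else 0) \<and>
        (\<Sum>\<gamma>\<in>pair_partitions n. incidence n \<alpha> \<gamma> * K \<gamma> \<beta>) = (if \<alpha> = \<beta> then 1 else 0)) \<and>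
      (\<forall>\<alpha> \<beta>. \<alpha> \<notin> pair_partitions n \<or> \<beta> \<notin> pair_partitions n \<longrightarrow> K \<alpha> \<beta> = 0))"

section \<open>Partition functions at $\kappa = 4$\<close>

definition chamber :: "nat \<Rightarrow> (nat \<Rightarrow> real) set" where
  "chamber m = {x. strict_mono_on {1..m} x}"

text \<open>Dyck paths are represented by the planar pair partitions with which they are identified:
  the up-steps are at the left endpoints $a_i$ of the links, the down-steps at the right
  endpoints $b_i$.\<close>

definition up_steps :: "link_pattern \<Rightarrow> nat set" where
  "up_steps \<alpha> = Min ` set_mset \<alpha>"

definition down_steps :: "link_pattern \<Rightarrow> nat set" where
  "down_steps \<alpha> = Max ` set_mset \<alpha>"

definition vartheta :: "link_pattern \<Rightarrow> nat \<Rightarrow> nat \<Rightarrow> real" where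
  "vartheta \<alpha> i j =
    (if i \<in> up_steps \<alpha> \<and> j \<in> up_steps \<alpha> \<or> i \<in> down_steps \<alpha> \<and> j \<in> down_steps \<alpha>
     then 1 else -1)"

definition U_conformal :: "nat \<Rightarrow> link_pattern \<Rightarrow> (nat \<Rightarrow> real) \<Rightarrow> real" where
  "U_conformal n \<alpha> x =
    (\<Prod>(i, j)\<in>{(i, j). 1 \<le> i \<and> i < j \<and> j \<le> 2 * n}. (x j - x i) powr (1/2 * vartheta \<alpha> i j))"

definition Z_pure :: "nat \<Rightarrow> link_pattern \<Rightarrow> (nat \<Rightarrow> real) \<Rightarrow> real" where
  "Z_pure n \<alpha> x = (\<Sum>\<beta>\<in>pair_partitions n. incidence_inv n \<alpha> \<beta> * U_conformal n \<beta> x)"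

text \<open>The filter of the limit $x_{2j-1}, x_{2j} \to y_j$ for all $1 \le j \le 2N$, with
  $x_1 < \dots < x_{4N}$.\<close>

definition fusion_filter :: "nat \<Rightarrow> (nat \<Rightarrow> real) \<Rightarrow> (nat \<Rightarrow> real) filter" where
  "fusion_filter N y =
    inf (INF j\<in>{1..2*N}. inf (filtercomap (\<lambda>x. x (2*j-1)) (nhds (y j)))
                             (filtercomap (\<lambda>x. x (2*j)) (nhds (y j))))
        (principal (chamber (4*N)))"

definition fusion_quotient :: "nat \<Rightarrow> link_pattern \<Rightarrow> (nat \<Rightarrow> real) \<Rightarrow> real" where
  "fusion_quotient N L x =
    Z_pure (2*N) (split_pattern (replicate (2*N) 2) L) x /
    (\<Prod>j=1..2*N. (x (2*j) - x (2*j-1)) powr (1/2))"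

definition Z_fused :: "nat \<Rightarrow> link_pattern \<Rightarrow> (nat \<Rightarrow> real) \<Rightarrow> real" where
  "Z_fused N L y = Lim (fusion_filter N y) (fusion_quotient N L)"

section \<open>Differential operators and Moebius maps\<close>

definition pderiv_at :: "nat \<Rightarrow> ((nat \<Rightarrow> real) \<Rightarrow> real) \<Rightarrow> (nat \<Rightarrow> real) \<Rightarrow> real" where
  "pderiv_at i f y = deriv (\<lambda>t. f (y(i := t))) (y i)"

definition pdifferentiable :: "nat \<Rightarrow> ((nat \<Rightarrow> real) \<Rightarrow> real) \<Rightarrow> (nat \<Rightarrow> real) \<Rightarrow> bool" where
  "pdifferentiable i f y \<longleftrightarrow> (\<lambda>t. f (y(i := t))) field_differentiable (at (y i))"

definition L_minus2 ::
  "real \<Rightarrow> nat \<Rightarrow> nat \<Rightarrow> ((nat \<Rightarrow> real) \<Rightarrow> real) \<Rightarrow> (nat \<Rightarrow> real) \<Rightarrow> real" where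
  "L_minus2 H m j f y =
    (\<Sum>i\<in>{1..m} - {j}. H / (y i - y j)^2 * f y - 1 / (y i - y j) * pderiv_at i f y)"

definition L_minus3 ::
  "real \<Rightarrow> nat \<Rightarrow> nat \<Rightarrow> ((nat \<Rightarrow> real) \<Rightarrow> real) \<Rightarrow> (nat \<Rightarrow> real) \<Rightarrow> real" where
  "L_minus3 H m j f y =
    (\<Sum>i\<in>{1..m} - {j}. 2 * H / (y i - y j)^3 * f y - 1 / (y i - y j)^2 * pderiv_at i f y)"

text \<open>The action on the real line of the Moebius map of the upper half-plane with coefficients
  \<open>a, b, c, d\<close>, where $ad - bc > 0$; at the pole the value is the arbitrary number 0.\<close>

definition moebius_map :: "real \<Rightarrow> real \<Rightarrow> real \<Rightarrow> real \<Rightarrow> real \<Rightarrow> real" where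
  "moebius_map a b c d x = (a * x + b) / (c * x + d)"

end

(* Multiplied by the product of the (x_k - x_i)^(1/2), a conformal block U_beta is a product of two
   complementary Vandermonde minors, and M^(-1) expresses such products in a basis of Temperley-Lieb
   immanants: the pure partition function of alpha is the coefficient at alpha. Divided by the
   x_{2j} - x_{2j-1}, the coefficient of an unlinked matching extends to the diagonal as the same
   coefficient of a matrix of divided differences, which gives the limit; total positivity of divided
   differences (Neville elimination), together with a combinatorial transition rule for the
   coefficients, gives the sign.
   For the differential equation a single pair of points is merged first. Each conformal block then
   turns into a correlator of vertex operators with charge 1 or 0 at the merged point, and both kinds
   satisfy the third order null vector equation by direct computation; the remaining pairs are merged
   by continuity. Moebius covariance passes to the limit from the conformal blocks, since each point
   carries total exponent -1. *)

theory Submission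
  imports Defs "Jordan_Normal_Form.Determinant"
begin

text \<open>The inverse of the incidence matrix has entries of both signs as soon as there are two
  links, and a block with one left and one right endpoint at \<open>x (2 * j - 1)\<close> and
  \<open>x (2 * j)\<close> diverges after the division, like the inverse of their distance. So
  neither the limit nor its sign can be read off term by term. For this reason the coefficients are
  carried through row operations: with multipliers \<open>t \<ge> 0\<close> the rule
  \<open>step_coeff\<close> has no subtraction. An operation replaces a row by its neighbour and so
  destroys complementarity; hence the double rows \<open>P\<close>, although the coefficient that is
  wanted has none. Positivity at distinct points could still be lost on the diagonal. What survives
  is a lower bound free of the small differences, obtained by following one history backwards in
  which each of them enters exactly once. In the differential equation the poles cancel without a
  computation: the limit is known to exist, which forces the residues to add up to zero and leaves a
  derivative. The operator singles out one \<open>y j\<close>, so the other pairs may stay apart in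
  the computation, as two points of weight 1/4 each instead of one of weight 1.\<close>

section \<open>Noncrossing matchings\<close>

text \<open>A noncrossing perfect matching of a finite set \<open>X\<close> is encoded as the involution of
  \<^typ>\<open>nat\<close> that exchanges partners and fixes every point outside \<open>X\<close>.\<close>

definition webs :: "nat set \<Rightarrow> (nat \<Rightarrow> nat) set" where
  "webs X = {p. (\<forall>x. p (p x) = x) \<and> {x. p x \<noteq> x} = X \<and>
     (\<forall>x y. x < y \<longrightarrow> y < p x \<longrightarrow> \<not> p x < p y)}"

definition ups :: "(nat \<Rightarrow> nat) \<Rightarrow> nat set" where
  "ups p = {x. x < p x}"

text \<open>A two-colouring of the points by \<open>S\<close>. With \<open>S = ups a\<close> this is
  the incidence relation of the matchings \<open>a\<close> and \<open>p\<close>, see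
  \<open>incidence_pattern\<close>.\<close>

definition compat :: "nat set \<Rightarrow> (nat \<Rightarrow> nat) \<Rightarrow> bool" where
  "compat S p \<longleftrightarrow> (\<forall>x. p x \<noteq> x \<longrightarrow> (x \<in> S) \<noteq> (p x \<in> S))"

lemma webs_invol: "p \<in> webs X \<Longrightarrow> p (p x) = x"
  by (auto simp: webs_def)

lemma webs_mem: "p \<in> webs X \<Longrightarrow> p x \<noteq> x \<longleftrightarrow> x \<in> X"
  by (auto simp: webs_def)

lemma webs_fix: "p \<in> webs X \<Longrightarrow> x \<notin> X \<Longrightarrow> p x = x"
  by (auto simp: webs_def)

lemma webs_in: "p \<in> webs X \<Longrightarrow> x \<in> X \<Longrightarrow> p x \<in> X"
  by (auto simp: webs_def)

lemma webs_support: "p \<in> webs X \<Longrightarrow> {x. p x \<noteq> x} = X"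
  by (auto simp: webs_def)

lemma webs_nocross: "p \<in> webs X \<Longrightarrow> x < y \<Longrightarrow> y < p x \<Longrightarrow> p x < p y \<Longrightarrow> False"
  by (auto simp: webs_def)

lemma webs_nested:
  assumes "p \<in> webs X" "x < y" "y < p x"
  shows "x < p y" "p y < p x"
proof -
  note inv = webs_invol[OF assms(1)]
  have "p y \<noteq> p x" "p y \<noteq> x" using assms inv by (metis less_irrefl)+
  moreover have "\<not> p x < p y" using webs_nocross assms by blast
  moreover have "\<not> p y < x"
    using webs_nocross[OF assms(1), of "p y" x] assms inv by auto
  ultimately show "x < p y" "p y < p x" by auto
qed

lemma websI:
  assumes "\<And>x. p (p x) = x" "\<And>x. p x \<noteq> x \<longleftrightarrow> x \<in> X"
    "\<And>x y. x < y \<Longrightarrow> y < p x \<Longrightarrow> p x < p y \<Longrightarrow> False"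
  shows "p \<in> webs X"
  using assms unfolding webs_def by blast

lemma finite_webs: assumes "finite X" shows "finite (webs X)"
proof (rule finite_imageD)
  show "finite ((\<lambda>p. restrict p X) ` webs X)"
  proof (rule finite_subset)
    show "(\<lambda>p. restrict p X) ` webs X \<subseteq> X \<rightarrow>\<^sub>E X"
      by (auto simp: PiE_def extensional_def intro: webs_in)
    show "finite (X \<rightarrow>\<^sub>E X)" using assms by (simp add: finite_PiE)
  qed
  show "inj_on (\<lambda>p. restrict p X) (webs X)"
  proof (rule inj_onI, rule ext)
    fix p q x assume "p \<in> webs X" "q \<in> webs X" "restrict p X = restrict q X"
    then show "p x = q x"
      by (cases "x \<in> X") (metis restrict_apply', simp add: webs_fix)
  qed
qed

section \<open>Left endpoints determine a noncrossing matching; the incidence matrix is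
  unitriangular\<close>

lemma ups_subset: "p \<in> webs X \<Longrightarrow> ups p \<subseteq> X"
  using webs_mem[of p X] by (force simp: ups_def)

lemma down_iff: "p \<in> webs X \<Longrightarrow> x \<in> X \<Longrightarrow> x \<notin> ups p \<longleftrightarrow> p x < x"
  using webs_mem[of p X x] by (auto simp: ups_def)

lemma compat_ups_self: "p \<in> webs X \<Longrightarrow> compat (ups p) p"
  unfolding compat_def ups_def using webs_invol by (metis mem_Collect_eq less_asym' linorder_neqE_nat)

text \<open>Used at the largest left endpoint \<open>x\<close> at which the matchings differ. The
  point \<open>p x\<close> is a right endpoint for \<open>q\<close> as well. Its
  \<open>q\<close>-partner is nested under the \<open>q\<close>-link of \<open>x\<close>, hence is a
  left endpoint beyond \<open>x\<close>, where both matchings agree; so it would also be the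
  \<open>p\<close>-partner of \<open>p x\<close>, which is \<open>x\<close>.\<close>

lemma ups_inj_aux:
  assumes p: "p \<in> webs X" and q: "q \<in> webs X" and u: "ups p = ups q"
    and x: "x \<in> ups p" "p x < q x"
    and max: "\<And>z. z \<in> ups p \<Longrightarrow> x < z \<Longrightarrow> p z = q z"
  shows False
proof -
  have 1: "x < p x" using x by (simp add: ups_def)
  have "p x \<in> X" using webs_in[OF p] ups_subset[OF p] x by blast
  moreover have "p x \<notin> ups p" using 1 webs_invol[OF p, of x] by (simp add: ups_def)
  ultimately have 2: "q (p x) < p x" using down_iff[OF q] u by auto
  have 3: "x < q (p x)" using webs_nested[OF q 1 x(2)] by simp
  have "q (p x) \<in> ups q" using 2 webs_invol[OF q] by (simp add: ups_def)
  then have "p (q (p x)) = q (q (p x))" using max 3 u by auto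
  then have "p (q (p x)) = p x" using webs_invol[OF q] by simp
  then have "q (p x) = x" using webs_invol[OF p] by metis
  then show False using 3 by simp
qed

lemma ups_inj:
  assumes X: "finite X" and p: "p \<in> webs X" and q: "q \<in> webs X" and u: "ups p = ups q"
  shows "p = q"
proof (rule ccontr)
  assume "p \<noteq> q"
  then obtain z where z: "p z \<noteq> q z" by blast
  then have zX: "z \<in> X" using webs_fix[OF p] webs_fix[OF q] by metis
  define B where "B = {x \<in> ups p. p x \<noteq> q x}"
  have finB: "finite B" using finite_subset[OF ups_subset[OF p] X] by (simp add: B_def)
  have "B \<noteq> {}"
  proof (cases "z \<in> ups p")
    case True then show ?thesis using z by (auto simp: B_def)
  next
    case False
    then have "p z < z" using down_iff[OF p zX] by simp
    then have "p z \<in> ups p" using webs_invol[OF p] by (simp add: ups_def)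
    moreover have "p (p z) \<noteq> q (p z)" using z webs_invol[OF p] webs_invol[OF q] by metis
    ultimately show ?thesis by (auto simp: B_def)
  qed
  define x where "x = Max B"
  have xB: "x \<in> B" using finB \<open>B \<noteq> {}\<close> by (simp add: x_def)
  have mx: "p w = q w" if "w \<in> ups p" "x < w" for w
    using that Max_ge[OF finB, of w] unfolding x_def B_def[symmetric] by (cases "w \<in> B") (auto simp: B_def)
  consider "p x < q x" | "q x < p x" using xB by (force simp: B_def)
  then show False
  proof cases
    case 1 then show ?thesis using ups_inj_aux[OF p q u _ 1] xB mx by (auto simp: B_def)
  next
    case 2 then show ?thesis using ups_inj_aux[OF q p u[symmetric] _ 2] xB mx u by (auto simp: B_def)
  qed
qed

text \<open>Each link of \<open>b\<close> has exactly one end in \<open>ups a\<close>, and going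
  from its left end to that end never decreases the index. So the sum of the left endpoints grows
  from \<open>ups b\<close> to \<open>ups a\<close>, strictly unless the two sets agree, in which
  case the matchings do.\<close>

lemma compat_ups_triangular:
  assumes X: "finite X" and a: "a \<in> webs X" and b: "b \<in> webs X" and c: "compat (ups a) b"
  shows "a = b \<or> \<Sum>(ups b) < \<Sum>(ups a)"
proof -
  \<comment> \<open>For a left endpoint \<open>z\<close> of \<open>b\<close>, \<open>f z\<close> is
    the end of its link that lies in \<open>ups a\<close>.\<close>
  define f where "f z = (if z \<in> ups a then z else b z)" for z
  have fa: "finite (ups a)" and fb: "finite (ups b)"
    using finite_subset[OF ups_subset X] a b by blast+
  have bb: "b z \<notin> ups b" if "z \<in> ups b" for z
    using that webs_invol[OF b] by (simp add: ups_def)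
  have bij: "bij_betw f (ups b) (ups a)"
    unfolding bij_betw_def
  proof (intro conjI equalityI subsetI)
    show "inj_on f (ups b)"
      using bb webs_invol[OF b] by (auto simp: inj_on_def f_def split: if_splits) metis+
  next
    fix w assume "w \<in> f ` ups b"
    then show "w \<in> ups a" using c unfolding compat_def f_def ups_def by (auto split: if_splits)
  next
    fix w assume w: "w \<in> ups a"
    show "w \<in> f ` ups b"
    proof (cases "w \<in> ups b")
      case True then show ?thesis using w by (force simp: f_def)
    next
      case False
      have "w \<in> X" using w ups_subset[OF a] by auto
      then have "b w < w" using down_iff[OF b] False by simp
      then have 1: "b w \<in> ups b" using webs_invol[OF b, of w] by (simp add: ups_def)
      have "b w \<notin> ups a"
        using c w \<open>b w < w\<close> unfolding compat_def by (metis less_irrefl)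
      then have "f (b w) = w" using webs_invol[OF b, of w] by (simp add: f_def)
      then show ?thesis using 1 by force
    qed
  qed
  have fge: "z \<le> f z" if "z \<in> ups b" for z using that by (auto simp: f_def ups_def)
  have s: "\<Sum>(ups a) = (\<Sum>z\<in>ups b. f z)"
    using sum.reindex_bij_betw[OF bij, of "\<lambda>z. z"] by simp
  show ?thesis
  proof (cases "\<forall>z\<in>ups b. f z = z")
    case True
    then have "f ` ups b = ups b" by force
    then have "ups a = ups b" using bij by (simp add: bij_betw_def)
    then show ?thesis using ups_inj[OF X a b] by simp
  next
    case False
    then obtain z where "z \<in> ups b" "z < f z" using fge by fastforce
    then have "\<Sum>(ups b) < (\<Sum>z\<in>ups b. f z)"
      using sum_strict_mono_ex1[OF fb, of "\<lambda>z. z" f] fge by auto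
    then show ?thesis using s by simp
  qed
qed

text \<open>Strong induction on the weight: row \<open>a\<close> of the inverse is the unit row,
  corrected by the rows of smaller weight with the entries of \<open>M\<close> as
  multipliers.\<close>

lemma unitriangular_left_inverse:
  fixes M :: "'a \<Rightarrow> 'a \<Rightarrow> real" and w :: "'a \<Rightarrow> nat"
  assumes A: "finite A" and d: "\<And>a. a \<in> A \<Longrightarrow> M a a = 1"
    and t: "\<And>a b. a \<in> A \<Longrightarrow> b \<in> A \<Longrightarrow> M a b \<noteq> 0 \<Longrightarrow> a = b \<or> w b < w a"
  shows "\<exists>K. \<forall>a\<in>A. \<forall>b\<in>A. (\<Sum>c\<in>A. K a c * M c b) = of_bool (a = b)"
proof -
  have "\<exists>k. \<forall>b\<in>A. (\<Sum>c\<in>A. k c * M c b) = of_bool (a = b)" if "a \<in> A" for a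
    using that
  proof (induction "w a" arbitrary: a rule: less_induct)
    case less
    define B where "B = {e \<in> A. w e < w a}"
    have "\<forall>e\<in>B. \<exists>k. \<forall>b\<in>A. (\<Sum>c\<in>A. k c * M c b) = of_bool (e = b)"
      using less by (auto simp: B_def)
    then obtain kk where kk: "\<And>e b. e \<in> B \<Longrightarrow> b \<in> A \<Longrightarrow> (\<Sum>c\<in>A. kk e c * M c b) = of_bool (e = b)"
      by metis
    define k where "k c = of_bool (c = a) - (\<Sum>e\<in>B. M a e * kk e c)" for c
    have "(\<Sum>c\<in>A. k c * M c b) = of_bool (a = b)" if b: "b \<in> A" for b
    proof -
      have "(\<Sum>c\<in>A. k c * M c b) = (\<Sum>c\<in>A. of_bool (c = a) * M c b) - (\<Sum>c\<in>A. \<Sum>e\<in>B. M a e * kk e c * M c b)"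
        by (simp add: k_def left_diff_distrib sum_subtractf sum_distrib_right)
      also have "(\<Sum>c\<in>A. of_bool (c = a) * M c b) = M a b"
        using A less.prems by (simp add: of_bool_def if_distrib[of "\<lambda>x. x * _"] sum.delta' cong: if_cong)
      also have "(\<Sum>c\<in>A. \<Sum>e\<in>B. M a e * kk e c * M c b) = (\<Sum>e\<in>B. M a e * (\<Sum>c\<in>A. kk e c * M c b))"
        by (subst sum.swap) (simp add: sum_distrib_left mult.assoc)
      also have "\<dots> = (\<Sum>e\<in>B. M a e * of_bool (e = b))" by (rule sum.cong) (auto simp: kk b)
      also have "\<dots> = of_bool (b \<in> B) * M a b"
        using A by (auto simp: B_def of_bool_def if_distrib[of "\<lambda>x. _ * x"] sum.delta' cong: if_cong)
      also have "M a b - of_bool (b \<in> B) * M a b = of_bool (a = b)"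
        using t[OF less.prems b] d[OF b] b by (auto simp: B_def)
      finally show ?thesis .
    qed
    then show ?case by blast
  qed
  then show ?thesis by metis
qed

text \<open>The transpose is unitriangular for the reversed weight \<open>w'\<close>, so the
  preceding lemma also yields a right inverse, and by associativity the two coincide. The truncated
  subtraction in \<open>w'\<close> reverses the order strictly because each weight is at most the
  total (\<open>le\<close>).\<close>

lemma unitriangular_inverse:
  fixes M :: "'a \<Rightarrow> 'a \<Rightarrow> real" and w :: "'a \<Rightarrow> nat"
  assumes A: "finite A" and d: "\<And>a. a \<in> A \<Longrightarrow> M a a = 1"
    and t: "\<And>a b. a \<in> A \<Longrightarrow> b \<in> A \<Longrightarrow> M a b \<noteq> 0 \<Longrightarrow> a = b \<or> w b < w a"
  shows "\<exists>K. (\<forall>a\<in>A. \<forall>b\<in>A. (\<Sum>c\<in>A. K a c * M c b) = of_bool (a = b)) \<and>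
             (\<forall>a\<in>A. \<forall>b\<in>A. (\<Sum>c\<in>A. M a c * K c b) = of_bool (a = b))"
proof -
  have "\<exists>K. \<forall>a\<in>A. \<forall>b\<in>A. (\<Sum>c\<in>A. K a c * M c b) = of_bool (a = b)"
    by (rule unitriangular_left_inverse[OF A, where w = w]) (use d t in auto)
  then obtain K where K: "\<And>a b. a \<in> A \<Longrightarrow> b \<in> A \<Longrightarrow> (\<Sum>c\<in>A. K a c * M c b) = of_bool (a = b)"
    by blast
  define w' where "w' a = \<Sum>(w ` A) - w a" for a
  have le: "w a \<le> \<Sum>(w ` A)" if "a \<in> A" for a
    using that A by (intro member_le_sum) auto
  have "\<exists>L. \<forall>a\<in>A. \<forall>b\<in>A. (\<Sum>c\<in>A. L a c * M b c) = of_bool (a = b)"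
  proof (rule unitriangular_left_inverse[OF A, where w = w'])
    fix a b assume "a \<in> A" "b \<in> A" "M b a \<noteq> 0"
    then show "a = b \<or> w' b < w' a"
      using t[of b a] le[of a] le[of b] unfolding w'_def by auto
  qed (use d in auto)
  then obtain L0 where L0: "\<And>a b. a \<in> A \<Longrightarrow> b \<in> A \<Longrightarrow> (\<Sum>c\<in>A. L0 a c * M b c) = of_bool (a = b)"
    by blast
  define L where "L = L0"
  have L: "(\<Sum>c\<in>A. M a c * L b c) = of_bool (a = b)" if "a \<in> A" "b \<in> A" for a b
    using L0[OF that(2,1)] by (simp add: L_def mult.commute eq_commute)
  have KL: "K a b = L b a" if a: "a \<in> A" and b: "b \<in> A" for a b
  proof -
    have "K a b = (\<Sum>c\<in>A. K a c * of_bool (c = b))"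
      using A b by (simp add: of_bool_def if_distrib[of "\<lambda>x. _ * x"] sum.delta' cong: if_cong)
    also have "\<dots> = (\<Sum>c\<in>A. \<Sum>e\<in>A. K a c * M c e * L b e)"
      using b by (intro sum.cong refl) (simp add: L mult.assoc flip: sum_distrib_left)
    also have "\<dots> = (\<Sum>e\<in>A. (\<Sum>c\<in>A. K a c * M c e) * L b e)"
      by (subst sum.swap) (simp add: sum_distrib_right)
    also have "\<dots> = (\<Sum>e\<in>A. of_bool (e = a) * L b e)"
      using a by (intro sum.cong) (auto simp: K)
    also have "\<dots> = L b a"
      using A a by (simp add: of_bool_def if_distrib[of "\<lambda>x. x * _"] sum.delta' cong: if_cong)
    finally show ?thesis .
  qed
  have "(\<Sum>c\<in>A. M a c * K c b) = of_bool (a = b)" if "a \<in> A" "b \<in> A" for a b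
    using L[OF that] KL that by simp
  with K show ?thesis by blast
qed

text \<open>A choice without ambiguity, since a two-sided inverse is unique on
  \<open>webs X\<close>. Ground sets other than an initial segment are needed because double rows
  leave fewer points to be matched.\<close>

definition web_inv :: "nat set \<Rightarrow> (nat \<Rightarrow> nat) \<Rightarrow> (nat \<Rightarrow> nat) \<Rightarrow> real" where
  "web_inv X = (SOME K.
     (\<forall>a\<in>webs X. \<forall>b\<in>webs X. (\<Sum>c\<in>webs X. K a c * of_bool (compat (ups c) b)) = of_bool (a = b)) \<and>
     (\<forall>a\<in>webs X. \<forall>b\<in>webs X. (\<Sum>c\<in>webs X. of_bool (compat (ups a) c) * K c b) = of_bool (a = b)))"

lemma web_inv:
  assumes X: "finite X"
  shows "\<forall>a\<in>webs X. \<forall>b\<in>webs X. (\<Sum>c\<in>webs X. web_inv X a c * of_bool (compat (ups c) b)) = of_bool (a = b)"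
    and "\<forall>a\<in>webs X. \<forall>b\<in>webs X. (\<Sum>c\<in>webs X. of_bool (compat (ups a) c) * web_inv X c b) = of_bool (a = b)"
proof -
  have "\<exists>K. (\<forall>a\<in>webs X. \<forall>b\<in>webs X. (\<Sum>c\<in>webs X. K a c * of_bool (compat (ups c) b)) = of_bool (a = b)) \<and>
     (\<forall>a\<in>webs X. \<forall>b\<in>webs X. (\<Sum>c\<in>webs X. of_bool (compat (ups a) c) * K c b) = (of_bool (a = b) :: real))"
    by (rule unitriangular_inverse[OF finite_webs[OF X], where w = "\<lambda>a. \<Sum>(ups a)"])
      (use compat_ups_self compat_ups_triangular[OF X] in \<open>auto simp: of_bool_def split: if_splits\<close>)
  from someI_ex[OF this] show
    "\<forall>a\<in>webs X. \<forall>b\<in>webs X. (\<Sum>c\<in>webs X. web_inv X a c * of_bool (compat (ups c) b)) = of_bool (a = b)"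
    "\<forall>a\<in>webs X. \<forall>b\<in>webs X. (\<Sum>c\<in>webs X. of_bool (compat (ups a) c) * web_inv X c b) = of_bool (a = b)"
    unfolding web_inv_def by blast+
qed

text \<open>Inversion of the linear system by which products of minors determine the
  coefficients.\<close>

lemma web_inv_solve:
  fixes d :: "(nat \<Rightarrow> nat) \<Rightarrow> real"
  assumes X: "finite X" and e: "\<And>a. a \<in> webs X \<Longrightarrow> d a = (\<Sum>b\<in>webs X. of_bool (compat (ups a) b) * c b)"
    and a: "a \<in> webs X"
  shows "c a = (\<Sum>b\<in>webs X. web_inv X a b * d b)"
proof -
  have "(\<Sum>b\<in>webs X. web_inv X a b * d b) = (\<Sum>b\<in>webs X. \<Sum>e\<in>webs X. web_inv X a b * of_bool (compat (ups b) e) * c e)"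
    by (intro sum.cong refl) (auto simp: e sum_distrib_left mult.assoc)
  also have "\<dots> = (\<Sum>e\<in>webs X. (\<Sum>b\<in>webs X. web_inv X a b * of_bool (compat (ups b) e)) * c e)"
    by (subst sum.swap) (simp add: sum_distrib_right)
  also have "\<dots> = (\<Sum>e\<in>webs X. of_bool (a = e) * c e)"
    using web_inv(1)[OF X] a by (intro sum.cong refl) auto
  also have "\<dots> = c a"
    using finite_webs[OF X] a by (simp add: of_bool_def if_distrib[of "\<lambda>x. x * _"] sum.delta cong: if_cong)
  finally show ?thesis by simp
qed

section \<open>Expansions of complementary products\<close>

text \<open>A function \<open>D\<close> on the \<open>n\<close>-element subsets of \<open>V\<close> stands for the family of maximal minors of a
  matrix with rows \<open>V\<close> and \<open>n\<close> columns. The coefficients \<open>c P p\<close> generalise the Temperley-Lieb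
  immanants: \<open>P\<close> is the set of rows used twice and \<open>p\<close> matches the rows used once.\<close>

definition web_expansion ::
  "nat set \<Rightarrow> nat \<Rightarrow> (nat set \<Rightarrow> real) \<Rightarrow> (nat set \<Rightarrow> (nat \<Rightarrow> nat) \<Rightarrow> real) \<Rightarrow> bool" where
  "web_expansion V n D c \<longleftrightarrow>
    (\<forall>S T. S \<subseteq> V \<longrightarrow> T \<subseteq> V \<longrightarrow> card S = n \<longrightarrow> card T = n \<longrightarrow>
      D S * D T = (\<Sum>p\<in>webs (sym_diff S T). of_bool (compat S p) * c (S \<inter> T) p))"

abbreviation swp :: "nat \<Rightarrow> nat \<Rightarrow> nat" where
  "swp i \<equiv> Transposition.transpose i (Suc i)"

definition conj_swap :: "nat \<Rightarrow> (nat \<Rightarrow> nat) \<Rightarrow> nat \<Rightarrow> nat" where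
  "conj_swap i p = swp i \<circ> p \<circ> swp i"

text \<open>The cap of the Temperley-Lieb calculus: \<open>i\<close> and \<open>Suc i\<close> are
  removed and their partners joined. If the two were linked to each other, a closed loop disappears;
  this is the source of the factor 2 in \<open>step_coeff\<close>.\<close>

definition cut :: "nat \<Rightarrow> (nat \<Rightarrow> nat) \<Rightarrow> nat \<Rightarrow> nat" where
  "cut i p = (\<lambda>x. if x = i \<or> x = Suc i then x else if p x = i then p (Suc i)
                  else if p x = Suc i then p i else p x)"

definition shift_down :: "nat \<Rightarrow> nat set \<Rightarrow> nat set" where
  "shift_down i S = insert i (S - {Suc i})"

text \<open>The effect on the minors of adding \<open>t\<close> times row \<open>i\<close> to row
  \<open>Suc i\<close>. A set that contains both indices gets no new term, since the new minor would
  have two equal rows.\<close>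

definition row_step :: "nat \<Rightarrow> real \<Rightarrow> (nat set \<Rightarrow> real) \<Rightarrow> nat set \<Rightarrow> real" where
  "row_step i t D S = D S + (if Suc i \<in> S \<and> i \<notin> S then t * D (shift_down i S) else 0)"

definition step_coeff :: "nat \<Rightarrow> real \<Rightarrow> (nat set \<Rightarrow> (nat \<Rightarrow> nat) \<Rightarrow> real) \<Rightarrow> nat set \<Rightarrow> (nat \<Rightarrow> nat) \<Rightarrow> real"
  where
  "step_coeff i t c P p = c P p +
    (if p (Suc i) \<noteq> Suc i \<and> p i = i \<and> i \<notin> P then t * c P (conj_swap i p)
     else if Suc i \<in> P \<and> p i \<noteq> i then t * c (shift_down i P) (conj_swap i p)
     else if p i = Suc i then t * c (insert i P) (cut i p)
     else if Suc i \<in> P \<and> p i = i \<and> i \<notin> P then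
       t * (\<Sum>q\<in>{q\<in>webs (insert i (insert (Suc i) {x. p x \<noteq> x})). cut i q = p}.
              (if q i = Suc i then 2 else 1) * c (P - {Suc i}) q) +
       t\<^sup>2 * c (shift_down i P) p
     else 0)"

section \<open>The transition rule of the coefficients under a row operation\<close>

lemma compat_cong: "p \<in> webs X \<Longrightarrow> S \<inter> X = S' \<inter> X \<Longrightarrow> compat S p \<longleftrightarrow> compat S' p"
proof -
  assume p: "p \<in> webs X" and S: "S \<inter> X = S' \<inter> X"
  have "x \<in> S \<longleftrightarrow> x \<in> S'" if "x \<in> X" for x using S that by blast
  then show ?thesis unfolding compat_def using webs_mem[OF p] webs_in[OF p] by auto
qed

lemma compat_compl:
  assumes "p \<in> webs (sym_diff S T)"
  shows "compat S p \<longleftrightarrow> compat T p"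
proof -
  have "x \<in> S \<longleftrightarrow> x \<notin> T" if "p x \<noteq> x" for x
    using webs_mem[OF assms] that by auto
  moreover have "p x \<in> S \<longleftrightarrow> p x \<notin> T" if "p x \<noteq> x" for x
    using webs_mem[OF assms, of x] webs_in[OF assms, of x] that by auto
  ultimately show ?thesis unfolding compat_def by blast
qed

lemma web_expansionD:
  assumes "web_expansion V n D c" "S \<subseteq> V" "T \<subseteq> V" "card S = n" "card T = n"
    "sym_diff S T = X" "S \<inter> T = P"
  shows "D S * D T = (\<Sum>p\<in>webs X. of_bool (compat S p) * c P p)"
  using assms(1)[unfolded web_expansion_def, rule_format, OF assms(2-5)] unfolding assms(6,7) .

lemma conj_swap_invol: "conj_swap i (conj_swap i p) = p"
  by (simp add: conj_swap_def fun_eq_iff)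

lemma swp_eq_iff: "swp i u = x \<longleftrightarrow> u = swp i x"
  by (auto simp: Transposition.transpose_def)

lemma swp_less_iff:
  assumes "a \<noteq> b" "{a, b} \<noteq> {i, Suc i}"
  shows "swp i a < swp i b \<longleftrightarrow> a < b"
  using assms by (auto simp: Transposition.transpose_def)

text \<open>As only one of \<open>i\<close> and \<open>Suc i\<close> is matched, the transposition
  preserves the order of the matched points, so no crossing can arise.\<close>

lemma conj_swap_webs:
  assumes p: "p \<in> webs X" and i: "i \<in> X \<longleftrightarrow> Suc i \<notin> X"
  shows "conj_swap i p \<in> webs (swp i ` X)"
proof (rule websI)
  let ?t = "swp i"
  fix x y
  show "conj_swap i p (conj_swap i p x) = x"
    using webs_invol[OF p] by (simp add: conj_swap_def)
  have mem: "z \<in> ?t ` X \<longleftrightarrow> ?t z \<in> X" for z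
    by (metis imageE image_eqI Transposition.transpose_involutory)
  show "(conj_swap i p x \<noteq> x) = (x \<in> ?t ` X)"
    unfolding mem conj_swap_def using webs_mem[OF p, of "?t x"] by (simp add: swp_eq_iff)
  assume a: "x < y" "y < conj_swap i p x" "conj_swap i p x < conj_swap i p y"
  define u v where "u = ?t x" and "v = ?t y"
  have x: "x = ?t u" "y = ?t v"
    unfolding u_def v_def by (rule Transposition.transpose_involutory[symmetric])+
  have c: "conj_swap i p x = ?t (p u)" "conj_swap i p y = ?t (p v)"
    by (simp_all add: conj_swap_def u_def v_def)
  have pu: "p u \<noteq> u"
  proof
    assume "p u = u" then have "conj_swap i p x = x" using c(1) x(1)[symmetric] by simp
    then show False using a by simp
  qed
  have pv: "p v \<noteq> v"
  proof
    assume "p v = v" then have "conj_swap i p y = y" using c(2) x(2)[symmetric] by simp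
    then show False using a by simp
  qed
  have uX: "u \<in> X" "p u \<in> X" "v \<in> X" "p v \<in> X"
    using pu pv webs_mem[OF p] webs_in[OF p] by auto
  have ne: "{s, r} \<noteq> {i, Suc i}" if "s \<in> X" "r \<in> X" for s r
  proof
    assume "{s, r} = {i, Suc i}"
    then have "i \<in> X" "Suc i \<in> X" using that by (auto simp: doubleton_eq_iff)
    then show False using i by simp
  qed
  have lt: "s < r" if "s \<in> X" "r \<in> X" "?t s < ?t r" for s r
    using swp_less_iff[of s r i] ne[OF that(1,2)] that(3) by (cases "s = r") auto
  have "u < v" "v < p u" "p u < p v"
    using lt[OF uX(1,3)] lt[OF uX(3,2)] lt[OF uX(2,4)] a c x(1)[symmetric] x(2)[symmetric] by simp_all
  then show False using webs_nocross[OF p] by blast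
qed

lemma sum_webs_conj_swap:
  assumes i: "i \<in> X \<longleftrightarrow> Suc i \<notin> X"
  shows "(\<Sum>p\<in>webs X. of_bool (compat S p) * f (conj_swap i p)) =
         (\<Sum>q\<in>webs (swp i ` X). of_bool (compat (swp i ` S) q) * (f q :: real))"
proof (rule sum.reindex_bij_witness[where i = "conj_swap i" and j = "conj_swap i"])
  let ?t = "swp i"
  have tt: "?t ` ?t ` X = X" by (simp add: image_comp)
  have ti: "(i \<in> ?t ` X) = (Suc i \<notin> ?t ` X)"
    using i by (auto simp: Transposition.transpose_def image_iff split: if_splits)
  fix p
  show "conj_swap i (conj_swap i p) = p" "conj_swap i (conj_swap i p) = p"
    by (rule conj_swap_invol)+
  { assume "p \<in> webs X" then show "conj_swap i p \<in> webs (?t ` X)" by (rule conj_swap_webs[OF _ i]) }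
  { assume "p \<in> webs (?t ` X)"
    from conj_swap_webs[OF this ti] show "conj_swap i p \<in> webs X" by (simp only: tt) }
  have mem: "z \<in> ?t ` S \<longleftrightarrow> ?t z \<in> S" for z
    by (metis imageE image_eqI Transposition.transpose_involutory)
  have "compat (?t ` S) (conj_swap i p) = compat S p"
    unfolding compat_def mem conj_swap_def comp_def
    by (metis Transposition.transpose_involutory)
  then show "of_bool (compat (?t ` S) (conj_swap i p)) * f (conj_swap i p) = of_bool (compat S p) * f (conj_swap i p)"
    by simp
qed

text \<open>If \<open>i\<close> and \<open>Suc i\<close> are not linked, noncrossing leaves three
  positions for their partners \<open>a\<close> and \<open>b\<close>, listed in \<open>ord\<close>.
  In each of them a link that crosses the new link of \<open>a\<close> and \<open>b\<close> would
  cross the old link of \<open>i\<close> or of \<open>Suc i\<close>.\<close>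

lemma cut_webs:
  assumes p: "p \<in> webs X" and i: "i \<in> X" "Suc i \<in> X"
  shows "cut i p \<in> webs (X - {i, Suc i})"
proof (cases "p i = Suc i")
  case True
  then have s: "p (Suc i) = i" using webs_invol[OF p] by metis
  have c: "cut i p x = (if x = i \<or> x = Suc i then x else p x)" for x
    using True s webs_invol[OF p] by (auto simp: cut_def)
  have cut_px: "p x \<noteq> i" "p x \<noteq> Suc i" if "x \<noteq> i" "x \<noteq> Suc i" for x
    using that True s webs_invol[OF p] by metis+
  show ?thesis
  proof (rule websI)
    fix x y
    show "cut i p (cut i p x) = x" using cut_px webs_invol[OF p] unfolding c by simp
    show "(cut i p x \<noteq> x) = (x \<in> X - {i, Suc i})" using webs_mem[OF p] unfolding c by auto
    show "x < y \<Longrightarrow> y < cut i p x \<Longrightarrow> cut i p x < cut i p y \<Longrightarrow> False"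
      using webs_nocross[OF p, of x y] unfolding c by (auto split: if_splits)
  qed
next
  case False
  define a b where "a = p i" and "b = p (Suc i)"
  note inv = webs_invol[OF p]
  have pa: "p a = i" "p b = Suc i" by (simp_all add: a_def b_def inv)
  have "a \<noteq> b" using pa by (metis n_not_Suc_n)
  moreover have "a \<noteq> i" "b \<noteq> Suc i" using i webs_mem[OF p] by (auto simp: a_def b_def)
  moreover have "a \<noteq> Suc i" "b \<noteq> i" using False inv by (auto simp: a_def b_def) metis
  ultimately have ab: "a \<noteq> i" "a \<noteq> Suc i" "b \<noteq> i" "b \<noteq> Suc i" "a \<noteq> b" by auto
  have iffs: "p x = i \<longleftrightarrow> x = a" "p x = Suc i \<longleftrightarrow> x = b" for x
    using inv unfolding a_def b_def by metis+
  have c: "cut i p x = (if x = i \<or> x = Suc i then x else if x = a then b else if x = b then a else p x)" for x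
    using iffs by (simp add: cut_def a_def[symmetric] b_def[symmetric])
  have abX: "a \<in> X" "b \<in> X" using webs_in[OF p] i by (auto simp: a_def b_def)
  have px: "p x \<noteq> i" "p x \<noteq> Suc i" "p x \<noteq> a" "p x \<noteq> b"
    if "x \<noteq> i" "x \<noteq> Suc i" "x \<noteq> a" "x \<noteq> b" for x
    using that pa inv by metis+
  have pi: "p i = a" "p (Suc i) = b" by (simp_all add: a_def b_def)
  have nc: "\<not> (x < y \<and> y < p x \<and> p x < p y)" for x y using webs_nocross[OF p] by blast
  have "\<not> (a < b \<and> b < i)" "\<not> (Suc i < a \<and> a < b)" "\<not> (b < i \<and> Suc i < a)"
    using nc[of a b] nc[of i "Suc i"] nc[of b i] pa pi by auto
  then have ord: "a < i \<and> Suc i < b \<or> b < a \<and> a < i \<or> Suc i < b \<and> b < a"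
    using ab by arith
  \<comment> \<open>\<open>out\<close> excludes a link that starts under the new one and ends to its
    right, \<open>out'\<close> one that starts to its left and ends under it.\<close>
  have out: False if "min a b < y" "y < max a b" "max a b < p y" "y \<noteq> i" "y \<noteq> Suc i" for y
  proof -
    have py: "p y \<noteq> i" "p y \<noteq> Suc i" using px that by auto
    show False
      using ord
    proof (elim disjE conjE)
      assume 1: "a < i" "Suc i < b"
      then have "a < y" "y < b" "b < p y" using that by auto
      then show False using 1 that(4,5) nc[of a y] nc[of "Suc i" y] unfolding pa pi by (cases "y < i") auto
    next
      assume 1: "b < a" "a < i"
      then have "b < y" "y < a" "a < p y" using that by auto
      then show False using 1 py nc[of b y] nc[of y a] unfolding pa pi by (cases "p y < i") auto
    next
      assume 1: "Suc i < b" "b < a"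
      then have "b < y" "y < a" "a < p y" using that by auto
      then show False using 1 nc[of i y] unfolding pa pi by auto
    qed
  qed
  have out': False if "x < min a b" "min a b < p x" "p x < max a b" "x \<noteq> i" "x \<noteq> Suc i" for x
  proof -
    have py: "p x \<noteq> i" "p x \<noteq> Suc i" using px that by auto
    show False
      using ord
    proof (elim disjE conjE)
      assume 1: "a < i" "Suc i < b"
      then have "x < a" "a < p x" "p x < b" using that by auto
      then show False using 1 py nc[of x a] nc[of x "Suc i"] unfolding pa pi by (cases "p x < i") auto
    next
      assume 1: "b < a" "a < i"
      then have "x < b" "b < p x" "p x < a" using that by auto
      then show False using 1 nc[of x b] unfolding pa pi by auto
    next
      assume 1: "Suc i < b" "b < a"
      then have "x < b" "b < p x" "p x < a" using that by auto
      then show False using 1 that(4,5) nc[of x i] nc[of "Suc i" x] unfolding pa pi by (cases "x < i") auto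
    qed
  qed
  show ?thesis
  proof (rule websI)
    fix x y
    show "cut i p (cut i p x) = x" using ab px[of x] inv[of x] unfolding c by simp
    show "(cut i p x \<noteq> x) = (x \<in> X - {i, Suc i})"
      using webs_mem[OF p, of x] ab abX unfolding c by auto
    assume xy: "x < y" "y < cut i p x" "cut i p x < cut i p y"
    have ne: "x \<noteq> i" "x \<noteq> Suc i" "y \<noteq> i" "y \<noteq> Suc i" using xy unfolding c by auto
    consider "x \<in> {a, b}" "y \<in> {a, b}" | "x \<in> {a, b}" "y \<notin> {a, b}" | "x \<notin> {a, b}" "y \<in> {a, b}" | "x \<notin> {a, b}" "y \<notin> {a, b}"
      by blast
    then show False
    proof cases
      case 1
      have "x < cut i p x" using xy by simp
      moreover have "x = a \<and> cut i p x = b \<or> x = b \<and> cut i p x = a"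
        using 1 ab by (auto simp: c)
      moreover have "cut i p a = b" "cut i p b = a" using ab by (simp_all add: c)
      ultimately show ?thesis using 1 xy by auto
    next
      case 2
      have cx: "cut i p y = p y" using 2 ne by (simp add: c)
      have "x < cut i p x" using xy by simp
      moreover have "x = a \<and> cut i p x = b \<or> x = b \<and> cut i p x = a"
        using 2(1) c[of a] c[of b] ab by fastforce
      ultimately have "min a b = x" "max a b = cut i p x" by auto
      with cx show ?thesis using out[of y] xy ne by simp
    next
      case 3
      have cx: "cut i p x = p x" using 3 ne by (simp add: c)
      have "y < cut i p y" using xy by simp
      moreover have "y = a \<and> cut i p y = b \<or> y = b \<and> cut i p y = a"
        using 3(2) c[of a] c[of b] ab by fastforce
      ultimately have "min a b = y" "max a b = cut i p y" by auto
      with cx show ?thesis using out'[of x] xy ne by simp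
    next
      case 4
      then have "cut i p x = p x" "cut i p y = p y" using 4 ne by (simp_all add: c)
      then show ?thesis using xy nc[of x y] by simp
    qed
  qed
qed

text \<open>\<open>S\<close> and \<open>S'\<close> differ only by exchanging the colours of
  \<open>i\<close> and \<open>Suc i\<close>. If these are not linked, compatibility prescribes the
  colours of their partners, oppositely for \<open>S\<close> and \<open>S'\<close>, whereas after
  the cut the two colours only have to differ; so exactly one of the colourings is compatible
  whenever the cut matching is. If they are linked, both colourings are.\<close>

lemma compat_cut:
  assumes p: "p \<in> webs X" and i: "i \<in> X" "Suc i \<in> X" and S: "i \<in> S" "Suc i \<notin> S"
    "S - {i, Suc i} = S' - {i, Suc i}" "Suc i \<in> S'" "i \<notin> S'"
  shows "of_bool (compat S p) + of_bool (compat S' p) =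
    (if p i = Suc i then 2 else 1) * (of_bool (compat S (cut i p)) :: real)"
proof -
  note inv = webs_invol[OF p]
  define a b where "a = p i" and "b = p (Suc i)"
  have SS: "x \<in> S \<longleftrightarrow> x \<in> S'" if "x \<noteq> i" "x \<noteq> Suc i" for x using S(3) that by blast
  have ne: "a \<noteq> i" "b \<noteq> Suc i" using i webs_mem[OF p] by (auto simp: a_def b_def)
  have pa: "p a = i" "p b = Suc i" by (simp_all add: a_def b_def inv)
  show ?thesis
  proof (cases "p i = Suc i")
    case True
    then have s: "p (Suc i) = i" using inv by metis
    have c: "cut i p x = (if x = i \<or> x = Suc i then x else p x)" for x
      using True s inv by (auto simp: cut_def)
    have px: "p x \<noteq> i" "p x \<noteq> Suc i" if "x \<noteq> i" "x \<noteq> Suc i" for x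
      using that True s inv by metis+
    have "compat S p \<longleftrightarrow> compat S (cut i p)" "compat S' p \<longleftrightarrow> compat S (cut i p)"
      unfolding compat_def c using S True s SS px by metis+
    then show ?thesis using True by simp
  next
    case False
    have ab: "a \<noteq> Suc i" "b \<noteq> i" "a \<noteq> b"
      using False inv pa unfolding a_def b_def by (metis n_not_Suc_n)+
    have iffs: "p x = i \<longleftrightarrow> x = a" "p x = Suc i \<longleftrightarrow> x = b" for x
      using inv unfolding a_def b_def by metis+
    have c: "cut i p x = (if x = i \<or> x = Suc i then x else if x = a then b else if x = b then a else p x)" for x
      using iffs by (simp add: cut_def a_def[symmetric] b_def[symmetric])
    have px: "p x \<noteq> i" "p x \<noteq> Suc i" "p x \<noteq> a" "p x \<noteq> b"
      if "x \<noteq> i" "x \<noteq> Suc i" "x \<noteq> a" "x \<noteq> b" for x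
      using that pa inv by metis+
    define Q where "Q \<longleftrightarrow> (\<forall>x. x \<notin> {i, Suc i, a, b} \<longrightarrow> p x \<noteq> x \<longrightarrow> (x \<in> S) \<noteq> (p x \<in> S))"
    have 1: "compat S p \<longleftrightarrow> Q \<and> a \<notin> S \<and> b \<in> S"
      unfolding compat_def Q_def using S a_def b_def pa ne ab by (metis insert_iff empty_iff)
    have 2: "compat S' p \<longleftrightarrow> Q \<and> a \<in> S \<and> b \<notin> S"
      unfolding compat_def Q_def using S a_def b_def pa ne ab SS px by (metis insert_iff empty_iff)
    have 3: "compat S (cut i p) \<longleftrightarrow> Q \<and> (a \<in> S \<longleftrightarrow> b \<notin> S)"
    proof
      assume l: "compat S (cut i p)"
      have "a \<in> S \<longleftrightarrow> b \<notin> S" using l[unfolded compat_def, rule_format, of a] ne ab by (simp add: c)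
      moreover have Q unfolding Q_def
      proof (intro allI impI)
        fix x assume "x \<notin> {i, Suc i, a, b}" "p x \<noteq> x"
        then show "(x \<in> S) \<noteq> (p x \<in> S)" using l[unfolded compat_def, rule_format, of x] by (simp add: c)
      qed
      ultimately show "Q \<and> (a \<in> S \<longleftrightarrow> b \<notin> S)" by simp
    next
      assume r: "Q \<and> (a \<in> S \<longleftrightarrow> b \<notin> S)"
      show "compat S (cut i p)" unfolding compat_def
      proof (intro allI impI)
        fix x assume "cut i p x \<noteq> x"
        then show "(x \<in> S) \<noteq> (cut i p x \<in> S)"
          using r[unfolded Q_def, THEN conjunct1, rule_format, of x] r by (auto simp: c split: if_splits)
      qed
    qed
    show ?thesis unfolding 1 2 3 using False by auto
  qed
qed

text \<open>On matchings that link \<open>i\<close> with \<open>Suc i\<close>, \<open>cut\<close> is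
  inverted by inserting this link, which is compatible because \<open>S\<close> contains exactly one
  of the two points.\<close>

lemma sum_webs_cut:
  assumes i: "i \<notin> X" "Suc i \<notin> X" and S: "i \<in> S \<longleftrightarrow> Suc i \<notin> S"
  shows "(\<Sum>p\<in>{p\<in>webs (insert i (insert (Suc i) X)). p i = Suc i}. of_bool (compat S p) * f (cut i p)) =
         (\<Sum>q\<in>webs X. of_bool (compat S q) * (f q :: real))"
proof (rule sum.reindex_bij_witness[where i = "\<lambda>q. q(i := Suc i, Suc i := i)" and j = "cut i"])
  let ?Y = "insert i (insert (Suc i) X)"
  fix p assume "p \<in> {p\<in>webs ?Y. p i = Suc i}"
  then have p: "p \<in> webs ?Y" and pi: "p i = Suc i" by auto
  note inv = webs_invol[OF p]
  have ps: "p (Suc i) = i" using inv pi by metis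
  have c: "cut i p x = (if x = i \<or> x = Suc i then x else p x)" for x
    using pi ps inv by (auto simp: cut_def)
  show "(cut i p)(i := Suc i, Suc i := i) = p" using pi ps by (auto simp: fun_eq_iff c)
  have "?Y - {i, Suc i} = X" using i by auto
  then show "cut i p \<in> webs X" using cut_webs[OF p, of i] by simp
  have px: "p x \<noteq> i" "p x \<noteq> Suc i" if "x \<noteq> i" "x \<noteq> Suc i" for x
    using that pi ps inv by metis+
  have "compat S (cut i p) = compat S p" unfolding compat_def c using S pi ps by metis
  then show "of_bool (compat S (cut i p)) * f (cut i p) = of_bool (compat S p) * f (cut i p)" by simp
next
  let ?Y = "insert i (insert (Suc i) X)"
  fix q assume q: "q \<in> webs X"
  have qi: "q i = i" "q (Suc i) = Suc i" using i webs_fix[OF q] by auto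
  have qx: "q x \<noteq> i" "q x \<noteq> Suc i" if "x \<noteq> i" "x \<noteq> Suc i" for x
    using that qi webs_invol[OF q] by metis+
  show "cut i (q(i := Suc i, Suc i := i)) = q" using qi qx by (auto simp: fun_eq_iff cut_def)
  have "q(i := Suc i, Suc i := i) \<in> webs ?Y"
  proof (rule websI)
    fix x y
    show "(q(i := Suc i, Suc i := i)) ((q(i := Suc i, Suc i := i)) x) = x"
      using qi qx webs_invol[OF q] by auto
    show "((q(i := Suc i, Suc i := i)) x \<noteq> x) = (x \<in> ?Y)" using webs_mem[OF q] by auto
    show "x < y \<Longrightarrow> y < (q(i := Suc i, Suc i := i)) x \<Longrightarrow>
       (q(i := Suc i, Suc i := i)) x < (q(i := Suc i, Suc i := i)) y \<Longrightarrow> False"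
      using webs_nocross[OF q, of x y] by (auto split: if_splits)
  qed
  then show "q(i := Suc i, Suc i := i) \<in> {p\<in>webs ?Y. p i = Suc i}" by simp
qed

lemma mem_swp_image: "z \<in> swp i ` X \<longleftrightarrow> swp i z \<in> X"
  by (metis imageE image_eqI Transposition.transpose_involutory)

lemma swp_simps: "swp i i = Suc i" "swp i (Suc i) = i" "x \<noteq> i \<Longrightarrow> x \<noteq> Suc i \<Longrightarrow> swp i x = x"
  by (auto simp: Transposition.transpose_def)

lemma swp_image_up: "Suc i \<in> X \<Longrightarrow> i \<notin> X \<Longrightarrow> swp i ` X = insert i (X - {Suc i})"
  by (rule Set.set_eqI, unfold mem_swp_image) (auto simp: Transposition.transpose_def)

lemma swp_image_down: "Suc i \<notin> X \<Longrightarrow> i \<in> X \<Longrightarrow> swp i ` X = insert (Suc i) (X - {i})"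
  by (rule Set.set_eqI, unfold mem_swp_image) (auto simp: Transposition.transpose_def)

lemma card_shift_down:
  "finite S \<Longrightarrow> Suc i \<in> S \<Longrightarrow> i \<notin> S \<Longrightarrow> card (shift_down i S) = card S"
  using card_Suc_Diff1[of S "Suc i"] by (simp add: shift_down_def)

lemma step_coeff_inactive:
  assumes p: "p \<in> webs (sym_diff S T)" and S: "\<not> (Suc i \<in> S \<and> i \<notin> S)" "\<not> (Suc i \<in> T \<and> i \<notin> T)"
  shows "of_bool (compat S p) * step_coeff i t c (S \<inter> T) p = of_bool (compat S p) * (c (S \<inter> T) p :: real)"
proof (cases "compat S p")
  case True
  have "p i \<noteq> Suc i"
  proof
    assume pi: "p i = Suc i"
    then have "(i \<in> S) \<noteq> (Suc i \<in> S)" using True unfolding compat_def by (metis n_not_Suc_n)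
    moreover have "i \<in> sym_diff S T" "Suc i \<in> sym_diff S T"
      using pi webs_mem[OF p, of i] webs_in[OF p, of i] by auto
    ultimately show False using S by auto
  qed
  then show ?thesis using S webs_mem[OF p] by (auto simp: step_coeff_def)
qed simp

text \<open>Only the minor of \<open>S\<close> acquires a new term. The cases \<open>none\<close>,
  \<open>both\<close> and \<open>low\<close> for \<open>T\<close> correspond to the first three
  branches of \<open>step_coeff\<close>.\<close>

lemma row_step_one:
  assumes e: "web_expansion V n D c" and V: "finite V" "i \<in> V"
    and ST: "S \<subseteq> V" "T \<subseteq> V" "card S = n" "card T = n"
    and S: "Suc i \<in> S" "i \<notin> S" and T: "\<not> (Suc i \<in> T \<and> i \<notin> T)"
  shows "(D S + t * D (shift_down i S)) * D T =
    (\<Sum>p\<in>webs (sym_diff S T). of_bool (compat S p) * step_coeff i t c (S \<inter> T) p)"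
proof -
  let ?X = "sym_diff S T" and ?P = "S \<inter> T" and ?S = "shift_down i S"
  have fS: "finite S" using finite_subset ST V by blast
  have finX: "finite ?X" using finite_subset[OF _ V(1)] ST by auto
  have S': "?S \<subseteq> V" "card ?S = n" using ST V S card_shift_down[OF fS S] by (auto simp: shift_down_def)
  have e0: "D S * D T = (\<Sum>p\<in>webs ?X. of_bool (compat S p) * c ?P p)"
    using web_expansionD[OF e ST] by simp
  note e1 = web_expansionD[OF e S'(1) ST(2) S'(2) ST(4)]
  have imS: "swp i ` S = ?S" using swp_image_up[OF S] by (simp add: shift_down_def)
  consider (none) "i \<notin> T" "Suc i \<notin> T" | (both) "i \<in> T" "Suc i \<in> T" | (low) "i \<in> T" "Suc i \<notin> T"
    using T by blast
  then have "t * (D ?S * D T) = (\<Sum>p\<in>webs ?X. of_bool (compat S p) * (step_coeff i t c ?P p - c ?P p))"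
  proof cases
    case none
    have X: "Suc i \<in> ?X" "i \<notin> ?X" using S none by auto
    then have cs: "i \<in> ?X \<longleftrightarrow> Suc i \<notin> ?X" by blast
    have "sym_diff ?S T = swp i ` ?X" "?S \<inter> T = ?P"
      unfolding swp_image_up[OF X] using S none by (auto simp: shift_down_def)
    from e1[OF this] have "D ?S * D T = (\<Sum>p\<in>webs ?X. of_bool (compat S p) * c ?P (conj_swap i p))"
      unfolding sum_webs_conj_swap[OF cs, of S "c ?P", unfolded imS] .
    moreover have "step_coeff i t c ?P p - c ?P p = t * c ?P (conj_swap i p)" if "p \<in> webs ?X" for p
      using webs_mem[OF that, of i] webs_mem[OF that, of "Suc i"] X S by (simp add: step_coeff_def)
    ultimately show ?thesis by (simp add: sum_distrib_left mult.left_commute)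
  next
    case both
    have X: "Suc i \<notin> ?X" "i \<in> ?X" using S both by auto
    then have cs: "i \<in> ?X \<longleftrightarrow> Suc i \<notin> ?X" by blast
    have "sym_diff ?S T = swp i ` ?X" "?S \<inter> T = shift_down i ?P"
      unfolding swp_image_down[OF X] using S both by (auto simp: shift_down_def)
    from e1[OF this] have "D ?S * D T = (\<Sum>p\<in>webs ?X. of_bool (compat S p) * c (shift_down i ?P) (conj_swap i p))"
      unfolding sum_webs_conj_swap[OF cs, of S "c (shift_down i ?P)", unfolded imS] .
    moreover have "step_coeff i t c ?P p - c ?P p = t * c (shift_down i ?P) (conj_swap i p)" if "p \<in> webs ?X" for p
      using webs_mem[OF that, of i] webs_mem[OF that, of "Suc i"] X S both by (simp add: step_coeff_def)
    ultimately show ?thesis by (simp add: sum_distrib_left mult.left_commute)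
  next
    case low
    have X: "Suc i \<in> ?X" "i \<in> ?X" using S low by auto
    let ?Y = "?X - {i, Suc i}"
    have Y: "insert i (insert (Suc i) ?Y) = ?X" using X by auto
    have "sym_diff ?S T = ?Y" "?S \<inter> T = insert i ?P"
      using S low by (auto simp: shift_down_def)
    from e1[OF this] have "D ?S * D T = (\<Sum>q\<in>webs ?Y. of_bool (compat ?S q) * c (insert i ?P) q)" .
    also have "\<dots> = (\<Sum>q\<in>webs ?Y. of_bool (compat S q) * c (insert i ?P) q)"
    proof (rule sum.cong[OF refl])
      fix q assume "q \<in> webs ?Y"
      then have "compat ?S q = compat S q" by (rule compat_cong) (auto simp: shift_down_def)
      then show "of_bool (compat ?S q) * c (insert i ?P) q = of_bool (compat S q) * c (insert i ?P) q" by simp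
    qed
    also have "\<dots> = (\<Sum>p\<in>{p\<in>webs ?X. p i = Suc i}. of_bool (compat S p) * c (insert i ?P) (cut i p))"
      using sum_webs_cut[of i ?Y S "c (insert i ?P)"] S unfolding Y by simp
    also have "\<dots> = (\<Sum>p\<in>webs ?X. if p i = Suc i then of_bool (compat S p) * c (insert i ?P) (cut i p) else 0)"
      by (rule sum.inter_filter[OF finite_webs[OF finX]])
    finally have "D ?S * D T = \<dots>" .
    moreover have "step_coeff i t c ?P p - c ?P p = (if p i = Suc i then t * c (insert i ?P) (cut i p) else 0)"
      if "p \<in> webs ?X" for p
      using webs_mem[OF that, of i] webs_mem[OF that, of "Suc i"] X S low by (simp add: step_coeff_def)
    ultimately show ?thesis by (auto simp: sum_distrib_left intro!: sum.cong)
  qed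
  then have "t * (D ?S * D T) = (\<Sum>p\<in>webs ?X. of_bool (compat S p) * step_coeff i t c ?P p) - D S * D T"
    unfolding e0 by (simp add: right_diff_distrib sum_subtractf)
  then show ?thesis by (simp add: algebra_simps)
qed

text \<open>Both minors acquire a new term. The constant and the quadratic term of the product keep
  the set of matched points. In the linear term \<open>i\<close> and \<open>Suc i\<close> become
  matched, once with the colouring \<open>S\<close> and once with \<open>shift_down i S\<close>, and
  \<open>compat_cut\<close> adds these two up.\<close>

lemma row_step_two:
  assumes e: "web_expansion V n D c" and V: "finite V" "i \<in> V"
    and ST: "S \<subseteq> V" "T \<subseteq> V" "card S = n" "card T = n"
    and S: "Suc i \<in> S" "i \<notin> S" and T: "Suc i \<in> T" "i \<notin> T"
  shows "(D S + t * D (shift_down i S)) * (D T + t * D (shift_down i T)) =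
    (\<Sum>p\<in>webs (sym_diff S T). of_bool (compat S p) * step_coeff i t c (S \<inter> T) p)"
proof -
  let ?X = "sym_diff S T" and ?P = "S \<inter> T" and ?S = "shift_down i S" and ?T = "shift_down i T"
  let ?Y = "insert i (insert (Suc i) ?X)" and ?c = "c (?P - {Suc i})"
  let ?m = "\<lambda>q. if q i = Suc i then 2 else (1::real)"
  have fS: "finite S" "finite T" using finite_subset ST V by blast+
  have finX: "finite ?X" "finite ?Y" using fS by auto
  have YX: "?Y - {i, Suc i} = ?X" using S T by auto
  have S': "?S \<subseteq> V" "card ?S = n" using ST V S card_shift_down[OF fS(1) S] by (auto simp: shift_down_def)
  have T': "?T \<subseteq> V" "card ?T = n" using ST V T card_shift_down[OF fS(2) T] by (auto simp: shift_down_def)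
  have e0: "D S * D T = (\<Sum>p\<in>webs ?X. of_bool (compat S p) * c ?P p)"
    using web_expansionD[OF e ST] by simp
  have "D ?S * D ?T = (\<Sum>p\<in>webs ?X. of_bool (compat ?S p) * c (shift_down i ?P) p)"
    by (rule web_expansionD[OF e S'(1) T'(1) S'(2) T'(2)]) (use S T in \<open>auto simp: shift_down_def\<close>)
  also have "\<dots> = (\<Sum>p\<in>webs ?X. of_bool (compat S p) * c (shift_down i ?P) p)"
  proof (rule sum.cong[OF refl])
    fix q assume "q \<in> webs ?X"
    then have "compat ?S q = compat S q" by (rule compat_cong) (use S T in \<open>auto simp: shift_down_def\<close>)
    then show "of_bool (compat ?S q) * c (shift_down i ?P) q = of_bool (compat S q) * c (shift_down i ?P) q" by simp
  qed
  finally have e2: "D ?S * D ?T = \<dots>" .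
  have "D ?S * D T = (\<Sum>q\<in>webs ?Y. of_bool (compat ?S q) * ?c q)"
    by (rule web_expansionD[OF e S'(1) ST(2) S'(2) ST(4)]) (use S T in \<open>auto simp: shift_down_def\<close>)
  moreover have "D S * D ?T = (\<Sum>q\<in>webs ?Y. of_bool (compat S q) * ?c q)"
    by (rule web_expansionD[OF e ST(1) T'(1) ST(3) T'(2)]) (use S T in \<open>auto simp: shift_down_def\<close>)
  ultimately have "D ?S * D T + D S * D ?T = (\<Sum>q\<in>webs ?Y. (of_bool (compat ?S q) + of_bool (compat S q)) * ?c q)"
    by (simp add: sum.distrib distrib_right)
  also have "\<dots> = (\<Sum>q\<in>webs ?Y. of_bool (compat S (cut i q)) * (?m q * ?c q))"
  proof (rule sum.cong[OF refl])
    fix q assume q: "q \<in> webs ?Y"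
    have "of_bool (compat ?S q) + of_bool (compat S q) = ?m q * (of_bool (compat ?S (cut i q)) :: real)"
      by (rule compat_cut[OF q]) (use S in \<open>auto simp: shift_down_def\<close>)
    moreover have "cut i q \<in> webs ?X"
    proof -
      have "cut i q \<in> webs (?Y - {i, Suc i})" by (rule cut_webs[OF q]) blast+
      then show ?thesis by (simp only: YX)
    qed
    then have "compat ?S (cut i q) = compat S (cut i q)"
      by (rule compat_cong) (use S T in \<open>auto simp: shift_down_def\<close>)
    ultimately show "(of_bool (compat ?S q) + of_bool (compat S q)) * ?c q = of_bool (compat S (cut i q)) * (?m q * ?c q)"
      by simp
  qed
  \<comment> \<open>Grouping by the cut matching yields the inner sum in the last branch of
    \<open>step_coeff\<close>.\<close>
  also have "\<dots> = (\<Sum>p\<in>webs ?X. \<Sum>q\<in>{q\<in>webs ?Y. cut i q = p}. of_bool (compat S (cut i q)) * (?m q * ?c q))"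
  proof (rule sum.group[symmetric])
    have "cut i q \<in> webs (?Y - {i, Suc i})" if "q \<in> webs ?Y" for q
      by (rule cut_webs[OF that]) blast+
    then show "cut i ` webs ?Y \<subseteq> webs ?X" unfolding YX by blast
  qed (use finX finite_webs in auto)
  also have "\<dots> = (\<Sum>p\<in>webs ?X. of_bool (compat S p) * (\<Sum>q\<in>{q\<in>webs ?Y. cut i q = p}. ?m q * ?c q))"
    by (intro sum.cong refl) (simp add: sum_distrib_left)
  finally have e1: "D ?S * D T + D S * D ?T = \<dots>" .
  have st: "step_coeff i t c ?P p = c ?P p + (t * (\<Sum>q\<in>{q\<in>webs ?Y. cut i q = p}. ?m q * ?c q) + t\<^sup>2 * c (shift_down i ?P) p)"
    if "p \<in> webs ?X" for p
    using webs_mem[OF that, of i] webs_mem[OF that, of "Suc i"] webs_support[OF that] S T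
    by (simp add: step_coeff_def)
  have "(D S + t * D ?S) * (D T + t * D ?T) = D S * D T + (t * (D ?S * D T + D S * D ?T) + t\<^sup>2 * (D ?S * D ?T))"
    by (simp add: algebra_simps power2_eq_square)
  also have "\<dots> = (\<Sum>p\<in>webs ?X. of_bool (compat S p) * (c ?P p + (t * (\<Sum>q\<in>{q\<in>webs ?Y. cut i q = p}. ?m q * ?c q) + t\<^sup>2 * c (shift_down i ?P) p)))"
    unfolding e0 e1 e2 by (simp add: distrib_left sum.distrib sum_distrib_left mult.left_commute)
  also have "\<dots> = (\<Sum>p\<in>webs ?X. of_bool (compat S p) * step_coeff i t c ?P p)"
    by (intro sum.cong refl) (simp add: st)
  finally show ?thesis .
qed

theorem web_expansion_row_step:
  assumes e: "web_expansion V n D c" and V: "finite V" "i \<in> V"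
  shows "web_expansion V n (row_step i t D) (step_coeff i t c)"
  unfolding web_expansion_def
proof (intro allI impI)
  fix S T assume ST: "S \<subseteq> V" "T \<subseteq> V" "card S = n" "card T = n"
  let ?a = "\<lambda>S. Suc i \<in> S \<and> i \<notin> S"
  have sym: "(\<Sum>p\<in>webs (sym_diff T S). of_bool (compat T p) * step_coeff i t c (T \<inter> S) p) =
     (\<Sum>p\<in>webs (sym_diff S T). of_bool (compat S p) * step_coeff i t c (S \<inter> T) p)"
    by (intro sum.cong) (auto simp: Un_commute Int_commute compat_compl)
  show "row_step i t D S * row_step i t D T =
    (\<Sum>p\<in>webs (sym_diff S T). of_bool (compat S p) * step_coeff i t c (S \<inter> T) p)"
  proof -
    consider "\<not> ?a S" "\<not> ?a T" | "?a S" "\<not> ?a T" | "\<not> ?a S" "?a T" | "?a S" "?a T" by blast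
    then show ?thesis
    proof cases
      case 1
      then have "row_step i t D S * row_step i t D T = D S * D T" by (auto simp: row_step_def)
      also have "\<dots> = (\<Sum>p\<in>webs (sym_diff S T). of_bool (compat S p) * c (S \<inter> T) p)"
        using web_expansionD[OF e ST] by simp
      also have "\<dots> = (\<Sum>p\<in>webs (sym_diff S T). of_bool (compat S p) * step_coeff i t c (S \<inter> T) p)"
        by (intro sum.cong refl step_coeff_inactive[symmetric]) (use 1 in auto)
      finally show ?thesis .
    next
      case 2
      then show ?thesis
        using row_step_one[OF e V ST, of t] by (auto simp: row_step_def)
    next
      case 3
      then show ?thesis
        using row_step_one[OF e V ST(2,1,4,3), of t] sym by (auto simp: row_step_def mult.commute)
    next
      case 4
      then show ?thesis
        using row_step_two[OF e V ST, of t] by (auto simp: row_step_def)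
    qed
  qed
qed

section \<open>Lower bounds from the transition rule; scaling of rows and adjoining a unit
  row\<close>

lemma step_coeff_nonneg:
  assumes "\<And>P p. c P p \<ge> 0" "t \<ge> 0"
  shows "step_coeff i t c P p \<ge> 0"
  unfolding step_coeff_def using assms by (auto intro!: add_nonneg_nonneg mult_nonneg_nonneg sum_nonneg)

lemma step_coeff_ge:
  assumes "\<And>P p. c P p \<ge> 0" "t \<ge> 0"
  shows "step_coeff i t c P p \<ge> c P p"
  unfolding step_coeff_def using assms by (auto intro!: add_nonneg_nonneg mult_nonneg_nonneg sum_nonneg)

text \<open>Each bound keeps one term of the rule. This suffices because positivity is derived from
  a single history.\<close>

lemma step_coeff_move:
  assumes "\<And>P p. c P p \<ge> 0" "t \<ge> 0"
  shows "p (Suc i) \<noteq> Suc i \<Longrightarrow> p i = i \<Longrightarrow> i \<notin> P \<Longrightarrow> step_coeff i t c P p \<ge> t * c P (conj_swap i p)"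
    and "p (Suc i) = Suc i \<Longrightarrow> Suc i \<in> P \<Longrightarrow> p i \<noteq> i \<Longrightarrow>
      step_coeff i t c P p \<ge> t * c (shift_down i P) (conj_swap i p)"
    and "p i = Suc i \<Longrightarrow> Suc i \<notin> P \<Longrightarrow> step_coeff i t c P p \<ge> t * c (insert i P) (cut i p)"
    and "p (Suc i) = Suc i \<Longrightarrow> p i = i \<Longrightarrow> Suc i \<in> P \<Longrightarrow> i \<notin> P \<Longrightarrow>
      step_coeff i t c P p \<ge> t\<^sup>2 * c (shift_down i P) p"
  unfolding step_coeff_def using assms
  by (auto intro!: add_nonneg_nonneg mult_nonneg_nonneg sum_nonneg)

text \<open>Valid for every \<open>t\<close>, in particular for \<open>t = -1\<close>: subtracting
  the two rows of a pair from each other does not change the coefficient of a matching that does not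
  link them.\<close>

lemma step_coeff_unlinked:
  assumes "p i \<noteq> i" "p (Suc i) \<noteq> Suc i" "p i \<noteq> Suc i" "Suc i \<notin> P"
  shows "step_coeff i t c P p = c P p"
  using assms by (simp add: step_coeff_def)

text \<open>A double row occurs in both minors and contributes its factor squared, a single row
  contributes it once.\<close>

lemma web_expansion_scale:
  assumes e: "web_expansion V n D c" and V: "finite V"
  shows "web_expansion V n (\<lambda>S. prod s S * D S)
    (\<lambda>P p. (prod s P)\<^sup>2 * prod s {x. p x \<noteq> x} * c P p)"
  unfolding web_expansion_def
proof (intro allI impI)
  fix S T assume ST: "S \<subseteq> V" "T \<subseteq> V" "card S = n" "card T = n"
  have fin: "finite S" "finite T" using finite_subset ST V by blast+
  have "prod s S * prod s T = (prod s (S \<inter> T))\<^sup>2 * prod s (sym_diff S T)"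
  proof -
    have "prod s S = prod s (S \<inter> T) * prod s (S - T)" "prod s T = prod s (S \<inter> T) * prod s (T - S)"
      using prod.Int_Diff[OF fin(1), of s T] prod.Int_Diff[OF fin(2), of s S] by (simp_all add: Int_commute)
    moreover have "prod s (sym_diff S T) = prod s (S - T) * prod s (T - S)"
      using fin by (intro prod.union_disjoint) auto
    ultimately show ?thesis by (simp add: power2_eq_square)
  qed
  then have "(prod s S * D S) * (prod s T * D T) = (prod s (S \<inter> T))\<^sup>2 * prod s (sym_diff S T) * (D S * D T)"
    by (metis mult.assoc mult.left_commute)
  also have "D S * D T = (\<Sum>p\<in>webs (sym_diff S T). of_bool (compat S p) * c (S \<inter> T) p)"
    using web_expansionD[OF e ST] by simp
  finally have "(prod s S * D S) * (prod s T * D T) =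
    (\<Sum>p\<in>webs (sym_diff S T). (prod s (S \<inter> T))\<^sup>2 * prod s (sym_diff S T) * (of_bool (compat S p) * c (S \<inter> T) p))"
    by (simp add: sum_distrib_left)
  also have "\<dots> = (\<Sum>p\<in>webs (sym_diff S T). of_bool (compat S p) *
      ((prod s (S \<inter> T))\<^sup>2 * prod s {x. p x \<noteq> x} * c (S \<inter> T) p))"
    by (intro sum.cong refl) (simp add: webs_support)
  finally show "(prod s S * D S) * (prod s T * D T) = \<dots>" .
qed

lemma web_expansion_cong:
  assumes "web_expansion V n D c" "\<And>S. S \<subseteq> V \<Longrightarrow> card S = n \<Longrightarrow> D' S = D S"
  shows "web_expansion V n D' c"
  using assms unfolding web_expansion_def by simp

text \<open>A minor vanishes unless it uses the new row \<open>s\<close>, so in a nonzero product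
  this row is double.\<close>

lemma web_expansion_unit_row:
  assumes e: "web_expansion V n D c" and V: "finite V" "s \<notin> V"
  shows "web_expansion (insert s V) (Suc n) (\<lambda>S. if s \<in> S then D (S - {s}) else 0)
    (\<lambda>P p. if s \<in> P then c (P - {s}) p else 0)"
  unfolding web_expansion_def
proof (intro allI impI)
  fix S T assume ST: "S \<subseteq> insert s V" "T \<subseteq> insert s V" "card S = Suc n" "card T = Suc n"
  have fin: "finite S" "finite T" using finite_subset ST V by (meson finite_insert)+
  show "(if s \<in> S then D (S - {s}) else 0) * (if s \<in> T then D (T - {s}) else 0) =
    (\<Sum>p\<in>webs (sym_diff S T). of_bool (compat S p) * (if s \<in> S \<inter> T then c (S \<inter> T - {s}) p else 0))"
  proof (cases "s \<in> S \<and> s \<in> T")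
    case True
    have "D (S - {s}) * D (T - {s}) = (\<Sum>p\<in>webs (sym_diff S T). of_bool (compat (S - {s}) p) * c (S \<inter> T - {s}) p)"
      by (rule web_expansionD[OF e]) (use ST fin True in auto)
    also have "\<dots> = (\<Sum>p\<in>webs (sym_diff S T). of_bool (compat S p) * c (S \<inter> T - {s}) p)"
    proof (rule sum.cong[OF refl])
      fix q assume "q \<in> webs (sym_diff S T)"
      then have "compat (S - {s}) q = compat S q" by (rule compat_cong) (use True in auto)
      then show "of_bool (compat (S - {s}) q) * c (S \<inter> T - {s}) q = of_bool (compat S q) * c (S \<inter> T - {s}) q"
        by simp
    qed
    finally show ?thesis using True by simp
  qed auto
qed

section \<open>Maximal minors\<close>

definition minor :: "nat \<Rightarrow> (nat \<Rightarrow> nat \<Rightarrow> real) \<Rightarrow> nat set \<Rightarrow> real" where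
  "minor n r S = Determinant.det (mat n n (\<lambda>(a, k). r (sorted_list_of_set S ! a) k))"

lemma det_row_linear:
  fixes A :: "real mat"
  assumes A: "A \<in> carrier_mat n n" and B: "B \<in> carrier_mat n n" and C: "C \<in> carrier_mat n n" and k: "k < n"
    and eq: "\<And>i j. i < n \<Longrightarrow> j < n \<Longrightarrow> i \<noteq> k \<Longrightarrow> A $$ (i, j) = B $$ (i, j)"
      "\<And>i j. i < n \<Longrightarrow> j < n \<Longrightarrow> i \<noteq> k \<Longrightarrow> A $$ (i, j) = C $$ (i, j)"
    and row: "\<And>j. j < n \<Longrightarrow> A $$ (k, j) = B $$ (k, j) + t * C $$ (k, j)"
  shows "Determinant.det A = Determinant.det B + t * Determinant.det C"
proof -
  have "mat_delete A k j = mat_delete B k j" "mat_delete A k j = mat_delete C k j" if "j < n" for j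
    using A B C k that by (auto intro!: eq_matI eq simp: mat_delete_def)
  then have "Determinant.cofactor A k j = Determinant.cofactor B k j"
    "Determinant.cofactor A k j = Determinant.cofactor C k j" if "j < n" for j
    using that by (simp_all add: Determinant.cofactor_def)
  then show ?thesis
    unfolding laplace_expansion_row[OF A k] laplace_expansion_row[OF B k] laplace_expansion_row[OF C k]
      sum_distrib_left sum.distrib[symmetric]
    by (intro sum.cong refl) (simp add: row algebra_simps)
qed

lemma minor_cong:
  assumes "finite S" "card S = n" "\<And>i k. i \<in> S \<Longrightarrow> k < n \<Longrightarrow> r i k = r' i k"
  shows "minor n r S = minor n r' S"
proof -
  have "sorted_list_of_set S ! a \<in> S" if "a < n" for a
    using that assms nth_mem[of a "sorted_list_of_set S"] by simp
  then show ?thesis unfolding minor_def using assms(3)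
    by (intro arg_cong[where f = Determinant.det] eq_matI) auto
qed

lemma sorted_list_of_set_image:
  assumes S: "finite (S :: nat set)" and f: "strict_mono_on S f"
  shows "sorted_list_of_set (f ` S) = map f (sorted_list_of_set S)"
proof -
  let ?xs = "sorted_list_of_set S"
  have "sorted_wrt (<) (map f ?xs)"
    unfolding sorted_wrt_map
    by (rule sorted_wrt_mono_rel[OF _ strict_sorted_list_of_set])
      (use f S in \<open>auto simp: strict_mono_on_def\<close>)
  then show ?thesis
    by (rule strict_sorted_equal) (use S in auto)
qed

lemma minor_row_step:
  assumes S: "finite S" "card S = n"
  shows "minor n (r(Suc i := (\<lambda>k. r (Suc i) k + t * r i k))) S = row_step i t (minor n r) S"
proof (cases "Suc i \<in> S")
  case False
  then have "minor n (r(Suc i := (\<lambda>k. r (Suc i) k + t * r i k))) S = minor n r S"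
    by (intro minor_cong S) auto
  then show ?thesis using False by (simp add: row_step_def)
next
  case True
  let ?xs = "sorted_list_of_set S"
  let ?r = "r(Suc i := (\<lambda>k. r (Suc i) k + t * r i k))"
  define f where "f x = (if x = Suc i then i else x)" for x
  have len: "length ?xs = n" and set: "set ?xs = S" and dist: "distinct ?xs" using S by auto
  obtain a where a: "a < n" "?xs ! a = Suc i"
    using True set len by (metis in_set_conv_nth)
  have other: "?xs ! b \<noteq> Suc i" if "b < n" "b \<noteq> a" for b
    using that a dist len by (metis nth_eq_iff_index_eq)
  let ?C = "mat n n (\<lambda>(a, k). r (f (?xs ! a)) k)"
  have eq: "minor n ?r S = minor n r S + t * Determinant.det ?C"
    unfolding minor_def
    by (rule det_row_linear[where k = a]) (use a other in \<open>auto simp: f_def\<close>)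
  show ?thesis
  proof (cases "i \<in> S")
    case iS: True
    then obtain b where b: "b < n" "?xs ! b = i"
      using set len by (metis in_set_conv_nth)
    have "a \<noteq> b" using a b by auto
    then have "Determinant.det ?C = 0"
      by (intro Determinant.det_identical_rows[of _ n a b])
         (use a b in \<open>auto simp: f_def intro!: eq_vecI\<close>)
    then show ?thesis using eq iS by (simp add: row_step_def)
  next
    case iS: False
    have "f ` S = shift_down i S" using True iS by (auto simp: f_def shift_down_def image_iff)
    \<comment> \<open>As \<open>i\<close> is not in \<open>S\<close>, replacing \<open>Suc i\<close>
      by \<open>i\<close> keeps the rows sorted, so no sign appears.\<close>
    moreover have "strict_mono_on S f" using iS
      by (auto simp: strict_mono_on_def f_def) (metis less_antisym)+
    ultimately have "sorted_list_of_set (shift_down i S) = map f ?xs"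
      using sorted_list_of_set_image[OF S(1)] by metis
    then have "minor n r (shift_down i S) = Determinant.det ?C"
      unfolding minor_def
      by (intro arg_cong[where f = Determinant.det] eq_matI) (use len in auto)
    then show ?thesis using eq True iS by (simp add: row_step_def)
  qed
qed

lemma minor_scale:
  assumes S: "finite S" "card S = n"
  shows "minor n (\<lambda>i k. s i * r i k) S = prod s S * minor n r S"
proof -
  let ?xs = "sorted_list_of_set S"
  have len: "length ?xs = n" and set: "set ?xs = S" and dist: "distinct ?xs" using S by auto
  have "minor n (\<lambda>i k. s i * r i k) S =
    Determinant.det (mat\<^sub>r n n (\<lambda>a. s (?xs ! a) \<cdot>\<^sub>v vec n (r (?xs ! a))))"
    unfolding minor_def by (intro arg_cong[where f = Determinant.det] eq_matI) auto
  also have "\<dots> = prod (\<lambda>a. s (?xs ! a)) {0..<n} * Determinant.det (mat\<^sub>r n n (\<lambda>a. vec n (r (?xs ! a))))"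
    by (rule det_rows_mul) auto
  also have "prod (\<lambda>a. s (?xs ! a)) {0..<n} = prod s S"
    using prod.reindex_bij_betw[OF bij_betw_nth[OF dist, of "{0..<n}" S], of s] len set
    by (simp add: atLeast0LessThan)
  also have "Determinant.det (mat\<^sub>r n n (\<lambda>a. vec n (r (?xs ! a)))) = minor n r S"
    unfolding minor_def by (intro arg_cong[where f = Determinant.det] eq_matI) auto
  finally show ?thesis .
qed

lemma sorted_list_of_set_Min_Cons:
  assumes "finite S" "s \<in> S" "\<And>i. i \<in> S \<Longrightarrow> s \<le> (i::nat)"
  shows "sorted_list_of_set S = s # sorted_list_of_set (S - {s})"
proof -
  have "Min S = s" using assms by (intro Min_eqI) auto
  then show ?thesis using sorted_list_of_set_nonempty[of S] assms by auto
qed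

text \<open>Expansion along the first column, in which row \<open>s\<close> has the only nonzero
  entry. As \<open>s\<close> is the smallest index, it is the top row and the cofactor has sign
  \<open>+\<close>.\<close>

lemma minor_unit_row:
  assumes S: "finite S" "card S = Suc n" "S \<subseteq> insert s V" and V: "\<And>i. i \<in> V \<Longrightarrow> s < i"
    and r: "r s 0 = 1" "\<And>i. i \<in> V \<Longrightarrow> r i 0 = 0"
  shows "minor (Suc n) r S = (if s \<in> S then minor n (\<lambda>i k. r i (Suc k)) (S - {s}) else 0)"
proof -
  let ?xs = "sorted_list_of_set S"
  let ?A = "mat (Suc n) (Suc n) (\<lambda>(a, k). r (?xs ! a) k)"
  have len: "length ?xs = Suc n" and set: "set ?xs = S" and dist: "distinct ?xs" using S by auto
  have A: "?A \<in> carrier_mat (Suc n) (Suc n)" by simp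
  have inS: "?xs ! a \<in> S" if "a < Suc n" for a using that len set nth_mem by metis
  have exp: "minor (Suc n) r S = (\<Sum>a<Suc n. ?A $$ (a, 0) * Determinant.cofactor ?A a 0)"
    unfolding minor_def by (rule laplace_expansion_column[OF A]) simp
  show ?thesis
  proof (cases "s \<in> S")
    case False
    then have "?A $$ (a, 0) = 0" if "a < Suc n" for a
      using that inS[OF that] S(3) r(2) by auto
    then show ?thesis using exp False by simp
  next
    case True
    have cons: "?xs = s # sorted_list_of_set (S - {s})"
    proof (rule sorted_list_of_set_Min_Cons[OF S(1) True])
      fix i assume "i \<in> S" then have "i \<in> insert s V" using S(3) by blast
      then show "s \<le> i" using V[of i] by auto
    qed
    have "?A $$ (a, 0) = of_bool (a = 0)" if "a < Suc n" for a
    proof (cases "a = 0")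
      case True then show ?thesis using cons r by simp
    next
      case False
      moreover have "?xs ! 0 = s" using cons by simp
      ultimately have "?xs ! a \<noteq> s" using nth_eq_iff_index_eq[OF dist, of a 0] that len by auto
      then show ?thesis using that inS[OF that] S(3) r(2) False by auto
    qed
    then have "minor (Suc n) r S = Determinant.cofactor ?A 0 0"
      unfolding exp by (subst sum.lessThan_Suc_shift) (simp add: sum.neutral)
    also have "\<dots> = minor n (\<lambda>i k. r i (Suc k)) (S - {s})"
      unfolding Determinant.cofactor_def minor_def using cons
      by (simp, intro arg_cong[where f = Determinant.det] eq_matI) (auto simp: mat_delete_def)
    finally show ?thesis using True by simp
  qed
qed

definition vdm :: "(nat \<Rightarrow> real) \<Rightarrow> nat set \<Rightarrow> real" where
  "vdm x S = (\<Prod>k\<in>S. \<Prod>i\<in>{i\<in>S. i < k}. x k - x i)"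

lemma vdm_Min:
  assumes "finite S" "s \<in> S" "\<And>i. i \<in> S \<Longrightarrow> s \<le> i"
  shows "vdm x S = (\<Prod>k\<in>S - {s}. x k - x s) * vdm x (S - {s})"
proof -
  have e: "{i\<in>S. i < s} = {}" using assms(3) by (auto simp: not_less)
  have "vdm x S = (\<Prod>k\<in>S - {s}. \<Prod>i\<in>{i\<in>S. i < k}. x k - x i)"
    unfolding vdm_def prod.remove[OF assms(1,2)] e by simp
  also have "\<dots> = (\<Prod>k\<in>S - {s}. (x k - x s) * (\<Prod>i\<in>{i\<in>S - {s}. i < k}. x k - x i))"
  proof (rule prod.cong[OF refl])
    fix k assume k: "k \<in> S - {s}"
    then have "{i\<in>S. i < k} = insert s {i\<in>S - {s}. i < k}"
      using assms(2) assms(3)[of k] by auto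
    then show "(\<Prod>i\<in>{i\<in>S. i < k}. x k - x i) = (x k - x s) * (\<Prod>i\<in>{i\<in>S - {s}. i < k}. x k - x i)"
      using assms(1) by simp
  qed
  finally show ?thesis unfolding vdm_def prod.distrib .
qed

lemma minor_vandermonde:
  assumes "finite S" "card S = n"
  shows "minor n (\<lambda>i k. x i ^ k) S = vdm x S"
  using assms
proof (induction n arbitrary: S)
  case 0
  then show ?case by (simp add: minor_def vdm_def)
next
  case (Suc n)
  define s where "s = Min S"
  have ne: "S \<noteq> {}" using Suc.prems by auto
  have s: "s \<in> S" "\<And>i. i \<in> S \<Longrightarrow> s \<le> i" using Suc.prems ne by (auto simp: s_def)
  let ?xs = "sorted_list_of_set S" and ?N = "Suc n"
  have cons: "?xs = s # sorted_list_of_set (S - {s})"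
    using sorted_list_of_set_Min_Cons[OF Suc.prems(1) s] .
  let ?A = "mat ?N ?N (\<lambda>(a, k). x (?xs ! a) ^ k)"
  \<comment> \<open>Right multiplication by \<open>?U\<close> subtracts from each column
    \<open>x s\<close> times the one before it, which clears the row of the smallest index
    \<open>s\<close> except for its first entry.\<close>
  let ?U = "mat ?N ?N (\<lambda>(k, l). if k = l then 1 else if Suc k = l then - x s else (0::real))"
  let ?r = "\<lambda>i k. case k of 0 \<Rightarrow> 1 | Suc k \<Rightarrow> (x i - x s) * x i ^ k"
  have "Determinant.det ?U = prod_list (diag_mat ?U)"
    by (rule Determinant.det_upper_triangular[of _ ?N]) (auto simp: upper_triangular_def)
  also have "\<dots> = 1" by (simp add: prod_list_diag_prod)
  finally have U: "Determinant.det ?U = 1" .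
  have AU: "?A * ?U = mat ?N ?N (\<lambda>(a, k). ?r (?xs ! a) k)" (is "_ = ?B")
  proof (rule eq_matI)
    fix a l assume al: "a < dim_row ?B" "l < dim_col ?B"
    have "(?A * ?U) $$ (a, l) = (\<Sum>k<?N. x (?xs ! a) ^ k * (if k = l then 1 else if Suc k = l then - x s else 0))"
      using al by (simp add: scalar_prod_def atLeast0LessThan)
    also have "\<dots> = (\<Sum>k<?N. if k = l then x (?xs ! a) ^ k else 0) + (\<Sum>k<?N. if Suc k = l then - x s * x (?xs ! a) ^ k else 0)"
      unfolding sum.distrib[symmetric] by (intro sum.cong refl) auto
    also have "\<dots> = ?r (?xs ! a) l"
      using al by (cases l) (simp_all add: sum.delta algebra_simps, metis Suc_lessI power_Suc)
    finally show "(?A * ?U) $$ (a, l) = ?B $$ (a, l)" using al by simp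
  qed auto
  have B: "?B \<in> carrier_mat ?N ?N" by simp
  have "minor ?N (\<lambda>i k. x i ^ k) S = Determinant.det ?B"
    unfolding minor_def AU[symmetric] by (subst Determinant.det_mult[of _ ?N]) (simp_all add: U)
  also have "\<dots> = (\<Sum>k<?N. ?B $$ (0, k) * Determinant.cofactor ?B 0 k)"
    by (rule laplace_expansion_row[OF B]) simp
  also have "\<dots> = Determinant.cofactor ?B 0 0"
    using cons by (subst sum.lessThan_Suc_shift) simp
  also have "\<dots> = minor n (\<lambda>i k. (x i - x s) * x i ^ k) (S - {s})"
    unfolding Determinant.cofactor_def minor_def using cons
    by (simp, intro arg_cong[where f = Determinant.det] eq_matI) (auto simp: mat_delete_def)
  also have "\<dots> = (\<Prod>i\<in>S - {s}. x i - x s) * minor n (\<lambda>i k. x i ^ k) (S - {s})"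
    by (rule minor_scale) (use Suc.prems s in auto)
  also have "minor n (\<lambda>i k. x i ^ k) (S - {s}) = vdm x (S - {s})"
    by (rule Suc.IH) (use Suc.prems s in auto)
  finally show ?case using vdm_Min[OF Suc.prems(1) s] by simp
qed

section \<open>Total positivity of divided differences\<close>

text \<open>\<open>hs x m i k\<close> is the divided difference of $z^{m+k}$ at the nodes $x_{i-m}, \dots, x_i$.\<close>

fun hs :: "(nat \<Rightarrow> real) \<Rightarrow> nat \<Rightarrow> nat \<Rightarrow> nat \<Rightarrow> real" where
  "hs x 0 i k = x i ^ k"
| "hs x (Suc m) i 0 = 1"
| "hs x (Suc m) i (Suc k) = hs x m (i - 1) (Suc k) + x i * hs x (Suc m) i k"

lemma hs_0 [simp]: "hs x m i 0 = 1"
  by (cases m) auto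

text \<open>\<open>hs\<close> is the complete homogeneous polynomial of degree \<open>k\<close> in
  its nodes, hence symmetric, but its recursion splits off the last node only. Here the first one is
  split off, by induction on \<open>m\<close> and then on \<open>k\<close>.\<close>

lemma hs_other_end:
  "m < i \<Longrightarrow> hs x (Suc m) i (Suc k) = hs x m i (Suc k) + x (i - Suc m) * hs x (Suc m) i k"
proof (induction m arbitrary: i k)
  case 0
  show ?case
  proof (induction k)
    case (Suc k)
    let ?z = "x (i - Suc 0)" and ?H = "hs x (Suc 0) i"
    have "?H (Suc (Suc k)) = ?z ^ Suc (Suc k) + x i * (x i ^ Suc k + ?z * ?H k)"
      using Suc by (simp only: hs.simps One_nat_def)
    also have "\<dots> = x i ^ Suc (Suc k) + ?z * (?z ^ Suc k + x i * ?H k)"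
      by (simp add: algebra_simps)
    finally show ?case by (simp only: hs.simps One_nat_def)
  qed (use 0 in simp)
next
  case (Suc m)
  have m: "hs x (Suc m) (i - 1) (Suc k) = hs x m (i - 1) (Suc k) + x (i - Suc (Suc m)) * hs x (Suc m) (i - 1) k" for k
    using Suc.IH[of "i - 1" k] Suc.prems by (simp add: algebra_simps)
  show ?case
  proof (induction k)
    case 0
    show ?case using m[of 0] by simp
  next
    case (Suc k)
    have "hs x (Suc (Suc m)) i (Suc (Suc k)) =
      hs x m (i - 1) (Suc (Suc k)) + x (i - Suc (Suc m)) * hs x (Suc m) (i - 1) (Suc k)
        + x i * hs x (Suc (Suc m)) i (Suc k)"
      by (subst hs.simps(3)) (simp only: m)
    also have "\<dots> = hs x m (i - 1) (Suc (Suc k)) + x (i - Suc (Suc m)) * hs x (Suc m) (i - 1) (Suc k)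
        + x i * (hs x (Suc m) i (Suc k) + x (i - Suc (Suc m)) * hs x (Suc (Suc m)) i k)"
      by (simp only: Suc)
    also have "\<dots> = (hs x m (i - 1) (Suc (Suc k)) + x i * hs x (Suc m) i (Suc k)) +
        x (i - Suc (Suc m)) * (hs x (Suc m) (i - 1) (Suc k) + x i * hs x (Suc (Suc m)) i k)"
      by (simp only: algebra_simps)
    finally show ?case by (simp only: hs.simps(3))
  qed
qed

text \<open>The recursion of divided differences without its denominator. Read as a statement on
  rows, it is the elementary operation of Neville elimination.\<close>

lemma hs_diff:
  "m < i \<Longrightarrow> hs x m i (Suc k) = hs x m (i - 1) (Suc k) + (x i - x (i - Suc m)) * hs x (Suc m) i k"
  using hs_other_end[of m i x k] by (simp add: algebra_simps)

text \<open>The pairs that occur in products of two minors with \<open>n\<close> rows from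
  \<open>V\<close>: the double rows counted twice and the single rows fill two sets of size
  \<open>n\<close>.\<close>

definition web_on :: "nat set \<Rightarrow> nat \<Rightarrow> nat set \<Rightarrow> (nat \<Rightarrow> nat) \<Rightarrow> bool" where
  "web_on V n P p \<longleftrightarrow> P \<subseteq> V \<and> (\<forall>x\<in>P. p x = x) \<and> {x. p x \<noteq> x} \<subseteq> V \<and>
     p \<in> webs {x. p x \<noteq> x} \<and> 2 * card P + card {x. p x \<noteq> x} = 2 * n"

lemma web_on_conj_swap:
  assumes w: "web_on V n P p" and V: "finite V" "k \<in> V" and p: "p (Suc k) \<noteq> Suc k" "p k = k" "k \<notin> P"
  shows "web_on V n P (conj_swap k p)"
proof -
  let ?X = "{x. p x \<noteq> x}"
  have fin: "finite ?X" using w V(1) finite_subset unfolding web_on_def by blast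
  have X: "Suc k \<in> ?X" "k \<notin> ?X" using p by auto
  have q: "conj_swap k p \<in> webs (insert k (?X - {Suc k}))"
    using conj_swap_webs[of p ?X k] w X swp_image_up[OF X] by (auto simp: web_on_def)
  note s = webs_support[OF q]
  have "card (insert k (?X - {Suc k})) = card ?X"
    using card_shift_down[OF fin X] by (simp add: shift_down_def)
  moreover have "conj_swap k p x = x" if "x \<in> P" for x
  proof -
    have "x \<notin> insert k (?X - {Suc k})" using that w p unfolding web_on_def by auto
    then show ?thesis using webs_mem[OF q] by blast
  qed
  moreover have "insert k (?X - {Suc k}) \<subseteq> V" using w V unfolding web_on_def by auto
  moreover have "P \<subseteq> V" "2 * card P + card ?X = 2 * n" using w by (auto simp: web_on_def)
  ultimately show ?thesis using q unfolding web_on_def s by simp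
qed

lemma web_on_conj_swap':
  assumes w: "web_on V n P p" and V: "finite V" "k \<in> V" and p: "p (Suc k) = Suc k" "p k \<noteq> k" "Suc k \<in> P"
  shows "web_on V n (shift_down k P) (conj_swap k p)"
proof -
  let ?X = "{x. p x \<noteq> x}"
  have fin: "finite ?X" "finite P" using w V(1) finite_subset unfolding web_on_def by blast+
  have X: "Suc k \<notin> ?X" "k \<in> ?X" using p by auto
  have kP: "k \<notin> P" using w p by (auto simp: web_on_def)
  have q: "conj_swap k p \<in> webs (insert (Suc k) (?X - {k}))"
    using conj_swap_webs[of p ?X k] w X swp_image_down[OF X] by (auto simp: web_on_def)
  note s = webs_support[OF q]
  have "card (insert (Suc k) (?X - {k})) = card ?X"
    using fin X card_Suc_Diff1[of ?X k] by simp
  moreover have "card (shift_down k P) = card P"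
    using card_shift_down[OF fin(2) p(3) kP] .
  moreover have "conj_swap k p x = x" if "x \<in> shift_down k P" for x
  proof -
    have "x \<notin> insert (Suc k) (?X - {k})"
      using that w p unfolding web_on_def shift_down_def by auto
    then show ?thesis using webs_mem[OF q] by blast
  qed
  moreover have "insert (Suc k) (?X - {k}) \<subseteq> V" "shift_down k P \<subseteq> V"
    using w V p unfolding web_on_def shift_down_def by auto
  moreover have "2 * card P + card ?X = 2 * n" using w by (auto simp: web_on_def)
  ultimately show ?thesis using q unfolding web_on_def s by simp
qed

lemma web_on_cut:
  assumes w: "web_on V n P p" and V: "finite V" "k \<in> V" and p: "p k = Suc k"
  shows "web_on V n (insert k P) (cut k p)"
proof -
  let ?X = "{x. p x \<noteq> x}"
  have fin: "finite ?X" "finite P" using w V(1) finite_subset unfolding web_on_def by blast+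
  have pw: "p \<in> webs ?X" using w by (simp add: web_on_def)
  have ps: "p (Suc k) = k" using webs_invol[OF pw, of k] p by simp
  have X: "Suc k \<in> ?X" "k \<in> ?X" using p ps by auto
  have kP: "k \<notin> P" using w p by (auto simp: web_on_def)
  have q: "cut k p \<in> webs (?X - {k, Suc k})"
    using cut_webs[OF pw X(2,1)] .
  note s = webs_support[OF q]
  have "card ?X = Suc (Suc (card (?X - {k, Suc k})))"
  proof -
    define Y where "Y = ?X - {k, Suc k}"
    have Y: "finite Y" "k \<notin> Y" "Suc k \<notin> Y" using fin by (auto simp: Y_def)
    have "?X = insert k (insert (Suc k) Y)" using X by (auto simp: Y_def)
    then have "card ?X = card (insert k (insert (Suc k) Y))" by (rule arg_cong)
    then show ?thesis unfolding Y_def[symmetric] using Y by simp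
  qed
  moreover have "cut k p x = x" if "x \<in> insert k P" for x
  proof -
    have "x \<notin> ?X - {k, Suc k}" using that w unfolding web_on_def by auto
    then show ?thesis using webs_mem[OF q] by blast
  qed
  moreover have "?X - {k, Suc k} \<subseteq> V" "insert k P \<subseteq> V"
    using w V unfolding web_on_def by auto
  moreover have "2 * card P + card ?X = 2 * n" using w by (auto simp: web_on_def)
  ultimately show ?thesis using q fin kP unfolding web_on_def s by simp
qed

lemma web_on_shift_down:
  assumes w: "web_on V n P p" and V: "finite V" "k \<in> V" and p: "p k = k" "Suc k \<in> P" "k \<notin> P"
  shows "web_on V n (shift_down k P) p"
proof -
  have fin: "finite P" using w V(1) finite_subset unfolding web_on_def by blast
  show ?thesis
    using w p V card_shift_down[OF fin p(2,3)] by (auto simp: web_on_def shift_down_def)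
qed

text \<open>A sufficient condition for a positive coefficient once the rows up to \<open>k\<close>
  have been treated. If \<open>k\<close> is the first row, it forces this row to be double (for at
  least one column); if \<open>k\<close> is the last row, every pattern satisfies it.\<close>

definition sweep_inv :: "nat \<Rightarrow> nat set \<Rightarrow> (nat \<Rightarrow> nat) \<Rightarrow> bool" where
  "sweep_inv k P p \<longleftrightarrow> k \<in> P \<or> p k < k \<or> (\<forall>x\<ge>k. x \<notin> P \<and> p x = x)"

text \<open>A pattern that is admissible for \<open>Suc k\<close> either is admissible for
  \<open>k\<close> itself or arises, by one term of the transition rule, from a pattern that
  is.\<close>

lemma sweep_inv_step:
  assumes c: "\<And>P p. c P p \<ge> 0"
    and pos: "\<And>P p. web_on V n P p \<Longrightarrow> sweep_inv k P p \<Longrightarrow> c P p > 0"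
    and V: "finite V" "k \<in> V"
    and w: "web_on V n P p" and i: "sweep_inv (Suc k) P p"
  shows "step_coeff k 1 c P p > 0"
proof -
  have ge: "step_coeff k 1 c P p \<ge> c P p" by (rule step_coeff_ge) (use c in auto)
  note move = step_coeff_move[of c 1 p k P, OF c]
  have pw: "p \<in> webs {x. p x \<noteq> x}" using w by (simp add: web_on_def)
  have fixd: "p x = x" if "x \<in> P" for x using w that by (auto simp: web_on_def)
  consider (dbl) "k \<in> P" | (dn) "p k < k" | (up) "p k > k" | (none) "p k = k" "k \<notin> P"
    by (meson linorder_neqE_nat)
  then show ?thesis
  proof cases
    case dbl
    then show ?thesis using pos[OF w] ge by (auto simp: sweep_inv_def)
  next
    case dn
    then show ?thesis using pos[OF w] ge by (auto simp: sweep_inv_def)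
  next
    case up
    consider "Suc k \<in> P" | "p (Suc k) < Suc k" | "\<forall>x\<ge>Suc k. x \<notin> P \<and> p x = x"
      using i by (auto simp: sweep_inv_def)
    then show ?thesis
    proof cases
      case 1
      have "0 < c (shift_down k P) (conj_swap k p)"
        by (rule pos[OF web_on_conj_swap'[OF w V]]) (use 1 up fixd in \<open>auto simp: sweep_inv_def shift_down_def\<close>)
      then show ?thesis using move(2) 1 up fixd by fastforce
    next
      case 2
      \<comment> \<open>A left endpoint \<open>k\<close> followed directly by a right endpoint must
        be linked to it; otherwise the two links would cross.\<close>
      have eq: "p k = Suc k"
      proof (rule ccontr)
        assume "p k \<noteq> Suc k"
        then have "Suc k < p k" using up by simp
        moreover have "p (Suc k) \<noteq> k" using calculation webs_invol[OF pw] by (metis less_irrefl)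
        ultimately show False
          using webs_nocross[OF pw, of "p (Suc k)" k] 2 webs_invol[OF pw] by simp
      qed
      have "0 < c (insert k P) (cut k p)"
        by (rule pos[OF web_on_cut[OF w V eq]]) (auto simp: sweep_inv_def)
      moreover have "Suc k \<notin> P" using fixd[of "Suc k"] 2 by auto
      ultimately show ?thesis using move(3) eq by fastforce
    next
      case 3
      then have "p (p k) = p k" using up by auto
      then show ?thesis using webs_invol[OF pw, of k] up by simp
    qed
  next
    case none
    consider "Suc k \<in> P" | "p (Suc k) < Suc k" | "\<forall>x\<ge>Suc k. x \<notin> P \<and> p x = x"
      using i by (auto simp: sweep_inv_def)
    then show ?thesis
    proof cases
      case 1
      have "0 < c (shift_down k P) p"
        by (rule pos[OF web_on_shift_down[OF w V]]) (use 1 none in \<open>auto simp: sweep_inv_def shift_down_def\<close>)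
      then show ?thesis using move(4) 1 none fixd by fastforce
    next
      case 2
      have "p (Suc k) \<noteq> k" using none webs_invol[OF pw] by (metis n_not_Suc_n)
      then have "conj_swap k p k = p (Suc k)" using 2 by (simp add: conj_swap_def swp_simps)
      moreover have "p (Suc k) < k" using 2 \<open>p (Suc k) \<noteq> k\<close> by simp
      ultimately have "0 < c P (conj_swap k p)"
        by (intro pos[OF web_on_conj_swap[OF w V]]) (use 2 none in \<open>auto simp: sweep_inv_def\<close>)
      then show ?thesis using move(1) 2 none by fastforce
    next
      case 3
      then have "sweep_inv k P p"
        using none unfolding sweep_inv_def by (metis le_antisym not_less_eq_eq)
      then show ?thesis using pos[OF w] ge by fastforce
    qed
  qed
qed

text \<open>One stage of Neville elimination, run backwards: after the steps below \<open>k\<close> the rows up to \<open>k\<close> are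
  the divided differences of order \<open>m\<close>, the others are still those of order \<open>Suc m\<close>.\<close>

definition neville :: "(nat \<Rightarrow> real) \<Rightarrow> nat \<Rightarrow> nat \<Rightarrow> nat \<Rightarrow> nat \<Rightarrow> real" where
  "neville x m k i l = (if i \<le> k then hs x m i l else
     case l of 0 \<Rightarrow> 0 | Suc l \<Rightarrow> (x i - x (i - Suc m)) * hs x (Suc m) i l)"

lemma neville_Suc:
  assumes "m < k"
  shows "neville x m (Suc k) = (neville x m k)(Suc k := (\<lambda>l. neville x m k (Suc k) l + 1 * neville x m k k l))"
proof (intro ext)
  fix i l
  show "neville x m (Suc k) i l = ((neville x m k)(Suc k := (\<lambda>l. neville x m k (Suc k) l + 1 * neville x m k k l))) i l"
  proof (cases "i = Suc k")
    case True
    then show ?thesis using assms hs_diff[of m "Suc k" x] by (cases l) (auto simp: neville_def)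
  qed (auto simp: neville_def)
qed

lemma webs_empty: "webs {} = {id}"
  by (auto simp: webs_def fun_eq_iff)

text \<open>Before the first operation of the stage, \<open>Suc m\<close> is the only row with a
  nonzero first entry, so both minors use it. Deleting it and the first column leaves the divided
  differences of the next order, scaled by the differences \<open>s i\<close>.\<close>

lemma neville_base:
  assumes c1: "web_expansion {Suc m<..R} n (minor n (hs x (Suc m))) c1" and m: "m < R"
    and s: "\<And>i. s i = (if i \<in> {Suc m<..R} then x i - x (i - Suc m) else 1)"
  shows "web_expansion {m<..R} (Suc n) (minor (Suc n) (neville x m (Suc m)))
    (\<lambda>P p. if Suc m \<in> P then (prod s (P - {Suc m}))\<^sup>2 * prod s {x. p x \<noteq> x} * c1 (P - {Suc m}) p else 0)"
proof -
  let ?V = "{m<..R}" and ?V' = "{Suc m<..R}"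
  have V: "?V = insert (Suc m) ?V'" using m by auto
  have "web_expansion ?V' n (\<lambda>S. prod s S * minor n (hs x (Suc m)) S)
      (\<lambda>P p. (prod s P)\<^sup>2 * prod s {x. p x \<noteq> x} * c1 P p)"
    by (rule web_expansion_scale[OF c1]) simp
  from web_expansion_unit_row[OF this, of "Suc m"]
  have e3: "web_expansion ?V (Suc n) (\<lambda>S. if Suc m \<in> S then
      prod s (S - {Suc m}) * minor n (hs x (Suc m)) (S - {Suc m}) else 0)
    (\<lambda>P p. if Suc m \<in> P then (prod s (P - {Suc m}))\<^sup>2 * prod s {x. p x \<noteq> x} * c1 (P - {Suc m}) p else 0)"
    unfolding V by simp
  show ?thesis
  proof (rule web_expansion_cong[OF e3])
    fix S assume S: "S \<subseteq> ?V" "card S = Suc n"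
    have fin: "finite S" using finite_subset[OF S(1)] by simp
    have "minor (Suc n) (neville x m (Suc m)) S = (if Suc m \<in> S then
       minor n (\<lambda>i k. neville x m (Suc m) i (Suc k)) (S - {Suc m}) else 0)"
      by (rule minor_unit_row[OF fin S(2), of _ ?V']) (use S in \<open>auto simp: neville_def V\<close>)
    also have "\<dots> = (if Suc m \<in> S then minor n (\<lambda>i k. s i * hs x (Suc m) i k) (S - {Suc m}) else 0)"
    proof (cases "Suc m \<in> S")
      case True
      have "minor n (\<lambda>i k. neville x m (Suc m) i (Suc k)) (S - {Suc m}) =
        minor n (\<lambda>i k. s i * hs x (Suc m) i k) (S - {Suc m})"
        by (rule minor_cong) (use fin S True in \<open>auto simp: neville_def s\<close>)
      then show ?thesis by simp
    qed simp
    also have "\<dots> = (if Suc m \<in> S then prod s (S - {Suc m}) * minor n (hs x (Suc m)) (S - {Suc m}) else 0)"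
      using minor_scale[of "S - {Suc m}" n s "hs x (Suc m)"] fin S by auto
    finally show "minor (Suc n) (neville x m (Suc m)) S = \<dots>" .
  qed
qed

lemma neville_step:
  assumes c: "web_expansion {m<..R} n (minor n (neville x m k)) c" and k: "m < k" "k \<le> R"
  shows "web_expansion {m<..R} n (minor n (neville x m (Suc k))) (step_coeff k 1 c)"
proof (rule web_expansion_cong[OF web_expansion_row_step[OF c, of k 1]])
  fix S assume S: "S \<subseteq> {m<..R}" "card S = n"
  then have "finite S" using finite_subset by blast
  then show "minor n (neville x m (Suc k)) S = row_step k 1 (minor n (neville x m k)) S"
    using minor_row_step[OF _ S(2), of "neville x m k" k 1] neville_Suc[of m k x] k by simp
qed (use k in auto)

lemma neville_last:
  assumes c: "web_expansion {m<..R} n (minor n (neville x m R)) c"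
  shows "web_expansion {m<..R} n (minor n (hs x m)) c"
proof (rule web_expansion_cong[OF c])
  fix S assume S: "S \<subseteq> {m<..R}" "card S = n"
  then have "finite S" using finite_subset by blast
  then show "minor n (hs x m) S = minor n (neville x m R) S"
    by (rule minor_cong) (use S in \<open>auto simp: neville_def\<close>)
qed

text \<open>Induction on the number of columns, each stage raising the order of the divided
  differences by one. Only nodes more than \<open>m\<close> places apart have to be in strict order.
  For \<open>m = 1\<close> the two points of a pair may coincide, so the statement applies on the
  diagonal itself.\<close>

theorem hs_expansion_positive:
  assumes x: "\<And>i j. 0 < i \<Longrightarrow> i + m < j \<Longrightarrow> j \<le> R \<Longrightarrow> x i < x j"
  shows "\<exists>c. web_expansion {m<..R} n (minor n (hs x m)) c \<and> (\<forall>P p. c P p \<ge> 0) \<and>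
     (\<forall>P p. web_on {m<..R} n P p \<longrightarrow> c P p > 0)"
  using x
proof (induction n arbitrary: m)
  case 0
  have "web_expansion {m<..R} 0 (minor 0 (hs x m)) (\<lambda>P p. 1)"
    unfolding web_expansion_def
  proof (intro allI impI)
    fix S T assume ST: "S \<subseteq> {m<..R}" "T \<subseteq> {m<..R}" "card S = 0" "card T = 0"
    then have "S = {}" "T = {}" using finite_subset[OF ST(1)] finite_subset[OF ST(2)] by auto
    then show "minor 0 (hs x m) S * minor 0 (hs x m) T = (\<Sum>p\<in>webs (sym_diff S T). of_bool (compat S p) * 1)"
      by (simp add: minor_def webs_empty compat_def)
  qed
  then show ?case by fastforce
next
  case (Suc n)
  let ?V = "{m<..R}" and ?V' = "{Suc m<..R}"
  show ?case
  proof (cases "m < R")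
    case False
    then have e: "?V = {}" by simp
    have "web_expansion ?V (Suc n) (minor (Suc n) (hs x m)) (\<lambda>P p. 0)"
      unfolding web_expansion_def e by auto
    moreover have "\<not> web_on ?V (Suc n) P p" for P p by (auto simp: web_on_def e)
    ultimately show ?thesis by (intro exI[of _ "\<lambda>P p. 0"]) auto
  next
    case True
    define s where "s i = (if i \<in> ?V' then x i - x (i - Suc m) else 1)" for i
    have s: "s i > 0" for i using Suc.prems[of "i - Suc m" i] by (auto simp: s_def)
    have V: "?V = insert (Suc m) ?V'" using True by auto
    obtain c1 where c1: "web_expansion ?V' n (minor n (hs x (Suc m))) c1" "\<And>P p. c1 P p \<ge> 0"
      "\<And>P p. web_on ?V' n P p \<Longrightarrow> c1 P p > 0"
      using Suc.IH[of "Suc m"] Suc.prems by force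
    define c2 where "c2 P p = (prod s P)\<^sup>2 * prod s {x. p x \<noteq> x} * c1 P p" for P p
    define c3 where "c3 P p = (if Suc m \<in> P then c2 (P - {Suc m}) p else 0)" for P p
    have prod_pos: "prod s A > 0" for A using s by (simp add: prod_pos)
    have c2: "c2 P p \<ge> 0" "web_on ?V' n P p \<Longrightarrow> c2 P p > 0" for P p
      using c1(2,3)[of P p] prod_pos[of P] prod_pos[of "{x. p x \<noteq> x}"] by (auto simp: c2_def)
    have "web_expansion ?V (Suc n) (minor (Suc n) (neville x m (Suc m))) c3"
      unfolding c3_def[abs_def] c2_def by (rule neville_base[OF c1(1) True]) (simp add: s_def)
    note base' = this
    have "\<exists>c. web_expansion ?V (Suc n) (minor (Suc n) (neville x m k)) c \<and> (\<forall>P p. c P p \<ge> 0) \<and>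
       (\<forall>P p. web_on ?V (Suc n) P p \<longrightarrow> sweep_inv k P p \<longrightarrow> c P p > 0)"
      if "m < k" "k \<le> R" for k
      using Suc_leI[OF that(1)] that(2)
    proof (induction k rule: dec_induct)
      case base
      have "c3 P p > 0" if w: "web_on ?V (Suc n) P p" and i: "sweep_inv (Suc m) P p" for P p
      proof -
        have pw: "p \<in> webs {x. p x \<noteq> x}" "{x. p x \<noteq> x} \<subseteq> ?V" "P \<subseteq> ?V" using w by (auto simp: web_on_def)
        have "\<not> p (Suc m) < Suc m"
        proof
          assume "p (Suc m) < Suc m"
          then have "p (Suc m) \<in> {x. p x \<noteq> x}" using webs_in[OF pw(1), of "Suc m"] by simp
          then show False using pw(2) \<open>p (Suc m) < Suc m\<close> by auto
        qed
        moreover have "\<not> (\<forall>x\<ge>Suc m. x \<notin> P \<and> p x = x)"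
        proof
          assume a: "\<forall>x\<ge>Suc m. x \<notin> P \<and> p x = x"
          then have "P = {}" "{x. p x \<noteq> x} = {}" using pw by force+
          then show False using w by (simp add: web_on_def)
        qed
        ultimately have sP: "Suc m \<in> P" using i by (auto simp: sweep_inv_def)
        have fP: "finite P" using finite_subset[OF pw(3)] by simp
        have "web_on ?V' n (P - {Suc m}) p"
          using w sP card_Suc_Diff1[OF fP sP] unfolding web_on_def V by auto
        then show ?thesis using c2 sP by (simp add: c3_def)
      qed
      moreover have "c3 P p \<ge> 0" for P p using c2(1) by (simp add: c3_def)
      ultimately show ?case using base'
        by blast
    next
      case (step k)
      then obtain c where c: "web_expansion ?V (Suc n) (minor (Suc n) (neville x m k)) c" "\<And>P p. c P p \<ge> 0"
        "\<And>P p. web_on ?V (Suc n) P p \<Longrightarrow> sweep_inv k P p \<Longrightarrow> c P p > 0"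
        by auto
      have kV: "k \<in> ?V" using step by auto
      have "web_expansion ?V (Suc n) (minor (Suc n) (neville x m (Suc k))) (step_coeff k 1 c)"
        using neville_step[OF c(1)] step by simp
      moreover have "step_coeff k 1 c P p \<ge> 0" for P p by (rule step_coeff_nonneg) (use c in auto)
      moreover have "step_coeff k 1 c P p > 0" if "web_on ?V (Suc n) P p" "sweep_inv (Suc k) P p" for P p
        by (rule sweep_inv_step[OF c(2,3) _ kV that]) auto
      ultimately show ?case by blast
    qed
    from this[of R] True obtain c where c: "web_expansion ?V (Suc n) (minor (Suc n) (neville x m R)) c"
      "\<And>P p. c P p \<ge> 0" "\<And>P p. web_on ?V (Suc n) P p \<Longrightarrow> sweep_inv R P p \<Longrightarrow> c P p > 0"
      by auto
    have "web_expansion ?V (Suc n) (minor (Suc n) (hs x m)) c" by (rule neville_last[OF c(1)])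
    moreover have "c P p > 0" if w: "web_on ?V (Suc n) P p" for P p
    proof (rule c(3)[OF w])
      have pw: "p \<in> webs {x. p x \<noteq> x}" "{x. p x \<noteq> x} \<subseteq> ?V" "P \<subseteq> ?V" using w by (auto simp: web_on_def)
      have "p R \<le> R" using webs_in[OF pw(1), of R] pw(2) by (cases "p R = R") auto
      moreover have "\<forall>x>R. x \<notin> P \<and> p x = x" using pw by auto
      ultimately show "sweep_inv R P p" unfolding sweep_inv_def using le_neq_implies_less le_eq_less_or_eq by metis
    qed
    ultimately show ?thesis using c(2) by blast
  qed
qed

section \<open>A class of smooth functions on a configuration space\<close>

definition config :: "(nat \<times> nat) set \<Rightarrow> (nat \<Rightarrow> real) set" where
  "config E = {x. \<forall>(i, k)\<in>E. x i < x k}"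

text \<open>An inductively generated class, so that continuity, partial derivatives and the chain
  rule all follow by induction and regularity never has to be tracked separately. \<open>I\<close>
  contains the coordinates that may occur. By \<open>smooth_cong\<close> only the values on
  \<open>config E\<close> matter, where the differences under the powers are positive.\<close>

inductive smooth :: "nat set \<Rightarrow> (nat \<times> nat) set \<Rightarrow> ((nat \<Rightarrow> real) \<Rightarrow> real) \<Rightarrow> bool" for I E where
  smooth_const: "smooth I E (\<lambda>_. c)"
| smooth_coord: "i \<in> I \<Longrightarrow> smooth I E (\<lambda>x. x i)"
| smooth_powr: "(i, k) \<in> E \<Longrightarrow> smooth I E (\<lambda>x. (x k - x i) powr r)"
| smooth_add: "smooth I E f \<Longrightarrow> smooth I E g \<Longrightarrow> smooth I E (\<lambda>x. f x + g x)"
| smooth_mult: "smooth I E f \<Longrightarrow> smooth I E g \<Longrightarrow> smooth I E (\<lambda>x. f x * g x)"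
| smooth_cong: "smooth I E f \<Longrightarrow> (\<And>x. x \<in> config E \<Longrightarrow> f x = g x) \<Longrightarrow> smooth I E g"

lemmas smooth_intros = smooth_const smooth_coord smooth_powr smooth_add smooth_mult

lemma smooth_sum:
  "finite A \<Longrightarrow> (\<And>a. a \<in> A \<Longrightarrow> smooth I E (f a)) \<Longrightarrow> smooth I E (\<lambda>x. \<Sum>a\<in>A. f a x)"
  by (induction A rule: finite_induct) (auto intro: smooth_intros)

lemma smooth_prod:
  "finite A \<Longrightarrow> (\<And>a. a \<in> A \<Longrightarrow> smooth I E (f a)) \<Longrightarrow> smooth I E (\<lambda>x. \<Prod>a\<in>A. f a x)"
  by (induction A rule: finite_induct) (auto intro: smooth_intros)

lemma smooth_diff:
  assumes "smooth I E f" "smooth I E g" shows "smooth I E (\<lambda>x. f x - g x)"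
proof -
  have "smooth I E (\<lambda>x. f x + (-1) * g x)" by (intro smooth_intros assms)
  then show ?thesis by simp
qed

lemma smooth_power: "smooth I E f \<Longrightarrow> smooth I E (\<lambda>x. f x ^ k)"
  by (induction k) (auto intro: smooth_intros)

lemma smooth_inverse_diff:
  assumes "(i, k) \<in> E" shows "smooth I E (\<lambda>x. 1 / (x k - x i))"
  by (rule smooth_cong[OF smooth_powr[OF assms, of _ "-1"]])
    (use assms in \<open>auto simp: config_def powr_minus_divide\<close>)

text \<open>\<open>config E\<close> is open with respect to convergence of the finitely many
  coordinates in \<open>I\<close>. All limits are taken coordinatewise.\<close>

lemma eventually_config:
  assumes "finite E" "E \<subseteq> I \<times> I" "x \<in> config E" "\<And>i. i \<in> I \<Longrightarrow> ((\<lambda>s. X s i) \<longlongrightarrow> x i) F"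
  shows "\<forall>\<^sub>F s in F. X s \<in> config E"
proof -
  have "\<forall>\<^sub>F s in F. X s (fst e) < X s (snd e)" if "e \<in> E" for e
  proof -
    have "x (fst e) < x (snd e)" "fst e \<in> I" "snd e \<in> I" using that assms(2,3) by (auto simp: config_def)
    moreover from this have "((\<lambda>s. X s (snd e) - X s (fst e)) \<longlongrightarrow> x (snd e) - x (fst e)) F"
      by (intro tendsto_diff assms(4))
    ultimately have "\<forall>\<^sub>F s in F. 0 < X s (snd e) - X s (fst e)"
      by (intro order_tendstoD(1)) auto
    then show ?thesis by eventually_elim simp
  qed
  then have "\<forall>\<^sub>F s in F. \<forall>e\<in>E. X s (fst e) < X s (snd e)"
    using assms(1) by (simp add: eventually_ball_finite_distrib)
  then show ?thesis by eventually_elim (auto simp: config_def)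
qed

lemma smooth_tendsto:
  assumes f: "smooth I E f" and E: "finite E" "E \<subseteq> I \<times> I" and x: "x \<in> config E"
    and X: "\<And>i. i \<in> I \<Longrightarrow> ((\<lambda>s. X s i) \<longlongrightarrow> x i) F"
  shows "((\<lambda>s. f (X s)) \<longlongrightarrow> f x) F"
  using f
proof induction
  case (smooth_powr i k r)
  then have "x k - x i \<noteq> 0" "i \<in> I" "k \<in> I" using x E by (auto simp: config_def)
  then show ?case by (intro tendsto_intros X) auto
next
  case (smooth_cong f g)
  have "f x = g x" using smooth_cong x by blast
  moreover have "\<forall>\<^sub>F s in F. f (X s) = g (X s)"
    using eventually_config[OF E x X] by (rule eventually_mono) (use smooth_cong in auto)
  ultimately show ?case using smooth_cong by (simp add: tendsto_cong)
qed (auto intro!: tendsto_intros X)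

text \<open>Derivatives along arbitrary curves rather than coordinate lines only: this makes the
  chain rule available when variables are identified with one another.\<close>

definition gradient ::
  "nat set \<Rightarrow> (nat \<times> nat) set \<Rightarrow> ((nat \<Rightarrow> real) \<Rightarrow> real) \<Rightarrow> (nat \<Rightarrow> (nat \<Rightarrow> real) \<Rightarrow> real) \<Rightarrow> bool" where
  "gradient I E f f' \<longleftrightarrow> (\<forall>i. smooth I E (f' i)) \<and> (\<forall>\<gamma> \<gamma>' t. \<gamma> t \<in> config E \<longrightarrow>
     (\<forall>i\<in>I. ((\<lambda>s. \<gamma> s i) has_real_derivative \<gamma>' i) (at t)) \<longrightarrow>
     ((\<lambda>s. f (\<gamma> s)) has_real_derivative (\<Sum>i\<in>I. f' i (\<gamma> t) * \<gamma>' i)) (at t))"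

lemma gradientD:
  assumes "gradient I E f f'"
  shows "smooth I E (f' i)"
    and "\<gamma> t \<in> config E \<Longrightarrow> \<forall>i\<in>I. ((\<lambda>s. \<gamma> s i) has_real_derivative \<gamma>' i) (at t) \<Longrightarrow>
      ((\<lambda>s. f (\<gamma> s)) has_real_derivative (\<Sum>i\<in>I. f' i (\<gamma> t) * \<gamma>' i)) (at t)"
  using assms unfolding gradient_def by blast+

lemma smooth_gradient:
  assumes I: "finite I" and E: "finite E" "E \<subseteq> I \<times> I" and f: "smooth I E f"
  shows "\<exists>f'. gradient I E f f'"
  using f
proof induction
  case (smooth_const c)
  show ?case
    by (rule exI[of _ "\<lambda>_ _. 0"]) (auto simp: gradient_def intro: smooth.smooth_const)
next
  case (smooth_coord i)
  have "(\<Sum>j\<in>I. of_bool (j = i) * \<gamma>' j) = (\<gamma>' i :: real)" for \<gamma>'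
    using I smooth_coord by (simp add: of_bool_def if_distrib[of "\<lambda>x. x * _"] sum.delta cong: if_cong)
  then show ?case using smooth_coord
    by (intro exI[of _ "\<lambda>j _. of_bool (j = i)"]) (auto simp: gradient_def intro: smooth.smooth_const)
next
  case (smooth_powr i k r)
  have ik: "i \<in> I" "k \<in> I" using smooth_powr E by auto
  let ?f' = "\<lambda>j x. (of_bool (j = k) - of_bool (j = i)) * (r * (x k - x i) powr (r - 1))"
  have "smooth I E (?f' j)" for j
    by (intro smooth.smooth_mult smooth.smooth_const smooth.smooth_powr smooth_powr)
  moreover have "((\<lambda>s. (\<gamma> s k - \<gamma> s i) powr r) has_real_derivative (\<Sum>j\<in>I. ?f' j (\<gamma> t) * \<gamma>' j)) (at t)"
    if g: "\<gamma> t \<in> config E" "\<forall>i\<in>I. ((\<lambda>s. \<gamma> s i) has_real_derivative \<gamma>' i) (at t)" for \<gamma> \<gamma>' t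
  proof -
    have pos: "\<gamma> t k - \<gamma> t i > 0" using g smooth_powr by (auto simp: config_def)
    have "((\<lambda>s. \<gamma> s k - \<gamma> s i) has_real_derivative (\<gamma>' k - \<gamma>' i)) (at t)"
      using g(2) ik by (intro derivative_intros) auto
    from DERIV_chain2[OF has_real_derivative_powr[OF pos, of r] this]
    have "((\<lambda>s. (\<gamma> s k - \<gamma> s i) powr r) has_real_derivative
      r * (\<gamma> t k - \<gamma> t i) powr (r - 1) * (\<gamma>' k - \<gamma>' i)) (at t)" .
    moreover have "(\<Sum>j\<in>I. ?f' j (\<gamma> t) * \<gamma>' j) =
       (\<Sum>j\<in>I. (if j = k then r * (\<gamma> t k - \<gamma> t i) powr (r - 1) * \<gamma>' j else 0)) -
       (\<Sum>j\<in>I. (if j = i then r * (\<gamma> t k - \<gamma> t i) powr (r - 1) * \<gamma>' j else 0))"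
      unfolding sum_subtractf[symmetric] by (intro sum.cong refl) (auto simp: algebra_simps)
    then have "(\<Sum>j\<in>I. ?f' j (\<gamma> t) * \<gamma>' j) = r * (\<gamma> t k - \<gamma> t i) powr (r - 1) * (\<gamma>' k - \<gamma>' i)"
      using I ik by (simp add: sum.delta right_diff_distrib)
    ultimately show ?thesis by simp
  qed
  ultimately show ?case unfolding gradient_def by (intro exI[of _ ?f'] conjI allI impI) blast+
next
  case (smooth_add f g)
  then obtain f' g' where fg: "gradient I E f f'" "gradient I E g g'" by blast
  note f' = gradientD[OF fg(1)] and g' = gradientD[OF fg(2)]
  show ?case unfolding gradient_def
  proof (intro exI[of _ "\<lambda>i x. f' i x + g' i x"] conjI allI impI)
    fix \<gamma> \<gamma>' t
    assume "\<gamma> t \<in> config E" "\<forall>i\<in>I. ((\<lambda>s. \<gamma> s i) has_real_derivative \<gamma>' i) (at t)"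
    from DERIV_add[OF f'(2)[OF this] g'(2)[OF this]]
    show "((\<lambda>s. f (\<gamma> s) + g (\<gamma> s)) has_real_derivative (\<Sum>i\<in>I. (f' i (\<gamma> t) + g' i (\<gamma> t)) * \<gamma>' i)) (at t)"
      by (simp add: distrib_right sum.distrib)
  qed (intro smooth.smooth_add f' g')
next
  case (smooth_mult f g)
  then obtain f' g' where fg: "gradient I E f f'" "gradient I E g g'" by blast
  note f' = gradientD[OF fg(1)] and g' = gradientD[OF fg(2)]
  show ?case unfolding gradient_def
  proof (intro exI[of _ "\<lambda>i x. f' i x * g x + g' i x * f x"] conjI allI impI)
    fix \<gamma> \<gamma>' t
    assume "\<gamma> t \<in> config E" "\<forall>i\<in>I. ((\<lambda>s. \<gamma> s i) has_real_derivative \<gamma>' i) (at t)"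
    from DERIV_mult[OF f'(2)[OF this] g'(2)[OF this]]
    show "((\<lambda>s. f (\<gamma> s) * g (\<gamma> s)) has_real_derivative
        (\<Sum>i\<in>I. (f' i (\<gamma> t) * g (\<gamma> t) + g' i (\<gamma> t) * f (\<gamma> t)) * \<gamma>' i)) (at t)"
      by (simp add: distrib_left sum.distrib sum_distrib_left sum_distrib_right mult_ac)
  qed (intro smooth.smooth_add smooth.smooth_mult f' g' smooth_mult)
next
  case (smooth_cong f g)
  then obtain f' where fg: "gradient I E f f'" by blast
  note f' = gradientD[OF fg]
  show ?case unfolding gradient_def
  proof (intro exI[of _ f'] conjI allI impI f'(1))
    fix \<gamma> :: "real \<Rightarrow> nat \<Rightarrow> real" and \<gamma>' t
    assume g: "\<gamma> t \<in> config E" "\<forall>i\<in>I. ((\<lambda>s. \<gamma> s i) has_real_derivative \<gamma>' i) (at t)"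
    have "((\<lambda>s. \<gamma> s i) \<longlongrightarrow> \<gamma> t i) (nhds t)" if "i \<in> I" for i
    proof -
      have "isCont (\<lambda>s. \<gamma> s i) t" using g(2) that by (blast intro: DERIV_isCont)
      then show ?thesis unfolding isCont_def using tendsto_at_iff_tendsto_nhds[of "\<lambda>s. \<gamma> s i" t] by blast
    qed
    from eventually_config[OF E g(1) this]
    have "\<forall>\<^sub>F s in nhds t. f (\<gamma> s) = g (\<gamma> s)"
      by (rule eventually_mono) (use smooth_cong in auto)
    then show "((\<lambda>s. g (\<gamma> s)) has_real_derivative (\<Sum>i\<in>I. f' i (\<gamma> t) * \<gamma>' i)) (at t)"
      using f'(2)[OF g] by (simp only: DERIV_cong_ev[OF refl _ refl])
  qed
qed

locale smooth_config =
  fixes I :: "nat set" and E :: "(nat \<times> nat) set"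
  assumes I: "finite I" and E: "finite E" "E \<subseteq> I \<times> I"
begin

lemma smooth_update_deriv:
  assumes f: "smooth I E f"
  shows "\<exists>f'. (\<forall>i. smooth I E (f' i)) \<and> (\<forall>x\<in>config E. \<forall>i.
     ((\<lambda>t. f (x(i := t))) has_real_derivative (if i \<in> I then f' i x else 0)) (at (x i))) \<and>
     (\<forall>\<gamma> \<gamma>' t. \<gamma> t \<in> config E \<longrightarrow>
     (\<forall>i\<in>I. ((\<lambda>s. \<gamma> s i) has_real_derivative \<gamma>' i) (at t)) \<longrightarrow>
     ((\<lambda>s. f (\<gamma> s)) has_real_derivative (\<Sum>i\<in>I. f' i (\<gamma> t) * \<gamma>' i)) (at t))"
proof -
  from smooth_gradient[OF I E f] obtain f' where fg: "gradient I E f f'" by blast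
  note f' = gradientD(1)[OF fg] and c = gradientD(2)[OF fg]
  have "((\<lambda>t. f (x(i := t))) has_real_derivative (if i \<in> I then f' i x else 0)) (at (x i))"
    if x: "x \<in> config E" for x i
  proof -
    have "((\<lambda>t. f (x(i := t))) has_real_derivative (\<Sum>j\<in>I. f' j (x(i := x i)) * of_bool (j = i))) (at (x i))"
      by (rule c) (use x in \<open>auto intro!: derivative_eq_intros\<close>)
    moreover have "(\<Sum>j\<in>I. f' j (x(i := x i)) * of_bool (j = i)) = (if i \<in> I then f' i x else 0)"
      using I by (simp add: of_bool_def if_distrib[of "\<lambda>x. _ * x"] sum.delta cong: if_cong)
    ultimately show ?thesis by simp
  qed
  then show ?thesis using f' c by blast
qed

lemma smooth_has_pderiv:
  assumes "smooth I E f" "x \<in> config E"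
  shows "((\<lambda>t. f (x(i := t))) has_real_derivative pderiv_at i f x) (at (x i))"
proof -
  obtain f' where "\<And>x i. x \<in> config E \<Longrightarrow>
     ((\<lambda>t. f (x(i := t))) has_real_derivative (if i \<in> I then f' i x else 0)) (at (x i))"
    using smooth_update_deriv[OF assms(1)] by blast
  from this[OF assms(2), of i] show ?thesis unfolding pderiv_at_def by (simp add: DERIV_imp_deriv)
qed

lemma smooth_pdifferentiable: "smooth I E f \<Longrightarrow> x \<in> config E \<Longrightarrow> pdifferentiable i f x"
  using smooth_has_pderiv unfolding pdifferentiable_def field_differentiable_def by blast

lemma smooth_pderiv:
  assumes f: "smooth I E f" shows "smooth I E (pderiv_at i f)"
proof -
  obtain f' where f': "smooth I E (f' i)"
    "\<And>x. x \<in> config E \<Longrightarrow> ((\<lambda>t. f (x(i := t))) has_real_derivative (if i \<in> I then f' i x else 0)) (at (x i))"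
    using smooth_update_deriv[OF f] by blast
  have eq: "pderiv_at i f x = (if i \<in> I then f' i x else 0)" if "x \<in> config E" for x
    unfolding pderiv_at_def by (rule DERIV_imp_deriv[OF f'(2)[OF that]])
  have "smooth I E (\<lambda>x. if i \<in> I then f' i x else 0)"
    using f' by (cases "i \<in> I") (auto intro: smooth.smooth_const)
  then show ?thesis by (rule smooth_cong) (simp add: eq)
qed

lemma smooth_curve:
  assumes f: "smooth I E f" and g: "\<gamma> t \<in> config E"
    "\<And>i. i \<in> I \<Longrightarrow> ((\<lambda>s. \<gamma> s i) has_real_derivative \<gamma>' i) (at t)"
  shows "((\<lambda>s. f (\<gamma> s)) has_real_derivative (\<Sum>i\<in>I. pderiv_at i f (\<gamma> t) * \<gamma>' i)) (at t)"
proof -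
  obtain f' where f': "\<And>x i. x \<in> config E \<Longrightarrow>
     ((\<lambda>t. f (x(i := t))) has_real_derivative (if i \<in> I then f' i x else 0)) (at (x i))"
    "((\<lambda>s. f (\<gamma> s)) has_real_derivative (\<Sum>i\<in>I. f' i (\<gamma> t) * \<gamma>' i)) (at t)"
    using smooth_update_deriv[OF f] g by blast
  have "pderiv_at i f (\<gamma> t) = f' i (\<gamma> t)" if "i \<in> I" for i
    unfolding pderiv_at_def using f'(1)[OF g(1), of i] that by (simp add: DERIV_imp_deriv)
  then show ?thesis using f'(2) by (simp cong: sum.cong)
qed

lemma smooth_update_config:
  assumes "x \<in> config E"
  shows "\<forall>\<^sub>F t in nhds (x i). x(i := t) \<in> config E"
proof (rule eventually_config[OF E assms])
  show "((\<lambda>t. (x(i := t)) j) \<longlongrightarrow> x j) (nhds (x i))" for j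
    by (cases "j = i") (auto simp: filterlim_ident)
qed

lemma pderiv_cong:
  assumes x: "x \<in> config E" and "\<And>x. x \<in> config E \<Longrightarrow> f x = g x"
  shows "pderiv_at i f x = pderiv_at i g x"
  unfolding pderiv_at_def
  by (rule deriv_cong_ev) (use eventually_mono[OF smooth_update_config[OF x]] assms in auto)

end

section \<open>Positivity of the fused coefficients\<close>

lemma smooth_minor:
  assumes S: "finite S" "card S = n" and r: "\<And>i k. i \<in> S \<Longrightarrow> k < n \<Longrightarrow> smooth I E (\<lambda>x. r x i k)"
  shows "smooth I E (\<lambda>x. minor n (r x) S)"
proof -
  let ?xs = "sorted_list_of_set S"
  have permutes_less: "p a < n" if "p permutes {0..<n}" "a < n" for p a
    using permutes_in_image[OF that(1), of a] that(2) by simp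
  have "minor n (r x) S = (\<Sum>p\<in>{p. p permutes {0..<n}}. signof p * (\<Prod>a\<in>{0..<n}. r x (?xs ! a) (p a)))" for x
    unfolding minor_def
    by (subst Determinant.det_def'[of _ n]) (auto intro!: sum.cong prod.cong arg_cong2[where f = "(*)"] simp: permutes_less)
  moreover have "smooth I E (\<lambda>x. \<Sum>p\<in>{p. p permutes {0..<n}}. signof p * (\<Prod>a\<in>{0..<n}. r x (?xs ! a) (p a)))"
  proof (intro smooth_sum smooth_mult smooth_const smooth_prod r)
    fix p a assume pa: "p \<in> {p. p permutes {0..<n}}" "a \<in> {0..<n}"
    then show "?xs ! a \<in> S" using S nth_mem[of a ?xs] by simp
    show "p a < n" using pa by (simp add: permutes_less)
  qed (simp_all add: finite_permutations)
  ultimately show ?thesis by simp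
qed

lemma smooth_hs: "{i - m..i} \<subseteq> I \<Longrightarrow> smooth I E (\<lambda>x. hs x m i k)"
proof (induction m arbitrary: i k)
  case 0
  then show ?case by (auto intro: smooth_power smooth_coord)
next
  case (Suc m)
  note IH = Suc.IH and nodes = Suc.prems
  show ?case
  proof (induction k)
    case 0
    then show ?case by (simp add: smooth_const)
  next
    case (Suc k)
    have "smooth I E (\<lambda>x. hs x m (i - 1) (Suc k))"
      by (rule IH) (rule subset_trans[OF _ nodes], auto)
    moreover have "smooth I E (\<lambda>x. x i)" using nodes by (intro smooth_coord) auto
    ultimately show ?case using Suc by (simp add: smooth_add smooth_mult)
  qed
qed

lemma card_ups:
  assumes p: "p \<in> webs X" and X: "finite X"
  shows "card (X - ups p) = card (ups p)" "2 * card (ups p) = card X"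
proof -
  note inv = webs_invol[OF p]
  have sub: "ups p \<subseteq> X" by (rule ups_subset[OF p])
  have "bij_betw p (ups p) (X - ups p)"
  proof (rule bij_betw_byWitness[where f' = p])
    show "p ` ups p \<subseteq> X - ups p"
      using webs_in[OF p] sub inv by (auto simp: ups_def)
    show "p ` (X - ups p) \<subseteq> ups p"
      using down_iff[OF p] inv by (auto simp: ups_def)
  qed (use inv in auto)
  then show *: "card (X - ups p) = card (ups p)" by (simp add: bij_betw_same_card)
  then show "2 * card (ups p) = card X"
    using card_Diff_subset[OF finite_subset[OF sub X] sub] card_mono[OF X sub] by linarith
qed

text \<open>The coefficient at \<open>(P, p)\<close>, recovered from the products of minors by the
  inverse incidence matrix. Unlike the coefficients of an expansion it is an explicit function of
  the points, hence smooth in them. For \<open>P = {}\<close> and Vandermonde products it is the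
  pure partition function up to a common factor, see \<open>Z_pure_pattern\<close>.\<close>

definition web_coeff :: "(nat set \<Rightarrow> real) \<Rightarrow> nat set \<Rightarrow> (nat \<Rightarrow> nat) \<Rightarrow> real" where
  "web_coeff D P p = (\<Sum>b\<in>webs {x. p x \<noteq> x}. web_inv {x. p x \<noteq> x} p b *
     (D (P \<union> ups b) * D (P \<union> ({x. p x \<noteq> x} - ups b))))"

lemma web_on_cards:
  assumes w: "web_on V n P p" and V: "finite V" and b: "b \<in> webs {x. p x \<noteq> x}"
  shows "P \<union> ups b \<subseteq> V" "P \<union> ({x. p x \<noteq> x} - ups b) \<subseteq> V"
    "card (P \<union> ups b) = n" "card (P \<union> ({x. p x \<noteq> x} - ups b)) = n"
proof -
  let ?X = "{x. p x \<noteq> x}"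
  have X: "?X \<subseteq> V" "P \<subseteq> V" "2 * card P + card ?X = 2 * n" "P \<inter> ?X = {}"
    using w by (auto simp: web_on_def)
  have fin: "finite ?X" "finite P" using X(1,2) finite_subset[OF _ V] by blast+
  have u: "ups b \<subseteq> ?X" by (rule ups_subset[OF b])
  show "P \<union> ups b \<subseteq> V" "P \<union> (?X - ups b) \<subseteq> V" using X u by auto
  have fu: "finite (ups b)" using finite_subset[OF u fin(1)] .
  have "card (P \<union> ups b) = card P + card (ups b)"
    by (rule card_Un_disjoint) (use fin fu u X in auto)
  then show "card (P \<union> ups b) = n" using card_ups(2)[OF b fin(1)] X(3) by linarith
  have "card (P \<union> (?X - ups b)) = card P + card (?X - ups b)"
    by (rule card_Un_disjoint) (use fin u X in auto)
  then show "card (P \<union> (?X - ups b)) = n" using card_ups[OF b fin(1)] X(3) by linarith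
qed

text \<open>Coefficients are unique. Distributing the single rows according to the left endpoints of
  each matching \<open>a\<close> gives a linear system whose matrix is the incidence matrix.\<close>

lemma web_expansion_coeff:
  assumes e: "web_expansion V n D c" and V: "finite V" and w: "web_on V n P p"
  shows "c P p = web_coeff D P p"
proof -
  let ?X = "{x. p x \<noteq> x}"
  have fin: "finite ?X" using w finite_subset[OF _ V] by (auto simp: web_on_def)
  have dis: "P \<inter> ?X = {}" using w by (auto simp: web_on_def)
  show ?thesis
    unfolding web_coeff_def
  proof (rule web_inv_solve[OF fin])
    show "p \<in> webs ?X" using w by (simp add: web_on_def)
    fix a assume a: "a \<in> webs ?X"
    note u = ups_subset[OF a]
    have sd: "sym_diff (P \<union> ups a) (P \<union> (?X - ups a)) = ?X" and int: "(P \<union> ups a) \<inter> (P \<union> (?X - ups a)) = P"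
      using u dis by auto
    have "D (P \<union> ups a) * D (P \<union> (?X - ups a)) = (\<Sum>b\<in>webs ?X. of_bool (compat (P \<union> ups a) b) * c P b)"
      by (rule web_expansionD[OF e web_on_cards[OF w V a] sd int])
    also have "\<dots> = (\<Sum>b\<in>webs ?X. of_bool (compat (ups a) b) * c P b)"
    proof (rule sum.cong[OF refl])
      fix b assume "b \<in> webs ?X"
      then have "compat (P \<union> ups a) b = compat (ups a) b" by (rule compat_cong) (use dis in auto)
      then show "of_bool (compat (P \<union> ups a) b) * c P b = of_bool (compat (ups a) b) * c P b" by simp
    qed
    finally show "D (P \<union> ups a) * D (P \<union> (?X - ups a)) = \<dots>" .
  qed
qed

lemma web_coeff_cong:
  assumes w: "web_on V n P p" and V: "finite V" and D: "\<And>S. S \<subseteq> V \<Longrightarrow> card S = n \<Longrightarrow> D S = D' S"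
  shows "web_coeff D P p = web_coeff D' P p"
  unfolding web_coeff_def
proof (rule sum.cong[OF refl])
  fix b assume b: "b \<in> webs {x. p x \<noteq> x}"
  note k = web_on_cards[OF w V b]
  show "web_inv {x. p x \<noteq> x} p b * (D (P \<union> ups b) * D (P \<union> ({x. p x \<noteq> x} - ups b))) =
    web_inv {x. p x \<noteq> x} p b * (D' (P \<union> ups b) * D' (P \<union> ({x. p x \<noteq> x} - ups b)))"
    by (simp only: D[OF k(1,3)] D[OF k(2,4)])
qed

lemma smooth_web_coeff:
  assumes w: "web_on V n P p" and V: "finite V"
    and r: "\<And>i k. i \<in> V \<Longrightarrow> k < n \<Longrightarrow> smooth I E (\<lambda>x. r x i k)"
  shows "smooth I E (\<lambda>x. web_coeff (minor n (r x)) P p)"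
proof -
  have fin: "finite {x. p x \<noteq> x}" using w finite_subset[OF _ V] by (auto simp: web_on_def)
  have S: "smooth I E (\<lambda>x. minor n (r x) S)" if "S \<subseteq> V" "card S = n" for S
    by (rule smooth_minor) (use that V r in \<open>auto intro: finite_subset\<close>)
  note k = web_on_cards[OF w V]
  show ?thesis
    unfolding web_coeff_def
    by (rule smooth_sum[OF finite_webs[OF fin]], rule smooth_mult[OF smooth_const smooth_mult])
      (rule S[OF k(1,3)], assumption+, rule S[OF k(2,4)], assumption+)
qed

text \<open>The rows of the Vandermonde matrix with \<open>x (2 * j)\<close> replaced by the divided difference at
  \<open>x (2 * j - 1)\<close> and \<open>x (2 * j)\<close>; they remain meaningful when these two points merge.\<close>

definition fused_row :: "(nat \<Rightarrow> real) \<Rightarrow> nat \<Rightarrow> nat \<Rightarrow> real" where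
  "fused_row x i k = (if even i then (case k of 0 \<Rightarrow> 0 | Suc k \<Rightarrow> hs x (Suc 0) i k) else x i ^ k)"

definition unlinked :: "(nat \<Rightarrow> nat) \<Rightarrow> bool" where
  "unlinked p \<longleftrightarrow> (\<forall>j. p (Suc (2 * j)) \<noteq> Suc (Suc (2 * j)))"

definition fused_coeff :: "nat \<Rightarrow> (nat \<Rightarrow> nat) \<Rightarrow> (nat \<Rightarrow> real) \<Rightarrow> real" where
  "fused_coeff M p x = web_coeff (minor M (fused_row x)) {} p"

lemma web_on_full: "p \<in> webs {0<..2 * M} \<Longrightarrow> web_on {0<..2 * M} M {} p"
  by (simp add: web_on_def webs_support)

lemma smooth_fused_coeff:
  assumes p: "p \<in> webs {0<..2 * M}" and I: "{0<..2 * M} \<subseteq> I"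
  shows "smooth I E (fused_coeff M p)"
proof -
  have "smooth I E (\<lambda>x. fused_row x i k)" if i: "i \<in> {0<..2 * M}" for i k
  proof (cases "even i")
    case True
    then have "i \<noteq> 1" "i > 0" using i by auto
    then have "{i - Suc 0..i} \<subseteq> {0<..2 * M}" using i by auto
    then have "{i - Suc 0..i} \<subseteq> I" using I by blast
    then show ?thesis using True by (cases k) (auto simp: fused_row_def intro: smooth_const smooth_hs)
  next
    case False
    then show ?thesis using I i by (auto simp: fused_row_def intro!: smooth_power smooth_coord)
  qed
  then show ?thesis
    unfolding fused_coeff_def[abs_def]
    by (intro smooth_web_coeff[OF web_on_full[OF p]]) auto
qed

text \<open>Subtracting row \<open>2 * j - 1\<close> from row \<open>2 * j\<close> does not affect the coefficient of an unlinked
  matching, whereas it makes the row divisible by \<open>x (2 * j) - x (2 * j - 1)\<close>.\<close>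

lemma fused_coeff_vandermonde:
  assumes e: "web_expansion {0<..2 * M} M (minor M (\<lambda>i k. x i ^ k)) c"
    and p: "p \<in> webs {0<..2 * M}" and u: "unlinked p"
  shows "c {} p = (\<Prod>i\<in>{i\<in>{0<..2 * M}. even i}. x i - x (i - 1)) * fused_coeff M p x"
proof -
  let ?V = "{0<..2 * M}"
  \<comment> \<open>In \<open>?B j\<close> the subtraction has been carried out for the first
    \<open>j\<close> pairs.\<close>
  let ?B = "\<lambda>j i k. if even i \<and> i \<le> 2 * j then x i ^ k - x (i - 1) ^ k else x i ^ k"
  note w = web_on_full[OF p]
  have "\<exists>c'. web_expansion ?V M (minor M (?B j)) c' \<and> c' {} p = c {} p" if "j \<le> M" for j
    using that
  proof (induction j)
    case 0
    have "?B 0 i k = x i ^ k" if "i \<in> ?V" for i k using that by simp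
    then have "minor M (?B 0) S = minor M (\<lambda>i k. x i ^ k) S" if "S \<subseteq> ?V" "card S = M" for S
      using that by (intro minor_cong) (auto intro: finite_subset)
    with web_expansion_cong[OF e, of "minor M (?B 0)"] show ?case by blast
  next
    case (Suc j)
    then obtain c' where c': "web_expansion ?V M (minor M (?B j)) c'" "c' {} p = c {} p" by auto
    let ?i = "Suc (2 * j)"
    have "web_expansion ?V M (minor M (?B (Suc j))) (step_coeff ?i (-1) c')"
    proof (rule web_expansion_cong[OF web_expansion_row_step[OF c'(1)]])
      fix S assume S: "S \<subseteq> ?V" "card S = M"
      then have "finite S" using finite_subset by blast
      moreover have "?B (Suc j) = (?B j)(Suc ?i := (\<lambda>k. ?B j (Suc ?i) k + (-1) * ?B j ?i k))"
        by (intro ext) (auto elim!: evenE simp: less_Suc_eq_le)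
      ultimately show "minor M (?B (Suc j)) S = row_step ?i (-1) (minor M (?B j)) S"
        using minor_row_step[OF _ S(2), of "?B j" ?i "-1"] by simp
    qed (use Suc.prems in auto)
    moreover have "step_coeff ?i (-1) c' {} p = c' {} p"
      by (rule step_coeff_unlinked) (use webs_mem[OF p] u Suc.prems in \<open>auto simp: unlinked_def\<close>)
    ultimately show ?case using c'(2) by auto
  qed
  from this[of M] obtain c' where c': "web_expansion ?V M (minor M (?B M)) c'" "c' {} p = c {} p" by auto
  define s where "s i = (if even i then x i - x (i - 1) else 1)" for i
  have B: "?B M i k = s i * fused_row x i k" if "i \<in> ?V" for i k
    using that hs_diff[of 0 i x] by (cases k) (auto simp: s_def fused_row_def algebra_simps)
  have D: "minor M (?B M) S = prod s S * minor M (fused_row x) S" if "S \<subseteq> ?V" "card S = M" for S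
  proof -
    have "finite S" using that finite_subset by blast
    then have "minor M (?B M) S = minor M (\<lambda>i k. s i * fused_row x i k) S"
      (is "minor M ?C S = _")
    proof (rule minor_cong[OF _ that(2)])
      fix i k assume "i \<in> S"
      then have "i \<in> ?V" using that(1) by blast
      then show "?C i k = s i * fused_row x i k" by (rule B)
    qed
    then show ?thesis using minor_scale[OF \<open>finite S\<close> that(2)] by simp
  qed
  have "c {} p = web_coeff (minor M (?B M)) {} p"
    using web_expansion_coeff[OF c'(1) _ w] c'(2) by simp
  also have "\<dots> = web_coeff (\<lambda>S. prod s S * minor M (fused_row x) S) {} p"
    by (rule web_coeff_cong[OF w]) (use D in auto)
  also have "\<dots> = prod s ?V * fused_coeff M p x"
    unfolding web_coeff_def fused_coeff_def sum_distrib_left webs_support[OF p]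
  proof (rule sum.cong[OF refl])
    fix b assume "b \<in> webs ?V"
    then have "ups b \<subseteq> ?V" by (rule ups_subset)
    then have "prod s ?V = prod s (ups b) * prod s (?V - ups b)"
      using prod.subset_diff[of "ups b" ?V s] by (simp add: mult.commute)
    then show "web_inv ?V p b * (prod s ({} \<union> ups b) * minor M (fused_row x) ({} \<union> ups b) *
        (prod s ({} \<union> (?V - ups b)) * minor M (fused_row x) ({} \<union> (?V - ups b)))) =
      prod s ?V * (web_inv ?V p b * (minor M (fused_row x) ({} \<union> ups b) * minor M (fused_row x) ({} \<union> (?V - ups b))))"
      by simp
  qed
  also have "prod s ?V = (\<Prod>i\<in>{i\<in>?V. even i}. x i - x (i - 1))"
    unfolding s_def by (subst prod.inter_filter) auto
  finally show ?thesis .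
qed

text \<open>The last Neville stage for merging pairs \<open>x (2 * j - 1)\<close>, \<open>x (2 * j)\<close>: each of the even
  rows carries the small factor \<open>x (2 * j) - x (2 * j - 1)\<close>, so one follows, backwards from a
  matching of all rows, a history in which every even row is used exactly once at the start.\<close>

definition fused_inv :: "nat \<Rightarrow> nat \<Rightarrow> nat set \<Rightarrow> (nat \<Rightarrow> nat) \<Rightarrow> bool" where
  "fused_inv M k P p \<longleftrightarrow>
     (\<forall>i. 0 < i \<longrightarrow> i < k \<longrightarrow> p i \<noteq> i) \<and>
     (\<forall>i. k < i \<longrightarrow> i \<le> 2 * M \<longrightarrow> even i \<longrightarrow> p i \<noteq> i) \<and>
     (\<forall>i. even i \<longrightarrow> 0 < i \<longrightarrow> i \<le> k \<longrightarrow> p (i - 1) \<noteq> i) \<and>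
     (if even k then p k < k \<or> (k \<in> P \<and> k - 1 < p (k - 1)) \<or> (k < p k \<and> p (k - 1) < k - 1)
      else k \<in> P \<or> p k < k)"

lemma fused_invD:
  assumes "fused_inv M k P p"
  shows "0 < i \<Longrightarrow> i < k \<Longrightarrow> p i \<noteq> i"
    and "k < i \<Longrightarrow> i \<le> 2 * M \<Longrightarrow> even i \<Longrightarrow> p i \<noteq> i"
    and "even i \<Longrightarrow> 0 < i \<Longrightarrow> i \<le> k \<Longrightarrow> p (i - 1) \<noteq> i"
    and "even k \<Longrightarrow> p k < k \<or> (k \<in> P \<and> k - 1 < p (k - 1)) \<or> (k < p k \<and> p (k - 1) < k - 1)"
    and "odd k \<Longrightarrow> k \<in> P \<or> p k < k"
proof -
  note a = assms[unfolded fused_inv_def]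
  show "0 < i \<Longrightarrow> i < k \<Longrightarrow> p i \<noteq> i"
    and "k < i \<Longrightarrow> i \<le> 2 * M \<Longrightarrow> even i \<Longrightarrow> p i \<noteq> i"
    and "even i \<Longrightarrow> 0 < i \<Longrightarrow> i \<le> k \<Longrightarrow> p (i - 1) \<noteq> i"
    and "even k \<Longrightarrow> p k < k \<or> (k \<in> P \<and> k - 1 < p (k - 1)) \<or> (k < p k \<and> p (k - 1) < k - 1)"
    and "odd k \<Longrightarrow> k \<in> P \<or> p k < k"
    using a by presburger+
qed

lemma conj_swap_other: "x \<noteq> k \<Longrightarrow> x \<noteq> Suc k \<Longrightarrow> conj_swap k p x = swp k (p x)"
  by (simp add: conj_swap_def swp_simps)

lemma conj_swap_other_neq: "x \<noteq> k \<Longrightarrow> x \<noteq> Suc k \<Longrightarrow> p x \<noteq> x \<Longrightarrow> conj_swap k p x \<noteq> x"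
  by (simp add: conj_swap_other swp_eq_iff swp_simps)

text \<open>The bound \<open>d\<close> is passed on unchanged, since a single term with multiplier 1
  is kept. For odd \<open>k\<close> the rows \<open>k\<close> and \<open>Suc k\<close> form a pair
  and are not linked. For even \<open>k\<close> they belong to different pairs, and a move is needed
  only if both rows \<open>k - 1\<close> and \<open>k\<close> of the pair just completed are left
  endpoints.\<close>

lemma fused_inv_step:
  assumes c: "\<And>P p. c P p \<ge> 0"
    and low: "\<And>P p. web_on {0<..2 * M} M P p \<Longrightarrow> fused_inv M k P p \<Longrightarrow> d \<le> c P p"
    and k: "0 < k" "Suc k \<le> 2 * M"
    and w: "web_on {0<..2 * M} M P p" and i: "fused_inv M (Suc k) P p"
  shows "d \<le> step_coeff k 1 c P p"
proof -
  let ?V = "{0<..2 * M}"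
  have V: "finite ?V" "k \<in> ?V" using k by auto
  have ge: "step_coeff k 1 c P p \<ge> c P p" by (rule step_coeff_ge) (use c in auto)
  have keep: ?thesis if "fused_inv M k P p" using low[OF w that] ge by linarith
  note move = step_coeff_move[of c 1 p k P, OF c]
  have pw: "p \<in> webs {x. p x \<noteq> x}" using w by (simp add: web_on_def)
  note inv = webs_invol[OF pw]
  have fixd: "p x = x" if "x \<in> P" for x using w that by (auto simp: web_on_def)
  have pk: "p k \<noteq> k" by (rule fused_invD(1)[OF i]) (use k in auto)
  have adj: "p k = Suc k" if "k < p k" "p (Suc k) < Suc k"
  proof (rule ccontr)
    assume "p k \<noteq> Suc k"
    then have "Suc k < p k" using that by simp
    moreover have "p (Suc k) \<noteq> k" using \<open>p k \<noteq> Suc k\<close> inv[of "Suc k"] by auto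
    ultimately show False using webs_nocross[OF pw, of "p (Suc k)" k] that inv[of "Suc k"] by simp
  qed
  have via2: ?thesis if "Suc k \<in> P" "fused_inv M k (shift_down k P) (conj_swap k p)"
  proof -
    have "d \<le> c (shift_down k P) (conj_swap k p)"
      by (rule low[OF web_on_conj_swap'[OF w V _ pk that(1)] that(2)]) (rule fixd[OF that(1)])
    then show ?thesis using move(2) fixd[OF that(1)] that(1) pk by fastforce
  qed
  have old: "conj_swap k p x \<noteq> x" if "0 < x" "x < k" for x
    by (rule conj_swap_other_neq) (use that fused_invD(1)[OF i, of x] in auto)
  have new: "conj_swap k p x \<noteq> x" if "Suc k < x" "x \<le> 2 * M" "even x" for x
    by (rule conj_swap_other_neq) (use that fused_invD(2)[OF i, of x] in auto)
  show ?thesis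
  proof (cases "even k")
    case odd: False
    have ns: "p k \<noteq> Suc k" using fused_invD(3)[OF i, of "Suc k"] odd by simp
    have rest: "x \<noteq> k" if "even x" for x using odd that by auto
    consider (a) "p (Suc k) < Suc k" | (b) "Suc k \<in> P" "k < p k" | (c) "Suc k < p (Suc k)" "p k < k"
      using fused_invD(4)[OF i] odd by auto
    then show ?thesis
    proof cases
      case a
      then have "p k < k" using adj ns pk by linarith
      moreover have "p x \<noteq> x" if "k < x" "x \<le> 2 * M" "even x" for x
        using fused_invD(2)[OF i, of x] that a by (cases "x = Suc k") auto
      ultimately show ?thesis
        using odd fused_invD(1,3)[OF i] by (intro keep) (simp add: fused_inv_def)
    next
      case c
      moreover have "p x \<noteq> x" if "k < x" "x \<le> 2 * M" "even x" for x
        using fused_invD(2)[OF i, of x] that c by (cases "x = Suc k") auto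
      ultimately show ?thesis
        using odd fused_invD(1,3)[OF i] by (intro keep) (simp add: fused_inv_def)
    next
      case b
      have q1: "conj_swap k p (Suc k) \<noteq> Suc k"
        using pk ns by (simp add: conj_swap_def swp_simps)
      have q2: "conj_swap k p (x - 1) \<noteq> x" if "even x" "0 < x" "x \<le> k" for x
      proof -
        have x: "x < k" using that rest[OF that(1)] by simp
        have "p (x - 1) \<noteq> x" using fused_invD(3)[OF i, of x] that by simp
        then show ?thesis using x by (simp add: conj_swap_other swp_eq_iff swp_simps)
      qed
      have "fused_inv M k (shift_down k P) (conj_swap k p)"
        unfolding fused_inv_def
      proof (intro conjI allI impI)
        fix x assume "k < x" "x \<le> 2 * M" "even x"
        then show "conj_swap k p x \<noteq> x" using new[of x] q1 by (cases "x = Suc k") auto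
      qed (use old q2 odd in \<open>auto simp: shift_down_def\<close>)
      then show ?thesis using via2 b by blast
    qed
  next
    case even: True
    then have k2: "0 < k - 1" "odd (k - 1)" "Suc (k - 1) = k" using k by auto
    have pk1: "p (k - 1) \<noteq> k - 1" "p (k - 1) \<noteq> k"
      using fused_invD(1)[OF i, of "k - 1"] fused_invD(3)[OF i, of k] k2 even k by auto
    have ev: "p x \<noteq> x" if "k < x" "x \<le> 2 * M" "even x" for x
      using fused_invD(2)[OF i, of x] that even by (cases "x = Suc k") auto
    show ?thesis
    proof (cases "p k < k \<or> p (k - 1) < k - 1")
      case True
      then have "p k < k \<or> k < p k \<and> p (k - 1) < k - 1" using pk by linarith
      then have "fused_inv M k P p"
        using even fused_invD(1,3)[OF i] ev unfolding fused_inv_def by auto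
      then show ?thesis by (rule keep)
    next
      case False
      then have up: "k < p k" "k < p (k - 1)" using pk pk1 by linarith+
      consider "Suc k \<in> P" | "p (Suc k) < Suc k" using fused_invD(5)[OF i] even by auto
      then show ?thesis
      proof cases
        case 1
        have ne: "p (k - 1) \<noteq> Suc k" using fixd[OF 1] inv[of "k - 1"] k2 by auto
        have q2: "conj_swap k p (x - 1) \<noteq> x" if "even x" "0 < x" "x \<le> k" for x
        proof (cases "x = k")
          case True
          then show ?thesis using ne k2 by (simp add: conj_swap_other swp_eq_iff swp_simps)
        next
          case False
          have "p (x - 1) \<noteq> x" using fused_invD(3)[OF i, of x] that by simp
          then show ?thesis using False that by (simp add: conj_swap_other swp_eq_iff swp_simps)
        qed
        have "swp k (p (k - 1)) = p (k - 1)" using up ne by (simp add: swp_simps)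
        then have "k - 1 < conj_swap k p (k - 1)" using up k2 by (simp add: conj_swap_other)
        moreover have "conj_swap k p x \<noteq> x" if "k < x" "x \<le> 2 * M" "even x" for x
          using new[of x] that even by (cases "x = Suc k") auto
        ultimately have "fused_inv M k (shift_down k P) (conj_swap k p)"
          using old q2 even by (simp add: fused_inv_def shift_down_def)
        then show ?thesis using via2 1 by blast
      next
        case 2
        then have eq: "p k = Suc k" using adj up by blast
        then have eq': "p (Suc k) = k" using inv[of k] by simp
        have cut: "cut k p x = p x" if "x \<noteq> k" "x \<noteq> Suc k" for x
          using that eq eq' inv[of x] by (auto simp: cut_def)
        have "p (x - 1) \<noteq> x" if "even x" "0 < x" "x \<le> k" for x
          using fused_invD(3)[OF i, of x] that by simp
        then have q2: "cut k p (x - 1) \<noteq> x" if "even x" "0 < x" "x \<le> k" for x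
          using that cut[of "x - 1"] by simp
        have "k - 1 < cut k p (k - 1)" using up k2 cut[of "k - 1"] by simp
        moreover have "cut k p x \<noteq> x" if "0 < x" "x < k" for x
          using fused_invD(1)[OF i, of x] that cut[of x] by simp
        moreover have "cut k p x \<noteq> x" if "k < x" "x \<le> 2 * M" "even x" for x
          using ev[OF that] that even cut[of x] by (cases "x = Suc k") auto
        ultimately have "fused_inv M k (insert k P) (cut k p)"
          using q2 even by (simp add: fused_inv_def)
        then have "d \<le> c (insert k P) (cut k p)"
          by (rule low[OF web_on_cut[OF w V eq]])
        moreover have "Suc k \<notin> P" using fixd[of "Suc k"] eq' by auto
        ultimately show ?thesis using move(3) eq by fastforce
      qed
    qed
  qed
qed

lemma fused_inv_last:
  assumes p: "p \<in> webs {0<..2 * M}" and u: "unlinked p" and M: "0 < M"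
  shows "fused_inv M (2 * M) {} p"
proof -
  have "p i \<noteq> i" if "0 < i" "i \<le> 2 * M" for i using webs_mem[OF p, of i] that by auto
  moreover have "p (i - 1) \<noteq> i" if ev: "even i" "0 < i" for i
  proof -
    obtain m where m: "i = 2 * m" using ev(1) by (rule evenE)
    with ev obtain j where "m = Suc j" by (cases m) auto
    with m have "i = Suc (Suc (2 * j))" by simp
    then show ?thesis using u by (simp add: unlinked_def)
  qed
  moreover have "p (2 * M) < 2 * M"
    using webs_mem[OF p, of "2 * M"] webs_in[OF p, of "2 * M"] M by auto
  ultimately show ?thesis by (simp add: fused_inv_def)
qed

lemma finite_web_on: "finite V \<Longrightarrow> finite {(P, p). web_on V n P p}"
proof (rule finite_subset)
  assume V: "finite V"
  show "{(P, p). web_on V n P p} \<subseteq> Pow V \<times> (\<Union>X\<in>Pow V. webs X)"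
    by (auto simp: web_on_def)
  have "finite (webs X)" if "X \<in> Pow V" for X
    using that finite_subset[OF _ V] by (intro finite_webs) auto
  then show "finite (Pow V \<times> (\<Union>X\<in>Pow V. webs X))"
    using V by (intro finite_cartesian_product finite_UN_I) auto
qed

text \<open>\<open>d\<close> bounds the coefficients at the start of the last Neville stage after
  removal of the factors that belong to even rows. These factors make up \<open>?e\<close> in every
  relevant pattern. As the coefficient of \<open>p\<close> in the Vandermonde expansion is
  \<open>?e\<close> times \<open>fused_coeff\<close>, the small product cancels and the estimate
  does not degenerate when pairs merge.\<close>

lemma fused_coeff_lower_bound:
  assumes x: "\<And>i j. 0 < i \<Longrightarrow> i < j \<Longrightarrow> j \<le> 2 * M \<Longrightarrow> x i < x j" and M: "0 < M"
    and p: "p \<in> webs {0<..2 * M}" and u: "unlinked p"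
    and d: "\<And>P p. web_on {0<..2 * M} M P p \<Longrightarrow> fused_inv M 1 P p \<Longrightarrow> 1 \<in> P \<Longrightarrow>
       d \<le> (\<Prod>i\<in>P - {1}. x i - x (i - 1))\<^sup>2 * (\<Prod>i\<in>{i. p i \<noteq> i \<and> odd i \<and> i \<noteq> 1}. x i - x (i - 1)) *
            web_coeff (minor (M - 1) (hs x (Suc 0))) (P - {1}) p"
  shows "d \<le> fused_coeff M p x"
    and "web_coeff (vdm x) {} p = (\<Prod>i\<in>{i\<in>{0<..2 * M}. even i}. x i - x (i - 1)) * fused_coeff M p x"
proof -
  let ?V = "{0<..2 * M}" and ?n = "M - 1"
  let ?e = "\<Prod>i\<in>{i\<in>?V. even i}. x i - x (i - 1)"
  have Mn: "Suc ?n = M" using M by simp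
  define s where "s i = (if i \<in> {Suc 0<..2 * M} then x i - x (i - Suc 0) else 1)" for i
  have spos: "s i > 0" for i using x[of "i - 1" i] by (auto simp: s_def)
  have epos: "?e > 0" by (rule prod_pos) (use x in \<open>auto elim!: evenE\<close>)
  obtain c1 where c1: "web_expansion {Suc 0<..2 * M} ?n (minor ?n (hs x (Suc 0))) c1" "\<And>P p. c1 P p \<ge> 0"
    using hs_expansion_positive[of "Suc 0" "2 * M" x ?n] x by force
  define c3 where "c3 P p = (if Suc 0 \<in> P then
     (prod s (P - {Suc 0}))\<^sup>2 * prod s {x. p x \<noteq> x} * c1 (P - {Suc 0}) p else 0)" for P p
  have c3_nonneg: "c3 P p \<ge> 0" for P p
  proof -
    have "prod s {x. p x \<noteq> x} \<ge> 0" by (rule prod_nonneg) (use spos less_imp_le in blast)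
    then show ?thesis using c1(2) by (simp add: c3_def)
  qed
  have base: "web_expansion ?V M (minor M (neville x 0 (Suc 0))) c3"
    using neville_base[OF c1(1), of s] M unfolding c3_def[abs_def] Mn by (simp add: s_def)
  have low: "?e * d \<le> c3 P p" if w: "web_on ?V M P p" and f: "fused_inv M (Suc 0) P p" for P p
  proof -
    let ?X = "{x. p x \<noteq> x}"
    have pw: "p \<in> webs ?X" "?X \<subseteq> ?V" "P \<subseteq> ?V" "P \<inter> ?X = {}" using w by (auto simp: web_on_def)
    have fX: "finite ?X" and fP: "finite P" using finite_subset pw by blast+
    have "\<not> p 1 < 1"
    proof
      assume "p 1 < 1"
      then have "p 1 \<in> ?X" using webs_in[OF pw(1), of 1] by simp
      then have "p 1 \<in> ?V" using pw(2) by blast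
      then show False using \<open>p 1 < 1\<close> by simp
    qed
    then have 1: "1 \<in> P" using fused_invD(5)[OF f] by auto
    \<comment> \<open>All even rows are single at the start, so each small factor occurs exactly
      once; row 1 is double and has the default factor 1.\<close>
    have sub: "{i\<in>?V. even i} \<subseteq> ?X" using fused_invD(2)[OF f] by (auto elim!: evenE)
    have p1: "p 1 = 1" using 1 pw(4) by blast
    then have X: "?X = {i\<in>?V. even i} \<union> {i. p i \<noteq> i \<and> odd i \<and> i \<noteq> 1}"
      using pw(2) sub by blast
    have sX: "prod s ?X = ?e * (\<Prod>i\<in>{i. p i \<noteq> i \<and> odd i \<and> i \<noteq> 1}. x i - x (i - 1))"
    proof -
      have "prod s ?X = prod s {i\<in>?V. even i} * prod s {i. p i \<noteq> i \<and> odd i \<and> i \<noteq> 1}"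
        by (subst X, rule prod.union_disjoint) (use fX in \<open>auto intro: finite_subset\<close>)
      moreover have "prod s {i\<in>?V. even i} = ?e"
        by (rule prod.cong) (auto simp: s_def elim!: evenE)
      moreover have "prod s {i. p i \<noteq> i \<and> odd i \<and> i \<noteq> 1} = (\<Prod>i\<in>{i. p i \<noteq> i \<and> odd i \<and> i \<noteq> 1}. x i - x (i - 1))"
      proof (rule prod.cong[OF refl])
        fix i assume "i \<in> {i. p i \<noteq> i \<and> odd i \<and> i \<noteq> 1}"
        then have "i \<in> ?V" "i \<noteq> 1" using pw(2) by auto
        then show "s i = x i - x (i - 1)" by (auto simp: s_def)
      qed
      ultimately show ?thesis by simp
    qed
    have sP: "prod s (P - {1}) = (\<Prod>i\<in>P - {1}. x i - x (i - 1))"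
      by (rule prod.cong[OF refl]) (use pw(3) in \<open>auto simp: s_def\<close>)
    have "web_on {Suc 0<..2 * M} ?n (P - {1}) p"
    proof -
      have "{Suc 0<..2 * M} = ?V - {1}" by auto
      then have "?X \<subseteq> {Suc 0<..2 * M}" "P - {1} \<subseteq> {Suc 0<..2 * M}"
        using pw(2,3) p1 by blast+
      moreover have "card P = Suc (card (P - {1}))" using card_Suc_Diff1[OF fP 1] by simp
      ultimately show ?thesis using w M unfolding web_on_def by auto
    qed
    then have "c1 (P - {1}) p = web_coeff (minor ?n (hs x (Suc 0))) (P - {1}) p"
      by (intro web_expansion_coeff[OF c1(1)]) auto
    then have "c3 P p = ?e * ((\<Prod>i\<in>P - {1}. x i - x (i - 1))\<^sup>2 *
        (\<Prod>i\<in>{i. p i \<noteq> i \<and> odd i \<and> i \<noteq> 1}. x i - x (i - 1)) *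
        web_coeff (minor ?n (hs x (Suc 0))) (P - {1}) p)"
      using 1 sX sP by (simp add: c3_def)
    moreover have "d \<le> (\<Prod>i\<in>P - {1}. x i - x (i - 1))\<^sup>2 *
        (\<Prod>i\<in>{i. p i \<noteq> i \<and> odd i \<and> i \<noteq> 1}. x i - x (i - 1)) *
        web_coeff (minor ?n (hs x (Suc 0))) (P - {1}) p"
      using d[OF w _ 1] f by simp
    ultimately show ?thesis using mult_left_mono[OF _ less_imp_le[OF epos]] by simp
  qed
  have "\<exists>c. web_expansion ?V M (minor M (neville x 0 k)) c \<and> (\<forall>P p. c P p \<ge> 0) \<and>
     (\<forall>P p. web_on ?V M P p \<longrightarrow> fused_inv M k P p \<longrightarrow> ?e * d \<le> c P p)" if "Suc 0 \<le> k" "k \<le> 2 * M" for k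
    using that
  proof (induction k rule: dec_induct)
    case base
    then show ?case using \<open>web_expansion ?V M (minor M (neville x 0 (Suc 0))) c3\<close> c3_nonneg low by blast
  next
    case (step k)
    then obtain c where c: "web_expansion ?V M (minor M (neville x 0 k)) c" "\<And>P p. c P p \<ge> 0"
      "\<And>P p. web_on ?V M P p \<Longrightarrow> fused_inv M k P p \<Longrightarrow> ?e * d \<le> c P p" by auto
    have "web_expansion ?V M (minor M (neville x 0 (Suc k))) (step_coeff k 1 c)"
      using neville_step[OF c(1)] step by simp
    moreover have "step_coeff k 1 c P p \<ge> 0" for P p by (rule step_coeff_nonneg) (use c in auto)
    moreover have "?e * d \<le> step_coeff k 1 c P p" if "web_on ?V M P p" "fused_inv M (Suc k) P p" for P p
      by (rule fused_inv_step[OF c(2,3) _ _ that]) (use step in auto)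
    ultimately show ?case by blast
  qed
  from this[of "2 * M"] M obtain c where c: "web_expansion ?V M (minor M (neville x 0 (2 * M))) c"
    "\<And>P p. web_on ?V M P p \<Longrightarrow> fused_inv M (2 * M) P p \<Longrightarrow> ?e * d \<le> c P p" by auto
  have e: "web_expansion ?V M (minor M (\<lambda>i k. x i ^ k)) c"
  proof -
    have "hs x 0 = (\<lambda>i k. x i ^ k)" by (intro ext) simp
    then show ?thesis using neville_last[OF c(1)] by simp
  qed
  note w = web_on_full[OF p]
  have "?e * d \<le> ?e * fused_coeff M p x"
    using c(2)[OF w fused_inv_last[OF p u M]] fused_coeff_vandermonde[OF e p u] by simp
  then show "d \<le> fused_coeff M p x" using epos by simp
  have "c {} p = web_coeff (minor M (\<lambda>i k. x i ^ k)) {} p"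
    by (rule web_expansion_coeff[OF e _ w]) simp
  also have "\<dots> = web_coeff (vdm x) {} p"
  proof (rule web_coeff_cong[OF w])
    fix S assume S: "S \<subseteq> ?V" "card S = M"
    then have "finite S" using finite_subset by blast
    then show "minor M (\<lambda>i k. x i ^ k) S = vdm x S" using S minor_vandermonde by blast
  qed simp
  finally show "web_coeff (vdm x) {} p = ?e * fused_coeff M p x"
    using fused_coeff_vandermonde[OF e p u] by simp
qed

section \<open>Positivity on the diagonal, and agreement with the fusion quotient off it\<close>

definition cross :: "nat \<Rightarrow> (nat \<times> nat) set" where
  "cross M = {(i, k). 0 < i \<and> i < k \<and> k \<le> 2 * M \<and> Suc i div 2 < Suc k div 2}"

definition diag :: "(nat \<Rightarrow> real) \<Rightarrow> nat \<Rightarrow> real" where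
  "diag y = (\<lambda>i. y (Suc i div 2))"

text \<open>Defined on both sides of the limit: only differences between points of different pairs
  are raised to negative powers, and these stay positive on the diagonal.\<close>

definition fused_g :: "nat \<Rightarrow> (nat \<Rightarrow> nat) \<Rightarrow> (nat \<Rightarrow> real) \<Rightarrow> real" where
  "fused_g M p x = fused_coeff M p x * (\<Prod>(i, k)\<in>cross M. (x k - x i) powr (-1/2))"

lemma finite_cross: "finite (cross M)" and cross_subset: "cross M \<subseteq> {0<..2 * M} \<times> {0<..2 * M}"
proof -
  show *: "cross M \<subseteq> {0<..2 * M} \<times> {0<..2 * M}" by (auto simp: cross_def)
  show "finite (cross M)" by (rule finite_subset[OF *]) simp
qed

lemma diag_config:
  assumes "strict_mono_on {1..M} y"
  shows "diag y \<in> config (cross M)"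
proof -
  have "y (Suc i div 2) < y (Suc k div 2)" if "(i, k) \<in> cross M" for i k
    using that by (intro strict_mono_onD[OF assms]) (auto simp: cross_def)
  then show ?thesis by (auto simp: config_def diag_def)
qed

lemma diag_less:
  assumes y: "strict_mono_on {1..M} y" and ij: "0 < i" "i < j" "j \<le> 2 * M" "even i \<or> Suc i < j"
  shows "diag y i < diag y j"
proof -
  have "Suc i div 2 < Suc j div 2" using ij by (auto elim!: evenE)
  then show ?thesis unfolding diag_def using ij by (intro strict_mono_onD[OF y]) auto
qed

lemma smooth_fused_g:
  assumes "p \<in> webs {0<..2 * M}"
  shows "smooth {0<..2 * M} (cross M) (fused_g M p)"
  unfolding fused_g_def[abs_def] case_prod_unfold
  by (intro smooth_mult smooth_fused_coeff[OF assms] smooth_prod finite_cross smooth_powr) auto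

lemma web_on_remove_first:
  assumes w: "web_on {0<..2 * M} M P p" and 1: "1 \<in> P" and M: "0 < M"
  shows "web_on {Suc 0<..2 * M} (M - 1) (P - {1}) p"
proof -
  let ?X = "{x. p x \<noteq> x}" and ?V = "{0<..2 * M}"
  have pw: "?X \<subseteq> ?V" "P \<subseteq> ?V" "P \<inter> ?X = {}" using w by (auto simp: web_on_def)
  have fP: "finite P" using finite_subset pw by blast
  have p1: "p 1 = 1" using 1 pw(3) by blast
  have "{Suc 0<..2 * M} = ?V - {1}" by auto
  then have "?X \<subseteq> {Suc 0<..2 * M}" "P - {1} \<subseteq> {Suc 0<..2 * M}" using pw(1,2) p1 by blast+
  moreover have "card P = Suc (card (P - {1}))" using card_Suc_Diff1[OF fP 1] by simp
  ultimately show ?thesis using w M unfolding web_on_def by auto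
qed

theorem fused_coeff_diag_pos:
  assumes y: "strict_mono_on {1..M} y" and M: "0 < M"
    and p: "p \<in> webs {0<..2 * M}" and u: "unlinked p"
  shows "fused_coeff M p (diag y) > 0"
proof -
  let ?V = "{0<..2 * M}" and ?n = "M - 1"
  \<comment> \<open>Each pair is separated by \<open>s\<close>; the limit \<open>s\<close> to 0 from
    the right returns to the diagonal.\<close>
  define X where "X s i = diag y i + (if even i then s else 0)" for s i
  have X: "((\<lambda>s. X s i) \<longlongrightarrow> diag y i) (at_right 0)" for i
    by (cases "even i") (auto simp: X_def intro!: tendsto_eq_intros)
  define G where "G = {(P, p). web_on ?V M P p \<and> fused_inv M 1 P p \<and> 1 \<in> P}"
  \<comment> \<open>The lower bound of \<open>fused_coeff_lower_bound\<close> as a function of the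
    point. For the patterns in \<open>G\<close> it contains \<open>x i - x (i - 1)\<close> only for
    odd \<open>i > 1\<close>, where the two points belong to different pairs, and a coefficient for
    divided differences of order 1. Both are positive on the diagonal, and \<open>G\<close> is
    finite, so one constant \<open>d\<close> serves all of them nearby.\<close>
  define B where "B = (\<lambda>(P, p) x. (\<Prod>i\<in>P - {1}. x i - x (i - 1))\<^sup>2 *
      (\<Prod>i\<in>{i. p i \<noteq> i \<and> odd i \<and> i \<noteq> 1}. x i - x (i - 1)) *
      web_coeff (minor ?n (hs x (Suc 0))) (P - {1}) p)"
  have finG: "finite G"
    by (rule finite_subset[OF _ finite_web_on[of ?V M]]) (auto simp: G_def)
  have BG: "smooth ?V {} (B g) \<and> B g (diag y) > 0" if "g \<in> G" for g
  proof -
    obtain P q where g: "g = (P, q)" by (cases g)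
    have w: "web_on ?V M P q" and f: "fused_inv M 1 P q" and 1: "1 \<in> P" using that by (auto simp: G_def g)
    let ?Y = "{i. q i \<noteq> i \<and> odd i \<and> i \<noteq> 1}"
    note w' = web_on_remove_first[OF w 1 M]
    have PV: "P \<subseteq> ?V" "{i. q i \<noteq> i} \<subseteq> ?V" "\<And>i. i \<in> P \<Longrightarrow> q i = i" using w by (auto simp: web_on_def)
    have fin: "finite P" "finite ?Y" using finite_subset[OF PV(1)] finite_subset[OF _ finite_subset[OF PV(2)], of ?Y] by auto
    have gt1: "i \<in> ?V \<and> odd i \<and> Suc 0 < i" if "i \<in> P - {1} \<or> i \<in> ?Y" for i
      using that PV(1,2) PV(3)[of i] fused_invD(2)[OF f, of i] by (auto simp: nat_neq_iff)
    have sm: "smooth ?V {} (\<lambda>x. x i - x (i - 1))" if "i \<in> P - {1} \<or> i \<in> ?Y" for i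
      using gt1[OF that] by (intro smooth_diff smooth_coord) auto
    have "smooth ?V {} (\<lambda>x. web_coeff (minor ?n (hs x (Suc 0))) (P - {1}) q)"
      by (rule smooth_web_coeff[OF w']) (auto intro!: smooth_hs)
    then have 1: "smooth ?V {} (B g)"
      unfolding B_def g prod.case using fin sm by (intro smooth_mult smooth_power smooth_prod) auto
    have pos: "diag y i - diag y (i - 1) > 0" if "i \<in> P - {1} \<or> i \<in> ?Y" for i
      using gt1[OF that] diag_less[OF y, of "i - 1" i] by simp
    obtain c where c: "web_expansion {Suc 0<..2 * M} ?n (minor ?n (hs (diag y) (Suc 0))) c"
      "\<And>P p. web_on {Suc 0<..2 * M} ?n P p \<Longrightarrow> c P p > 0"
      using hs_expansion_positive[of "Suc 0" "2 * M" "diag y" ?n] diag_less[OF y] by force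
    have "web_coeff (minor ?n (hs (diag y) (Suc 0))) (P - {1}) q > 0"
      using c(2)[OF w'] web_expansion_coeff[OF c(1) _ w'] by simp
    then have "B g (diag y) > 0"
      unfolding B_def g prod.case using pos by (intro mult_pos_pos zero_less_power prod_pos) auto
    with 1 show ?thesis by blast
  qed
  have "\<exists>d>0. \<forall>g\<in>G. d < B g (diag y)"
  proof (cases "G = {}")
    case False
    define m where "m = Min ((\<lambda>g. B g (diag y)) ` G)"
    have "m > 0" using False finG BG by (simp add: m_def)
    moreover have "m \<le> B g (diag y)" if "g \<in> G" for g
      unfolding m_def using finG that by (intro Min_le) auto
    ultimately have "m / 2 > 0" "\<forall>g\<in>G. m / 2 < B g (diag y)" by fastforce+
    then show ?thesis by blast
  qed (auto intro: exI[of _ 1])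
  then obtain d where d: "d > 0" "\<And>g. g \<in> G \<Longrightarrow> d < B g (diag y)" by blast
  have "\<forall>\<^sub>F s in at_right 0. d < B g (X s)" if "g \<in> G" for g
  proof -
    have "((\<lambda>s. B g (X s)) \<longlongrightarrow> B g (diag y)) (at_right 0)"
      by (rule smooth_tendsto[where E = "{}" and I = ?V]) (use BG[OF that] X in \<open>auto simp: config_def\<close>)
    then show ?thesis using d(2)[OF that] by (rule order_tendstoD(1))
  qed
  then have "\<forall>\<^sub>F s in at_right 0. \<forall>g\<in>G. d < B g (X s)"
    using finG by (simp add: eventually_ball_finite_distrib)
  moreover have "\<forall>\<^sub>F s in at_right 0. X s \<in> config (cross M)"
    by (rule eventually_config[OF finite_cross cross_subset diag_config[OF y] X])
  moreover have "\<forall>\<^sub>F s in at_right 0. (0::real) < s" by (rule eventually_at_right_less)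
  ultimately have "\<forall>\<^sub>F s in at_right 0. d \<le> fused_coeff M p (X s)"
  proof eventually_elim
    case (elim s)
    have "X s i < X s j" if "0 < i" "i < j" "j \<le> 2 * M" for i j
    proof (cases "Suc i div 2 < Suc j div 2")
      case True
      then show ?thesis using elim(2) that by (auto simp: config_def cross_def)
    next
      case False
      then have "odd i" "j = Suc i" using that by presburger+
      then show ?thesis using elim(3) by (simp add: X_def diag_def)
    qed
    then show ?case
    proof (rule fused_coeff_lower_bound(1)[OF _ M p u])
      fix P q assume "web_on ?V M P q" "fused_inv M 1 P q" "1 \<in> P"
      then have "(P, q) \<in> G" by (simp add: G_def)
      then show "d \<le> (\<Prod>i\<in>P - {1}. X s i - X s (i - 1))\<^sup>2 *
          (\<Prod>i\<in>{i. q i \<noteq> i \<and> odd i \<and> i \<noteq> 1}. X s i - X s (i - 1)) *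
            web_coeff (minor (M - 1) (hs (X s) (Suc 0))) (P - {1}) q"
        using elim(1) by (force simp: B_def)
    qed
  qed
  moreover have "((\<lambda>s. fused_coeff M p (X s)) \<longlongrightarrow> fused_coeff M p (diag y)) (at_right 0)"
    by (rule smooth_tendsto[where E = "{}" and I = ?V])
      (use smooth_fused_coeff[OF p] X in \<open>auto simp: config_def\<close>)
  ultimately have "d \<le> fused_coeff M p (diag y)"
    using tendsto_lowerbound trivial_limit_at_right_real by blast
  then show ?thesis using d(1) by simp
qed

lemma fused_g_diag_pos:
  assumes y: "strict_mono_on {1..M} y" and "0 < M" "p \<in> webs {0<..2 * M}" "unlinked p"
  shows "fused_g M p (diag y) > 0"
  unfolding fused_g_def
proof (rule mult_pos_pos[OF fused_coeff_diag_pos[OF assms] prod_pos], clarify)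
  fix i k assume "(i, k) \<in> cross M"
  then show "0 < (diag y k - diag y i) powr (- 1 / 2)"
    using diag_config[OF y] by (auto simp: config_def)
qed

definition pairs :: "nat \<Rightarrow> (nat \<times> nat) set" where
  "pairs m = {(i, k). 0 < i \<and> i < k \<and> k \<le> m}"

lemma finite_pairs: "finite (pairs m)"
  by (rule finite_subset[of _ "{0<..m} \<times> {0<..m}"]) (auto simp: pairs_def)

lemma pairs_cross: "pairs (2 * M) = cross M \<union> (\<lambda>j. (2 * j - 1, 2 * j)) ` {1..M}"
  "cross M \<inter> (\<lambda>j. (2 * j - 1, 2 * j)) ` {1..M} = {}"
proof -
  show "pairs (2 * M) = cross M \<union> (\<lambda>j. (2 * j - 1, 2 * j)) ` {1..M}"
  proof (intro equalityI subsetI)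
    fix e assume "e \<in> pairs (2 * M)"
    then obtain i k where e: "e = (i, k)" "0 < i" "i < k" "k \<le> 2 * M" by (auto simp: pairs_def)
    show "e \<in> cross M \<union> (\<lambda>j. (2 * j - 1, 2 * j)) ` {1..M}"
    proof (cases "Suc i div 2 < Suc k div 2")
      case True then show ?thesis using e by (simp add: cross_def)
    next
      case False
      then have "k = 2 * (k div 2)" "i = 2 * (k div 2) - 1" "k div 2 \<in> {1..M}" using e by presburger+
      then have "e = (\<lambda>j. (2 * j - 1, 2 * j)) (k div 2)" using e by simp
      then show ?thesis using \<open>k div 2 \<in> {1..M}\<close> by blast
    qed
  qed (auto simp: pairs_def cross_def)
  show "cross M \<inter> (\<lambda>j. (2 * j - 1, 2 * j)) ` {1..M} = {}"
    by (auto simp: cross_def)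
qed

lemma prod_evens:
  fixes M :: nat
  shows "(\<Prod>i\<in>{i\<in>{0<..2 * M}. even i}. f i) = (\<Prod>j\<in>{1..M}. f (2 * j))"
  by (rule prod.reindex_bij_witness[where i = "\<lambda>j. 2 * j" and j = "\<lambda>i. i div 2"]) (auto elim!: evenE)

text \<open>Off the diagonal, \<open>fused_g\<close> is the fusion quotient of the pure partition function.\<close>

lemma fused_g_off_diag:
  assumes x: "\<And>i j. 0 < i \<Longrightarrow> i < j \<Longrightarrow> j \<le> 2 * M \<Longrightarrow> x i < x j" and M: "0 < M"
    and p: "p \<in> webs {0<..2 * M}" and u: "unlinked p"
  shows "fused_g M p x * (\<Prod>j\<in>{1..M}. (x (2 * j) - x (2 * j - 1)) powr (1/2)) =
    (\<Prod>(i, k)\<in>pairs (2 * M). (x k - x i) powr (-1/2)) * web_coeff (vdm x) {} p"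
proof -
  define F where "F = (\<lambda>(P, q). (\<Prod>i\<in>P - {1}. x i - x (i - 1))\<^sup>2 *
      (\<Prod>i\<in>{i. q i \<noteq> i \<and> odd i \<and> i \<noteq> 1}. x i - x (i - 1)) *
      web_coeff (minor (M - 1) (hs x (Suc 0))) (P - {1}) q)"
  let ?W = "{(P, q). web_on {0<..2 * M} M P q}"
  have fin: "finite (F ` ?W)" by (intro finite_imageI finite_web_on) simp
  \<comment> \<open>Only the identity in \<open>fused_coeff_lower_bound\<close> is wanted here; the
    bound that it asks for is supplied by the minimum over the finitely many patterns.\<close>
  have d: "Min (F ` ?W) \<le> (\<Prod>i\<in>P - {1}. x i - x (i - 1))\<^sup>2 *
      (\<Prod>i\<in>{i. q i \<noteq> i \<and> odd i \<and> i \<noteq> 1}. x i - x (i - 1)) * web_coeff (minor (M - 1) (hs x (Suc 0))) (P - {1}) q"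
    if "web_on {0<..2 * M} M P q" for P q
  proof -
    have "F (P, q) \<in> F ` ?W" using that by blast
    from Min_le[OF fin this] show ?thesis by (simp add: F_def)
  qed
  have v: "web_coeff (vdm x) {} p = (\<Prod>j\<in>{1..M}. x (2 * j) - x (2 * j - 1)) * fused_coeff M p x"
    by (rule fused_coeff_lower_bound(2)[OF x M p u d, unfolded prod_evens])
  have inj: "inj_on (\<lambda>j. (2 * j - 1, 2 * j)) {1..M}" by (auto simp: inj_on_def)
  have "(\<Prod>(i, k)\<in>pairs (2 * M). (x k - x i) powr (-1/2)) =
    (\<Prod>(i, k)\<in>cross M. (x k - x i) powr (-1/2)) * (\<Prod>j\<in>{1..M}. (x (2 * j) - x (2 * j - 1)) powr (-1/2))"
    unfolding pairs_cross(1) prod.union_disjoint[OF finite_cross finite_imageI[OF finite_atLeastAtMost] pairs_cross(2)]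
      prod.reindex[OF inj] comp_def prod.case ..
  moreover have "(\<Prod>j\<in>{1..M}. (x (2 * j) - x (2 * j - 1)) powr (-1/2)) * (\<Prod>j\<in>{1..M}. x (2 * j) - x (2 * j - 1)) =
     (\<Prod>j\<in>{1..M}. (x (2 * j) - x (2 * j - 1)) powr (1/2))"
    unfolding prod.distrib[symmetric]
  proof (rule prod.cong[OF refl])
    fix j assume "j \<in> {1..M}"
    then have pos: "x (2 * j) - x (2 * j - 1) > 0" using x[of "2 * j - 1" "2 * j"] by auto
    have "(x (2 * j) - x (2 * j - 1)) powr (-1/2) * (x (2 * j) - x (2 * j - 1)) powr 1 =
       (x (2 * j) - x (2 * j - 1)) powr (1/2)"
      unfolding powr_add[symmetric] by simp
    then show "(x (2 * j) - x (2 * j - 1)) powr (-1/2) * (x (2 * j) - x (2 * j - 1)) =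
       (x (2 * j) - x (2 * j - 1)) powr (1/2)" using pos by simp
  qed
  ultimately show ?thesis unfolding fused_g_def v by (simp add: mult_ac)
qed

section \<open>Planar link patterns and noncrossing matchings\<close>

text \<open>The Fashoda theorem in a rectangle with its base on the real line, large enough to
  contain both paths. As that theorem speaks of real vectors, complex numbers are translated by
  \<open>h\<close>.\<close>

lemma half_plane_paths_meet:
  fixes f g :: "real \<Rightarrow> complex"
  assumes f: "path f" "\<And>t. t \<in> {0..1} \<Longrightarrow> 0 \<le> Im (f t)" "Im (f 0) = 0" "Im (f 1) = 0"
    and g: "path g" "\<And>t. t \<in> {0..1} \<Longrightarrow> 0 \<le> Im (g t)" "Im (g 0) = 0" "Im (g 1) = 0"
    and ord: "Re (f 0) < Re (g 0)" "Re (g 0) < Re (f 1)" "Re (f 1) < Re (g 1)"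
  shows "path_image f \<inter> path_image g \<noteq> {}"
proof -
  define h :: "complex \<Rightarrow> real^2" where "h z = (\<chi> i. if i = 1 then Re z else Im z)" for z
  have h: "h z $ 1 = Re z" "h z $ 2 = Im z" for z by (simp_all add: h_def)
  have cont: "continuous_on A h" for A
    unfolding h_def
  proof (rule continuous_on_vec_lambda)
    show "continuous_on A (\<lambda>z. if i = 1 then Re z else Im z)" for i :: 2
      by (cases "i = 1") (auto intro!: continuous_intros)
  qed
  have pf: "path (h \<circ> f)" "path (h \<circ> g)" using f g cont path_continuous_image by blast+
  have "bounded (path_image f \<union> path_image g)"
    using compact_path_image[OF f(1)] compact_path_image[OF g(1)] by (simp add: compact_imp_bounded)
  then obtain B where B: "\<And>z. z \<in> path_image f \<union> path_image g \<Longrightarrow> norm z \<le> B"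
    by (auto simp: bounded_iff)
  have box: "h z \<in> cbox (vector [-B, 0]) (vector [B, B])"
    if "z \<in> path_image f \<union> path_image g" "0 \<le> Im z" for z
    using B[OF that(1)] that(2) abs_Re_le_cmod[of z] abs_Im_le_cmod[of z]
    by (auto simp: mem_box_cart forall_2 h)
  obtain z where "z \<in> path_image (h \<circ> f)" "z \<in> path_image (h \<circ> g)"
  proof (rule fashoda_interlace[OF pf])
    show "path_image (h \<circ> f) \<subseteq> cbox (vector [-B, 0]) (vector [B, B])"
      using f(2) by (auto simp: path_image_def intro!: box)
    show "path_image (h \<circ> g) \<subseteq> cbox (vector [-B, 0]) (vector [B, B])"
      using g(2) by (auto simp: path_image_def intro!: box)
  qed (use f g ord in \<open>auto simp: h pathstart_def pathfinish_def\<close>)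
  then obtain z1 z2 where "z1 \<in> path_image f" "z2 \<in> path_image g" "h z1 = h z2"
    by (auto simp: path_image_def)
  moreover have "z1 = z2" using calculation(3) h by (metis complex_eqI)
  ultimately show ?thesis by blast
qed

text \<open>The curves of the two links (copy 0 of each) would have to meet, but links without a
  common index admit no common point.\<close>

lemma planar_links_noncrossing:
  assumes L: "planar_links L" "{a, b} \<in># L" "{c, d} \<in># L" and ord: "a < c" "c < b" "b < d"
  shows False
proof -
  obtain \<gamma> :: "nat set \<times> nat \<Rightarrow> real \<Rightarrow> complex" where \<gamma>:
    "\<And>e k. k < count L e \<Longrightarrow> arc (\<gamma> (e, k)) \<and> {pathstart (\<gamma> (e, k)), pathfinish (\<gamma> (e, k))} = of_nat ` e \<and>
        (\<forall>t\<in>{0<..<1}. Im (\<gamma> (e, k) t) > 0)"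
    "\<And>e k e' k'. k < count L e \<Longrightarrow> k' < count L e' \<Longrightarrow> (e, k) \<noteq> (e', k') \<Longrightarrow>
        path_image (\<gamma> (e, k)) \<inter> path_image (\<gamma> (e', k')) \<subseteq> of_nat ` (e \<inter> e')"
    using L(1) unfolding planar_links_def by metis
  \<comment> \<open>The curve of a link may run in either direction; it is reversed if
    necessary.\<close>
  have orient: "\<exists>f. path f \<and> path_image f = path_image (\<gamma> ({i, j}, 0)) \<and> f 0 = of_nat i \<and> f 1 = of_nat j \<and>
      (\<forall>t\<in>{0..1}. 0 \<le> Im (f t))" if "{i, j} \<in># L" for i j
  proof -
    let ?f = "\<gamma> ({i, j}, 0)"
    have 1: "arc ?f" "{pathstart ?f, pathfinish ?f} = {of_nat i, of_nat j}" "\<forall>t\<in>{0<..<1}. Im (?f t) > 0"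
      using \<gamma>(1)[of 0 "{i, j}"] that by auto
    have Im: "0 \<le> Im (?f t)" if "t \<in> {0..1}" for t
    proof (cases "t \<in> {0<..<1}")
      case True then show ?thesis using bspec[OF 1(3) True] by simp
    next
      case False
      then have "?f t \<in> {pathstart ?f, pathfinish ?f}" using that by (force simp: pathstart_def pathfinish_def)
      then show ?thesis unfolding 1(2) by auto
    qed
    consider "pathstart ?f = of_nat i" "pathfinish ?f = of_nat j" | "pathstart ?f = of_nat j" "pathfinish ?f = of_nat i"
      using 1(2) by (auto simp: doubleton_eq_iff)
    then show ?thesis
    proof cases
      case 1
      then show ?thesis using \<open>arc ?f\<close> Im by (intro exI[of _ ?f]) (auto simp: arc_imp_path pathstart_def pathfinish_def)
    next
      case 2
      have "path (reversepath ?f)" "path_image (reversepath ?f) = path_image ?f"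
        using \<open>arc ?f\<close> by (simp_all add: arc_imp_path)
      moreover have "reversepath ?f t = ?f (1 - t)" for t by (simp add: reversepath_def)
      ultimately show ?thesis using 2 Im
        by (intro exI[of _ "reversepath ?f"]) (auto simp: pathstart_def pathfinish_def)
    qed
  qed
  obtain f where f: "path f" "path_image f = path_image (\<gamma> ({a, b}, 0))" "f 0 = of_nat a" "f 1 = of_nat b"
    "\<And>t. t \<in> {0..1} \<Longrightarrow> 0 \<le> Im (f t)" using orient[OF L(2)] by blast
  obtain g where g: "path g" "path_image g = path_image (\<gamma> ({c, d}, 0))" "g 0 = of_nat c" "g 1 = of_nat d"
    "\<And>t. t \<in> {0..1} \<Longrightarrow> 0 \<le> Im (g t)" using orient[OF L(3)] by blast
  have "path_image f \<inter> path_image g \<noteq> {}"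
    by (rule half_plane_paths_meet) (use f g ord in auto)
  moreover have "path_image f \<inter> path_image g \<subseteq> of_nat ` ({a, b} \<inter> {c, d})"
    unfolding f(2) g(2) by (rule \<gamma>(2)) (use L ord in \<open>auto simp: doubleton_eq_iff\<close>)
  moreover have "{a, b} \<inter> {c, d} = {}" using ord by auto
  ultimately show False by auto
qed

definition semicircle :: "real \<Rightarrow> real \<Rightarrow> real \<Rightarrow> complex" where
  "semicircle a b t = of_real ((a + b) / 2) + of_real ((b - a) / 2) * cis (pi * (1 - t))"

lemma arc_semicircle:
  assumes "a < b" shows "arc (semicircle a b)"
  unfolding arc_def
proof
  show "path (semicircle a b)"
    unfolding path_def semicircle_def by (intro continuous_intros)
  show "inj_on (semicircle a b) {0..1}"
  proof (rule inj_onI)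
    fix s t assume st: "s \<in> {0..1}" "t \<in> {0..1}" "semicircle a b s = semicircle a b t"
    then have "cis (pi * (1 - s)) = cis (pi * (1 - t))" using assms by (simp add: semicircle_def)
    then have "cos (pi * (1 - s)) = cos (pi * (1 - t))" by (metis cis.sel(1))
    moreover have "0 \<le> pi * (1 - s)" "pi * (1 - s) \<le> pi" "0 \<le> pi * (1 - t)" "pi * (1 - t) \<le> pi"
      using st by auto
    ultimately have "pi * (1 - s) = pi * (1 - t)" using cos_inj_pi by blast
    then show "s = t" by simp
  qed
qed

lemma semicircle_mem:
  assumes "a < b" "z \<in> path_image (semicircle a b)"
  shows "a \<le> Re z" "Re z \<le> b" "(Re z - a) * (b - Re z) = (Im z)\<^sup>2"
proof -
  obtain t where z: "z = semicircle a b t" using assms(2) by (auto simp: path_image_def)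
  define c s where "c = cos (pi * (1 - t))" and "s = sin (pi * (1 - t))"
  have R: "Re z = (a + b) / 2 + (b - a) / 2 * c" "Im z = (b - a) / 2 * s"
    by (simp_all add: z semicircle_def c_def s_def)
  have c: "\<bar>c\<bar> \<le> 1" "s\<^sup>2 = 1 - c\<^sup>2" by (simp_all add: c_def s_def sin_squared_eq)
  have "(b - a) / 2 * c \<le> (b - a) / 2 * 1" "(b - a) / 2 * (-1) \<le> (b - a) / 2 * c"
    using c(1) assms(1) by (intro mult_left_mono; simp)+
  then show "a \<le> Re z" "Re z \<le> b" unfolding R by (simp_all add: field_simps)
  have "(Re z - a) * (b - Re z) = ((b - a) / 2)\<^sup>2 * (1 - c\<^sup>2)"
    unfolding R by (simp add: field_simps power2_eq_square)
  then show "(Re z - a) * (b - Re z) = (Im z)\<^sup>2" unfolding R(2) c(2)[symmetric] power_mult_distrib .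
qed

text \<open>At a common point the product \<open>(Re z - a) * (b - Re z)\<close> takes the same
  value for both semicircles, namely the squared height. For nested intervals the outer product is
  strictly larger.\<close>

lemma semicircles_disjoint:
  assumes "a < b" "c < d" and dis: "b < c \<or> d < a \<or> (a < c \<and> d < b) \<or> (c < a \<and> b < d)"
  shows "path_image (semicircle a b) \<inter> path_image (semicircle c d) = {}"
proof (rule ccontr)
  assume "path_image (semicircle a b) \<inter> path_image (semicircle c d) \<noteq> {}"
  then obtain z where z: "z \<in> path_image (semicircle a b)" "z \<in> path_image (semicircle c d)" by blast
  note 1 = semicircle_mem[OF assms(1) z(1)] and 2 = semicircle_mem[OF assms(2) z(2)]
  have eq: "(Re z - a) * (b - Re z) = (Re z - c) * (d - Re z)" using 1(3) 2(3) by simp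
  have "False" if "a < c" "d < b"
  proof -
    have "(Re z - c) * (d - Re z) < (Re z - a) * (b - Re z)"
      by (rule mult_strict_mono) (use that 2 in auto)
    then show False using eq by simp
  qed
  moreover have "False" if "c < a" "b < d"
  proof -
    have "(Re z - a) * (b - Re z) < (Re z - c) * (d - Re z)"
      by (rule mult_strict_mono) (use that 1 in auto)
    then show False using eq by simp
  qed
  ultimately show False using dis 1 2 by linarith
qed

section \<open>Noncrossing matchings as planar pair partitions\<close>

definition links :: "(nat \<Rightarrow> nat) \<Rightarrow> nat set set" where
  "links p = (\<lambda>x. {x, p x}) ` {x. p x \<noteq> x}"

definition pattern :: "(nat \<Rightarrow> nat) \<Rightarrow> link_pattern" where
  "pattern p = mset_set (links p)"

lemma links_ups: "p \<in> webs X \<Longrightarrow> links p = (\<lambda>x. {x, p x}) ` ups p"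
proof -
  assume p: "p \<in> webs X"
  note inv = webs_invol[OF p]
  have "{x, p x} \<in> (\<lambda>x. {x, p x}) ` ups p" if "p x \<noteq> x" for x
  proof (cases "x < p x")
    case True then show ?thesis by (auto simp: ups_def)
  next
    case False
    then have "p x \<in> ups p" "{x, p x} = {p x, p (p x)}" using that inv by (auto simp: ups_def)
    then show ?thesis by blast
  qed
  then show ?thesis by (auto simp: links_def ups_def)
qed

lemma inj_on_ups_link: "p \<in> webs X \<Longrightarrow> inj_on (\<lambda>x. {x, p x}) (ups p)"
  using webs_invol by (auto simp: inj_on_def doubleton_eq_iff ups_def)

lemma mem_links: "p \<in> webs X \<Longrightarrow> {i, j} \<in> links p \<longleftrightarrow> i \<in> X \<and> p i = j"
  using webs_invol[of p X] webs_mem[of p X]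
  by (fastforce simp: links_def doubleton_eq_iff)

lemma finite_links: "p \<in> webs X \<Longrightarrow> finite X \<Longrightarrow> finite (links p)"
  by (simp add: links_def webs_support)

lemma links_Min_Max:
  assumes "p \<in> webs X" "x \<in> ups p"
  shows "Min {x, p x} = x" "Max {x, p x} = p x"
  using assms by (auto simp: ups_def)

text \<open>Each link is drawn as the semicircle above it. All multiplicities are 1, so different
  copies belong to different links.\<close>

lemma planar_links_pattern:
  assumes p: "p \<in> webs X" and X: "finite X"
  shows "planar_links (pattern p)"
  unfolding planar_links_def
proof (intro exI[of _ "\<lambda>(e :: nat set, k :: nat). semicircle (real (Min e)) (real (Max e))"] conjI allI impI)
  have cnt: "k < count (pattern p) e \<Longrightarrow> k = 0 \<and> (\<exists>x\<in>ups p. e = {x, p x})" for k e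
    using finite_links[OF p X] links_ups[OF p] by (auto simp: pattern_def count_mset_set' split: if_splits)
  fix e k assume "k < count (pattern p) e"
  then obtain x where x: "x \<in> ups p" "e = {x, p x}" using cnt by blast
  then have lt: "real x < real (p x)" by (simp add: ups_def)
  note mm = links_Min_Max[OF p x(1)]
  let ?f = "case (e, k) of (e :: nat set, k :: nat) \<Rightarrow> semicircle (real (Min e)) (real (Max e))"
  have f: "?f = semicircle x (p x)" using x mm by simp
  show "arc ?f" unfolding f by (rule arc_semicircle[OF lt])
  have "semicircle x (p x) 0 = of_nat x" "semicircle x (p x) 1 = of_nat (p x)"
    by (simp_all add: semicircle_def complex_eq_iff field_simps)
  then show "{pathstart ?f, pathfinish ?f} = of_nat ` e"
    unfolding f unfolding x(2) pathstart_def pathfinish_def by simp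
  show "\<forall>t\<in>{0<..<1}. 0 < Im (?f t)"
  proof
    fix t :: real assume "t \<in> {0<..<1}"
    then have "0 < sin (pi * (1 - t))" by (intro sin_gt_zero) auto
    then show "0 < Im (?f t)" using lt unfolding f by (simp add: semicircle_def)
  qed
  fix e' k' assume "k' < count (pattern p) e'" and ne: "(e, k) \<noteq> (e', k')"
  then obtain y where y: "y \<in> ups p" "e' = {y, p y}" using cnt by blast
  have "k = 0" using cnt[OF \<open>k < count (pattern p) e\<close>] by simp
  moreover have "k' = 0" using cnt[OF \<open>k' < count (pattern p) e'\<close>] by simp
  ultimately have "e \<noteq> e'" using ne by simp
  have lt': "real y < real (p y)" using y by (simp add: ups_def)
  note mm' = links_Min_Max[OF p y(1)]
  note inv = webs_invol[OF p]
  have ne': "x \<noteq> y" "x \<noteq> p y" "p x \<noteq> y" "p x \<noteq> p y"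
  proof -
    show xy: "x \<noteq> y" using \<open>e \<noteq> e'\<close> x y by auto
    show "x \<noteq> p y" using \<open>e \<noteq> e'\<close> x y inv[of y] by (auto simp: insert_commute)
    show "p x \<noteq> y" using \<open>e \<noteq> e'\<close> x y inv[of x] by (auto simp: insert_commute)
    show "p x \<noteq> p y" using xy inv by metis
  qed
  have "p x < y \<or> p y < x \<or> (x < y \<and> p y < p x) \<or> (y < x \<and> p x < p y)"
    using ne' webs_nocross[OF p, of x y] webs_nocross[OF p, of y x] by arith
  then have "path_image (semicircle x (p x)) \<inter> path_image (semicircle y (p y)) = {}"
    by (intro semicircles_disjoint lt lt') auto
  then show "path_image ?f \<inter> path_image (case (e', k') of (e, k) \<Rightarrow> semicircle (real (Min e)) (real (Max e))) \<subseteq> of_nat ` (e \<inter> e')"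
    using f y mm' by simp
qed

lemma valence_pattern:
  assumes p: "p \<in> webs X" and X: "finite X"
  shows "size {#e \<in># pattern p. i \<in> e#} = of_bool (i \<in> X)"
proof -
  have "{e \<in> links p. i \<in> e} = (if i \<in> X then {{i, p i}} else {})"
    using webs_invol[OF p] webs_mem[OF p] webs_in[OF p] by (auto simp: links_def insert_commute)
  then show ?thesis unfolding pattern_def by (simp add: filter_mset_mset_set[OF finite_links[OF p X]])
qed

lemma size_pattern:
  assumes p: "p \<in> webs X" and X: "finite X"
  shows "2 * size (pattern p) = card X"
  unfolding pattern_def links_ups[OF p]
  using card_image[OF inj_on_ups_link[OF p]] card_ups(2)[OF p X] by simp

lemma pattern_in_pair_partitions:
  assumes p: "p \<in> webs {0<..2 * n}"
  shows "pattern p \<in> pair_partitions n"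
  unfolding pair_partitions_def link_patterns_def mem_Collect_eq
proof (intro conjI ballI)
  show "2 * size (pattern p) = sum_list (replicate (2 * n) 1)"
    using size_pattern[OF p] by (simp add: sum_list_replicate)
  show "planar_links (pattern p)" using planar_links_pattern[OF p] by simp
  fix e assume "e \<in># pattern p"
  then obtain x where x: "p x \<noteq> x" "e = {x, p x}" using finite_links[OF p] by (auto simp: pattern_def links_def)
  then have "x \<in> {0<..2 * n}" "p x \<in> {0<..2 * n}" using webs_mem[OF p, of x] webs_in[OF p, of x] by auto
  then show "\<exists>c\<in>{1..length (replicate (2 * n) 1)}. \<exists>d\<in>{1..length (replicate (2 * n) 1)}. c \<noteq> d \<and> e = {c, d}"
    using x by (intro bexI[of _ x] bexI[of _ "p x"]) auto
next
  fix i assume "i \<in> {1..length (replicate (2 * n) (1::nat))}"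
  then have "i - 1 < 2 * n" "i \<in> {0<..2 * n}" by auto
  then show "size {#e \<in># pattern p. i \<in> e#} = replicate (2 * n) 1 ! (i - 1)"
    using valence_pattern[OF p] by (simp only: nth_replicate) simp
qed

lemma inj_on_pattern: "finite X \<Longrightarrow> inj_on pattern (webs X)"
proof (rule inj_onI, rule ext)
  fix p q x assume X: "finite X" and p: "p \<in> webs X" and q: "q \<in> webs X" and e: "pattern p = pattern q"
  then have l: "links p = links q"
    using finite_links[OF p X] finite_links[OF q X] by (simp add: pattern_def)
  show "p x = q x"
  proof (cases "x \<in> X")
    case True
    then have "{x, p x} \<in> links q" using mem_links[OF p] l by simp
    then show ?thesis using mem_links[OF q] by simp
  qed (simp add: webs_fix[OF p] webs_fix[OF q])
qed

text \<open>Valence 1 gives each point a unique partner and each link multiplicity at most 1. The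
  curves enter only through \<open>planar_links_noncrossing\<close>.\<close>

lemma pair_partitions_is_pattern:
  assumes a: "\<alpha> \<in> pair_partitions n"
  shows "\<exists>p\<in>webs {0<..2 * n}. \<alpha> = pattern p"
proof -
  let ?V = "{0<..2 * n}"
  have V: "{1..2 * n} = ?V" by auto
  have a': "\<forall>e\<in>#\<alpha>. \<exists>c\<in>?V. \<exists>d\<in>?V. c \<noteq> d \<and> e = {c, d}"
    "\<forall>i\<in>?V. size {#e \<in># \<alpha>. i \<in> e#} = replicate (2 * n) 1 ! (i - 1)" and pl: "planar_links \<alpha>"
    using a unfolding pair_partitions_def link_patterns_def length_replicate V by blast+
  have e: "\<exists>c\<in>?V. \<exists>d\<in>?V. c \<noteq> d \<and> e = {c, d}" if "e \<in># \<alpha>" for e using a'(1) that by blast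
  have one: "size {#e \<in># \<alpha>. i \<in> e#} = 1" if "i \<in> ?V" for i
  proof -
    have "i - 1 < 2 * n" using that by auto
    then show ?thesis using a'(2) that by (simp only: nth_replicate)
  qed
  have single: "\<exists>u. {#e \<in># \<alpha>. i \<in> e#} = {#u#}" if "i \<in> ?V" for i
    using one[OF that] by (simp add: size_1_singleton_mset)
  have uniq: "e = e'" if "e \<in># \<alpha>" "e' \<in># \<alpha>" "i \<in> e" "i \<in> e'" for e e' i
  proof -
    have "i \<in> ?V" using e[OF that(1)] that(3) by auto
    then obtain u where u: "{#e \<in># \<alpha>. i \<in> e#} = {#u#}" using single by blast
    have "e \<in># {#e \<in># \<alpha>. i \<in> e#}" "e' \<in># {#e \<in># \<alpha>. i \<in> e#}" using that by auto
    then show ?thesis unfolding u by simp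
  qed
  have ex: "\<exists>j. j \<noteq> i \<and> {i, j} \<in># \<alpha>" if i: "i \<in> ?V" for i
  proof -
    obtain u where "{#e \<in># \<alpha>. i \<in> e#} = {#u#}" using single[OF i] by blast
    then have "u \<in># {#e \<in># \<alpha>. i \<in> e#}" by simp
    then have u: "u \<in># \<alpha>" "i \<in> u" by auto
    then obtain c d where "c \<noteq> d" "u = {c, d}" using e by blast
    then show ?thesis using u by (auto simp: insert_commute)
  qed
  define p where "p = (\<lambda>i. if i \<in> ?V then SOME j. j \<noteq> i \<and> {i, j} \<in># \<alpha> else i)"
  have out: "p i = i" if "i \<notin> ?V" for i using that unfolding p_def by (rule if_not_P)
  have p: "p i \<noteq> i" "{i, p i} \<in># \<alpha>" if "i \<in> ?V" for i
    using someI_ex[OF ex[OF that]] unfolding p_def if_P[OF that] by blast+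
  have pV: "p i \<in> ?V" if "i \<in> ?V" for i
    using e[OF p(2)[OF that]] by (auto simp: doubleton_eq_iff)
  have invo: "p (p i) = i" for i
  proof (cases "i \<in> ?V")
    case True
    have "{p i, p (p i)} = {i, p i}" by (rule uniq[of _ _ "p i"]) (use p True pV in auto)
    then show ?thesis using p(1)[OF True] by (auto simp: doubleton_eq_iff)
  next
    case False then show ?thesis using out[OF False] by metis
  qed
  have mem: "p i \<noteq> i \<longleftrightarrow> i \<in> ?V" for i using p(1)[of i] out[of i] by blast
  have pw: "p \<in> webs ?V"
  proof (rule websI[OF invo mem])
    fix x y assume xy: "x < y" "y < p x" "p x < p y"
    then have "x \<in> ?V" "y \<in> ?V" using mem[of x] mem[of y] by auto
    then show False using planar_links_noncrossing[OF pl p(2) p(2), of x y] xy by blast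
  qed
  have "count \<alpha> e \<le> 1" for e
  proof (cases "e \<in># \<alpha>")
    case True
    then obtain c where c: "c \<in> ?V" "c \<in> e" using e by blast
    have "count \<alpha> e = count {#e \<in># \<alpha>. c \<in> e#} e" using c by simp
    also have "\<dots> \<le> size {#e \<in># \<alpha>. c \<in> e#}" by (rule count_le_size)
    finally show ?thesis using one[OF c(1)] by simp
  qed (simp add: not_in_iff)
  moreover have "set_mset \<alpha> = links p"
  proof (intro equalityI subsetI)
    fix u assume u: "u \<in># \<alpha>"
    then obtain c d where cd: "c \<in> ?V" "u = {c, d}" using e by blast
    then have "u = {c, p c}" by (intro uniq[of _ _ c] u p) auto
    then show "u \<in> links p" using mem cd by (auto simp: links_def)
  qed (use mem p in \<open>auto simp: links_def\<close>)
  ultimately have "\<alpha> = pattern p"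
    unfolding pattern_def using finite_links[OF pw]
    by (intro multiset_eqI) (auto simp: count_mset_set' not_in_iff[symmetric] le_Suc_eq simp flip: count_greater_zero_iff)
  then show ?thesis using pw by blast
qed

lemma bij_betw_pattern: "bij_betw pattern (webs {0<..2 * n}) (pair_partitions n)"
  unfolding bij_betw_def
  using inj_on_pattern pattern_in_pair_partitions pair_partitions_is_pattern by blast

section \<open>Existence and uniqueness of the splitting map\<close>

lemma links_insert_pair:
  assumes p: "p \<in> webs X" and ab: "a \<notin> X" "b \<notin> X" "a \<noteq> b"
  shows "links (p(a := b, b := a)) = insert {a, b} (links p)" "{a, b} \<notin> links p"
proof -
  have pab: "p a = a" "p b = b" using webs_fix[OF p] ab by auto
  have px: "p x \<noteq> a" "p x \<noteq> b" if "p x \<noteq> x" for x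
    using webs_mem[OF p, of x] webs_in[OF p, of x] that ab by auto
  have "{x. (p(a := b, b := a)) x \<noteq> x} = insert a (insert b {x. p x \<noteq> x})" using pab ab by auto
  then have "links (p(a := b, b := a)) =
      (\<lambda>x. {x, (p(a := b, b := a)) x}) ` insert a (insert b {x. p x \<noteq> x})" by (simp add: links_def)
  also have "\<dots> = insert {a, b} ((\<lambda>x. {x, (p(a := b, b := a)) x}) ` {x. p x \<noteq> x})"
    using ab by (auto simp: insert_commute)
  also have "(\<lambda>x. {x, (p(a := b, b := a)) x}) ` {x. p x \<noteq> x} = links p"
    unfolding links_def by (rule image_cong) (use pab in auto)
  finally show "links (p(a := b, b := a)) = insert {a, b} (links p)" .
  show "{a, b} \<notin> links p" using mem_links[OF p] ab by simp
qed

lemma webs_insert_adjacent: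
  assumes p: "p \<in> webs X" and ab: "a \<notin> X" "b \<notin> X" "a < b" and adj: "\<And>x. x \<in> X \<Longrightarrow> \<not> (a < x \<and> x < b)"
  shows "p(a := b, b := a) \<in> webs (insert a (insert b X))"
proof (rule websI)
  have pab: "p a = a" "p b = b" using webs_fix[OF p] ab by auto
  have px: "p x \<noteq> a" "p x \<noteq> b" if "x \<noteq> a" "x \<noteq> b" for x
    using webs_invol[OF p, of x] pab that by metis+
  fix x y
  show "(p(a := b, b := a)) ((p(a := b, b := a)) x) = x" using px[of x] webs_invol[OF p] by auto
  show "((p(a := b, b := a)) x \<noteq> x) = (x \<in> insert a (insert b X))" using webs_mem[OF p] ab by auto
  assume xy: "x < y" "y < (p(a := b, b := a)) x" "(p(a := b, b := a)) x < (p(a := b, b := a)) y"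
  have yX: "y \<in> X" if "y \<noteq> a" "y \<noteq> b" using xy that webs_mem[OF p, of y] by auto
  have xX: "p x \<in> X" "x \<in> X" if "x \<noteq> a" "x \<noteq> b" using xy that webs_mem[OF p, of x] webs_in[OF p, of x] by auto
  consider "x = a" | "x = b" | "x \<noteq> a" "x \<noteq> b" "y = a" | "x \<noteq> a" "x \<noteq> b" "y = b" | "x \<noteq> a" "x \<noteq> b" "y \<noteq> a" "y \<noteq> b"
    by blast
  then show False
  proof cases
    case 1 then show ?thesis using xy ab yX adj[of y] by auto
  next
    case 2 then show ?thesis using xy ab by auto
  next
    case 3 then show ?thesis using xy ab xX adj[of "p x"] by auto
  next
    case 4 then show ?thesis using xy ab by auto
  next
    case 5 then show ?thesis using xy webs_nocross[OF p, of x y] by auto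
  qed
qed

lemma webs_remove_pair:
  assumes p: "p \<in> webs X" and ab: "p a = b"
  shows "p(a := a, b := b) \<in> webs (X - {a, b})"
proof (rule websI)
  have pb: "p b = a" using webs_invol[OF p] ab by metis
  have px: "p x \<noteq> a" "p x \<noteq> b" if "x \<noteq> a" "x \<noteq> b" for x
    using webs_invol[OF p, of x] ab pb that by metis+
  fix x y
  show "(p(a := a, b := b)) ((p(a := a, b := b)) x) = x" using px[of x] webs_invol[OF p] by auto
  show "((p(a := a, b := b)) x \<noteq> x) = (x \<in> X - {a, b})" using webs_mem[OF p] by auto
  show "x < y \<Longrightarrow> y < (p(a := a, b := b)) x \<Longrightarrow> (p(a := a, b := b)) x < (p(a := a, b := b)) y \<Longrightarrow> False"
    using webs_nocross[OF p, of x y] by (auto split: if_splits)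
qed

text \<open>Induction on the number of links, removing a link \<open>{a, b}\<close> of minimal
  length. No point of \<open>X\<close> lies over an index strictly between \<open>a\<close> and
  \<open>b\<close>, because a link of that index would be enclosed by \<open>{a, b}\<close> and
  shorter. Hence the last point \<open>u\<close> over \<open>a\<close> and the first point
  \<open>v\<close> over \<open>b\<close> are neighbours, and every lift has to link them.\<close>

theorem split_noncrossing:
  fixes f :: "nat \<Rightarrow> nat"
  assumes "finite X" "mono_on X f"
    and "\<And>e. e \<in># L \<Longrightarrow> \<exists>c d. c < d \<and> e = {c, d}"
    and "\<And>a b c d. {a, b} \<in># L \<Longrightarrow> {c, d} \<in># L \<Longrightarrow> a < c \<Longrightarrow> c < b \<Longrightarrow> b < d \<Longrightarrow> False"
    and "\<And>i. size {#e \<in># L. i \<in> e#} = card {x \<in> X. f x = i}"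
  shows "\<exists>!p. p \<in> webs X \<and> image_mset (\<lambda>e. f ` e) (pattern p) = L"
  using assms
proof (induction "size L" arbitrary: L X)
  case 0
  then have L: "L = {#}" by simp
  have X: "X = {}"
  proof (rule ccontr)
    assume "X \<noteq> {}"
    then obtain x where "x \<in> X" by blast
    moreover have "card {y \<in> X. f y = f x} = 0" using 0(6)[of "f x"] L by simp
    ultimately show False using \<open>finite X\<close> by auto
  qed
  show ?case unfolding X L by (auto simp: webs_empty pattern_def links_def)
next
  case (Suc n L X)
  note fin = Suc.prems(1) and mono = Suc.prems(2) and lk = Suc.prems(3) and nc = Suc.prems(4) and val = Suc.prems(5)
  have mle: "f x \<le> f y" if "x \<in> X" "y \<in> X" "x \<le> y" for x y using mono that by (auto simp: mono_on_def)
  have occ: "\<exists>z\<in>X. f z = i" if "{i, j} \<in># L" for i j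
  proof -
    have "{i, j} \<in># {#e \<in># L. i \<in> e#}" using that by simp
    then have "card {x \<in> X. f x = i} \<noteq> 0" using val[of i] by (metis empty_iff set_mset_empty size_eq_0_iff_empty)
    then show ?thesis by (metis (mono_tags, lifting) card.empty empty_Collect_eq)
  qed
  have hit: "\<exists>j. j \<noteq> f x \<and> {f x, j} \<in># L" if "x \<in> X" for x
  proof -
    have "card {y \<in> X. f y = f x} \<noteq> 0" using that fin by auto
    then have "size {#e \<in># L. f x \<in> e#} \<noteq> 0" using val[of "f x"] by (simp only: not_False_eq_True)
    then have "{#e \<in># L. f x \<in> e#} \<noteq> {#}" by (simp only: size_eq_0_iff_empty not_False_eq_True)
    then obtain e where e: "e \<in># {#e \<in># L. f x \<in> e#}" by (meson multiset_nonemptyE)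
    then have "e \<in># L" by simp
    then obtain c d where "c < d" "e = {c, d}" using lk by blast
    then have cd: "c \<noteq> d" "{c, d} \<in># L" "{d, c} \<in># L" "f x = c \<or> f x = d"
      using e by (auto simp: insert_commute)
    then show ?thesis by metis
  qed
  define P where "P = (\<lambda>m. \<exists>a b. {a, b} \<in># L \<and> b = a + m \<and> 0 < m)"
  have "L \<noteq> {#}" using Suc(2) by auto
  then obtain e0 where "e0 \<in># L" by (meson multiset_nonemptyE)
  then obtain a0 b0 where "a0 < b0" "{a0, b0} \<in># L" using lk by blast
  then have "P (b0 - a0)" unfolding P_def by (intro exI[of _ a0] exI[of _ b0]) auto
  then have "P (Least P)" by (rule LeastI)
  then obtain a b where abL: "{a, b} \<in># L" and ab: "a < b" "b = a + Least P" unfolding P_def by auto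
  have least: "b - a \<le> d - c" if "{c, d} \<in># L" "c < d" for c d
  proof -
    have "P (d - c)" using that unfolding P_def by (intro exI[of _ c] exI[of _ d]) auto
    then show ?thesis using Least_le[of P "d - c"] ab by simp
  qed
  have gap: "\<not> (a < f y \<and> f y < b)" if y: "y \<in> X" for y
  proof
    assume in_: "a < f y \<and> f y < b"
    obtain j where j: "j \<noteq> f y" "{f y, j} \<in># L" using hit[OF y] by blast
    have j': "{j, f y} \<in># L" using j(2) by (simp add: insert_commute)
    have "a \<le> j"
    proof (rule ccontr)
      assume "\<not> a \<le> j"
      then show False using nc[OF j' abL] in_ by auto
    qed
    moreover have "j \<le> b"
    proof (rule ccontr)
      assume "\<not> j \<le> b"
      then show False using nc[OF abL j(2)] in_ by auto
    qed
    ultimately show False using least[OF j(2)] least[OF j'] j(1) in_ by linarith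
  qed
  define A B where "A = {x \<in> X. f x = a}" and "B = {x \<in> X. f x = b}"
  have "finite A" "finite B" using fin by (auto simp: A_def B_def)
  have "A \<noteq> {}" using occ[OF abL] by (auto simp: A_def)
  have "B \<noteq> {}" using occ[of b a] abL by (auto simp: B_def insert_commute)
  define u v where "u = Max A" and "v = Min B"
  have "u \<in> A" "v \<in> B" unfolding u_def v_def using \<open>finite A\<close> \<open>finite B\<close> \<open>A \<noteq> {}\<close> \<open>B \<noteq> {}\<close> by auto
  then have u: "u \<in> X" "f u = a" and v: "v \<in> X" "f v = b" by (auto simp: A_def B_def)
  have umax: "x \<le> u" if "x \<in> X" "f x = a" for x
    unfolding u_def using that \<open>finite A\<close> by (intro Max_ge) (auto simp: A_def)
  have vmin: "v \<le> x" if "x \<in> X" "f x = b" for x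
    unfolding v_def using that \<open>finite B\<close> by (intro Min_le) (auto simp: B_def)
  have uv: "u < v" using mle[OF v(1) u(1)] u v ab by (meson leD leI)
  have adj: "\<not> (u < x \<and> x < v)" if x: "x \<in> X" for x
  proof
    assume in_: "u < x \<and> x < v"
    then have "a \<le> f x" "f x \<le> b" using mle[OF u(1) x] mle[OF x v(1)] u v by auto
    moreover have "f x \<noteq> a" "f x \<noteq> b" using umax[OF x] vmin[OF x] in_ by auto
    ultimately show False using gap[OF x] by linarith
  qed
  define X' L' where "X' = X - {u, v}" and "L' = L - {#{a, b}#}"
  have LL: "L = add_mset {a, b} L'" using abL by (simp add: L'_def)
  have XX: "X = insert u (insert v X')" "u \<notin> X'" "v \<notin> X'" using u v by (auto simp: X'_def)
  have sub: "e \<in># L" if "e \<in># L'" for e using that by (simp add: LL)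
  have val': "size {#e \<in># L'. i \<in> e#} = card {x \<in> X'. f x = i}" for i
  proof -
    have "card {x \<in> X. f x = i} = card {x \<in> X'. f x = i} + of_bool (i = a \<or> i = b)"
    proof -
      have fX': "finite {x \<in> X'. f x = i}" using fin by (simp add: X'_def)
      have "{x \<in> X. f x = i} = (if i = a then insert u {x \<in> X'. f x = i} else
          if i = b then insert v {x \<in> X'. f x = i} else {x \<in> X'. f x = i})"
        using XX u v ab by auto
      moreover have "u \<notin> {x \<in> X'. f x = i}" "v \<notin> {x \<in> X'. f x = i}" using XX(2,3) by auto
      ultimately show ?thesis using fX' by (cases "i = a"; cases "i = b") (simp_all only: card_insert_disjoint, simp_all)
    qed
    moreover have "size {#e \<in># L. i \<in> e#} = size {#e \<in># L'. i \<in> e#} + of_bool (i = a \<or> i = b)"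
      by (simp add: LL)
    ultimately show ?thesis using val[of i] by simp
  qed
  have IH: "\<exists>!p. p \<in> webs X' \<and> image_mset (\<lambda>e. f ` e) (pattern p) = L'"
  proof (rule Suc.hyps(1))
    show "n = size L'" using Suc(2) by (simp add: LL)
    show "finite X'" using fin by (simp add: X'_def)
    show "mono_on X' f" using mono by (auto simp: mono_on_def X'_def)
    show "\<exists>c d. c < d \<and> e = {c, d}" if "e \<in># L'" for e using lk sub that by blast
    show "{a, b} \<in># L' \<Longrightarrow> {c, d} \<in># L' \<Longrightarrow> a < c \<Longrightarrow> c < b \<Longrightarrow> b < d \<Longrightarrow> False" for a b c d
      using nc sub by blast
    show "size {#e \<in># L'. i \<in> e#} = card {x \<in> X'. f x = i}" for i by (rule val')
  qed
  then obtain p where p: "p \<in> webs X'" "image_mset (\<lambda>e. f ` e) (pattern p) = L'" by blast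
  have uniq: "q = p" if "q \<in> webs X'" "image_mset (\<lambda>e. f ` e) (pattern q) = L'" for q using IH p that by blast
  have fX': "finite X'" using fin by (simp add: X'_def)
  have pat: "image_mset (\<lambda>e. f ` e) (pattern (q(u := v, v := u))) = add_mset {a, b} (image_mset (\<lambda>e. f ` e) (pattern q))"
    if "q \<in> webs X'" for q
    using links_insert_pair[OF that XX(2,3)] uv finite_links[OF that fX'] u v by (simp add: pattern_def)
  show ?case
  proof (rule ex1I[of _ "p(u := v, v := u)"], rule conjI)
    show "p(u := v, v := u) \<in> webs X"
      unfolding XX(1) by (rule webs_insert_adjacent[OF p(1) XX(2,3) uv]) (use adj in \<open>auto simp: X'_def\<close>)
    show "image_mset (\<lambda>e. f ` e) (pattern (p(u := v, v := u))) = L" using pat[OF p(1)] p(2) by (simp add: LL)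
  next
    fix q assume q: "q \<in> webs X \<and> image_mset (\<lambda>e. f ` e) (pattern q) = L"
    then have qw: "q \<in> webs X" and qL: "image_mset (\<lambda>e. f ` e) (pattern q) = L" by auto
    note inv = webs_invol[OF qw]
    have setL: "set_mset L = (\<lambda>e. f ` e) ` links q"
      using finite_links[OF qw fin] by (simp add: qL[symmetric] pattern_def)
    have noloop: "f x \<noteq> f (q x)" if "x \<in> X" for x
    proof
      assume e: "f x = f (q x)"
      have "{x, q x} \<in> links q" using mem_links[OF qw] that by simp
      then have "f ` {x, q x} \<in># L" unfolding setL by (rule imageI)
      then have "{f x} \<in># L" using e by simp
      then show False using lk by (metis insertI1 insert_iff less_irrefl singletonD)
    qed
    have "{a, b} \<in> (\<lambda>e. f ` e) ` links q" using abL setL by simp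
    then obtain x where x: "x \<in> X" "f ` {x, q x} = {a, b}" using webs_mem[OF qw] by (auto simp: links_def)
    \<comment> \<open>Uniqueness: some link of the lift \<open>q\<close> lies over
      \<open>{a, b}\<close>, with \<open>w \<le> u\<close> and \<open>v \<le> q w\<close>. Unless it
      starts at \<open>u\<close>, nesting puts the partner of \<open>u\<close> over \<open>a\<close>
      or \<open>b\<close>, and \<open>a\<close> would give a loop. If that partner were beyond
      \<open>v\<close>, nesting would put \<open>q v\<close> after \<open>u\<close> and over
      \<open>a\<close> or \<open>b\<close>; but \<open>u\<close> is the last point over
      \<open>a\<close>, and \<open>b\<close> would give a loop.\<close>
    have "\<exists>w\<in>X. f w = a \<and> f (q w) = b"
    proof -
      have "f x = a \<and> f (q x) = b \<or> f x = b \<and> f (q x) = a" using x(2) by (auto simp: doubleton_eq_iff)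
      then show ?thesis using x(1) webs_in[OF qw x(1)] inv by metis
    qed
    then obtain w where w: "w \<in> X" "f w = a" "f (q w) = b" by blast
    have qwX: "q w \<in> X" by (rule webs_in[OF qw w(1)])
    have wu: "w \<le> u" "v \<le> q w" using umax[OF w(1,2)] vmin[OF qwX w(3)] by auto
    have between: "f z = a \<or> f z = b" if z: "z \<in> X" "w \<le> z" "z \<le> q w" for z
      using mle[OF w(1) z(1,2)] mle[OF z(1) qwX z(3)] gap[OF z(1)] w by linarith
    have qu: "f (q u) = b"
    proof (cases "w = u")
      case False
      then have "w < u" "u < q w" using wu uv by auto
      from webs_nested[OF qw this] have "f (q u) = a \<or> f (q u) = b"
        by (intro between webs_in[OF qw u(1)]) auto
      then show ?thesis using noloop[OF u(1)] u by auto
    qed (use w in simp)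
    have quX: "q u \<in> X" by (rule webs_in[OF qw u(1)])
    have "q u = v"
    proof (rule ccontr)
      assume "q u \<noteq> v"
      then have lt: "u < v" "v < q u" using uv vmin[OF quX qu] by auto
      note nst = webs_nested[OF qw lt]
      have qvX: "q v \<in> X" by (rule webs_in[OF qw v(1)])
      have "a \<le> f (q v)" "f (q v) \<le> b" using mle[OF u(1) qvX] mle[OF qvX quX] nst u qu by auto
      moreover have "f (q v) \<noteq> b" using noloop[OF v(1)] v by auto
      moreover have "f (q v) \<noteq> a" using umax[OF qvX] nst(1) by auto
      ultimately show False using gap[OF qvX] by linarith
    qed
    then have quv: "q u = v" "q v = u" using inv by metis+
    define q' where "q' = q(u := u, v := v)"
    have q': "q' \<in> webs X'" unfolding q'_def X'_def by (rule webs_remove_pair[OF qw quv(1)])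
    have qq: "q = q'(u := v, v := u)" using quv uv by (auto simp: q'_def fun_eq_iff)
    have "add_mset {a, b} (image_mset (\<lambda>e. f ` e) (pattern q')) = add_mset {a, b} L'"
      using pat[OF q'] qL unfolding qq[symmetric] LL by simp
    then have "q' = p" by (intro uniq[OF q']) simp
    then show "q = p(u := v, v := u)" using qq by simp
  qed
qed

lemma parent_two:
  assumes "0 < k" "k \<le> 2 * M"
  shows "parent (replicate M 2) k = Suc k div 2"
  unfolding parent_def
proof (rule Least_equality)
  show "k \<le> sum_list (take (Suc k div 2) (replicate M 2))"
    using assms by (simp add: sum_list_replicate min_def) presburger
  show "Suc k div 2 \<le> j" if "k \<le> sum_list (take j (replicate M 2))" for j
    using assms that by (auto simp: sum_list_replicate min_def split: if_splits)
qed

text \<open>The source of \<open>unlinked\<close>: a link between the two points of a pair would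
  come from a link of an index to itself.\<close>

theorem split_pattern_two:
  assumes L: "L \<in> link_patterns (replicate M 2)"
  shows "\<exists>p\<in>webs {0<..2 * M}. split_pattern (replicate M 2) L = pattern p \<and> unlinked p"
proof -
  let ?s = "replicate M (2::nat)" and ?V = "{0<..2 * M}"
  let ?f = "parent ?s"
  have f: "?f k = Suc k div 2" if "k \<in> ?V" for k using parent_two that by auto
  have lk: "\<exists>c d. c \<in> {1..M} \<and> d \<in> {1..M} \<and> c < d \<and> e = {c, d}" if eL: "e \<in># L" for e
  proof -
    have "\<exists>c\<in>{1..M}. \<exists>d\<in>{1..M}. c \<noteq> d \<and> e = {c, d}"
      using L eL unfolding link_patterns_def length_replicate by blast
    then obtain c d where cd: "c \<in> {1..M}" "d \<in> {1..M}" "c \<noteq> d" "e = {c, d}" by blast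
    show ?thesis
    proof (cases "c < d")
      case False
      then have "d < c" "e = {d, c}" using cd by auto
      then show ?thesis using cd by blast
    qed (use cd in blast)
  qed
  have pl: "planar_links L" using L by (simp add: link_patterns_def)
  have val: "size {#e \<in># L. i \<in> e#} = card {x \<in> ?V. ?f x = i}" for i
  proof (cases "i \<in> {1..M}")
    case True
    then have "i - 1 < M" by auto
    then have "size {#e \<in># L. i \<in> e#} = 2"
      using L True unfolding link_patterns_def length_replicate by simp
    moreover have "{x \<in> ?V. ?f x = i} = {2 * i - 1, 2 * i}"
    proof (intro equalityI subsetI)
      fix x assume "x \<in> {x \<in> ?V. ?f x = i}"
      then have "Suc x div 2 = i" using f by auto
      then show "x \<in> {2 * i - 1, 2 * i}" by auto
    next
      fix x assume x: "x \<in> {2 * i - 1, 2 * i}"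
      then have "x \<in> ?V" "Suc x div 2 = i" using True by auto
      then show "x \<in> {x \<in> ?V. ?f x = i}" using f by auto
    qed
    moreover have "2 * i - 1 \<noteq> 2 * i" using True by auto
    ultimately show ?thesis by simp
  next
    case False
    then have "{#e \<in># L. i \<in> e#} = {#}" using lk by (force simp: filter_mset_eq_conv)
    moreover have "{x \<in> ?V. ?f x = i} = {}"
    proof -
      have "?f x \<noteq> i" if "x \<in> ?V" for x using False that f[OF that] by auto
      then show ?thesis by blast
    qed
    ultimately show ?thesis by (simp only: size_empty card.empty)
  qed
  have "\<exists>!p. p \<in> webs ?V \<and> image_mset (\<lambda>e. ?f ` e) (pattern p) = L"
  proof (rule split_noncrossing)
    show "mono_on ?V ?f" using f by (auto simp: mono_on_def intro: div_le_mono)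
    show "\<exists>c d. c < d \<and> e = {c, d}" if "e \<in># L" for e using lk[OF that] by blast
    show "{a, b} \<in># L \<Longrightarrow> {c, d} \<in># L \<Longrightarrow> a < c \<Longrightarrow> c < b \<Longrightarrow> b < d \<Longrightarrow> False" for a b c d
      by (rule planar_links_noncrossing[OF pl])
  qed (use val in auto)
  then obtain p where p: "p \<in> webs ?V" "image_mset (\<lambda>e. ?f ` e) (pattern p) = L"
    and uniq: "\<And>q. q \<in> webs ?V \<Longrightarrow> image_mset (\<lambda>e. ?f ` e) (pattern q) = L \<Longrightarrow> q = p" by blast
  have s: "sum_list ?s div 2 = M" by (simp add: sum_list_replicate)
  have "split_pattern ?s L = pattern p"
    unfolding split_pattern_def s
  proof (rule the_equality)
    show "pattern p \<in> pair_partitions M \<and> image_mset (\<lambda>e. ?f ` e) (pattern p) = L"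
      using p pattern_in_pair_partitions by blast
    show "\<alpha> = pattern p" if "\<alpha> \<in> pair_partitions M \<and> image_mset (\<lambda>e. ?f ` e) \<alpha> = L" for \<alpha>
      using pair_partitions_is_pattern[of \<alpha> M] that uniq by blast
  qed
  moreover have "unlinked p"
    unfolding unlinked_def
  proof (intro allI notI)
    fix j assume e: "p (Suc (2 * j)) = Suc (Suc (2 * j))"
    then have 1: "Suc (2 * j) \<in> ?V" using webs_mem[OF p(1), of "Suc (2 * j)"] by simp
    then have 2: "Suc (Suc (2 * j)) \<in> ?V" using webs_in[OF p(1) 1] e by simp
    have "{Suc (2 * j), Suc (Suc (2 * j))} \<in># pattern p"
      using mem_links[OF p(1)] 1 e finite_links[OF p(1)] by (simp add: pattern_def)
    then have "?f ` {Suc (2 * j), Suc (Suc (2 * j))} \<in> (\<lambda>e. ?f ` e) ` set_mset (pattern p)" by (rule imageI)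
    then have "?f ` {Suc (2 * j), Suc (Suc (2 * j))} \<in># L" using p(2) by (metis set_image_mset)
    then have "{Suc j} \<in># L" using f[OF 1] f[OF 2] by simp
    then show False using lk[of "{Suc j}"] by (auto simp: doubleton_eq_iff)
  qed
  ultimately show ?thesis using p(1) by blast
qed

section \<open>The incidence matrix and the conformal blocks in terms of matchings\<close>

lemma incidence_patternD:
  assumes a: "a \<in> webs X" and b: "b \<in> webs X" and X: "finite X"
    and r: "pairs_repr n (pattern a) u v" "s permutes {1..n}"
      "pattern b = {#{u i, v (s i)}. i \<in># mset_set {1..n}#}"
  shows "compat (ups a) b"
proof -
  have la: "links a = (\<lambda>i. {u i, v i}) ` {1..n}"
  proof -
    have "set_mset (pattern a) = (\<lambda>i. {u i, v i}) ` {1..n}"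
      using r(1) unfolding pairs_repr_def by simp
    then show ?thesis using finite_links[OF a X] by (simp add: pattern_def)
  qed
  have lb: "links b = (\<lambda>i. {u i, v (s i)}) ` {1..n}"
  proof -
    have "set_mset (pattern b) = (\<lambda>i. {u i, v (s i)}) ` {1..n}" using r(3) by simp
    then show ?thesis using finite_links[OF b X] by (simp add: pattern_def)
  qed
  have uv: "u i \<in> ups a \<and> v i \<notin> ups a" if "i \<in> {1..n}" for i
  proof -
    have "{u i, v i} \<in> links a" using that la by blast
    then have "a (u i) = v i" using mem_links[OF a] by simp
    moreover have "u i < v i" using r(1) that by (simp add: pairs_repr_def)
    ultimately show ?thesis using webs_invol[OF a, of "u i"] by (auto simp: ups_def)
  qed
  show ?thesis
    unfolding compat_def
  proof (intro allI impI)
    fix x assume "b x \<noteq> x"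
    then have "{x, b x} \<in> links b" by (auto simp: links_def)
    then obtain i where i: "i \<in> {1..n}" "{x, b x} = {u i, v (s i)}" using lb by auto
    have "s i \<in> {1..n}" using permutes_in_image[OF r(2)] i(1) by blast
    then have "u i \<in> ups a" "v (s i) \<notin> ups a" using uv i(1) by blast+
    then show "(x \<in> ups a) \<noteq> (b x \<in> ups a)" using i(2) by (auto simp: doubleton_eq_iff)
  qed
qed

lemma pairs_repr_exists:
  assumes a: "a \<in> webs {0<..2 * n}"
  shows "\<exists>u. bij_betw u {1..n} (ups a) \<and> pairs_repr n (pattern a) u (\<lambda>i. a (u i))"
proof -
  let ?V = "{0<..2 * n}" and ?xs = "sorted_list_of_set (ups a)"
  have fin: "finite (ups a)" using finite_subset[OF ups_subset[OF a]] by simp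
  have len: "length ?xs = n" using card_ups(2)[OF a] by simp
  define u where "u i = ?xs ! (i - 1)" for i
  have mono: "strict_mono_on {1..n} u"
  proof (rule strict_mono_onI)
    fix i j assume "i \<in> {1..n}" "j \<in> {1..n}" "i < j"
    then show "u i < u j"
      unfolding u_def using strict_sorted_list_of_set[of "ups a"] len
      by (intro sorted_wrt_nth_less[of "(<)"]) auto
  qed
  have "u ` {1..n} = ups a"
  proof -
    have "u ` {1..n} = (\<lambda>i. ?xs ! i) ` {0..<n}"
      unfolding u_def by (force simp: image_iff Bex_def intro: exI[of _ "Suc _"])
    also have "\<dots> = set ?xs" using len by (auto simp: set_conv_nth)
    finally show ?thesis using fin by simp
  qed
  then have bij: "bij_betw u {1..n} (ups a)"
    unfolding bij_betw_def using strict_mono_on_imp_inj_on[OF mono] by simp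
  have "{#{u i, a (u i)}. i \<in># mset_set {1..n}#} = mset_set ((\<lambda>i. {u i, a (u i)}) ` {1..n})"
  proof (rule image_mset_mset_set)
    have "inj_on ((\<lambda>x. {x, a x}) \<circ> u) {1..n}"
      using bij inj_on_ups_link[OF a] by (intro comp_inj_on) (auto simp: bij_betw_def)
    then show "inj_on (\<lambda>i. {u i, a (u i)}) {1..n}" by (simp add: comp_def)
  qed
  also have "(\<lambda>i. {u i, a (u i)}) ` {1..n} = links a"
    unfolding links_ups[OF a] using bij by (auto simp: bij_betw_def image_image[symmetric])
  finally have "pattern a = {#{u i, a (u i)}. i \<in># mset_set {1..n}#}" by (simp add: pattern_def)
  moreover have "u i < a (u i)" if "i \<in> {1..n}" for i
    using bij that by (force simp: bij_betw_def ups_def)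
  ultimately show ?thesis using mono bij unfolding pairs_repr_def by blast
qed

lemma incidence_pattern:
  assumes a: "a \<in> webs {0<..2 * n}" and b: "b \<in> webs {0<..2 * n}"
  shows "incidence n (pattern a) (pattern b) = of_bool (compat (ups a) b)"
proof -
  let ?V = "{0<..2 * n}"
  have "\<exists>u v s. pairs_repr n (pattern a) u v \<and> s permutes {1..n} \<and>
      pattern b = {#{u i, v (s i)}. i \<in># mset_set {1..n}#}" if c: "compat (ups a) b"
  proof -
    obtain u where u: "bij_betw u {1..n} (ups a)" "pairs_repr n (pattern a) u (\<lambda>i. a (u i))"
      using pairs_repr_exists[OF a] by blast
    have fin: "finite (ups a)" using finite_subset[OF ups_subset[OF a]] by simp
    have ab: "a (b x) \<in> ups a" "b x \<notin> ups a" "b x \<in> ?V" if "x \<in> ups a" for x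
    proof -
      have xV: "x \<in> ?V" using ups_subset[OF a] that by blast
      then have "b x \<noteq> x" using webs_mem[OF b] by blast
      then show *: "b x \<notin> ups a" using c that unfolding compat_def by blast
      show bV: "b x \<in> ?V" by (rule webs_in[OF b xV])
      have "a (b x) < b x" using down_iff[OF a bV] * by simp
      then show "a (b x) \<in> ups a" using webs_invol[OF a, of "b x"] by (simp add: ups_def)
    qed
    have inj: "inj_on (\<lambda>x. a (b x)) (ups a)"
      using webs_invol[OF a] webs_invol[OF b] by (metis (mono_tags, lifting) inj_onI)
    have bij: "bij_betw (\<lambda>x. a (b x)) (ups a) (ups a)"
      unfolding bij_betw_def using inj endo_inj_surj[OF fin _ inj] ab by auto
    \<comment> \<open>\<open>b\<close> links the left endpoint \<open>u i\<close> of
      \<open>a\<close> to a right endpoint of \<open>a\<close>, and the left end belonging to the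
      latter is \<open>u (t i)\<close>. This is the required permutation.\<close>
    define t where "t = inv_into {1..n} u \<circ> ((\<lambda>x. a (b x)) \<circ> u)"
    have t: "bij_betw t {1..n} {1..n}"
      unfolding t_def by (intro bij_betw_trans[OF bij_betw_trans[OF u(1) bij]] bij_betw_inv_into u(1))
    have ut: "u (t i) = a (b (u i))" if "i \<in> {1..n}" for i
    proof -
      have "u ` {1..n} = ups a" using u(1) by (simp add: bij_betw_def)
      moreover have "u i \<in> u ` {1..n}" using that by (rule imageI)
      ultimately have "a (b (u i)) \<in> u ` {1..n}" using ab(1) by simp
      then show ?thesis unfolding t_def comp_def by (rule f_inv_into_f)
    qed
    define s where "s i = (if i \<in> {1..n} then t i else i)" for i
    have "s permutes {1..n}"
      by (rule bij_imp_permutes) (use t bij_betw_cong[of "{1..n}" s t] in \<open>auto simp: s_def\<close>)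
    moreover have "pattern b = {#{u i, a (u (s i))}. i \<in># mset_set {1..n}#}"
    proof -
      have eq: "{u i, a (u (s i))} = {u i, b (u i)}" if "i \<in> {1..n}" for i
        using ut[OF that] webs_invol[OF a] that by (simp add: s_def)
      have injb: "inj_on (\<lambda>x. {x, b x}) (ups a)"
        using ab by (auto simp: inj_on_def doubleton_eq_iff)
      have "{#{u i, a (u (s i))}. i \<in># mset_set {1..n}#} = {#{u i, b (u i)}. i \<in># mset_set {1..n}#}"
        by (rule image_mset_cong) (use eq in auto)
      also have "\<dots> = mset_set ((\<lambda>i. {u i, b (u i)}) ` {1..n})"
      proof (rule image_mset_mset_set)
        have "inj_on ((\<lambda>x. {x, b x}) \<circ> u) {1..n}"
          using u(1) injb by (intro comp_inj_on) (auto simp: bij_betw_def)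
        then show "inj_on (\<lambda>i. {u i, b (u i)}) {1..n}" by (simp add: comp_def)
      qed
      also have "(\<lambda>i. {u i, b (u i)}) ` {1..n} = (\<lambda>x. {x, b x}) ` ups a"
        using u(1) by (auto simp: bij_betw_def image_image[symmetric])
      also have "\<dots> = links b"
      proof (intro equalityI subsetI)
        fix e assume "e \<in> (\<lambda>x. {x, b x}) ` ups a"
        then obtain x where x: "x \<in> ups a" "e = {x, b x}" by blast
        then have "x \<in> ?V" using ups_subset[OF a] by blast
        then show "e \<in> links b" using mem_links[OF b] x by simp
      next
        fix e assume "e \<in> links b"
        then obtain x where x: "b x \<noteq> x" "e = {x, b x}" by (auto simp: links_def)
        show "e \<in> (\<lambda>x. {x, b x}) ` ups a"
        proof (cases "x \<in> ups a")
          case False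
          then have "b x \<in> ups a" using c x(1) unfolding compat_def by blast
          moreover have "e = {b x, b (b x)}" using x webs_invol[OF b] by (simp add: insert_commute)
          ultimately show ?thesis by blast
        qed (use x in blast)
      qed
      finally show ?thesis by (simp add: pattern_def)
    qed
    ultimately show ?thesis using u(2) by blast
  qed
  moreover have "compat (ups a) b" if "\<exists>u v s. pairs_repr n (pattern a) u v \<and> s permutes {1..n} \<and>
      pattern b = {#{u i, v (s i)}. i \<in># mset_set {1..n}#}"
    using that incidence_patternD[OF a b] by blast
  ultimately show ?thesis unfolding incidence_def by (auto simp: of_bool_def)
qed

text \<open>The definition of \<open>incidence_inv\<close> is a unique description, so uniqueness
  has to be proved too: on pair partitions by the usual argument for two-sided inverses, elsewhere
  by the prescribed value 0.\<close>

lemma incidence_inv_pattern: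
  assumes a: "a \<in> webs {0<..2 * n}" and b: "b \<in> webs {0<..2 * n}"
  shows "incidence_inv n (pattern a) (pattern b) = web_inv {0<..2 * n} a b"
proof -
  let ?V = "{0<..2 * n}" and ?PP = "pair_partitions n"
  define d where "d = inv_into (webs ?V) pattern"
  note bij = bij_betw_pattern[of n]
  have d: "d (pattern p) = p" if "p \<in> webs ?V" for p
    unfolding d_def using bij that by (intro inv_into_f_f) (auto simp: bij_betw_def)
  have dPP: "d \<alpha> \<in> webs ?V" "pattern (d \<alpha>) = \<alpha>" if "\<alpha> \<in> ?PP" for \<alpha>
    using that bij unfolding d_def bij_betw_def by (auto simp: inv_into_into f_inv_into_f)
  have fin: "finite ?PP" using bij_betw_finite[OF bij] finite_webs[of ?V] by simp
  have inc: "incidence n \<alpha> \<beta> = of_bool (compat (ups (d \<alpha>)) (d \<beta>))" if "\<alpha> \<in> ?PP" "\<beta> \<in> ?PP" for \<alpha> \<beta>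
    using incidence_pattern[of "d \<alpha>" n "d \<beta>"] dPP that by simp
  have sum: "(\<Sum>\<gamma>\<in>?PP. F (d \<gamma>)) = (\<Sum>c\<in>webs ?V. F c)" for F :: "(nat \<Rightarrow> nat) \<Rightarrow> real"
    using sum.reindex_bij_betw[OF bij, of "\<lambda>\<gamma>. F (d \<gamma>)"] d by simp
  define K0 where "K0 \<alpha> \<beta> = (if \<alpha> \<in> ?PP \<and> \<beta> \<in> ?PP then web_inv ?V (d \<alpha>) (d \<beta>) else 0)" for \<alpha> \<beta>
  have deq: "d \<alpha> = d \<beta> \<longleftrightarrow> \<alpha> = \<beta>" if "\<alpha> \<in> ?PP" "\<beta> \<in> ?PP" for \<alpha> \<beta>
    using dPP that by metis
  have K0: "(\<Sum>\<gamma>\<in>?PP. K0 \<alpha> \<gamma> * incidence n \<gamma> \<beta>) = (if \<alpha> = \<beta> then 1 else 0)"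
    "(\<Sum>\<gamma>\<in>?PP. incidence n \<alpha> \<gamma> * K0 \<gamma> \<beta>) = (if \<alpha> = \<beta> then 1 else 0)"
    if ab: "\<alpha> \<in> ?PP" "\<beta> \<in> ?PP" for \<alpha> \<beta>
  proof -
    have "(\<Sum>\<gamma>\<in>?PP. K0 \<alpha> \<gamma> * incidence n \<gamma> \<beta>) =
      (\<Sum>\<gamma>\<in>?PP. web_inv ?V (d \<alpha>) (d \<gamma>) * of_bool (compat (ups (d \<gamma>)) (d \<beta>)))"
      by (intro sum.cong refl) (simp add: K0_def ab inc)
    also have "\<dots> = of_bool (d \<alpha> = d \<beta>)"
      using sum[of "\<lambda>c. web_inv ?V (d \<alpha>) c * of_bool (compat (ups c) (d \<beta>))"] web_inv(1)[of ?V] dPP ab by simp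
    finally show "(\<Sum>\<gamma>\<in>?PP. K0 \<alpha> \<gamma> * incidence n \<gamma> \<beta>) = (if \<alpha> = \<beta> then 1 else 0)"
      using deq[OF ab] by simp
    have "(\<Sum>\<gamma>\<in>?PP. incidence n \<alpha> \<gamma> * K0 \<gamma> \<beta>) =
      (\<Sum>\<gamma>\<in>?PP. of_bool (compat (ups (d \<alpha>)) (d \<gamma>)) * web_inv ?V (d \<gamma>) (d \<beta>))"
      by (intro sum.cong refl) (simp add: K0_def ab inc)
    also have "\<dots> = of_bool (d \<alpha> = d \<beta>)"
      using sum[of "\<lambda>c. of_bool (compat (ups (d \<alpha>)) c) * web_inv ?V c (d \<beta>)"] web_inv(2)[of ?V] dPP ab by simp
    finally show "(\<Sum>\<gamma>\<in>?PP. incidence n \<alpha> \<gamma> * K0 \<gamma> \<beta>) = (if \<alpha> = \<beta> then 1 else 0)"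
      using deq[OF ab] by simp
  qed
  have "incidence_inv n = K0"
    unfolding incidence_inv_def
  proof (rule the_equality)
    show "(\<forall>\<alpha>\<in>?PP. \<forall>\<beta>\<in>?PP. (\<Sum>\<gamma>\<in>?PP. K0 \<alpha> \<gamma> * incidence n \<gamma> \<beta>) = (if \<alpha> = \<beta> then 1 else 0) \<and>
        (\<Sum>\<gamma>\<in>?PP. incidence n \<alpha> \<gamma> * K0 \<gamma> \<beta>) = (if \<alpha> = \<beta> then 1 else 0)) \<and>
      (\<forall>\<alpha> \<beta>. \<alpha> \<notin> ?PP \<or> \<beta> \<notin> ?PP \<longrightarrow> K0 \<alpha> \<beta> = 0)"
      using K0 by (auto simp: K0_def)
  next
    fix K
    assume K: "(\<forall>\<alpha>\<in>?PP. \<forall>\<beta>\<in>?PP. (\<Sum>\<gamma>\<in>?PP. K \<alpha> \<gamma> * incidence n \<gamma> \<beta>) = (if \<alpha> = \<beta> then 1 else 0) \<and>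
        (\<Sum>\<gamma>\<in>?PP. incidence n \<alpha> \<gamma> * K \<gamma> \<beta>) = (if \<alpha> = \<beta> then 1 else 0)) \<and>
      (\<forall>\<alpha> \<beta>. \<alpha> \<notin> ?PP \<or> \<beta> \<notin> ?PP \<longrightarrow> K \<alpha> \<beta> = 0)"
    show "K = K0"
    proof (intro ext)
      fix \<alpha> \<beta>
      show "K \<alpha> \<beta> = K0 \<alpha> \<beta>"
      proof (cases "\<alpha> \<in> ?PP \<and> \<beta> \<in> ?PP")
        case True
        have "K \<alpha> \<beta> = (\<Sum>\<gamma>\<in>?PP. K \<alpha> \<gamma> * (if \<gamma> = \<beta> then 1 else 0))"
          using fin True by (simp add: if_distrib[of "\<lambda>x. _ * x"] sum.delta cong: if_cong)
        also have "\<dots> = (\<Sum>\<gamma>\<in>?PP. K \<alpha> \<gamma> * (\<Sum>\<delta>\<in>?PP. incidence n \<gamma> \<delta> * K0 \<delta> \<beta>))"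
          by (intro sum.cong refl) (simp add: K0 True)
        also have "\<dots> = (\<Sum>\<delta>\<in>?PP. (\<Sum>\<gamma>\<in>?PP. K \<alpha> \<gamma> * incidence n \<gamma> \<delta>) * K0 \<delta> \<beta>)"
          unfolding sum_distrib_left sum_distrib_right by (subst sum.swap) (simp add: mult.assoc)
        also have "\<dots> = (\<Sum>\<delta>\<in>?PP. (if \<alpha> = \<delta> then 1 else 0) * K0 \<delta> \<beta>)"
          by (intro sum.cong refl) (use K True in simp)
        also have "\<dots> = K0 \<alpha> \<beta>"
          using fin True by (simp add: if_distrib[of "\<lambda>x. x * _"] sum.delta' cong: if_cong)
        finally show ?thesis .
      qed (use K in \<open>auto simp: K0_def\<close>)
    qed
  qed
  then show ?thesis using pattern_in_pair_partitions a b d by (simp add: K0_def)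
qed

lemma up_steps_pattern: "p \<in> webs X \<Longrightarrow> finite X \<Longrightarrow> up_steps (pattern p) = ups p"
  using links_Min_Max(1)[of p X] finite_links[of p X] links_ups[of p X]
  by (simp add: up_steps_def pattern_def image_image cong: image_cong)

lemma down_steps_pattern:
  assumes p: "p \<in> webs X" and X: "finite X"
  shows "down_steps (pattern p) = X - ups p"
proof -
  have "down_steps (pattern p) = p ` ups p"
    using links_Min_Max(2)[OF p] finite_links[OF p X] links_ups[OF p]
    by (simp add: down_steps_def pattern_def image_image cong: image_cong)
  also have "\<dots> = X - ups p"
  proof (intro equalityI subsetI)
    fix y assume "y \<in> p ` ups p"
    then obtain x where x: "x < p x" "y = p x" by (auto simp: ups_def)
    then show "y \<in> X - ups p"
      using webs_invol[OF p, of x] webs_in[OF p, of x] webs_mem[OF p, of x] by (auto simp: ups_def)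
  next
    fix y assume "y \<in> X - ups p"
    then have "p y < y" using down_iff[OF p] by auto
    then have "p y \<in> ups p" "y = p (p y)" using webs_invol[OF p, of y] by (auto simp: ups_def)
    then show "y \<in> p ` ups p" by blast
  qed
  finally show ?thesis .
qed

lemma vdm_pairs:
  assumes "S \<subseteq> {0<..m}"
  shows "vdm x S = (\<Prod>(i, k)\<in>pairs m. if i \<in> S \<and> k \<in> S then x k - x i else 1)"
proof -
  have fS: "finite S" using finite_subset[OF assms] by simp
  have "vdm x S = (\<Prod>(k, i)\<in>Sigma S (\<lambda>k. {i\<in>S. i < k}). x k - x i)"
    unfolding vdm_def by (rule prod.Sigma) (use fS in auto)
  also have "\<dots> = (\<Prod>(i, k)\<in>{e\<in>pairs m. fst e \<in> S \<and> snd e \<in> S}. x k - x i)"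
    by (rule prod.reindex_bij_witness[where i = "\<lambda>(i, k). (k, i)" and j = "\<lambda>(k, i). (i, k)"])
      (use assms in \<open>auto simp: pairs_def\<close>)
  also have "\<dots> = (\<Prod>e\<in>pairs m. if fst e \<in> S \<and> snd e \<in> S then (case e of (i, k) \<Rightarrow> x k - x i) else 1)"
    by (rule prod.inter_filter[OF finite_pairs])
  also have "\<dots> = (\<Prod>(i, k)\<in>pairs m. if i \<in> S \<and> k \<in> S then x k - x i else 1)"
    by (rule prod.cong) auto
  finally show ?thesis .
qed

text \<open>Each exponent is \<open>-1/2\<close>, plus 1 if both points are left endpoints or both
  are right endpoints. The additional factors form the two Vandermonde products.\<close>

lemma U_conformal_pattern:
  assumes p: "p \<in> webs {0<..2 * n}" and x: "\<And>i j. 0 < i \<Longrightarrow> i < j \<Longrightarrow> j \<le> 2 * n \<Longrightarrow> x i < x j"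
  shows "U_conformal n (pattern p) x =
    (\<Prod>(i, k)\<in>pairs (2 * n). (x k - x i) powr (-1/2)) * (vdm x (ups p) * vdm x ({0<..2 * n} - ups p))"
proof -
  let ?V = "{0<..2 * n}"
  have U: "ups p \<subseteq> ?V" by (rule ups_subset[OF p])
  have "{(i, j). 1 \<le> i \<and> i < j \<and> j \<le> 2 * n} = pairs (2 * n)" by (auto simp: pairs_def)
  then have "U_conformal n (pattern p) x =
      (\<Prod>(i, k)\<in>pairs (2 * n). (x k - x i) powr (1/2 * vartheta (pattern p) i k))"
    by (simp add: U_conformal_def)
  also have "\<dots> = (\<Prod>(i, k)\<in>pairs (2 * n). (x k - x i) powr (-1/2) *
      ((if i \<in> ups p \<and> k \<in> ups p then x k - x i else 1) *
       (if i \<in> ?V - ups p \<and> k \<in> ?V - ups p then x k - x i else 1)))"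
  proof (rule prod.cong[OF refl], clarify)
    fix i k assume "(i, k) \<in> pairs (2 * n)"
    then have ik: "i \<in> ?V" "k \<in> ?V" "x i < x k" using x by (auto simp: pairs_def)
    have t: "vartheta (pattern p) i k = (if (i \<in> ups p) = (k \<in> ups p) then 1 else -1)"
      unfolding vartheta_def using ik p by (auto simp: up_steps_pattern down_steps_pattern)
    have "(x k - x i) powr (1/2) = (x k - x i) powr (-1/2) * (x k - x i) powr 1"
      unfolding powr_add[symmetric] by simp
    then show "(x k - x i) powr (1/2 * vartheta (pattern p) i k) = (x k - x i) powr (-1/2) *
      ((if i \<in> ups p \<and> k \<in> ups p then x k - x i else 1) *
       (if i \<in> ?V - ups p \<and> k \<in> ?V - ups p then x k - x i else 1))"
      using ik t by auto
  qed
  also have "\<dots> = (\<Prod>(i, k)\<in>pairs (2 * n). (x k - x i) powr (-1/2)) * (vdm x (ups p) * vdm x (?V - ups p))"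
    unfolding vdm_pairs[OF U] vdm_pairs[OF Diff_subset] case_prod_unfold prod.distrib ..
  finally show ?thesis .
qed

theorem Z_pure_pattern:
  assumes p: "p \<in> webs {0<..2 * n}" and x: "\<And>i j. 0 < i \<Longrightarrow> i < j \<Longrightarrow> j \<le> 2 * n \<Longrightarrow> x i < x j"
  shows "Z_pure n (pattern p) x =
    (\<Prod>(i, k)\<in>pairs (2 * n). (x k - x i) powr (-1/2)) * web_coeff (vdm x) {} p"
proof -
  let ?V = "{0<..2 * n}"
  have "Z_pure n (pattern p) x = (\<Sum>b\<in>webs ?V. incidence_inv n (pattern p) (pattern b) * U_conformal n (pattern b) x)"
    unfolding Z_pure_def by (rule sum.reindex_bij_betw[OF bij_betw_pattern, symmetric])
  also have "\<dots> = (\<Sum>b\<in>webs ?V. web_inv ?V p b * ((\<Prod>(i, k)\<in>pairs (2 * n). (x k - x i) powr (-1/2)) *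
      (vdm x (ups b) * vdm x (?V - ups b))))"
    by (intro sum.cong refl) (simp only: incidence_inv_pattern[OF p] U_conformal_pattern[OF _ x])
  also have "\<dots> = (\<Prod>(i, k)\<in>pairs (2 * n). (x k - x i) powr (-1/2)) * web_coeff (vdm x) {} p"
    unfolding web_coeff_def webs_support[OF p] sum_distrib_left
    by (intro sum.cong refl) simp
  finally show ?thesis .
qed

section \<open>The fused partition functions\<close>

lemma Z_fused_eq:
  assumes N: "1 \<le> N" and p: "p \<in> webs {0<..2 * (2 * N)}" and u: "unlinked p"
    and L: "split_pattern (replicate (2 * N) 2) L = pattern p" and y: "y \<in> chamber (2 * N)"
  shows "(fusion_quotient N L \<longlongrightarrow> fused_g (2 * N) p (diag y)) (fusion_filter N y)"
    and "Z_fused N L y = fused_g (2 * N) p (diag y)"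
proof -
  let ?M = "2 * N" and ?F = "fusion_filter N y"
  let ?V = "{0<..2 * ?M}"
  have y': "strict_mono_on {1..?M} y" using y by (simp add: chamber_def)
  have coord: "((\<lambda>x. x i) \<longlongrightarrow> diag y i) ?F" if "i \<in> ?V" for i
  proof -
    define j where "j = Suc i div 2"
    have j: "j \<in> {1..?M}" "i = 2 * j - 1 \<or> i = 2 * j" "diag y i = y j" using that by (auto simp: j_def diag_def)
    have "?F \<le> inf (filtercomap (\<lambda>x. x (2 * j - 1)) (nhds (y j))) (filtercomap (\<lambda>x. x (2 * j)) (nhds (y j)))"
      unfolding fusion_filter_def by (rule le_infI1, rule INF_lower[OF j(1)])
    then have "?F \<le> filtercomap (\<lambda>x. x (2 * j - 1)) (nhds (y j))" "?F \<le> filtercomap (\<lambda>x. x (2 * j)) (nhds (y j))"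
      by simp_all
    then show ?thesis using j by (auto simp: filterlim_iff_le_filtercomap)
  qed
  have ch: "\<forall>\<^sub>F x in ?F. x \<in> chamber (4 * N)"
    by (rule filter_leD[of _ "principal (chamber (4 * N))"]) (simp_all add: fusion_filter_def eventually_principal)
  have quot: "fusion_quotient N L x = fused_g ?M p x" if "x \<in> chamber (4 * N)" for x
  proof -
    have x: "x i < x j" if "0 < i" "i < j" "j \<le> 2 * ?M" for i j
      using \<open>x \<in> chamber (4 * N)\<close> that unfolding chamber_def by (auto intro!: strict_mono_onD[of "{1..4 * N}" x])
    have pos: "(\<Prod>j\<in>{1..?M}. (x (2 * j) - x (2 * j - 1)) powr (1/2)) > 0"
    proof (rule prod_pos)
      fix j assume "j \<in> {1..?M}"
      then have "x (2 * j - 1) < x (2 * j)" by (intro x) auto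
      then show "0 < (x (2 * j) - x (2 * j - 1)) powr (1/2)" by simp
    qed
    have "Z_pure ?M (pattern p) x = fused_g ?M p x * (\<Prod>j\<in>{1..?M}. (x (2 * j) - x (2 * j - 1)) powr (1/2))"
    proof -
      have "Z_pure ?M (pattern p) x =
          (\<Prod>(i, k)\<in>pairs (2 * ?M). (x k - x i) powr (-1/2)) * web_coeff (vdm x) {} p"
        by (rule Z_pure_pattern[OF p]) (rule x)
      also have "\<dots> = fused_g ?M p x * (\<Prod>j\<in>{1..?M}. (x (2 * j) - x (2 * j - 1)) powr (1/2))"
        by (rule fused_g_off_diag[OF _ _ p u, symmetric]) (rule x, assumption+, use N in simp)
      finally show ?thesis .
    qed
    then show ?thesis using less_imp_neq[OF pos] unfolding fusion_quotient_def L
      by (simp only: nonzero_mult_div_cancel_right not_sym not_False_eq_True)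
  qed
  have "((\<lambda>x. fused_g ?M p x) \<longlongrightarrow> fused_g ?M p (diag y)) ?F"
    by (rule smooth_tendsto[OF smooth_fused_g[OF p] finite_cross cross_subset diag_config[OF y'] coord])
  moreover have "\<forall>\<^sub>F x in ?F. fused_g ?M p x = fusion_quotient N L x"
    using ch by (rule eventually_mono) (simp add: quot)
  ultimately show lim: "(fusion_quotient N L \<longlongrightarrow> fused_g ?M p (diag y)) ?F"
    by (rule Lim_transform_eventually)
  \<comment> \<open>\<open>Lim\<close> is determined by convergence only on a proper filter. The
    curve \<open>X\<close> tends to the diagonal inside the chamber, so the fusion filter is
    proper.\<close>
  define X where "X s i = diag y i + (if even i then s else 0)" for s i
  have X: "((\<lambda>s. X s i) \<longlongrightarrow> diag y i) (at_right 0)" for i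
    by (cases "even i") (auto simp: X_def intro!: tendsto_eq_intros)
  have "filterlim X ?F (at_right 0)"
    unfolding fusion_filter_def filterlim_inf filterlim_INF filterlim_filtercomap_iff filterlim_principal
  proof (intro conjI ballI)
    fix j assume j: "j \<in> {1..?M}"
    then have "diag y (2 * j - 1) = y j" "diag y (2 * j) = y j" by (auto simp: diag_def)
    then show "filterlim ((\<lambda>x. x (2 * j - 1)) \<circ> X) (nhds (y j)) (at_right 0)"
      "filterlim ((\<lambda>x. x (2 * j)) \<circ> X) (nhds (y j)) (at_right 0)"
      using X[of "2 * j - 1"] X[of "2 * j"] by (simp_all add: comp_def)
  next
    have "\<forall>\<^sub>F s in at_right 0. X s \<in> config (cross ?M)"
      by (rule eventually_config[OF finite_cross cross_subset diag_config[OF y'] X])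
    moreover have "\<forall>\<^sub>F s in at_right 0. (0::real) < s" by (rule eventually_at_right_less)
    ultimately show "\<forall>\<^sub>F s in at_right 0. X s \<in> chamber (4 * N)"
    proof eventually_elim
      case (elim s)
      show ?case unfolding chamber_def mem_Collect_eq
      proof (rule strict_mono_onI)
        fix i j assume ij: "i \<in> {1..4 * N}" "j \<in> {1..4 * N}" "i < j"
        show "X s i < X s j"
        proof (cases "Suc i div 2 < Suc j div 2")
          case True
          then show ?thesis using elim(1) ij by (auto simp: config_def cross_def)
        next
          case False
          then have "odd i" "j = Suc i" using ij by presburger+
          then show ?thesis using elim(2) by (simp add: X_def diag_def)
        qed
      qed
    qed
  qed
  then have "filtermap X (at_right 0) \<le> ?F" by (simp add: filterlim_def)
  moreover have "filtermap X (at_right (0::real)) \<noteq> bot"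
    by (simp add: filtermap_bot_iff trivial_limit_at_right_real)
  ultimately have "?F \<noteq> bot" by (metis bot.extremum_uniqueI)
  then show "Z_fused N L y = fused_g ?M p (diag y)"
    unfolding Z_fused_def using lim by (rule tendsto_Lim)
qed

section \<open>Identification of variables, and products of powers of differences\<close>

lemma smooth_substitute:
  assumes f: "smooth I E f" and r: "\<And>i. i \<in> I \<Longrightarrow> r i \<in> I'" and E: "\<And>i k. (i, k) \<in> E \<Longrightarrow> (r i, r k) \<in> E'"
  shows "smooth I' E' (\<lambda>x. f (\<lambda>i. x (r i)))"
  using f
proof induction
  case (smooth_cong f g)
  have "(\<lambda>i. x (r i)) \<in> config E" if "x \<in> config E'" for x
    using that E by (force simp: config_def)
  then show ?case using smooth.smooth_cong[OF smooth_cong.IH] smooth_cong.hyps(2) by simp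
qed (auto intro: smooth_intros r E)

text \<open>The chain rule: a change of \<open>x l\<close> moves all coordinates \<open>i\<close>
  with \<open>r i = l\<close> at once.\<close>

lemma pderiv_substitute:
  assumes c: "smooth_config I E" and f: "smooth I E f"
    and rE: "\<And>i k. (i, k) \<in> E \<Longrightarrow> (r i, r k) \<in> E'" and x: "x \<in> config E'"
  shows "pderiv_at l (\<lambda>x. f (\<lambda>i. x (r i))) x = (\<Sum>i\<in>{i\<in>I. r i = l}. pderiv_at i f (\<lambda>i. x (r i)))"
proof -
  interpret smooth_config I E by (rule c)
  define \<gamma> where "\<gamma> t i = (x(l := t)) (r i)" for t i
  have \<gamma>0: "\<gamma> (x l) = (\<lambda>i. x (r i))" by (auto simp: \<gamma>_def)
  have "(\<lambda>i. x (r i)) \<in> config E" using x rE by (force simp: config_def)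
  then have "((\<lambda>t. f (\<gamma> t)) has_real_derivative (\<Sum>i\<in>I. pderiv_at i f (\<gamma> (x l)) * of_bool (r i = l))) (at (x l))"
    by (intro smooth_curve[OF f]) (auto simp: \<gamma>0 \<gamma>_def intro!: derivative_eq_intros)
  then have "deriv (\<lambda>t. f (\<gamma> t)) (x l) = (\<Sum>i\<in>I. pderiv_at i f (\<lambda>i. x (r i)) * of_bool (r i = l))"
    unfolding \<gamma>0 by (rule DERIV_imp_deriv)
  also have "\<dots> = (\<Sum>i\<in>{i\<in>I. r i = l}. pderiv_at i f (\<lambda>i. x (r i)))"
    by (subst sum.inter_filter[OF I]) (rule sum.cong[OF refl], simp)
  finally show ?thesis unfolding pderiv_at_def[of l] \<gamma>_def .
qed

definition prodpow :: "(nat \<times> nat) set \<Rightarrow> (nat \<Rightarrow> nat \<Rightarrow> real) \<Rightarrow> (nat \<Rightarrow> real) \<Rightarrow> real" where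
  "prodpow A e x = (\<Prod>(i, k)\<in>A. (x k - x i) powr e i k)"

lemma smooth_prodpow:
  assumes "finite A" "A \<subseteq> E" shows "smooth I E (prodpow A e)"
  unfolding prodpow_def[abs_def] case_prod_unfold
  by (intro smooth_prod smooth_powr assms) (use assms in auto)

lemma pderiv_prodpow:
  assumes A: "finite A" and x: "x \<in> config A"
  shows "pderiv_at l (prodpow A e) x =
    prodpow A e x * (\<Sum>(i, k)\<in>A. e i k * (of_bool (k = l) - of_bool (i = l)) / (x k - x i))"
proof -
  have "((\<lambda>t. \<Prod>c\<in>B. ((x(l := t)) (snd c) - (x(l := t)) (fst c)) powr e (fst c) (snd c)) has_real_derivative
     prodpow B e x * (\<Sum>(i, k)\<in>B. e i k * (of_bool (k = l) - of_bool (i = l)) / (x k - x i))) (at (x l))"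
    if "B \<subseteq> A" for B
    using finite_subset[OF that A] that
  proof (induction B rule: finite_induct)
    case empty
    then show ?case by (simp add: prodpow_def)
  next
    case (insert c B)
    obtain i k where c: "c = (i, k)" by (cases c)
    have pos: "x k - x i > 0" using insert.prems x by (auto simp: config_def c)
    have d: "((\<lambda>t. (x(l := t)) k - (x(l := t)) i) has_real_derivative (of_bool (k = l) - of_bool (i = l))) (at (x l))"
      by (auto intro!: derivative_eq_intros)
    have pos': "0 < (x(l := x l)) k - (x(l := x l)) i" using pos by simp
    from DERIV_chain2[OF has_real_derivative_powr[OF pos', of "e i k"] d]
    have 1: "((\<lambda>t. ((x(l := t)) k - (x(l := t)) i) powr e i k) has_real_derivative
      e i k * (x k - x i) powr (e i k - 1) * (of_bool (k = l) - of_bool (i = l))) (at (x l))" by simp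
    have pw: "(x k - x i) powr (e i k - 1) = (x k - x i) powr e i k / (x k - x i)"
      using pos by (simp add: powr_diff)
    have IH: "((\<lambda>t. \<Prod>c\<in>B. ((x(l := t)) (snd c) - (x(l := t)) (fst c)) powr e (fst c) (snd c)) has_real_derivative
     prodpow B e x * (\<Sum>(i, k)\<in>B. e i k * (of_bool (k = l) - of_bool (i = l)) / (x k - x i))) (at (x l))"
      using insert by simp
    have B: "(\<Prod>c\<in>B. ((x(l := x l)) (snd c) - (x(l := x l)) (fst c)) powr e (fst c) (snd c)) = prodpow B e x"
      by (simp add: prodpow_def case_prod_unfold)
    have ins: "prodpow (insert c B) e x = (x k - x i) powr e i k * prodpow B e x"
      "(\<Sum>(i, k)\<in>insert c B. e i k * (of_bool (k = l) - of_bool (i = l)) / (x k - x i)) =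
        e i k * (of_bool (k = l) - of_bool (i = l)) / (x k - x i) +
        (\<Sum>(i, k)\<in>B. e i k * (of_bool (k = l) - of_bool (i = l)) / (x k - x i))"
      using insert by (simp_all add: prodpow_def c)
    have fn: "(\<lambda>t. \<Prod>c\<in>insert c B. ((x(l := t)) (snd c) - (x(l := t)) (fst c)) powr e (fst c) (snd c)) =
       (\<lambda>t. ((x(l := t)) k - (x(l := t)) i) powr e i k *
         (\<Prod>c\<in>B. ((x(l := t)) (snd c) - (x(l := t)) (fst c)) powr e (fst c) (snd c)))"
      using insert by (simp only: prod.insert c fst_conv snd_conv not_False_eq_True)
    show ?case
      unfolding fn ins using DERIV_mult[OF 1 IH] unfolding B pw
      by (simp add: algebra_simps)
  qed
  from DERIV_imp_deriv[OF this[OF subset_refl]]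
  show ?thesis unfolding pderiv_at_def[of l "prodpow A e"] prodpow_def[of A e "x(l := _)"] case_prod_unfold by simp
qed

section \<open>The third order equation for vertex operator correlators\<close>

text \<open>A relational form on all of \<open>config E\<close>, which lets iterated derivatives be
  composed from closed formulas.\<close>

definition has_pd ::
  "(nat \<times> nat) set \<Rightarrow> nat \<Rightarrow> ((nat \<Rightarrow> real) \<Rightarrow> real) \<Rightarrow> ((nat \<Rightarrow> real) \<Rightarrow> real) \<Rightarrow> bool" where
  "has_pd E l f f' \<longleftrightarrow>
    (\<forall>x\<in>config E. ((\<lambda>t. f (x(l := t))) has_real_derivative f' x) (at (x l)))"

lemma has_pdD: "has_pd E l f f' \<Longrightarrow> x \<in> config E \<Longrightarrow> pderiv_at l f x = f' x"
  unfolding has_pd_def pderiv_at_def by (blast intro: DERIV_imp_deriv)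

lemma has_pd_mult:
  assumes "has_pd E l f f'" "has_pd E l g g'"
  shows "has_pd E l (\<lambda>x. f x * g x) (\<lambda>x. f' x * g x + g' x * f x)"
  unfolding has_pd_def
proof
  fix x assume x: "x \<in> config E"
  show "((\<lambda>t. f (x(l := t)) * g (x(l := t))) has_real_derivative f' x * g x + g' x * f x) (at (x l))"
    using DERIV_mult[of "\<lambda>t. f (x(l := t))" "f' x" "x l" UNIV "\<lambda>t. g (x(l := t))" "g' x"] assms x
    by (simp add: has_pd_def)
qed

lemma has_pd_add:
  assumes "has_pd E l f f'" "has_pd E l g g'"
  shows "has_pd E l (\<lambda>x. f x + g x) (\<lambda>x. f' x + g' x)"
  using assms unfolding has_pd_def by (auto intro: DERIV_add)

lemma has_pd_cmult:
  assumes "has_pd E l f f'"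
  shows "has_pd E l (\<lambda>x. c * f x) (\<lambda>x. c * f' x)"
  using assms unfolding has_pd_def by (auto intro: DERIV_cmult)

lemma has_pd_sum:
  assumes "\<And>a. a \<in> A \<Longrightarrow> has_pd E l (f a) (f' a)"
  shows "has_pd E l (\<lambda>x. \<Sum>a\<in>A. f a x) (\<lambda>x. \<Sum>a\<in>A. f' a x)"
  using assms unfolding has_pd_def by (auto intro!: DERIV_sum)

lemma has_pd_power:
  assumes "has_pd E l f f'"
  shows "has_pd E l (\<lambda>x. f x ^ m) (\<lambda>x. real m * f x ^ (m - 1) * f' x)"
  unfolding has_pd_def
proof
  fix x assume x: "x \<in> config E"
  show "((\<lambda>t. f (x(l := t)) ^ m) has_real_derivative real m * f x ^ (m - 1) * f' x) (at (x l))"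
    using DERIV_power[of "\<lambda>t. f (x(l := t))" "f' x" "x l" UNIV m] assms x
    by (simp add: has_pd_def mult_ac)
qed

lemma has_pd_eq:
  assumes "has_pd E l f f'" "\<And>x. x \<in> config E \<Longrightarrow> f' x = g' x" shows "has_pd E l f g'"
  using assms unfolding has_pd_def by simp

lemma has_pd_cong:
  assumes c: "smooth_config I E" and f: "has_pd E l f f'" and eq: "\<And>x. x \<in> config E \<Longrightarrow> f x = g x"
  shows "has_pd E l g f'"
  unfolding has_pd_def
proof
  interpret smooth_config I E by (rule c)
  fix x assume x: "x \<in> config E"
  have "\<forall>\<^sub>F t in nhds (x l). f (x(l := t)) = g (x(l := t))"
    using eventually_mono[OF smooth_update_config[OF x]] eq by auto
  moreover have "((\<lambda>t. f (x(l := t))) has_real_derivative f' x) (at (x l))" using f x by (simp add: has_pd_def)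
  ultimately show "((\<lambda>t. g (x(l := t))) has_real_derivative f' x) (at (x l))"
    by (simp only: DERIV_cong_ev[OF refl _ refl])
qed

definition star :: "nat \<Rightarrow> nat set \<Rightarrow> (nat \<times> nat) set" where
  "star l B = (\<lambda>m. if m < l then (m, l) else (l, m)) ` B"

definition pairs_on :: "nat set \<Rightarrow> (nat \<times> nat) set" where
  "pairs_on J = {(i, k). i \<in> J \<and> k \<in> J \<and> i < k}"

lemma pairs_on_insert: "l \<notin> J \<Longrightarrow> pairs_on (insert l J) = pairs_on J \<union> star l J"
  by (auto simp: pairs_on_def star_def image_iff split: if_splits) (metis linorder_neqE_nat)+

lemma finite_pairs_on: "finite J \<Longrightarrow> finite (pairs_on J)"
  by (rule finite_subset[of _ "J \<times> J"]) (auto simp: pairs_on_def)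

lemma pairs_on_subset: "pairs_on J \<subseteq> J \<times> J"
  by (auto simp: pairs_on_def)

lemma pairs_on_full: "pairs_on {0<..m} = pairs m"
  by (auto simp: pairs_on_def pairs_def)

lemma inj_on_star: "l \<notin> B \<Longrightarrow> inj_on (\<lambda>m. if m < l then (m, l) else (l, m)) B"
  by (auto simp: inj_on_def split: if_splits)

lemma prodpow_star_union:
  assumes J: "finite A" "finite B" and l: "l \<notin> B" "A \<inter> star l B = {}" and e: "\<And>m. m \<in> B \<Longrightarrow> e m l = e l m"
  shows "prodpow (A \<union> star l B) e x =
    prodpow A e x * (\<Prod>m\<in>B. (if m < l then x l - x m else x m - x l) powr e l m)"
proof -
  have "finite (star l B)" using J by (simp add: star_def)
  then have "prodpow (A \<union> star l B) e x = prodpow A e x * prodpow (star l B) e x"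
    unfolding prodpow_def using J l(2) by (intro prod.union_disjoint)
  also have "prodpow (star l B) e x = (\<Prod>m\<in>B. (if m < l then x l - x m else x m - x l) powr e l m)"
    unfolding prodpow_def star_def prod.reindex[OF inj_on_star[OF l(1)]]
    by (rule prod.cong) (auto simp: e)
  finally show ?thesis .
qed

text \<open>The logarithmic derivative of \<open>prodpow A e\<close> in the variable
  \<open>x l\<close>.\<close>

definition logd :: "(nat \<times> nat) set \<Rightarrow> (nat \<Rightarrow> nat \<Rightarrow> real) \<Rightarrow> nat \<Rightarrow> (nat \<Rightarrow> real) \<Rightarrow> real" where
  "logd A e l x = (\<Sum>(i, k)\<in>A. e i k * (of_bool (k = l) - of_bool (i = l)) / (x k - x i))"

lemma logd_absent: "A \<subseteq> J \<times> J \<Longrightarrow> l \<notin> J \<Longrightarrow> logd A e l x = 0"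
  unfolding logd_def by (rule sum.neutral) auto

lemma logd_star_union:
  assumes J: "finite A" "finite B" and l: "l \<notin> B" "A \<inter> star l B = {}" and e: "\<And>m. m \<in> B \<Longrightarrow> e m l = e l m"
  shows "logd (A \<union> star l B) e l x = logd A e l x + (\<Sum>m\<in>B. e l m / (x l - x m))"
proof -
  have "finite (star l B)" using J by (simp add: star_def)
  then have "logd (A \<union> star l B) e l x = logd A e l x + logd (star l B) e l x"
    unfolding logd_def using J l(2) by (intro sum.union_disjoint)
  also have "logd (star l B) e l x = (\<Sum>m\<in>B. e l m / (x l - x m))"
    unfolding logd_def star_def sum.reindex[OF inj_on_star[OF l(1)]]
  proof (rule sum.cong[OF refl])
    fix m assume m: "m \<in> B"
    then have "m \<noteq> l" using l by auto
    have "- e l m / (x m - x l) = e l m / (x l - x m)" by (metis minus_diff_eq minus_divide_divide minus_minus)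
    then show "((\<lambda>(i, k). e i k * (of_bool (k = l) - of_bool (i = l)) / (x k - x i)) \<circ>
        (\<lambda>m. if m < l then (m, l) else (l, m))) m = e l m / (x l - x m)"
      using e[OF m] \<open>m \<noteq> l\<close> by auto
  qed
  finally show ?thesis .
qed

lemma logd_pairs_on:
  assumes J: "finite J" "l \<in> J" and e: "\<And>m. m \<in> J \<Longrightarrow> e m l = e l m"
  shows "logd (pairs_on J) e l x = (\<Sum>m\<in>J - {l}. e l m / (x l - x m))"
proof -
  have "pairs_on J = pairs_on (J - {l}) \<union> star l (J - {l})"
    using pairs_on_insert[of l "J - {l}"] J(2) by (simp add: insert_absorb)
  moreover have "pairs_on (J - {l}) \<inter> star l (J - {l}) = {}" by (auto simp: pairs_on_def star_def)
  ultimately have "logd (pairs_on J) e l x = logd (pairs_on (J - {l})) e l x + (\<Sum>m\<in>J - {l}. e l m / (x l - x m))"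
    using logd_star_union[where A = "pairs_on (J - {l})" and B = "J - {l}" and l = l and e = e and x = x] J e by (simp add: finite_pairs_on)
  moreover have "logd (pairs_on (J - {l})) e l x = 0" by (rule logd_absent[OF pairs_on_subset]) simp
  ultimately show ?thesis by simp
qed

lemma has_pd_prodpow:
  assumes "finite A" "A \<subseteq> E" "finite E" "E \<subseteq> I \<times> I" "finite I"
  shows "has_pd E l (prodpow A e) (\<lambda>x. prodpow A e x * logd A e l x)"
  unfolding has_pd_def
proof
  interpret smooth_config I E by standard (use assms in auto)
  fix x assume x: "x \<in> config E"
  then have "x \<in> config A" using assms(2) by (auto simp: config_def)
  then show "((\<lambda>t. prodpow A e (x(l := t))) has_real_derivative prodpow A e x * logd A e l x) (at (x l))"
    using smooth_has_pderiv[OF smooth_prodpow[OF assms(1,2), of I e] x, of l] pderiv_prodpow[OF assms(1), where x = x and l = l and e = e]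
    by (simp add: logd_def)
qed

text \<open>The exponent of a conformal block between points with signs \<open>s i\<close> and
  \<open>s k\<close>, with the square root of the gap of each unmerged pair divided out. Within a
  pair it is therefore 0 for equal signs and -1 for opposite ones.\<close>

definition charge_exp :: "(nat \<Rightarrow> nat) \<Rightarrow> (nat \<Rightarrow> real) \<Rightarrow> nat \<Rightarrow> nat \<Rightarrow> real" where
  "charge_exp tau s i k = s i * s k / 2 - of_bool (k = tau i) / 2"

text \<open>The generic point \<open>x c\<close> carries a fused operator, the points \<open>x i\<close>, \<open>i \<in> J\<close>, carry unfused
  operators of charge \<open>s i / 2\<close>; \<open>tau\<close> exchanges the two points of a pair that is still to be
  merged.\<close>

locale vertex =
  fixes J :: "nat set" and c :: nat and tau :: "nat \<Rightarrow> nat"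
  assumes J: "finite J" and c: "c \<notin> J"
    and tau: "\<And>i. i \<in> J \<Longrightarrow> tau i \<in> J" "\<And>i. i \<in> J \<Longrightarrow> tau i \<noteq> i" "\<And>i. i \<in> J \<Longrightarrow> tau (tau i) = i"
begin

abbreviation "E \<equiv> pairs_on (insert c J)"

definition a :: "nat \<Rightarrow> (nat \<Rightarrow> real) \<Rightarrow> real" where
  "a i x = 1 / (x i - x c)"

text \<open>\<open>W2\<close> and \<open>W3\<close> are the weight terms of the operators of orders
  -2 and -3 for points of weight 1/4, conjugated with the square roots of the pair gaps; the
  conjugation produces the mixed terms. In the limit of merged pairs they turn into the terms for
  \<open>H = 1\<close>, see \<open>W_diag\<close>.\<close>

definition W2 :: "(nat \<Rightarrow> real) \<Rightarrow> real" where
  "W2 x = (\<Sum>i\<in>J. (a i x)\<^sup>2 + a i x * a (tau i) x) / 4"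

definition W3 :: "(nat \<Rightarrow> real) \<Rightarrow> real" where
  "W3 x = (\<Sum>i\<in>J. (a i x) ^ 3 + (a i x)\<^sup>2 * a (tau i) x) / 2"

text \<open>Power sums of the \<open>a i\<close>, weighted with the charges. \<open>p s 1\<close> is
  the factor contributed by a current (charge 0) at \<open>x c\<close>, and differentiation in
  \<open>x c\<close> raises \<open>m\<close>.\<close>

definition p :: "(nat \<Rightarrow> real) \<Rightarrow> nat \<Rightarrow> (nat \<Rightarrow> real) \<Rightarrow> real" where
  "p s m x = (\<Sum>i\<in>J. s i / 2 * (a i x) ^ m)"

abbreviation "ex \<equiv> charge_exp tau"

text \<open>The logarithmic derivative in \<open>x i\<close> of the correlator of the points in
  \<open>J\<close> alone.\<close>

definition B :: "(nat \<Rightarrow> real) \<Rightarrow> nat \<Rightarrow> (nat \<Rightarrow> real) \<Rightarrow> real" where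
  "B s i x = (\<Sum>k\<in>J - {i}. ex s i k / (x i - x k))"

lemma config_distinct:
  assumes "x \<in> config E" "i \<in> insert c J" "k \<in> insert c J" "i \<noteq> k"
  shows "x i \<noteq> x k"
proof -
  consider "i < k" | "k < i" using assms(4) by linarith
  then show ?thesis
  proof cases
    case 1 then have "(i, k) \<in> E" using assms by (simp add: pairs_on_def)
    then show ?thesis using assms(1) by (auto simp: config_def)
  next
    case 2 then have "(k, i) \<in> E" using assms by (simp add: pairs_on_def)
    then show ?thesis using assms(1) by (auto simp: config_def)
  qed
qed

lemma a_diff:
  assumes "x \<in> config E" "i \<in> J" "k \<in> J" "i \<noteq> k"
  shows "(a i x - a k x) / (x i - x k) = - (a i x * a k x)"
proof -
  have "x i \<noteq> x k" "x i \<noteq> x c" "x k \<noteq> x c" using config_distinct[OF assms(1)] assms c by auto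
  have aux: "1 / u - 1 / v = (u - v) * - (1 / u * (1 / v))" if "u \<noteq> 0" "v \<noteq> 0" for u v :: real
    using that by (simp add: field_simps)
  have "a i x - a k x = (x i - x k) * - (a i x * a k x)"
    using aux[of "x i - x c" "x k - x c"] \<open>x i \<noteq> x c\<close> \<open>x k \<noteq> x c\<close> unfolding a_def by simp
  then show ?thesis using \<open>x i \<noteq> x k\<close> by (simp only: nonzero_mult_div_cancel_left right_minus_eq not_False_eq_True)
qed

lemma sum_offdiag_swap:
  "(\<Sum>i\<in>J. \<Sum>k\<in>J - {i}. F i k) = (\<Sum>i\<in>J. \<Sum>k\<in>J - {i}. F k i :: real)"
proof -
  have "(\<Sum>i\<in>J. \<Sum>k\<in>J - {i}. F i k) = (\<Sum>i\<in>J. \<Sum>k\<in>J. if k = i then 0 else F i k)" for F :: "nat \<Rightarrow> nat \<Rightarrow> real"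
  proof (rule sum.cong[OF refl])
    fix i assume "i \<in> J"
    have "(\<Sum>k\<in>J - {i}. F i k) = (\<Sum>k\<in>J - {i}. if k = i then 0 else F i k)" by (rule sum.cong) auto
    then show "(\<Sum>k\<in>J - {i}. F i k) = (\<Sum>k\<in>J. if k = i then 0 else F i k)"
      using sum.remove[OF J \<open>i \<in> J\<close>, of "\<lambda>k. if k = i then 0 else F i k"] by simp
  qed
  note * = this
  show ?thesis unfolding *[of F] *[of "\<lambda>i k. F k i"]
    by (subst sum.swap) (intro sum.cong refl, auto)
qed

lemma ex_sym: "i \<in> J \<Longrightarrow> k \<in> J \<Longrightarrow> ex s i k = ex s k i"
  using tau(3) by (auto simp: charge_exp_def)

text \<open>Without the restriction to different indices the charge part would be a product of power
  sums. As the signs square to 1, the diagonal terms do not depend on \<open>s\<close>; together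
  with the partner corrections they form \<open>W2\<close> for \<open>m = 1\<close> and
  \<open>W3\<close> for \<open>m = 2\<close>.\<close>

lemma sum_ex:
  assumes s: "\<And>i. i \<in> J \<Longrightarrow> s i * s i = 1"
  shows "(\<Sum>i\<in>J. \<Sum>k\<in>J - {i}. ex s i k * ((a i x) ^ m * a k x)) =
    2 * (p s m x * p s 1 x) - (\<Sum>i\<in>J. (a i x) ^ Suc m + (a i x) ^ m * a (tau i) x) / 2"
proof -
  have "(\<Sum>k\<in>J - {i}. ex s i k * ((a i x) ^ m * a k x)) =
      s i * (a i x) ^ m * p s 1 x - (a i x) ^ Suc m / 2 - (a i x) ^ m * a (tau i) x / 2" if i: "i \<in> J" for i
  proof -
    have "(\<Sum>k\<in>J - {i}. ex s i k * ((a i x) ^ m * a k x)) =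
      (\<Sum>k\<in>J - {i}. s i * (a i x) ^ m * (s k / 2 * a k x)) - (\<Sum>k\<in>J - {i}. if k = tau i then (a i x) ^ m * a k x / 2 else 0)"
      unfolding sum_subtractf[symmetric] by (intro sum.cong refl) (auto simp: charge_exp_def algebra_simps)
    also have "(\<Sum>k\<in>J - {i}. if k = tau i then (a i x) ^ m * a k x / 2 else 0) = (a i x) ^ m * a (tau i) x / 2"
      using J tau[OF i] by (simp add: sum.delta)
    also have "(\<Sum>k\<in>J - {i}. s i * (a i x) ^ m * (s k / 2 * a k x)) =
        s i * (a i x) ^ m * p s 1 x - s i * (a i x) ^ m * (s i / 2 * a i x)"
    proof -
      define R where "R = (\<Sum>k\<in>J - {i}. s k / 2 * a k x)"
      have "p s 1 x = s i / 2 * a i x + R"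
        using sum.remove[OF J i, of "\<lambda>k. s k / 2 * a k x ^ 1"] by (simp only: p_def R_def power_one_right)
      then have R: "R = p s 1 x - s i / 2 * a i x" by simp
      have "(\<Sum>k\<in>J - {i}. s i * (a i x) ^ m * (s k / 2 * a k x)) = s i * (a i x) ^ m * R"
        by (simp only: R_def sum_distrib_left)
      then show ?thesis unfolding R by (simp only: right_diff_distrib)
    qed
    also have "s i * (a i x) ^ m * (s i / 2 * a i x) = (s i * s i) * ((a i x) ^ Suc m / 2)" by simp
    finally show ?thesis using s[OF i] by simp
  qed
  then have "(\<Sum>i\<in>J. \<Sum>k\<in>J - {i}. ex s i k * ((a i x) ^ m * a k x)) =
    (\<Sum>i\<in>J. s i * (a i x) ^ m * p s 1 x - (a i x) ^ Suc m / 2 - (a i x) ^ m * a (tau i) x / 2)"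
    by (intro sum.cong refl)
  also have "\<dots> = (\<Sum>i\<in>J. 2 * (s i / 2 * (a i x) ^ m) * p s 1 x) - (\<Sum>i\<in>J. (a i x) ^ Suc m + (a i x) ^ m * a (tau i) x) / 2"
    unfolding sum_divide_distrib sum_subtractf[symmetric] by (intro sum.cong refl) (simp add: field_simps)
  also have "(\<Sum>i\<in>J. 2 * (s i / 2 * (a i x) ^ m) * p s 1 x) = 2 * (p s m x * p s 1 x)"
    by (simp add: p_def[of s m] sum_distrib_left sum_distrib_right mult_ac)
  finally show ?thesis .
qed

text \<open>Symmetrising in \<open>i\<close> and \<open>k\<close> turns the singular factor into a
  difference quotient of powers of \<open>a\<close>, which is a polynomial in \<open>a i\<close> and
  \<open>a k\<close> by \<open>a_diff\<close>. All singularities between points of \<open>J\<close>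
  thus disappear, and \<open>sum_ex\<close> evaluates the rest.\<close>

lemma sum_a_B:
  assumes x: "x \<in> config E" and s: "\<And>i. i \<in> J \<Longrightarrow> s i * s i = 1"
  shows "(\<Sum>i\<in>J. a i x * B s i x) = W2 x - (p s 1 x)\<^sup>2"
    and "(\<Sum>i\<in>J. (a i x)\<^sup>2 * B s i x) = W3 x - 2 * p s 1 x * p s 2 x"
proof -
  have gen: "(\<Sum>i\<in>J. (a i x) ^ m * B s i x) =
     (\<Sum>i\<in>J. \<Sum>k\<in>J - {i}. ex s i k * (((a i x) ^ m - (a k x) ^ m) / (x i - x k))) / 2" for m
  proof -
    have 1: "(\<Sum>i\<in>J. (a i x) ^ m * B s i x) = (\<Sum>i\<in>J. \<Sum>k\<in>J - {i}. ex s i k * ((a i x) ^ m / (x i - x k)))"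
      by (simp add: B_def sum_distrib_left mult_ac)
    also have "\<dots> = (\<Sum>i\<in>J. \<Sum>k\<in>J - {i}. ex s k i * ((a k x) ^ m / (x k - x i)))"
      by (rule sum_offdiag_swap)
    also have "\<dots> = (\<Sum>i\<in>J. \<Sum>k\<in>J - {i}. - (ex s i k * ((a k x) ^ m / (x i - x k))))"
    proof (intro sum.cong refl)
      fix i k assume ik: "i \<in> J" "k \<in> J - {i}"
      have "(a k x) ^ m / (x k - x i) = - ((a k x) ^ m / (x i - x k))" by (metis minus_diff_eq minus_divide_right)
      moreover have "ex s k i = ex s i k" using ik by (intro ex_sym) auto
      ultimately show "ex s k i * ((a k x) ^ m / (x k - x i)) = - (ex s i k * ((a k x) ^ m / (x i - x k)))"
        by (simp only: mult_minus_right)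
    qed
    finally have 2: "(\<Sum>i\<in>J. (a i x) ^ m * B s i x) = \<dots>" .
    have "2 * (\<Sum>i\<in>J. (a i x) ^ m * B s i x) =
       (\<Sum>i\<in>J. \<Sum>k\<in>J - {i}. ex s i k * ((a i x) ^ m / (x i - x k))) +
       (\<Sum>i\<in>J. \<Sum>k\<in>J - {i}. - (ex s i k * ((a k x) ^ m / (x i - x k))))"
      using 1 2 by linarith
    also have "\<dots> = (\<Sum>i\<in>J. \<Sum>k\<in>J - {i}. ex s i k * (((a i x) ^ m - (a k x) ^ m) / (x i - x k)))"
      unfolding sum.distrib[symmetric] by (intro sum.cong refl) (simp add: diff_divide_distrib right_diff_distrib)
    finally show ?thesis by simp
  qed
  have se: "(\<Sum>i\<in>J. \<Sum>k\<in>J - {i}. ex s i k * ((a i x) ^ m * a k x)) =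
    2 * (p s m x * p s 1 x) - (\<Sum>i\<in>J. (a i x) ^ Suc m + (a i x) ^ m * a (tau i) x) / 2" for m
    by (rule sum_ex) (rule s)
  have w: "(\<Sum>i\<in>J. (a i x) ^ Suc 1 + (a i x) ^ 1 * a (tau i) x) = 4 * W2 x"
    "(\<Sum>i\<in>J. (a i x) ^ Suc 2 + (a i x) ^ 2 * a (tau i) x) = 2 * W3 x"
    by (simp_all add: W2_def W3_def power2_eq_square power3_eq_cube mult_ac)
  have "(\<Sum>i\<in>J. a i x * B s i x) = (\<Sum>i\<in>J. \<Sum>k\<in>J - {i}. ex s i k * ((a i x - a k x) / (x i - x k))) / 2"
    using gen[of 1] by (simp only: power_one_right)
  also have "(\<Sum>i\<in>J. \<Sum>k\<in>J - {i}. ex s i k * ((a i x - a k x) / (x i - x k))) =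
     (\<Sum>i\<in>J. \<Sum>k\<in>J - {i}. - (ex s i k * ((a i x) ^ 1 * a k x)))"
  proof (intro sum.cong refl)
    fix i k assume "i \<in> J" "k \<in> J - {i}"
    then have "(a i x - a k x) / (x i - x k) = - (a i x * a k x)" by (intro a_diff x) auto
    then show "ex s i k * ((a i x - a k x) / (x i - x k)) = - (ex s i k * ((a i x) ^ 1 * a k x))"
      by (simp only: power_one_right mult_minus_right)
  qed
  also have "\<dots> = - (2 * (p s 1 x * p s 1 x) - 4 * W2 x / 2)"
    unfolding sum_negf se w ..
  finally show "(\<Sum>i\<in>J. a i x * B s i x) = W2 x - (p s 1 x)\<^sup>2"
    by (simp add: power2_eq_square)
  have d2: "((a i x)\<^sup>2 - (a k x)\<^sup>2) / (x i - x k) = - ((a i x)\<^sup>2 * a k x) - (a k x)\<^sup>2 * a i x"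
    if "i \<in> J" "k \<in> J - {i}" for i k
  proof -
    have "((a i x)\<^sup>2 - (a k x)\<^sup>2) / (x i - x k) = (a i x - a k x) / (x i - x k) * (a i x + a k x)"
      by (simp add: power2_eq_square algebra_simps diff_divide_distrib add_divide_distrib)
    also have "\<dots> = - ((a i x)\<^sup>2 * a k x) - (a k x)\<^sup>2 * a i x"
      using a_diff[OF x, of i k] that by (simp add: power2_eq_square algebra_simps)
    finally show ?thesis .
  qed
  have "(\<Sum>i\<in>J. \<Sum>k\<in>J - {i}. ex s i k * (((a i x)\<^sup>2 - (a k x)\<^sup>2) / (x i - x k))) =
     (\<Sum>i\<in>J. \<Sum>k\<in>J - {i}. - (ex s i k * ((a i x)\<^sup>2 * a k x)) - ex s i k * ((a k x)\<^sup>2 * a i x))"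
    by (intro sum.cong refl) (simp only: d2 right_diff_distrib mult_minus_right)
  also have "\<dots> = - (\<Sum>i\<in>J. \<Sum>k\<in>J - {i}. ex s i k * ((a i x)\<^sup>2 * a k x)) -
       (\<Sum>i\<in>J. \<Sum>k\<in>J - {i}. ex s i k * ((a k x)\<^sup>2 * a i x))"
    by (simp only: sum_subtractf sum_negf)
  also have "(\<Sum>i\<in>J. \<Sum>k\<in>J - {i}. ex s i k * ((a k x)\<^sup>2 * a i x)) =
     (\<Sum>i\<in>J. \<Sum>k\<in>J - {i}. ex s i k * ((a i x)\<^sup>2 * a k x))"
    by (subst sum_offdiag_swap) (intro sum.cong refl, auto simp: ex_sym)
  finally have 2: "(\<Sum>i\<in>J. \<Sum>k\<in>J - {i}. ex s i k * (((a i x)\<^sup>2 - (a k x)\<^sup>2) / (x i - x k))) =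
    - (2 * (p s 2 x * p s 1 x) - 2 * W3 x / 2) - (2 * (p s 2 x * p s 1 x) - 2 * W3 x / 2)"
    unfolding se w .
  show "(\<Sum>i\<in>J. (a i x)\<^sup>2 * B s i x) = W3 x - 2 * p s 1 x * p s 2 x"
    unfolding gen[of 2] 2 by simp
qed

section \<open>Derivatives of the correlators, and the null vector equation\<close>

lemma finite_E: "finite E"
  using J by (simp add: finite_pairs_on)

lemma smooth_config_E: "smooth_config (insert c J) E"
  by standard (use J finite_E pairs_on_subset in auto)

lemma has_pd_a_c:
  assumes i: "i \<in> J" shows "has_pd E c (a i) (\<lambda>x. (a i x)\<^sup>2)"
  unfolding has_pd_def
proof
  fix x assume x: "x \<in> config E"
  have ne: "x i - x c \<noteq> 0" using config_distinct[OF x, of i c] i c by auto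
  have "i \<noteq> c" using i c by auto
  then have "(\<lambda>t. a i (x(c := t))) = (\<lambda>t. 1 / (x i - t))" by (simp add: a_def fun_eq_iff)
  moreover have "((\<lambda>t. 1 / (x i - t)) has_real_derivative (a i x)\<^sup>2) (at (x c))"
    using ne by (auto intro!: derivative_eq_intros simp: a_def power2_eq_square divide_simps)
  ultimately show "((\<lambda>t. a i (x(c := t))) has_real_derivative (a i x)\<^sup>2) (at (x c))" by (simp only:)
qed

lemma has_pd_a:
  assumes i: "i \<in> J" and l: "l \<in> J"
  shows "has_pd E l (a i) (\<lambda>x. if i = l then - (a i x)\<^sup>2 else 0)"
  unfolding has_pd_def
proof
  fix x assume x: "x \<in> config E"
  have ne: "x i - x c \<noteq> 0" using config_distinct[OF x, of i c] i c by auto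
  have lc: "c \<noteq> l" using l c by auto
  show "((\<lambda>t. a i (x(l := t))) has_real_derivative (if i = l then - (a i x)\<^sup>2 else 0)) (at (x l))"
  proof (cases "i = l")
    case True
    have 1: "(\<lambda>t. a i (x(l := t))) = (\<lambda>t. 1 / (t - x c))" using lc True by (simp add: a_def fun_eq_iff)
    have "((\<lambda>t. 1 / (t - x c)) has_real_derivative - (a i x)\<^sup>2) (at (x l))"
      using ne True by (auto intro!: derivative_eq_intros simp: a_def power2_eq_square divide_simps)
    then show ?thesis unfolding 1 if_P[OF True] .
  next
    case False
    then have "(\<lambda>t. a i (x(l := t))) = (\<lambda>t. a i x)" using lc by (simp add: a_def fun_eq_iff)
    then show ?thesis using False by simp
  qed
qed

lemma has_pd_p_c:
  assumes "0 < m" shows "has_pd E c (p s m) (\<lambda>x. real m * p s (m + 1) x)"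
proof -
  obtain n where n: "m = Suc n" using assms by (cases m) auto
  have "has_pd E c (\<lambda>x. \<Sum>i\<in>J. s i / 2 * a i x ^ m) (\<lambda>x. \<Sum>i\<in>J. s i / 2 * (real m * a i x ^ (m - 1) * (a i x)\<^sup>2))"
    by (intro has_pd_sum has_pd_cmult has_pd_power has_pd_a_c)
  then have 1: "has_pd E c (p s m) (\<lambda>x. \<Sum>i\<in>J. s i / 2 * (real m * a i x ^ (m - 1) * (a i x)\<^sup>2))"
    unfolding p_def[abs_def] .
  show ?thesis
    by (rule has_pd_eq[OF 1]) (simp add: p_def sum_distrib_left power2_eq_square n mult_ac)
qed

lemma has_pd_p:
  assumes m: "0 < m" and l: "l \<in> J"
  shows "has_pd E l (p s m) (\<lambda>x. - (real m * (s l / 2) * a l x ^ (m + 1)))"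
proof -
  obtain n where n: "m = Suc n" using m by (cases m) auto
  have "has_pd E l (\<lambda>x. \<Sum>i\<in>J. s i / 2 * a i x ^ m)
     (\<lambda>x. \<Sum>i\<in>J. s i / 2 * (real m * a i x ^ (m - 1) * (if i = l then - (a i x)\<^sup>2 else 0)))"
    by (intro has_pd_sum has_pd_cmult has_pd_power has_pd_a l)
  then have 1: "has_pd E l (p s m)
     (\<lambda>x. \<Sum>i\<in>J. s i / 2 * (real m * a i x ^ (m - 1) * (if i = l then - (a i x)\<^sup>2 else 0)))"
    unfolding p_def[abs_def] .
  show ?thesis
  proof (rule has_pd_eq[OF 1])
    fix x
    have "(\<Sum>i\<in>J. s i / 2 * (real m * a i x ^ (m - 1) * (if i = l then - (a i x)\<^sup>2 else 0))) =
      (\<Sum>i\<in>J. if i = l then - (real m * (s i / 2) * a i x ^ (m + 1)) else 0)"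
      by (rule sum.cong) (auto simp: power2_eq_square n mult_ac)
    also have "\<dots> = - (real m * (s l / 2) * a l x ^ (m + 1))"
      by (subst sum.delta[OF J]) (simp only: l if_True)
    finally show "(\<Sum>i\<in>J. s i / 2 * (real m * a i x ^ (m - 1) * (if i = l then - (a i x)\<^sup>2 else 0))) =
      - (real m * (s l / 2) * a l x ^ (m + 1))" .
  qed
qed

text \<open>The third order equation at \<open>\<kappa> = 4\<close>, where its constants are 4 and
  2, for a generic point \<open>x c\<close> and unmerged pairs in \<open>J\<close>. The derivatives
  are part of the existential statement, which makes linearity in \<open>f\<close>
  immediate.\<close>

definition nullvec :: "((nat \<Rightarrow> real) \<Rightarrow> real) \<Rightarrow> bool" where
  "nullvec f \<longleftrightarrow> (\<exists>F1 F2 F3 D0 D1.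
     has_pd E c f F1 \<and> has_pd E c F1 F2 \<and> has_pd E c F2 F3 \<and>
     (\<forall>l\<in>J. has_pd E l f (D0 l)) \<and> (\<forall>l\<in>J. has_pd E l F1 (D1 l)) \<and>
     (\<forall>x\<in>config E. F3 x - 4 * (W2 x * F1 x - (\<Sum>l\<in>J. a l x * D1 l x)) +
        2 * (W3 x * f x - (\<Sum>l\<in>J. (a l x)\<^sup>2 * D0 l x)) = 0))"

lemma nullvecI:
  assumes "has_pd E c f F1" "has_pd E c F1 F2" "has_pd E c F2 F3"
    "\<And>l. l \<in> J \<Longrightarrow> has_pd E l f (D0 l)" "\<And>l. l \<in> J \<Longrightarrow> has_pd E l F1 (D1 l)"
    "\<And>x. x \<in> config E \<Longrightarrow> F3 x - 4 * (W2 x * F1 x - (\<Sum>l\<in>J. a l x * D1 l x)) +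
        2 * (W3 x * f x - (\<Sum>l\<in>J. (a l x)\<^sup>2 * D0 l x)) = 0"
  shows "nullvec f"
  unfolding nullvec_def
  by (rule exI[of _ F1], rule exI[of _ F2], rule exI[of _ F3], rule exI[of _ D0], rule exI[of _ D1],
    intro conjI ballI assms)

lemma nullvecD:
  assumes "nullvec f" and x: "x \<in> config E"
  shows "pderiv_at c (pderiv_at c (pderiv_at c f)) x
     - 4 * (W2 x * pderiv_at c f x - (\<Sum>l\<in>J. a l x * pderiv_at l (pderiv_at c f) x))
     + 2 * (W3 x * f x - (\<Sum>l\<in>J. (a l x)\<^sup>2 * pderiv_at l f x)) = 0"
proof -
  interpret smooth_config "insert c J" E by (rule smooth_config_E)
  from assms(1) obtain F1 F2 F3 D0 D1 where F: "has_pd E c f F1" "has_pd E c F1 F2" "has_pd E c F2 F3"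
    and D: "\<forall>l\<in>J. has_pd E l f (D0 l)" "\<forall>l\<in>J. has_pd E l F1 (D1 l)"
    and eq: "\<forall>x\<in>config E. F3 x - 4 * (W2 x * F1 x - (\<Sum>l\<in>J. a l x * D1 l x)) +
        2 * (W3 x * f x - (\<Sum>l\<in>J. (a l x)\<^sup>2 * D0 l x)) = 0"
    unfolding nullvec_def by (elim exE conjE) (rule that)
  note D = D[rule_format] and eq = eq[rule_format]
  have 1: "pderiv_at c f x = F1 x" if "x \<in> config E" for x using has_pdD[OF F(1) that] .
  have 2: "pderiv_at c (pderiv_at c f) x = F2 x" if x: "x \<in> config E" for x
    by (rule trans[OF pderiv_cong[OF x 1] has_pdD[OF F(2) x]])
  have 3: "pderiv_at c (pderiv_at c (pderiv_at c f)) x = F3 x"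
    by (rule trans[OF pderiv_cong[OF x 2] has_pdD[OF F(3) x]])
  have 4: "(\<Sum>l\<in>J. a l x * pderiv_at l (pderiv_at c f) x) = (\<Sum>l\<in>J. a l x * D1 l x)"
    by (intro sum.cong refl arg_cong2[where f = "(*)"] trans[OF pderiv_cong[OF x 1] has_pdD[OF D(2) x]])
  have 5: "(\<Sum>l\<in>J. (a l x)\<^sup>2 * pderiv_at l f x) = (\<Sum>l\<in>J. (a l x)\<^sup>2 * D0 l x)"
    by (intro sum.cong refl arg_cong2[where f = "(*)"] has_pdD[OF D(1) x])
  show ?thesis unfolding 1[OF x] 3 4 5 by (rule eq[OF x])
qed

lemma nullvec_cong:
  assumes "nullvec f" and fg: "\<And>x. x \<in> config E \<Longrightarrow> f x = g x"
  shows "nullvec g"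
proof -
  from assms(1) obtain F1 F2 F3 D0 D1 where F: "has_pd E c f F1" "has_pd E c F1 F2" "has_pd E c F2 F3"
    and D: "\<forall>l\<in>J. has_pd E l f (D0 l)" "\<forall>l\<in>J. has_pd E l F1 (D1 l)"
    and eq: "\<forall>x\<in>config E. F3 x - 4 * (W2 x * F1 x - (\<Sum>l\<in>J. a l x * D1 l x)) +
        2 * (W3 x * f x - (\<Sum>l\<in>J. (a l x)\<^sup>2 * D0 l x)) = 0"
    unfolding nullvec_def by (elim exE conjE) (rule that)
  note D = D[rule_format] and eq = eq[rule_format]
  show ?thesis
    by (rule nullvecI[OF has_pd_cong[OF smooth_config_E F(1) fg] F(2,3)
          has_pd_cong[OF smooth_config_E D(1) fg] D(2)])
      (use eq fg in auto)
qed

lemma nullvec_linear: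
  assumes "nullvec f" "nullvec g"
  shows "nullvec (\<lambda>x. k * f x + g x)"
proof -
  from assms(1) obtain F1 F2 F3 D0 D1 where F: "has_pd E c f F1" "has_pd E c F1 F2" "has_pd E c F2 F3"
    and D: "\<forall>l\<in>J. has_pd E l f (D0 l)" "\<forall>l\<in>J. has_pd E l F1 (D1 l)"
    and eqF: "\<forall>x\<in>config E. F3 x - 4 * (W2 x * F1 x - (\<Sum>l\<in>J. a l x * D1 l x)) +
        2 * (W3 x * f x - (\<Sum>l\<in>J. (a l x)\<^sup>2 * D0 l x)) = 0"
    unfolding nullvec_def by (elim exE conjE) (rule that)
  note D = D[rule_format] and eqF = eqF[rule_format]
  from assms(2) obtain G1 G2 G3 C0 C1 where G: "has_pd E c g G1" "has_pd E c G1 G2" "has_pd E c G2 G3"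
    and C: "\<forall>l\<in>J. has_pd E l g (C0 l)" "\<forall>l\<in>J. has_pd E l G1 (C1 l)"
    and eqG: "\<forall>x\<in>config E. G3 x - 4 * (W2 x * G1 x - (\<Sum>l\<in>J. a l x * C1 l x)) +
        2 * (W3 x * g x - (\<Sum>l\<in>J. (a l x)\<^sup>2 * C0 l x)) = 0"
    unfolding nullvec_def by (elim exE conjE) (rule that)
  note C = C[rule_format] and eqG = eqG[rule_format]
  show ?thesis
  proof (rule nullvecI)
    show "has_pd E c (\<lambda>x. k * f x + g x) (\<lambda>x. k * F1 x + G1 x)"
      "has_pd E c (\<lambda>x. k * F1 x + G1 x) (\<lambda>x. k * F2 x + G2 x)"
      "has_pd E c (\<lambda>x. k * F2 x + G2 x) (\<lambda>x. k * F3 x + G3 x)"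
      by (intro has_pd_add has_pd_cmult F G)+
    show "has_pd E l (\<lambda>x. k * f x + g x) (\<lambda>x. k * D0 l x + C0 l x)"
      "has_pd E l (\<lambda>x. k * F1 x + G1 x) (\<lambda>x. k * D1 l x + C1 l x)" if "l \<in> J" for l
      by (intro has_pd_add has_pd_cmult D C that)+
    fix x assume x: "x \<in> config E"
    have s: "(\<Sum>l\<in>J. a l x * (k * D1 l x + C1 l x)) = k * (\<Sum>l\<in>J. a l x * D1 l x) + (\<Sum>l\<in>J. a l x * C1 l x)"
      "(\<Sum>l\<in>J. (a l x)\<^sup>2 * (k * D0 l x + C0 l x)) = k * (\<Sum>l\<in>J. (a l x)\<^sup>2 * D0 l x) + (\<Sum>l\<in>J. (a l x)\<^sup>2 * C0 l x)"
      by (simp_all add: sum.distrib sum_distrib_left distrib_left mult_ac)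
    have "k * F3 x + G3 x - 4 * (W2 x * (k * F1 x + G1 x) - (\<Sum>l\<in>J. a l x * (k * D1 l x + C1 l x))) +
        2 * (W3 x * (k * f x + g x) - (\<Sum>l\<in>J. (a l x)\<^sup>2 * (k * D0 l x + C0 l x))) =
      k * (F3 x - 4 * (W2 x * F1 x - (\<Sum>l\<in>J. a l x * D1 l x)) +
        2 * (W3 x * f x - (\<Sum>l\<in>J. (a l x)\<^sup>2 * D0 l x))) +
      (G3 x - 4 * (W2 x * G1 x - (\<Sum>l\<in>J. a l x * C1 l x)) +
        2 * (W3 x * g x - (\<Sum>l\<in>J. (a l x)\<^sup>2 * C0 l x)))"
      unfolding s by (simp only: ring_distribs mult_ac add_ac diff_conv_add_uminus minus_add_distrib minus_minus mult_minus_right)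
    then show "k * F3 x + G3 x - 4 * (W2 x * (k * F1 x + G1 x) - (\<Sum>l\<in>J. a l x * (k * D1 l x + C1 l x))) +
        2 * (W3 x * (k * f x + g x) - (\<Sum>l\<in>J. (a l x)\<^sup>2 * (k * D0 l x + C0 l x))) = 0"
      unfolding eqF[OF x] eqG[OF x] by simp
  qed
qed

lemma nullvec_sum:
  assumes "finite A" "\<And>b. b \<in> A \<Longrightarrow> nullvec (f b)"
  shows "nullvec (\<lambda>x. \<Sum>b\<in>A. k b * f b x)"
  using assms
proof (induction A rule: finite_induct)
  case empty
  have "has_pd E l (\<lambda>_. 0) (\<lambda>_. 0)" for l by (simp add: has_pd_def)
  then have "nullvec (\<lambda>_. 0)"
    by (intro nullvecI[of "\<lambda>_. 0" "\<lambda>_. 0" "\<lambda>_. 0" "\<lambda>_. 0" "\<lambda>_ _. 0" "\<lambda>_ _. 0"])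
      simp_all
  then show ?case by simp
next
  case (insert b A)
  then show ?case using nullvec_linear[of "f b" "\<lambda>x. \<Sum>b\<in>A. k b * f b x" "k b"] by simp
qed

text \<open>Charge 1 at \<open>c\<close>, against charge \<open>s i / 2\<close> at the other points,
  gives the exponents \<open>s i\<close>.\<close>

definition same_exp :: "(nat \<Rightarrow> real) \<Rightarrow> nat \<Rightarrow> nat \<Rightarrow> real" where
  "same_exp s i k = (if i = c then s k else if k = c then s i else ex s i k)"

text \<open>Differentiation multiplies the product by \<open>- 2 * p s 1\<close> for
  \<open>x c\<close> and by \<open>s l * a l + B s l\<close> for \<open>x l\<close>. After
  \<open>sum_a_B\<close> the equation is a polynomial identity in \<open>p s 1\<close>,
  \<open>p s 2\<close>, \<open>p s 3\<close>, \<open>W2\<close> and \<open>W3\<close>.\<close>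

lemma nullvec_same:
  assumes s: "\<And>i. i \<in> J \<Longrightarrow> s i * s i = 1"
  shows "nullvec (prodpow E (same_exp s))"
proof -
  let ?G = "prodpow E (same_exp s)"
  have G0: "has_pd E l ?G (\<lambda>x. ?G x * logd E (same_exp s) l x)" for l
    by (rule has_pd_prodpow[OF finite_E subset_refl finite_E pairs_on_subset]) (use J in simp)
  have Gc: "has_pd E c ?G (\<lambda>x. - 2 * (p s 1 x * ?G x))"
  proof (rule has_pd_eq[OF G0])
    fix x assume x: "x \<in> config E"
    have "logd E (same_exp s) c x = (\<Sum>m\<in>insert c J - {c}. same_exp s c m / (x c - x m))"
      by (rule logd_pairs_on) (use J c in \<open>auto simp: same_exp_def\<close>)
    also have "insert c J - {c} = J" using c by auto
    also have "(\<Sum>m\<in>J. same_exp s c m / (x c - x m)) = (\<Sum>m\<in>J. - 2 * (s m / 2 * a m x ^ 1))"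
    proof (rule sum.cong[OF refl])
      fix m assume "m \<in> J"
      moreover from this have "m \<noteq> c" using c by blast
      ultimately have "x m - x c \<noteq> 0" "x c - x m \<noteq> 0" using config_distinct[OF x, of m c] by auto
      then show "same_exp s c m / (x c - x m) = - 2 * (s m / 2 * a m x ^ 1)"
        by (simp add: same_exp_def a_def field_simps)
    qed
    also have "\<dots> = - 2 * p s 1 x" by (simp only: p_def sum_distrib_left)
    finally show "?G x * logd E (same_exp s) c x = - 2 * (p s 1 x * ?G x)" by simp
  qed
  have Gl: "has_pd E l ?G (\<lambda>x. ?G x * (s l * a l x + B s l x))" if l: "l \<in> J" for l
  proof (rule has_pd_eq[OF G0])
    fix x assume x: "x \<in> config E"
    have lc: "l \<noteq> c" using l c by auto
    have "logd E (same_exp s) l x = (\<Sum>m\<in>insert c J - {l}. same_exp s l m / (x l - x m))"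
      by (rule logd_pairs_on) (use J l lc in \<open>auto simp: same_exp_def ex_sym\<close>)
    also have "insert c J - {l} = insert c (J - {l})" using lc by auto
    also have "(\<Sum>m\<in>insert c (J - {l}). same_exp s l m / (x l - x m)) =
        same_exp s l c / (x l - x c) + (\<Sum>m\<in>J - {l}. same_exp s l m / (x l - x m))"
      by (rule sum.insert) (use J c in auto)
    also have "same_exp s l c / (x l - x c) = s l * a l x" using lc by (simp add: same_exp_def a_def)
    also have "(\<Sum>m\<in>J - {l}. same_exp s l m / (x l - x m)) = B s l x"
      unfolding B_def by (rule sum.cong) (use c lc in \<open>auto simp: same_exp_def\<close>)
    finally show "?G x * logd E (same_exp s) l x = ?G x * (s l * a l x + B s l x)" by simp
  qed
  have P1: "has_pd E c (p s 1) (p s 2)" using has_pd_p_c[of 1 s] unfolding one_add_one by simp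
  have P2: "has_pd E c (p s 2) (\<lambda>x. 2 * p s 3 x)" using has_pd_p_c[of 2 s] by simp
  have Pl: "has_pd E l (p s 1) (\<lambda>x. - (s l / 2 * (a l x)\<^sup>2))" if "l \<in> J" for l
    using has_pd_p[OF _ that, of 1 s] unfolding one_add_one by simp
  let ?D1 = "\<lambda>l x. - 2 * (- (s l / 2 * (a l x)\<^sup>2) * ?G x + ?G x * (s l * a l x + B s l x) * p s 1 x)"
  show ?thesis
  proof (rule nullvecI[OF Gc has_pd_cmult[OF has_pd_mult[OF P1 Gc]]])
    show "has_pd E c (\<lambda>x. - 2 * (p s 2 x * ?G x + - 2 * (p s 1 x * ?G x) * p s 1 x))
      (\<lambda>x. - 2 * ((2 * p s 3 x * ?G x + - 2 * (p s 1 x * ?G x) * p s 2 x) +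
         (- 2 * (p s 2 x * ?G x + - 2 * (p s 1 x * ?G x) * p s 1 x) * p s 1 x + p s 2 x * (- 2 * (p s 1 x * ?G x)))))"
      by (intro has_pd_cmult has_pd_add has_pd_mult P1 P2 Gc)
    show "has_pd E l ?G (\<lambda>x. ?G x * (s l * a l x + B s l x))" if "l \<in> J" for l by (rule Gl[OF that])
    show "has_pd E l (\<lambda>x. - 2 * (p s 1 x * ?G x)) (?D1 l)" if "l \<in> J" for l
      by (intro has_pd_cmult has_pd_mult Pl Gl that)
    fix x assume x: "x \<in> config E"
    have aB: "(\<Sum>i\<in>J. a i x * B s i x) = W2 x - (p s 1 x)\<^sup>2"
      "(\<Sum>i\<in>J. (a i x)\<^sup>2 * B s i x) = W3 x - 2 * p s 1 x * p s 2 x"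
      by (rule sum_a_B[OF x]; rule s; assumption)+
    have "(\<Sum>l\<in>J. a l x * ?D1 l x) = (\<Sum>l\<in>J. 2 * ?G x * (s l / 2 * a l x ^ 3) -
        2 * p s 1 x * ?G x * (2 * (s l / 2 * a l x ^ 2) + a l x * B s l x))"
      by (intro sum.cong refl) (simp add: algebra_simps power2_eq_square power3_eq_cube)
    also have "\<dots> = 2 * ?G x * p s 3 x - 2 * p s 1 x * ?G x * (2 * p s 2 x + (\<Sum>l\<in>J. a l x * B s l x))"
      by (simp only: p_def[of s 3 x] p_def[of s 2 x] sum_subtractf sum.distrib sum_distrib_left[symmetric])
    finally have S1: "(\<Sum>l\<in>J. a l x * ?D1 l x) =
       2 * ?G x * p s 3 x - 2 * p s 1 x * ?G x * (2 * p s 2 x + (W2 x - (p s 1 x)\<^sup>2))"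
      unfolding aB .
    have "(\<Sum>l\<in>J. (a l x)\<^sup>2 * (?G x * (s l * a l x + B s l x))) =
       (\<Sum>l\<in>J. ?G x * (2 * (s l / 2 * a l x ^ 3) + (a l x)\<^sup>2 * B s l x))"
      by (intro sum.cong refl) (simp add: algebra_simps power2_eq_square power3_eq_cube)
    also have "\<dots> = ?G x * (2 * p s 3 x + (\<Sum>l\<in>J. (a l x)\<^sup>2 * B s l x))"
      by (simp only: p_def[of s 3 x] sum.distrib sum_distrib_left[symmetric])
    finally have S2: "(\<Sum>l\<in>J. (a l x)\<^sup>2 * (?G x * (s l * a l x + B s l x))) =
       ?G x * (2 * p s 3 x + (W3 x - 2 * p s 1 x * p s 2 x))"
      unfolding aB .
    show "- 2 * ((2 * p s 3 x * ?G x + - 2 * (p s 1 x * ?G x) * p s 2 x) +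
         (- 2 * (p s 2 x * ?G x + - 2 * (p s 1 x * ?G x) * p s 1 x) * p s 1 x + p s 2 x * (- 2 * (p s 1 x * ?G x)))) -
      4 * (W2 x * (- 2 * (p s 1 x * ?G x)) - (\<Sum>l\<in>J. a l x * ?D1 l x)) +
      2 * (W3 x * ?G x - (\<Sum>l\<in>J. (a l x)\<^sup>2 * (?G x * (s l * a l x + B s l x)))) = 0"
      unfolding S1 S2 by (simp add: algebra_simps power2_eq_square)
  qed
qed

text \<open>With charge 0 at \<open>x c\<close> the product does not depend on \<open>x c\<close>,
  so derivatives in \<open>x c\<close> act on the power sum only. Again \<open>sum_a_B\<close>
  reduces the equation to a polynomial identity.\<close>

lemma nullvec_mixed:
  assumes s: "\<And>i. i \<in> J \<Longrightarrow> s i * s i = 1"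
  shows "nullvec (\<lambda>x. p s 1 x * prodpow (pairs_on J) (ex s) x)"
proof -
  let ?h = "prodpow (pairs_on J) (ex s)"
  have "pairs_on J \<subseteq> E" by (auto simp: pairs_on_def)
  then have h0: "has_pd E l ?h (\<lambda>x. ?h x * logd (pairs_on J) (ex s) l x)" for l
    by (rule has_pd_prodpow[OF finite_pairs_on[OF J] _ finite_E pairs_on_subset]) (use J in simp)
  have hc: "has_pd E c ?h (\<lambda>x. 0)"
    by (rule has_pd_eq[OF h0]) (simp add: logd_absent[OF pairs_on_subset c])
  have hl: "has_pd E l ?h (\<lambda>x. ?h x * B s l x)" if l: "l \<in> J" for l
    by (rule has_pd_eq[OF h0], subst logd_pairs_on[OF J l]) (simp_all add: ex_sym l B_def)
  have P: "has_pd E c (p s 1) (p s 2)" "has_pd E c (p s 2) (\<lambda>x. 2 * p s 3 x)" "has_pd E c (p s 3) (\<lambda>x. 3 * p s 4 x)"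
    using has_pd_p_c[of 1 s] has_pd_p_c[of 2 s] has_pd_p_c[of 3 s] unfolding one_add_one by simp_all
  have Pl: "has_pd E l (p s 1) (\<lambda>x. - (s l / 2 * (a l x)\<^sup>2))" "has_pd E l (p s 2) (\<lambda>x. - (s l * a l x ^ 3))"
    if "l \<in> J" for l
    using has_pd_p[OF _ that, of 1 s] has_pd_p[OF _ that, of 2 s] unfolding one_add_one by simp_all
  have F1: "has_pd E c (\<lambda>x. p s 1 x * ?h x) (\<lambda>x. p s 2 x * ?h x)"
    by (rule has_pd_eq[OF has_pd_mult[OF P(1) hc]]) simp
  have F2: "has_pd E c (\<lambda>x. p s 2 x * ?h x) (\<lambda>x. 2 * (p s 3 x * ?h x))"
    by (rule has_pd_eq[OF has_pd_mult[OF P(2) hc]]) simp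
  have F3: "has_pd E c (\<lambda>x. 2 * (p s 3 x * ?h x)) (\<lambda>x. 6 * (p s 4 x * ?h x))"
    by (rule has_pd_eq[OF has_pd_cmult[OF has_pd_mult[OF P(3) hc]]]) simp
  let ?D0 = "\<lambda>l x. - (s l / 2 * (a l x)\<^sup>2) * ?h x + ?h x * B s l x * p s 1 x"
  let ?D1 = "\<lambda>l x. - (s l * a l x ^ 3) * ?h x + ?h x * B s l x * p s 2 x"
  show ?thesis
  proof (rule nullvecI[OF F1 F2 F3])
    show "has_pd E l (\<lambda>x. p s 1 x * ?h x) (?D0 l)" "has_pd E l (\<lambda>x. p s 2 x * ?h x) (?D1 l)" if "l \<in> J" for l
      by (intro has_pd_mult Pl hl that)+
    fix x assume x: "x \<in> config E"
    have aB: "(\<Sum>i\<in>J. a i x * B s i x) = W2 x - (p s 1 x)\<^sup>2"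
      "(\<Sum>i\<in>J. (a i x)\<^sup>2 * B s i x) = W3 x - 2 * p s 1 x * p s 2 x"
      by (rule sum_a_B[OF x]; rule s; assumption)+
    have "(\<Sum>l\<in>J. a l x * ?D1 l x) = (\<Sum>l\<in>J. ?h x * p s 2 x * (a l x * B s l x) - 2 * ?h x * (s l / 2 * a l x ^ 4))"
      by (intro sum.cong refl) (simp add: algebra_simps power4_eq_xxxx power3_eq_cube)
    also have "\<dots> = ?h x * p s 2 x * (\<Sum>l\<in>J. a l x * B s l x) - 2 * ?h x * p s 4 x"
      by (simp only: p_def[of s 4 x] sum_subtractf sum_distrib_left[symmetric])
    finally have S1: "(\<Sum>l\<in>J. a l x * ?D1 l x) = ?h x * p s 2 x * (W2 x - (p s 1 x)\<^sup>2) - 2 * ?h x * p s 4 x"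
      unfolding aB .
    have "(\<Sum>l\<in>J. (a l x)\<^sup>2 * ?D0 l x) = (\<Sum>l\<in>J. ?h x * p s 1 x * ((a l x)\<^sup>2 * B s l x) - ?h x * (s l / 2 * a l x ^ 4))"
      by (intro sum.cong refl) (simp add: algebra_simps power4_eq_xxxx power2_eq_square)
    also have "\<dots> = ?h x * p s 1 x * (\<Sum>l\<in>J. (a l x)\<^sup>2 * B s l x) - ?h x * p s 4 x"
      by (simp only: p_def[of s 4 x] sum_subtractf sum_distrib_left[symmetric])
    finally have S2: "(\<Sum>l\<in>J. (a l x)\<^sup>2 * ?D0 l x) =
        ?h x * p s 1 x * (W3 x - 2 * p s 1 x * p s 2 x) - ?h x * p s 4 x"
      unfolding aB .
    show "6 * (p s 4 x * ?h x) - 4 * (W2 x * (p s 2 x * ?h x) - (\<Sum>l\<in>J. a l x * ?D1 l x)) +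
      2 * (W3 x * (p s 1 x * ?h x) - (\<Sum>l\<in>J. (a l x)\<^sup>2 * ?D0 l x)) = 0"
      unfolding S1 S2 by (simp add: algebra_simps power2_eq_square)
  qed
qed

end

section \<open>Merging a pair of points\<close>

definition partner :: "nat \<Rightarrow> nat" where
  "partner i = (if odd i then Suc i else i - 1)"

definition charge :: "(nat \<Rightarrow> nat) \<Rightarrow> nat \<Rightarrow> real" where
  "charge b i = (if i \<in> ups b then 1 else -1)"

lemma charge_sq: "charge b i * charge b i = 1"
  by (simp add: charge_def)

lemma cross_iff: "(i, k) \<in> cross M \<longleftrightarrow> 0 < i \<and> k \<le> 2 * M \<and> Suc i div 2 < Suc k div 2"
  using div_le_mono[of "Suc k" "Suc i" 2] by (auto simp: cross_def)

lemma config_mono: "A \<subseteq> B \<Longrightarrow> x \<in> config B \<Longrightarrow> x \<in> config A"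
  by (auto simp: config_def)

lemma prod_pairs_partner:
  assumes x: "x \<in> config (pairs (2 * M))"
  shows "(\<Prod>(i, k)\<in>pairs (2 * M). (x k - x i) powr (of_bool (k = partner i) / 2)) =
    (\<Prod>j\<in>{1..M}. (x (2 * j) - x (2 * j - 1)) powr (1/2))"
proof -
  let ?f = "\<lambda>(i, k). (x k - x i) powr (of_bool (k = partner i) / 2)"
  have inj: "inj_on (\<lambda>j. (2 * j - 1, 2 * j)) {1..M}" by (auto simp: inj_on_def)
  have "prod ?f (pairs (2 * M)) = prod ?f (cross M) * prod ?f ((\<lambda>j. (2 * j - 1, 2 * j)) ` {1..M})"
    unfolding pairs_cross(1) by (rule prod.union_disjoint[OF finite_cross finite_imageI[OF finite_atLeastAtMost] pairs_cross(2)])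
  also have "prod ?f (cross M) = 1"
  proof (rule prod.neutral, clarify)
    fix i k assume ik: "(i, k) \<in> cross M"
    then have "k \<noteq> partner i" by (auto simp: cross_def partner_def elim!: oddE evenE)
    moreover have "(i, k) \<in> pairs (2 * M)" using ik by (auto simp: pairs_def cross_def)
    then have "x i < x k" using x by (auto simp: config_def)
    ultimately show "(x k - x i) powr (of_bool (k = partner i) / 2) = 1" by simp
  qed
  also have "prod ?f ((\<lambda>j. (2 * j - 1, 2 * j)) ` {1..M}) = (\<Prod>j\<in>{1..M}. (x (2 * j) - x (2 * j - 1)) powr (1/2))"
    unfolding prod.reindex[OF inj] comp_def prod.case
  proof (rule prod.cong[OF refl])
    fix j assume "j \<in> {1..M}"
    then have "partner (2 * j - 1) = 2 * j" by (simp add: partner_def)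
    then show "(x (2 * j) - x (2 * j - 1)) powr (of_bool (2 * j = partner (2 * j - 1)) / 2) =
      (x (2 * j) - x (2 * j - 1)) powr (1/2)" by simp
  qed
  finally show ?thesis by simp
qed

text \<open>Away from the diagonal the blocks are available separately. The gaps of all pairs are
  divided out, hence the exponents \<open>charge_exp\<close>.\<close>

lemma fused_g_expansion:
  assumes M: "0 < M" and p: "p \<in> webs {0<..2 * M}" and u: "unlinked p" and x: "x \<in> config (pairs (2 * M))"
  shows "fused_g M p x = (\<Sum>b\<in>webs {0<..2 * M}. web_inv {0<..2 * M} p b *
    prodpow (pairs (2 * M)) (charge_exp partner (charge b)) x)"
proof -
  let ?V = "{0<..2 * M}" and ?A = "pairs (2 * M)"
  define T where "T = (\<Prod>j\<in>{1..M}. (x (2 * j) - x (2 * j - 1)) powr (1/2))"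
  have lt: "x i < x k" if "(i, k) \<in> ?A" for i k using x that by (auto simp: config_def)
  have T: "T > 0" unfolding T_def
  proof (rule prod_pos)
    fix j assume "j \<in> {1..M}"
    then have "(2 * j - 1, 2 * j) \<in> ?A" by (auto simp: pairs_def)
    from lt[OF this] show "0 < (x (2 * j) - x (2 * j - 1)) powr (1/2)" by simp
  qed
  have tm: "(\<Prod>(i, k)\<in>?A. (x k - x i) powr (-1/2)) * (vdm x (ups b) * vdm x (?V - ups b)) =
      prodpow ?A (charge_exp partner (charge b)) x * T" if b: "b \<in> webs ?V" for b
  proof -
    have "prodpow ?A (charge_exp partner (charge b)) x * T =
      (\<Prod>(i, k)\<in>?A. (x k - x i) powr charge_exp partner (charge b) i k * (x k - x i) powr (of_bool (k = partner i) / 2))"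
      unfolding T_def prod_pairs_partner[OF x, symmetric] prodpow_def prod.distrib[symmetric]
      by (rule prod.cong) auto
    also have "\<dots> = (\<Prod>(i, k)\<in>?A. (x k - x i) powr (-1/2) * ((if i \<in> ups b \<and> k \<in> ups b then x k - x i else 1) *
        (if i \<in> ?V - ups b \<and> k \<in> ?V - ups b then x k - x i else 1)))"
    proof (rule prod.cong[OF refl], clarify)
      fix i k assume ik: "(i, k) \<in> ?A"
      then have V: "i \<in> ?V" "k \<in> ?V" by (auto simp: pairs_def)
      have pos: "x k - x i > 0" using lt[OF ik] by simp
      have h: "(x k - x i) powr (-1/2) * (x k - x i) = (x k - x i) powr (1/2)"
        using powr_add[of "x k - x i" "-1/2" 1] pos by simp
      have "(x k - x i) powr charge_exp partner (charge b) i k * (x k - x i) powr (of_bool (k = partner i) / 2) =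
          (x k - x i) powr (charge b i * charge b k / 2)"
        unfolding powr_add[symmetric] charge_exp_def by simp
      also have "\<dots> = (x k - x i) powr (-1/2) * ((if i \<in> ups b \<and> k \<in> ups b then x k - x i else 1) *
        (if i \<in> ?V - ups b \<and> k \<in> ?V - ups b then x k - x i else 1))"
        using V h by (cases "i \<in> ups b"; cases "k \<in> ups b") (simp_all add: charge_def)
      finally show "(x k - x i) powr charge_exp partner (charge b) i k * (x k - x i) powr (of_bool (k = partner i) / 2) =
        (x k - x i) powr (-1/2) * ((if i \<in> ups b \<and> k \<in> ups b then x k - x i else 1) *
        (if i \<in> ?V - ups b \<and> k \<in> ?V - ups b then x k - x i else 1))" .
    qed
    also have "\<dots> = (\<Prod>(i, k)\<in>?A. (x k - x i) powr (-1/2)) * (vdm x (ups b) * vdm x (?V - ups b))"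
      unfolding vdm_pairs[OF ups_subset[OF b]] vdm_pairs[OF Diff_subset] prod.distrib[symmetric]
      by (rule prod.cong) auto
    finally show ?thesis by simp
  qed
  have xs: "x i < x k" if "0 < i" "i < k" "k \<le> 2 * M" for i k
    using lt[of i k] that by (auto simp: pairs_def)
  have "fused_g M p x * T = (\<Prod>(i, k)\<in>?A. (x k - x i) powr (-1/2)) * web_coeff (vdm x) {} p"
    unfolding T_def by (rule fused_g_off_diag[OF xs M p u])
  also have "\<dots> = (\<Sum>b\<in>webs ?V. web_inv ?V p b *
      ((\<Prod>(i, k)\<in>?A. (x k - x i) powr (-1/2)) * (vdm x (ups b) * vdm x (?V - ups b))))"
    unfolding web_coeff_def webs_support[OF p] by (simp only: sum_distrib_left Un_empty_left mult.left_commute)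
  also have "\<dots> = (\<Sum>b\<in>webs ?V. web_inv ?V p b * prodpow ?A (charge_exp partner (charge b)) x) * T"
    unfolding sum_distrib_right by (rule sum.cong[OF refl]) (simp only: tm mult.assoc)
  finally show ?thesis using T by simp
qed

text \<open>\<open>S\<close> collects the regular terms and \<open>m t / t\<close> those with a
  simple pole. Convergence of \<open>G\<close> and \<open>S\<close> forces \<open>m 0 = 0\<close>,
  so that \<open>m t / t\<close> is a difference quotient.\<close>

lemma merge_limit:
  fixes G S m :: "real \<Rightarrow> real"
  assumes G: "(G \<longlongrightarrow> g) (at_right 0)" and S: "(S \<longlongrightarrow> s) (at_right 0)"
    and m: "(m has_real_derivative D) (at 0)"
    and eq: "\<forall>\<^sub>F t in at_right 0. G t = S t + m t / t"
  shows "g = s + D"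
proof -
  have nb: "at_right (0::real) \<noteq> bot" by (rule trivial_limit_at_right_real)
  have le: "at_right (0::real) \<le> at 0" by (simp add: at_le)
  have pos: "\<forall>\<^sub>F t in at_right 0. (0::real) < t" by (rule eventually_at_right_less)
  have "(m \<longlongrightarrow> m 0) (at 0)" using DERIV_isCont[OF m] by (simp add: isCont_def)
  then have 1: "(m \<longlongrightarrow> m 0) (at_right 0)" by (rule tendsto_mono[OF le])
  have "((\<lambda>t. t * (G t - S t)) \<longlongrightarrow> 0 * (g - s)) (at_right 0)"
    by (intro tendsto_mult tendsto_diff G S tendsto_ident_at)
  moreover have "\<forall>\<^sub>F t in at_right 0. t * (G t - S t) = m t"
    using eq pos by eventually_elim simp
  ultimately have "(m \<longlongrightarrow> 0) (at_right 0)" by (simp add: tendsto_cong)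
  then have m0: "m 0 = 0" using tendsto_unique[OF nb 1] by simp
  have "((\<lambda>t. (m t - m 0) / (t - 0)) \<longlongrightarrow> D) (at 0)" using m by (simp add: has_field_derivative_iff)
  then have "((\<lambda>t. m t / t) \<longlongrightarrow> D) (at_right 0)" unfolding m0 by (intro tendsto_mono[OF le]) simp
  moreover have "((\<lambda>t. G t - S t) \<longlongrightarrow> g - s) (at_right 0)" by (intro tendsto_diff G S)
  moreover have "\<forall>\<^sub>F t in at_right 0. G t - S t = m t / t" using eq by eventually_elim simp
  ultimately have "((\<lambda>t. m t / t) \<longlongrightarrow> g - s) (at_right 0)" by (simp add: tendsto_cong)
  then have "g - s = D" using \<open>((\<lambda>t. m t / t) \<longlongrightarrow> D) (at_right 0)\<close> tendsto_unique[OF nb] by blast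
  then show ?thesis by simp
qed

section \<open>Moebius covariance\<close>

lemma prod_pairs_sym:
  fixes F :: "nat \<Rightarrow> nat \<Rightarrow> real"
  assumes V: "finite V"
  shows "(\<Prod>(i, k)\<in>pairs_on V. F i k * F k i) = (\<Prod>i\<in>V. \<Prod>k\<in>V - {i}. F i k)"
proof -
  have "(\<Prod>i\<in>V. \<Prod>k\<in>V - {i}. F i k) = (\<Prod>(i, k)\<in>Sigma V (\<lambda>i. V - {i}). F i k)"
    by (rule prod.Sigma) (use V in auto)
  also have "Sigma V (\<lambda>i. V - {i}) = pairs_on V \<union> prod.swap ` pairs_on V"
  proof (intro equalityI subsetI)
    fix e assume "e \<in> Sigma V (\<lambda>i. V - {i})"
    then obtain i k where e: "e = (i, k)" "i \<in> V" "k \<in> V" "i \<noteq> k" by auto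
    show "e \<in> pairs_on V \<union> prod.swap ` pairs_on V"
    proof (cases "i < k")
      case True then show ?thesis using e by (simp add: pairs_on_def)
    next
      case False
      then have "(k, i) \<in> pairs_on V" using e by (simp add: pairs_on_def)
      from imageI[OF this, of prod.swap] show ?thesis using e by simp
    qed
  qed (auto simp: pairs_on_def)
  also have "(\<Prod>(i, k)\<in>pairs_on V \<union> prod.swap ` pairs_on V. F i k) =
      (\<Prod>(i, k)\<in>pairs_on V. F i k) * (\<Prod>(i, k)\<in>prod.swap ` pairs_on V. F i k)"
    by (rule prod.union_disjoint) (use finite_pairs_on[OF V] in \<open>auto simp: pairs_on_def\<close>)
  also have "(\<Prod>(i, k)\<in>prod.swap ` pairs_on V. F i k) = (\<Prod>(i, k)\<in>pairs_on V. F k i)"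
    unfolding prod.reindex[OF inj_swap] by (rule prod.cong) auto
  also have "(\<Prod>(i, k)\<in>pairs_on V. F i k) * (\<Prod>(i, k)\<in>pairs_on V. F k i) = (\<Prod>(i, k)\<in>pairs_on V. F i k * F k i)"
    unfolding prod.distrib[symmetric] by (rule prod.cong) auto
  finally show ?thesis ..
qed

lemma sum_charge:
  assumes b: "b \<in> webs V" and V: "finite V" shows "(\<Sum>i\<in>V. charge b i) = 0"
proof -
  have "(\<Sum>i\<in>V. charge b i) = (\<Sum>i\<in>V - ups b. charge b i) + (\<Sum>i\<in>ups b. charge b i)"
    by (rule sum.subset_diff[OF ups_subset[OF b] V])
  also have "(\<Sum>i\<in>V - ups b. charge b i) = (\<Sum>i\<in>V - ups b. - 1)" by (rule sum.cong) (auto simp: charge_def)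
  also have "(\<Sum>i\<in>ups b. charge b i) = (\<Sum>i\<in>ups b. 1)" by (rule sum.cong) (auto simp: charge_def)
  finally show ?thesis using card_ups(1)[OF b V] by simp
qed

lemma partner_mem: "i \<in> {0<..2 * M} \<Longrightarrow> partner i \<in> {0<..2 * M} \<and> partner i \<noteq> i \<and> partner (partner i) = i"
  by (auto simp: partner_def elim!: evenE oddE; presburger)

text \<open>By neutrality the other signs add up to \<open>- charge b i\<close>, which yields
  \<open>-1/2\<close>; the partner correction yields the other half. So every point scales with the
  first power of \<open>lam\<close> in \<open>fused_g_scale\<close>.\<close>

lemma sum_charge_exp:
  assumes b: "b \<in> webs {0<..2 * M}" and i: "i \<in> {0<..2 * M}"
  shows "(\<Sum>k\<in>{0<..2 * M} - {i}. charge_exp partner (charge b) i k) = - 1"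
proof -
  let ?V = "{0<..2 * M}"
  have "(\<Sum>k\<in>?V - {i}. charge_exp partner (charge b) i k) =
     charge b i / 2 * (\<Sum>k\<in>?V - {i}. charge b k) - (\<Sum>k\<in>?V - {i}. if k = partner i then 1 / 2 else 0)"
    unfolding sum_distrib_left sum_subtractf[symmetric] by (rule sum.cong) (auto simp: charge_exp_def)
  also have "(\<Sum>k\<in>?V - {i}. charge b k) = - charge b i"
    using sum.remove[OF _ i, of "charge b"] sum_charge[OF b] by simp
  also have "(\<Sum>k\<in>?V - {i}. if k = partner i then 1 / 2 else 0) = (1 / 2 :: real)"
    using partner_mem[OF i] by (subst sum.delta) auto
  finally show ?thesis using charge_sq[of b i] by simp
qed

text \<open>Under a Moebius map each difference is rescaled by one factor from either end, and the
  blocks depend on the differences only.\<close>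

lemma fused_g_scale:
  assumes M: "0 < M" and p: "p \<in> webs {0<..2 * M}" and u: "unlinked p" and x: "x \<in> config (pairs (2 * M))"
    and lam: "\<And>i. i \<in> {0<..2 * M} \<Longrightarrow> lam i > 0"
    and x': "\<And>i k. (i, k) \<in> pairs (2 * M) \<Longrightarrow> x' k - x' i = (x k - x i) / (lam i * lam k)"
  shows "fused_g M p x' = (\<Prod>i\<in>{0<..2 * M}. lam i) * fused_g M p x"
proof -
  let ?V = "{0<..2 * M}" and ?A = "pairs (2 * M)"
  have V: "i \<in> ?V" "k \<in> ?V" if "(i, k) \<in> ?A" for i k using that by (auto simp: pairs_def)
  have lt: "x i < x k" if "(i, k) \<in> ?A" for i k using x that by (auto simp: config_def)
  have c': "x' \<in> config ?A"
  proof -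
    have "x' i < x' k" if ik: "(i, k) \<in> ?A" for i k
    proof -
      have "(x k - x i) / (lam i * lam k) > 0" using lt[OF ik] lam V[OF ik] by simp
      then show ?thesis using x'[OF ik] by simp
    qed
    then show ?thesis by (auto simp: config_def)
  qed
  have main: "prodpow ?A (charge_exp partner (charge b)) x' = (\<Prod>i\<in>?V. lam i) * prodpow ?A (charge_exp partner (charge b)) x"
    if b: "b \<in> webs ?V" for b
  proof -
    let ?e = "charge_exp partner (charge b)"
    let ?F = "\<lambda>i k. lam i powr - ?e i k"
    have "prodpow ?A ?e x' = (\<Prod>(i, k)\<in>?A. (x k - x i) powr ?e i k * (?F i k * ?F k i))"
      unfolding prodpow_def
    proof (rule prod.cong[OF refl], clarify)
      fix i k assume ik: "(i, k) \<in> ?A"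
      have pos: "x k - x i > 0" "lam i > 0" "lam k > 0" using lt[OF ik] lam V[OF ik] by auto
      have "k = partner i \<longleftrightarrow> i = partner k" using partner_mem V[OF ik] by metis
      then have sym: "?e k i = ?e i k" by (simp add: charge_exp_def)
      show "(x' k - x' i) powr ?e i k = (x k - x i) powr ?e i k * (?F i k * ?F k i)"
        unfolding x'[OF ik] sym using pos by (simp add: powr_divide powr_mult powr_minus_divide)
    qed
    also have "\<dots> = prodpow ?A ?e x * (\<Prod>(i, k)\<in>?A. ?F i k * ?F k i)"
      unfolding prodpow_def prod.distrib[symmetric] by (rule prod.cong) auto
    also have "(\<Prod>(i, k)\<in>?A. ?F i k * ?F k i) = (\<Prod>i\<in>?V. \<Prod>k\<in>?V - {i}. ?F i k)"
      unfolding pairs_on_full[symmetric] by (rule prod_pairs_sym) simp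
    also have "\<dots> = (\<Prod>i\<in>?V. lam i)"
    proof (rule prod.cong[OF refl])
      fix i assume i: "i \<in> ?V"
      have "(\<Prod>k\<in>?V - {i}. ?F i k) = lam i powr (\<Sum>k\<in>?V - {i}. - ?e i k)"
        using lam[OF i] by (intro powr_sum[symmetric]) auto
      also have "\<dots> = lam i" using lam[OF i] by (simp add: sum_negf sum_charge_exp[OF b i])
      finally show "(\<Prod>k\<in>?V - {i}. ?F i k) = lam i" .
    qed
    finally show ?thesis by (simp only: mult.commute)
  qed
  show ?thesis
    unfolding fused_g_expansion[OF M p u c'] fused_g_expansion[OF M p u x] sum_distrib_left
    by (rule sum.cong[OF refl]) (simp only: main mult.left_commute)
qed

lemma prod_diag: "(\<Prod>i\<in>{0<..2 * M}. f (Suc i div 2)) = (\<Prod>j\<in>{1..M}. (f j :: real)\<^sup>2)"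
proof (induction M)
  case (Suc M)
  have "{0<..2 * Suc M} = insert (2 * M + 2) (insert (2 * M + 1) {0<..2 * M})" by auto
  moreover have "Suc (2 * M + 2) div 2 = Suc M" "Suc (2 * M + 1) div 2 = Suc M" by simp_all
  ultimately have "(\<Prod>i\<in>{0<..2 * Suc M}. f (Suc i div 2)) = f (Suc M) * (f (Suc M) * (\<Prod>i\<in>{0<..2 * M}. f (Suc i div 2)))"
    by simp
  then show ?case unfolding Suc.IH by (simp add: power2_eq_square)
qed simp

lemma moebius_map_diff:
  assumes "c * s + d \<noteq> 0" "c * t + d \<noteq> 0"
  shows "moebius_map a b c d t - moebius_map a b c d s = (a * d - b * c) * (t - s) / ((c * s + d) * (c * t + d))"
proof -
  have "moebius_map a b c d t - moebius_map a b c d s =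
      ((a * t + b) * (c * s + d) - (a * s + b) * (c * t + d)) / ((c * t + d) * (c * s + d))"
    unfolding moebius_map_def by (rule diff_frac_eq[OF assms(2,1)])
  also have "(a * t + b) * (c * s + d) - (a * s + b) * (c * t + d) = (a * d - b * c) * (t - s)"
    by (simp add: algebra_simps)
  finally show ?thesis by (simp only: mult.commute)
qed

lemma deriv_moebius_map:
  assumes "c * t + d \<noteq> 0"
  shows "deriv (moebius_map a b c d) t = (a * d - b * c) / (c * t + d)\<^sup>2"
proof (rule DERIV_imp_deriv)
  have n: "((\<lambda>x. a * x + b) has_real_derivative a) (at t)" "((\<lambda>x. c * x + d) has_real_derivative c) (at t)"
    by (auto intro!: derivative_eq_intros)
  have "(a * (c * t + d) - (a * t + b) * c) / ((c * t + d) * (c * t + d)) = (a * d - b * c) / (c * t + d)\<^sup>2"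
    by (simp add: algebra_simps power2_eq_square)
  then show "(moebius_map a b c d has_real_derivative (a * d - b * c) / (c * t + d)\<^sup>2) (at t)"
    using DERIV_divide[OF n assms] unfolding moebius_map_def[abs_def] by simp
qed

lemma fused_g_moebius:
  assumes M: "0 < M" and p: "p \<in> webs {0<..2 * M}" and u: "unlinked p"
    and y: "strict_mono_on {1..M} y" and D: "a * d - b * c > 0"
    and nz: "\<And>i. i \<in> {1..M} \<Longrightarrow> c * y i + d \<noteq> 0"
    and my: "strict_mono_on {1..M} (\<lambda>i. moebius_map a b c d (y i))"
  shows "fused_g M p (diag y) =
    (\<Prod>i=1..M. deriv (moebius_map a b c d) (y i) powr 1) * fused_g M p (diag (\<lambda>i. moebius_map a b c d (y i)))"
proof -
  let ?m = "moebius_map a b c d" and ?V = "{0<..2 * M}"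
  define q where "q t = c * t + d" for t
  define D where "D = a * d - b * c"
  have D0: "D > 0" using assms(5) by (simp add: D_def)
  \<comment> \<open>The map keeps the order of the points, so by the formula for differences the
    denominators at any two of them have the same sign.\<close>
  have sgn1: "q (y i) * q (y k) > 0" if ik: "i \<in> {1..M}" "k \<in> {1..M}" "i < k" for i k
  proof -
    have "y i < y k" "?m (y i) < ?m (y k)"
      using strict_mono_onD[OF y ik] strict_mono_onD[OF my ik] by auto
    moreover have e: "?m (y k) - ?m (y i) = D * (y k - y i) / (q (y i) * q (y k))"
      unfolding D_def q_def by (rule moebius_map_diff[OF nz[OF ik(1)] nz[OF ik(2)]])
    ultimately have "D * (y k - y i) / (q (y i) * q (y k)) > 0" "D * (y k - y i) > 0"
      using D0 unfolding e[symmetric] by simp_all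
    then show ?thesis by (auto simp: zero_less_divide_iff)
  qed
  have sgn: "q (y i) * q (y k) > 0" if ik: "i \<in> {1..M}" "k \<in> {1..M}" for i k
  proof -
    consider "i < k" | "k < i" | "i = k" by linarith
    then show ?thesis
    proof cases
      case 3 then show ?thesis using nz[OF ik(1)] by (simp add: q_def zero_less_mult_iff) linarith
    qed (use sgn1[of i k] sgn1[of k i] ik in \<open>auto simp: mult.commute\<close>)
  qed
  have par: "Suc i div 2 \<in> {1..M}" if "i \<in> ?V" for i using that by auto
  have sgnd: "q (diag y i) * q (diag y k) > 0" if "i \<in> ?V" "k \<in> ?V" for i k
    unfolding diag_def by (intro sgn par that)
  \<comment> \<open>The derivative of the map to the power \<open>-1/2\<close>. The two points of a
    pair together give the inverse of the derivative.\<close>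
  define lam where "lam t = \<bar>q t\<bar> / sqrt D" for t
  define X where "X s i = diag y i + (if even i then s else 0)" for s i
  have X: "((\<lambda>s. X s i) \<longlongrightarrow> diag y i) (at_right 0)" for i
    by (cases "even i") (auto simp: X_def intro!: tendsto_eq_intros)
  have qX: "((\<lambda>s. q (X s i)) \<longlongrightarrow> q (diag y i)) (at_right 0)" for i
    unfolding q_def by (intro tendsto_intros X)
  have "\<forall>\<^sub>F s in at_right 0. q (X s (fst e)) * q (X s (snd e)) > 0" if "e \<in> ?V \<times> ?V" for e
    by (rule order_tendstoD(1)[OF tendsto_mult[OF qX qX]]) (use sgnd that in auto)
  then have "\<forall>\<^sub>F s in at_right 0. \<forall>e\<in>?V \<times> ?V. q (X s (fst e)) * q (X s (snd e)) > 0"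
    by (intro eventually_ball_finite) auto
  moreover have "\<forall>\<^sub>F s in at_right 0. X s \<in> config (cross M)"
    by (rule eventually_config[OF finite_cross cross_subset diag_config[OF y] X])
  moreover have "\<forall>\<^sub>F s in at_right 0. (0::real) < s" by (rule eventually_at_right_less)
  ultimately have ev: "\<forall>\<^sub>F s in at_right 0. fused_g M p (\<lambda>i. ?m (X s i)) = (\<Prod>i\<in>?V. lam (X s i)) * fused_g M p (X s)"
  proof eventually_elim
    case (elim s)
    have pos: "q (X s i) * q (X s k) > 0" if "i \<in> ?V" "k \<in> ?V" for i k
      using bspec[OF elim(1), of "(i, k)"] that by simp
    have nzX: "q (X s i) \<noteq> 0" if "i \<in> ?V" for i using pos[OF that that] by auto
    have "X s i < X s k" if ik: "(i, k) \<in> pairs (2 * M)" for i k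
    proof (cases "Suc i div 2 < Suc k div 2")
      case True
      then show ?thesis using elim(2) ik by (auto simp: config_def cross_def pairs_def)
    next
      case False
      then have "odd i" "k = Suc i" using ik by (auto simp: pairs_def; presburger)+
      then show ?thesis using elim(3) by (simp add: X_def diag_def)
    qed
    then have c: "X s \<in> config (pairs (2 * M))" by (auto simp: config_def)
    show ?case
    proof (rule fused_g_scale[OF M p u c])
      show "0 < lam (X s i)" if "i \<in> ?V" for i using nzX[OF that] D0 by (simp add: lam_def)
      fix i k assume "(i, k) \<in> pairs (2 * M)"
      then have ik: "i \<in> ?V" "k \<in> ?V" by (auto simp: pairs_def)
      have "lam (X s i) * lam (X s k) = \<bar>q (X s i) * q (X s k)\<bar> / (sqrt D * sqrt D)"
        by (simp add: lam_def abs_mult)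
      also have "\<dots> = q (X s i) * q (X s k) / D" using pos[OF ik] D0 by simp
      finally have "(X s k - X s i) / (lam (X s i) * lam (X s k)) = D * (X s k - X s i) / (q (X s i) * q (X s k))"
        by simp
      then show "?m (X s k) - ?m (X s i) = (X s k - X s i) / (lam (X s i) * lam (X s k))"
        using moebius_map_diff[of c "X s i" d "X s k" a b] nzX ik by (simp add: q_def D_def)
    qed
  qed
  have L1: "((\<lambda>s. fused_g M p (\<lambda>i. ?m (X s i))) \<longlongrightarrow> fused_g M p (diag (\<lambda>i. ?m (y i)))) (at_right 0)"
  proof (rule smooth_tendsto[OF smooth_fused_g[OF p] finite_cross cross_subset diag_config[OF my]])
    fix i assume i: "i \<in> ?V"
    have "q (diag y i) \<noteq> 0" using sgnd[OF i i] by auto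
    then have "((\<lambda>s. (a * X s i + b) / (c * X s i + d)) \<longlongrightarrow> (a * diag y i + b) / (c * diag y i + d)) (at_right 0)"
      by (intro tendsto_intros X) (simp add: q_def)
    then show "((\<lambda>s. ?m (X s i)) \<longlongrightarrow> diag (\<lambda>i. ?m (y i)) i) (at_right 0)"
      by (simp add: moebius_map_def diag_def)
  qed
  have L2: "((\<lambda>s. (\<Prod>i\<in>?V. lam (X s i)) * fused_g M p (X s)) \<longlongrightarrow>
      (\<Prod>i\<in>?V. lam (diag y i)) * fused_g M p (diag y)) (at_right 0)"
    unfolding lam_def using D0
    by (intro tendsto_mult tendsto_prod tendsto_divide tendsto_rabs tendsto_const qX
      smooth_tendsto[OF smooth_fused_g[OF p] finite_cross cross_subset diag_config[OF y] X]) simp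
  have "fused_g M p (diag (\<lambda>i. ?m (y i))) = (\<Prod>i\<in>?V. lam (diag y i)) * fused_g M p (diag y)"
    by (rule tendsto_unique[OF trivial_limit_at_right_real iffD1[OF tendsto_cong[OF ev] L1] L2])
  also have "(\<Prod>i\<in>?V. lam (diag y i)) = (\<Prod>j=1..M. (lam (y j))\<^sup>2)"
    unfolding diag_def by (rule prod_diag)
  finally have 1: "fused_g M p (diag (\<lambda>i. ?m (y i))) = (\<Prod>j=1..M. (lam (y j))\<^sup>2) * fused_g M p (diag y)" .
  have "(\<Prod>i=1..M. deriv ?m (y i) powr 1) * (\<Prod>j=1..M. (lam (y j))\<^sup>2) = 1"
    unfolding prod.distrib[symmetric]
  proof (rule prod.neutral, rule ballI)
    fix i assume i: "i \<in> {1..M}"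
    have q0: "(q (y i))\<^sup>2 > 0" using nz[OF i] by (simp add: q_def)
    have d: "deriv ?m (y i) = D / (q (y i))\<^sup>2" using deriv_moebius_map[OF nz[OF i]] by (simp add: D_def q_def)
    have l: "(lam (y i))\<^sup>2 = (q (y i))\<^sup>2 / D" using D0 by (simp add: lam_def power_divide)
    have "D / (q (y i))\<^sup>2 > 0" using D0 q0 by simp
    then show "deriv ?m (y i) powr 1 * (lam (y i))\<^sup>2 = 1" unfolding d l using q0 D0 by simp
  qed
  then show ?thesis unfolding 1 by (simp only: mult.assoc[symmetric] mult_1_left)
qed

section \<open>The equation for the merged pair\<close>

locale fused_point =
  fixes M j :: nat and web :: "nat \<Rightarrow> nat"
  assumes j: "j \<in> {1..M}" and web: "web \<in> webs {0<..2 * M}" and unl: "unlinked web"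
begin

definition P :: nat where "P = 2 * j - 1"
definition Q :: nat where "Q = 2 * j"
definition J :: "nat set" where "J = {0<..2 * M} - {P, Q}"

lemma PQ: "P < Q" "Q = Suc P" "odd P" "even Q" "0 < P" "Q \<le> 2 * M" "Suc P div 2 = j" "Suc Q div 2 = j"
  using j by (auto simp: P_def Q_def)

lemma parent_j: "Suc i div 2 = j \<Longrightarrow> i = P \<or> i = Q"
  unfolding P_def Q_def by presburger

lemma J_mem: "i \<in> J \<longleftrightarrow> 0 < i \<and> i \<le> 2 * M \<and> i \<noteq> P \<and> i \<noteq> Q"
  by (auto simp: J_def)

lemma points: "{0<..2 * M} = insert Q (insert P J)" "Q \<notin> insert P J"
  using PQ by (auto simp: J_def)

lemma partner_PQ: "partner P = Q" "partner Q = P"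
  using PQ by (simp_all add: partner_def)

lemma partner_J:
  assumes "i \<in> J" shows "partner i \<in> J" "partner i \<noteq> i" "partner (partner i) = i"
proof -
  have "partner i \<noteq> P \<and> partner i \<noteq> Q \<and> 0 < partner i \<and> partner i \<le> 2 * M"
  proof (cases "odd i")
    case True
    then have "i \<noteq> 2 * M" by auto
    moreover have "Suc i \<noteq> P" using PQ(3) True by (metis even_Suc)
    ultimately show ?thesis using assms PQ True by (auto simp: J_mem partner_def)
  next
    case False
    moreover obtain n where "i = Suc n" using assms by (cases i) (auto simp: J_mem)
    ultimately show ?thesis using assms PQ by (auto simp: J_mem partner_def intro!: Nat.gr0I)
  qed
  then show "partner i \<in> J" by (simp add: J_mem)
  show "partner i \<noteq> i" "partner (partner i) = i"
    using assms by (auto simp: J_mem partner_def)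
qed

sublocale v: vertex J P partner
  by standard (use partner_J in \<open>auto simp: J_def\<close>)

lemma pairs_split: "pairs (2 * M) = insert (P, Q) (v.E \<union> star Q J)" "(P, Q) \<notin> v.E \<union> star Q J"
proof -
  have "star Q (insert P J) = insert (P, Q) (star Q J)" using PQ(1) by (simp add: star_def)
  then show "pairs (2 * M) = insert (P, Q) (v.E \<union> star Q J)"
    unfolding pairs_on_full[symmetric] points(1) pairs_on_insert[OF points(2)] by simp
  show "(P, Q) \<notin> v.E \<union> star Q J"
    using points(2) PQ(1) by (auto simp: pairs_on_def star_def J_mem split: if_splits)
qed

lemma disjoint_star: "v.E \<inter> star Q J = {}" "pairs_on J \<inter> star P J = {}"
  using points(2) by (auto simp: pairs_on_def star_def J_mem split: if_splits)

lemma star_bounds: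
  "finite (v.E \<union> star Q J)" "v.E \<union> star Q J \<subseteq> {0<..2 * M} \<times> {0<..2 * M}"
proof -
  show *: "v.E \<union> star Q J \<subseteq> {0<..2 * M} \<times> {0<..2 * M}"
  proof -
    have "v.E \<union> star Q J \<subseteq> pairs (2 * M)" unfolding pairs_split(1) by blast
    also have "\<dots> \<subseteq> {0<..2 * M} \<times> {0<..2 * M}" by (auto simp: pairs_def)
    finally show ?thesis .
  qed
  show "finite (v.E \<union> star Q J)" by (rule finite_subset[OF *]) simp
qed

lemma merge_config:
  assumes x: "x \<in> config v.E" shows "x(Q := x P) \<in> config (v.E \<union> star Q J)"
proof -
  have lt: "x i < x k" if "i \<in> insert P J" "k \<in> insert P J" "i < k" for i k
    using x that by (auto simp: config_def pairs_on_def)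
  have 1: "(x(Q := x P)) i < (x(Q := x P)) k" if "(i, k) \<in> v.E" for i k
  proof -
    have "i \<noteq> Q" "k \<noteq> Q" using that points(2) by (auto simp: pairs_on_def)
    then show ?thesis using x that by (auto simp: config_def)
  qed
  have 2: "(x(Q := x P)) i < (x(Q := x P)) k" if ik: "(i, k) \<in> star Q J" for i k
  proof -
    obtain m where m: "m \<in> J" "(i, k) = (if m < Q then (m, Q) else (Q, m))" using ik by (auto simp: star_def)
    have ne: "m \<noteq> P" "m \<noteq> Q" using m(1) by (auto simp: J_mem)
    show ?thesis
    proof (cases "m < Q")
      case True
      then have "m < P" using ne PQ(2) by simp
      then show ?thesis using lt[of m P] m True ne by simp
    next
      case False
      then have "P < m" using PQ(1) by simp
      then show ?thesis using lt[of P m] m False ne by simp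
    qed
  qed
  show ?thesis using 1 2 unfolding config_def by (auto simp del: fun_upd_apply)
qed

definition gap :: "nat \<Rightarrow> (nat \<Rightarrow> real) \<Rightarrow> real" where
  "gap m x = (if m < P then x P - x m else x m - x P)"

lemma gap_pos: "x \<in> config v.E \<Longrightarrow> m \<in> J \<Longrightarrow> gap m x > 0"
  by (auto simp: gap_def config_def pairs_on_def J_mem)

lemma prodpow_star:
  assumes "\<And>m. m \<in> J \<Longrightarrow> e m P = e P m"
  shows "prodpow v.E e x = prodpow (pairs_on J) e x * (\<Prod>m\<in>J. gap m x powr e P m)"
  unfolding pairs_on_insert[OF v.c] gap_def
  by (rule prodpow_star_union) (use assms v.J v.c disjoint_star finite_pairs_on in auto)

lemma prodpow_cong:
  assumes "\<And>i k. (i, k) \<in> A \<Longrightarrow> e i k = e' i k \<and> x i = x' i \<and> x k = x' k"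
  shows "prodpow A e x = prodpow A e' x'"
  unfolding prodpow_def by (rule prod.cong) (use assms in auto)

text \<open>Coordinate \<open>Q\<close> is overwritten by coordinate \<open>P\<close>, so this is a
  function of the merged point \<open>x P\<close> and of the points in \<open>J\<close>.\<close>

definition hat :: "(nat \<Rightarrow> real) \<Rightarrow> real" where
  "hat x = fused_g M web (x(Q := x P))"

text \<open>Signs relative to the one at \<open>P\<close>. Products of two signs are unchanged, and
  two equal signs at \<open>P\<close> and \<open>Q\<close> merge to charge 1, as
  \<open>same_exp\<close> requires.\<close>

definition rel_charge :: "(nat \<Rightarrow> nat) \<Rightarrow> nat \<Rightarrow> real" where
  "rel_charge b i = charge b P * charge b i"

lemma rel_charge_sq: "rel_charge b i * rel_charge b i = 1"
  by (simp add: rel_charge_def charge_def)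

text \<open>Equal signs at \<open>P\<close> and \<open>Q\<close> merge to a vertex operator of
  charge 1. Opposite signs leave charge 0 and a current, which arises from the derivative in
  \<open>merge_limit\<close>.\<close>

definition merged :: "(nat \<Rightarrow> nat) \<Rightarrow> (nat \<Rightarrow> real) \<Rightarrow> real" where
  "merged b = (if charge b P = charge b Q then prodpow v.E (v.same_exp (rel_charge b))
     else (\<lambda>x. v.p (rel_charge b) 1 x * prodpow (pairs_on J) (charge_exp partner (rel_charge b)) x))"

lemma merged_null: "v.nullvec (merged b)"
  unfolding merged_def using v.nullvec_same[of "rel_charge b"] v.nullvec_mixed[of "rel_charge b"] rel_charge_sq by simp

lemma charge_exp_rel: "charge_exp partner (rel_charge b) = charge_exp partner (charge b)"
  by (auto simp: charge_exp_def rel_charge_def charge_def fun_eq_iff)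

lemma charge_exp_J:
  assumes "m \<in> J"
  shows "charge_exp partner s P m = s P * s m / 2" "charge_exp partner s m P = s P * s m / 2"
    "charge_exp partner s Q m = s Q * s m / 2" "charge_exp partner s m Q = s Q * s m / 2"
  using partner_J(1)[OF assms] assms partner_PQ by (auto simp: charge_exp_def J_mem)

text \<open>At coinciding points the exponents of \<open>P\<close> and \<open>Q\<close> towards any
  other point add up: they double for equal signs and cancel for opposite ones.\<close>

lemma prodpow_merged:
  assumes x: "x \<in> config v.E"
  shows "prodpow (v.E \<union> star Q J) (charge_exp partner (charge b)) (x(Q := x P)) =
    (if charge b P = charge b Q then merged b x else prodpow (pairs_on J) (charge_exp partner (rel_charge b)) x)"
proof -
  let ?e = "charge_exp partner (charge b)"
  define x0 where x0: "x0 = x(Q := x P)"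
  have x0Q: "x0 Q = x P" and x0m: "\<And>m. m \<noteq> Q \<Longrightarrow> x0 m = x m" by (simp_all add: x0)
  have "prodpow (v.E \<union> star Q J) ?e x0 =
      prodpow v.E ?e x0 * (\<Prod>m\<in>J. (if m < Q then x0 Q - x0 m else x0 m - x0 Q) powr ?e Q m)"
    by (rule prodpow_star_union) (use v.finite_E v.J disjoint_star points(2) in \<open>auto simp: charge_exp_J\<close>)
  also have "(\<Prod>m\<in>J. (if m < Q then x0 Q - x0 m else x0 m - x0 Q) powr ?e Q m) = (\<Prod>m\<in>J. gap m x powr ?e Q m)"
  proof (rule prod.cong[OF refl])
    fix m assume "m \<in> J"
    then have "m \<noteq> Q" "m < Q \<longleftrightarrow> m < P" using PQ(2) by (auto simp: J_mem)
    then show "(if m < Q then x0 Q - x0 m else x0 m - x0 Q) powr ?e Q m = gap m x powr ?e Q m"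
      by (simp add: gap_def x0Q x0m)
  qed
  also have "prodpow v.E ?e x0 = prodpow (pairs_on J) ?e x * (\<Prod>m\<in>J. gap m x powr ?e P m)"
  proof -
    have "prodpow v.E ?e x0 = prodpow v.E ?e x"
    proof (rule prodpow_cong)
      fix i k assume "(i, k) \<in> v.E"
      then have "i \<noteq> Q" "k \<noteq> Q" using points(2) by (auto simp: pairs_on_def)
      then show "?e i k = ?e i k \<and> x0 i = x i \<and> x0 k = x k" by (simp add: x0m)
    qed
    also have "\<dots> = prodpow (pairs_on J) ?e x * (\<Prod>m\<in>J. gap m x powr ?e P m)"
      by (rule prodpow_star) (simp add: charge_exp_J)
    finally show ?thesis .
  qed
  finally have "prodpow (v.E \<union> star Q J) ?e x0 = prodpow (pairs_on J) ?e x *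
      ((\<Prod>m\<in>J. gap m x powr ?e P m) * (\<Prod>m\<in>J. gap m x powr ?e Q m))"
    by (simp only: mult.assoc)
  also have "(\<Prod>m\<in>J. gap m x powr ?e P m) * (\<Prod>m\<in>J. gap m x powr ?e Q m) =
      (\<Prod>m\<in>J. gap m x powr ((charge b P + charge b Q) * charge b m / 2))"
    unfolding prod.distrib[symmetric]
    by (rule prod.cong[OF refl]) (simp add: charge_exp_J powr_add[symmetric] add_divide_distrib[symmetric] distrib_right)
  finally have 1: "prodpow (v.E \<union> star Q J) ?e x0 = prodpow (pairs_on J) ?e x *
      (\<Prod>m\<in>J. gap m x powr ((charge b P + charge b Q) * charge b m / 2))" .
  show ?thesis
  proof (cases "charge b P = charge b Q")
    case True
    have "merged b x = prodpow (pairs_on J) (v.same_exp (rel_charge b)) x *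
        (\<Prod>m\<in>J. gap m x powr v.same_exp (rel_charge b) P m)"
      unfolding merged_def if_P[OF True]
      by (rule prodpow_star) (auto simp: v.same_exp_def J_mem)
    also have "prodpow (pairs_on J) (v.same_exp (rel_charge b)) x = prodpow (pairs_on J) ?e x"
      by (rule prodpow_cong) (use v.c in \<open>auto simp: pairs_on_def v.same_exp_def charge_exp_rel\<close>)
    also have "(\<Prod>m\<in>J. gap m x powr v.same_exp (rel_charge b) P m) =
       (\<Prod>m\<in>J. gap m x powr ((charge b P + charge b Q) * charge b m / 2))"
      by (rule prod.cong) (use True in \<open>simp_all add: v.same_exp_def rel_charge_def\<close>)
    finally show ?thesis using 1 True unfolding x0[symmetric] by simp
  next
    case False
    then have z: "charge b P + charge b Q = 0" by (auto simp: charge_def split: if_splits)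
    have "(\<Prod>m\<in>J. gap m x powr ((charge b P + charge b Q) * charge b m / 2)) = 1"
      by (rule prod.neutral) (use gap_pos[OF x] z in force)
    then show ?thesis using 1 False unfolding x0[symmetric] by (simp add: charge_exp_rel)
  qed
qed

lemma logd_merged:
  assumes ne: "charge b P \<noteq> charge b Q"
  shows "logd (v.E \<union> star Q J) (charge_exp partner (charge b)) Q (x(Q := x P)) = v.p (rel_charge b) 1 x"
proof -
  let ?e = "charge_exp partner (charge b)"
  define x0 where x0: "x0 = x(Q := x P)"
  have x0Q: "x0 Q = x P" and x0m: "\<And>m. m \<noteq> Q \<Longrightarrow> x0 m = x m" by (simp_all add: x0)
  have z: "charge b Q = - charge b P" using ne by (auto simp: charge_def split: if_splits)
  have "logd (v.E \<union> star Q J) ?e Q x0 = logd v.E ?e Q x0 + (\<Sum>m\<in>J. ?e Q m / (x0 Q - x0 m))"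
    by (rule logd_star_union) (use v.finite_E v.J disjoint_star points(2) in \<open>auto simp: charge_exp_J\<close>)
  also have "logd v.E ?e Q x0 = 0" by (rule logd_absent[OF pairs_on_subset points(2)])
  also have "(\<Sum>m\<in>J. ?e Q m / (x0 Q - x0 m)) = (\<Sum>m\<in>J. rel_charge b m / 2 * (v.a m x) ^ 1)"
  proof (rule sum.cong[OF refl])
    fix m assume m: "m \<in> J"
    have "?e Q m / (x0 Q - x0 m) = - (rel_charge b m / 2) / (x P - x m)"
      using m z by (simp add: charge_exp_J rel_charge_def J_mem x0Q x0m)
    also have "\<dots> = (rel_charge b m / 2) / (x m - x P)"
      by (metis minus_diff_eq minus_divide_divide)
    finally show "?e Q m / (x0 Q - x0 m) = rel_charge b m / 2 * (v.a m x) ^ 1"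
      by (simp add: v.a_def)
  qed
  finally show ?thesis unfolding x0[symmetric] v.p_def by simp
qed

text \<open>\<open>merge_limit\<close> applied to the distance \<open>t\<close> of \<open>Q\<close>
  from \<open>P\<close>, the other points being distinct and fixed. Blocks with equal signs at
  \<open>P\<close> and \<open>Q\<close> have exponent 0 in \<open>t\<close>, the others exponent -1.
  That the whole sum converges is known from the smoothness of \<open>fused_g\<close> across
  \<open>t = 0\<close>.\<close>

lemma hat_expansion:
  assumes x: "x \<in> config v.E"
  shows "hat x = (\<Sum>b\<in>webs {0<..2 * M}. web_inv {0<..2 * M} web b * merged b x)"
proof -
  let ?V = "{0<..2 * M}" and ?E0 = "v.E \<union> star Q J" and ?x0 = "x(Q := x P)"
  let ?K = "web_inv ?V web" and ?same = "\<lambda>b. charge b P = charge b Q"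
  let ?u = "\<lambda>b. prodpow ?E0 (charge_exp partner (charge b))"
  define X where "X t = x(Q := x P + t)" for t
  have x0: "?x0 \<in> config ?E0" by (rule merge_config[OF x])
  have X: "((\<lambda>t. X t i) \<longlongrightarrow> ?x0 i) (at_right 0)" for i
    by (cases "i = Q") (auto simp: X_def intro!: tendsto_eq_intros)
  define S where "S t = (\<Sum>b\<in>webs ?V. if ?same b then ?K b * ?u b (X t) else 0)" for t
  define m where "m t = (\<Sum>b\<in>webs ?V. if ?same b then 0 else ?K b * ?u b (X t))" for t
  have fin: "finite (webs ?V)" by (rule finite_webs) simp
  have us: "smooth ?V ?E0 (?u b)" for b by (rule smooth_prodpow[OF star_bounds(1) subset_refl])
  have "?x0 \<in> config (cross M)"
  proof -
    have "cross M \<subseteq> ?E0"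
    proof
      fix e assume "e \<in> cross M"
      moreover have "(P, Q) \<notin> cross M" using PQ(7,8) by (simp add: cross_def)
      ultimately have "e \<in> pairs (2 * M)" "e \<noteq> (P, Q)" unfolding pairs_cross(1) by auto
      then show "e \<in> ?E0" unfolding pairs_split(1) by blast
    qed
    then show ?thesis using x0 by (rule config_mono)
  qed
  then have "((\<lambda>t. fused_g M web (X t)) \<longlongrightarrow> hat x) (at_right 0)"
    unfolding hat_def using X by (rule smooth_tendsto[OF smooth_fused_g[OF web] finite_cross cross_subset])
  moreover have "(S \<longlongrightarrow> (\<Sum>b\<in>webs ?V. if ?same b then ?K b * ?u b ?x0 else 0)) (at_right 0)"
    unfolding S_def[abs_def]
  proof (rule tendsto_sum)
    fix b
    have "((\<lambda>t. ?u b (X t)) \<longlongrightarrow> ?u b ?x0) (at_right 0)" by (rule smooth_tendsto[OF us star_bounds x0 X])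
    then show "((\<lambda>t. if ?same b then ?K b * ?u b (X t) else 0) \<longlongrightarrow> (if ?same b then ?K b * ?u b ?x0 else 0)) (at_right 0)"
      by (cases "?same b") (auto intro!: tendsto_intros)
  qed
  moreover have "(m has_real_derivative
      (\<Sum>b\<in>webs ?V. if ?same b then 0 else ?K b * (?u b ?x0 * logd ?E0 (charge_exp partner (charge b)) Q ?x0))) (at 0)"
    unfolding m_def[abs_def]
  proof (rule DERIV_sum)
    fix b
    have "has_pd ?E0 Q (?u b) (\<lambda>x. ?u b x * logd ?E0 (charge_exp partner (charge b)) Q x)"
      by (rule has_pd_prodpow[OF star_bounds(1) subset_refl star_bounds]) simp
    then have "((\<lambda>t. ?u b (?x0(Q := t))) has_real_derivative ?u b ?x0 * logd ?E0 (charge_exp partner (charge b)) Q ?x0) (at (?x0 Q))"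
      using x0 unfolding has_pd_def by blast
    then have d: "((\<lambda>t. ?u b (x(Q := t))) has_real_derivative ?u b ?x0 * logd ?E0 (charge_exp partner (charge b)) Q ?x0) (at (x P + 0))"
      by simp
    have "((\<lambda>t. x P + t) has_real_derivative 1) (at 0)" by (auto intro!: derivative_eq_intros)
    from DERIV_chain2[OF d this]
    have "((\<lambda>t. ?u b (X t)) has_real_derivative ?u b ?x0 * logd ?E0 (charge_exp partner (charge b)) Q ?x0) (at 0)"
      by (simp add: X_def)
    from DERIV_cmult[OF this, of "?K b"]
    show "((\<lambda>t. if ?same b then 0 else ?K b * ?u b (X t)) has_real_derivative
      (if ?same b then 0 else ?K b * (?u b ?x0 * logd ?E0 (charge_exp partner (charge b)) Q ?x0))) (at 0)"
      by (cases "?same b") simp_all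
  qed
  moreover have "\<forall>\<^sub>F t in at_right 0. fused_g M web (X t) = S t + m t / t"
  proof -
    have "\<forall>\<^sub>F t in at_right 0. X t \<in> config ?E0" by (rule eventually_config[OF star_bounds x0 X])
    moreover have "\<forall>\<^sub>F t in at_right 0. (0::real) < t" by (rule eventually_at_right_less)
    ultimately show ?thesis
    proof eventually_elim
      case (elim t)
      have XPQ: "X t P = x P" "X t Q = x P + t" using PQ(1) by (auto simp: X_def)
      have c: "X t \<in> config (pairs (2 * M))"
        using elim XPQ unfolding pairs_split(1) config_def by simp
      have tm: "?K b * prodpow (pairs (2 * M)) (charge_exp partner (charge b)) (X t) =
         (if ?same b then ?K b * ?u b (X t) else 0) + (if ?same b then 0 else ?K b * ?u b (X t)) / t" for b
      proof -
        have ePQ: "charge_exp partner (charge b) P Q = (if ?same b then 0 else - 1)"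
          by (auto simp: charge_exp_def partner_PQ charge_def)
        have "prodpow (pairs (2 * M)) (charge_exp partner (charge b)) (X t) =
            (X t Q - X t P) powr charge_exp partner (charge b) P Q * ?u b (X t)"
          unfolding pairs_split(1) prodpow_def prod.insert[OF star_bounds(1) pairs_split(2)] prod.case ..
        also have "(X t Q - X t P) powr charge_exp partner (charge b) P Q = (if ?same b then 1 else 1 / t)"
          unfolding ePQ XPQ using elim(2) by (simp add: powr_minus_divide)
        finally show ?thesis by simp
      qed
      have "0 < M" using j by simp
      then show ?case
        unfolding fused_g_expansion[OF \<open>0 < M\<close> web unl c] S_def m_def sum_divide_distrib sum.distrib[symmetric]
        by (intro sum.cong refl tm)
    qed
  qed
  ultimately have "hat x = (\<Sum>b\<in>webs ?V. if ?same b then ?K b * ?u b ?x0 else 0) +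
      (\<Sum>b\<in>webs ?V. if ?same b then 0 else ?K b * (?u b ?x0 * logd ?E0 (charge_exp partner (charge b)) Q ?x0))"
    by (rule merge_limit)
  also have "\<dots> = (\<Sum>b\<in>webs ?V. ?K b * merged b x)"
    unfolding sum.distrib[symmetric]
  proof (rule sum.cong[OF refl])
    fix b
    show "(if ?same b then ?K b * ?u b ?x0 else 0) +
      (if ?same b then 0 else ?K b * (?u b ?x0 * logd ?E0 (charge_exp partner (charge b)) Q ?x0)) = ?K b * merged b x"
      by (cases "?same b") (simp_all add: prodpow_merged[OF x] logd_merged merged_def)
  qed
  finally show ?thesis .
qed

lemma hat_null: "v.nullvec hat"
proof (rule v.nullvec_cong)
  show "v.nullvec (\<lambda>x. \<Sum>b\<in>webs {0<..2 * M}. web_inv {0<..2 * M} web b * merged b x)"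
    by (rule v.nullvec_sum) (simp_all add: finite_webs merged_null)
qed (simp add: hat_expansion)

definition E1 :: "(nat \<times> nat) set" where
  "E1 = {(i, k) \<in> cross M. i \<in> insert P J \<and> k \<in> insert P J}"

lemma smooth_config_E1: "smooth_config (insert P J) E1"
proof
  show "finite (insert P J)" using v.J by simp
  show "finite E1" by (rule finite_subset[OF _ finite_cross[of M]]) (auto simp: E1_def)
  show "E1 \<subseteq> insert P J \<times> insert P J" by (auto simp: E1_def)
qed

sublocale e1: smooth_config "insert P J" E1
  by (rule smooth_config_E1)

lemma smooth_hat: "smooth (insert P J) E1 hat"
proof -
  define r where "r i = (if i = Q then P else i)" for i
  have par: "Suc (r i) div 2 = Suc i div 2" for i using PQ(7,8) by (simp add: r_def)
  have r: "r i \<in> insert P J" if "i \<in> {0<..2 * M}" for i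
    using that unfolding points(1) r_def by auto
  have "smooth (insert P J) E1 (\<lambda>x. fused_g M web (\<lambda>i. x (r i)))"
  proof (rule smooth_substitute[OF smooth_fused_g[OF web] r])
    fix i k assume ik: "(i, k) \<in> cross M"
    then have "r i \<in> insert P J" "r k \<in> insert P J" using r cross_subset by blast+
    moreover have "0 < r i" "r k \<le> 2 * M" using ik PQ by (auto simp: r_def cross_def)
    moreover have "Suc (r i) div 2 < Suc (r k) div 2" unfolding par using ik by (simp add: cross_def)
    ultimately show "(r i, r k) \<in> E1" unfolding E1_def by (simp add: cross_iff)
  qed
  moreover have "hat x = fused_g M web (\<lambda>i. x (r i))" for x
    unfolding hat_def by (rule arg_cong[where f = "fused_g M web"]) (auto simp: r_def fun_eq_iff)
  then have "hat = (\<lambda>x. fused_g M web (\<lambda>i. x (r i)))" by (rule ext)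
  ultimately show ?thesis by (simp only:)
qed

lemma smooth_a:
  assumes l: "l \<in> J" shows "smooth (insert P J) E1 (v.a l)"
proof -
  have ne: "Suc l div 2 \<noteq> Suc P div 2" using l parent_j[of l] PQ(7) by (auto simp: J_mem)
  have V: "0 < l" "l \<le> 2 * M" "0 < P" "P \<le> 2 * M" using l PQ by (auto simp: J_mem)
  have "(P, l) \<in> E1 \<or> (l, P) \<in> E1" using ne V l unfolding E1_def by (auto simp: cross_iff)
  then show ?thesis
  proof
    assume "(P, l) \<in> E1" from smooth_inverse_diff[OF this] show ?thesis by (simp add: v.a_def[abs_def])
  next
    assume e: "(l, P) \<in> E1"
    have "smooth (insert P J) E1 (\<lambda>x. - 1 * (1 / (x P - x l)))"
      by (intro smooth_mult smooth_const smooth_inverse_diff e)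
    moreover have "- 1 * (1 / (x P - x l)) = v.a l x" for x :: "nat \<Rightarrow> real"
      unfolding v.a_def by (metis minus_diff_eq minus_divide_right mult_minus1)
    ultimately show ?thesis by simp
  qed
qed

lemma diag_E1:
  assumes y: "y \<in> config (pairs M)" shows "diag y \<in> config E1"
proof -
  have "strict_mono_on {1..M} y"
    using y by (intro strict_mono_onI) (auto simp: config_def pairs_def)
  from diag_config[OF this] show ?thesis by (auto simp: config_def E1_def)
qed

text \<open>The left-hand side is smooth on \<open>config E1\<close> and vanishes by
  \<open>hat_null\<close> as long as the points of the remaining pairs are distinct; points on the
  diagonal are limits of such points.\<close>

lemma diag_null:
  assumes y: "y \<in> config (pairs M)"
  shows "pderiv_at P (pderiv_at P (pderiv_at P hat)) (diag y)
     - 4 * (v.W2 (diag y) * pderiv_at P hat (diag y) - (\<Sum>l\<in>J. v.a l (diag y) * pderiv_at l (pderiv_at P hat) (diag y)))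
     + 2 * (v.W3 (diag y) * hat (diag y) - (\<Sum>l\<in>J. (v.a l (diag y))\<^sup>2 * pderiv_at l hat (diag y))) = 0"
    (is "?T (diag y) = 0")
proof -
  have div: "smooth (insert P J) E1 (\<lambda>x. f x / k)" if "smooth (insert P J) E1 f" for f and k :: real
    using smooth_mult[OF that smooth_const[of _ _ "1 / k"]] by simp
  have sm: "smooth (insert P J) E1 ?T"
    unfolding v.W2_def v.W3_def
    by (intro smooth_add smooth_diff smooth_mult smooth_const smooth_sum smooth_power div
        e1.smooth_pderiv smooth_hat smooth_a v.J partner_J(1); assumption)
  define X where "X s i = diag y i + (if even i then s else 0)" for s i
  have X: "((\<lambda>s. X s i) \<longlongrightarrow> diag y i) (at_right 0)" for i
    by (cases "even i") (auto simp: X_def intro!: tendsto_eq_intros)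
  have "\<forall>\<^sub>F s in at_right 0. X s \<in> config E1"
    by (rule eventually_config[OF e1.E diag_E1[OF y] X])
  moreover have "\<forall>\<^sub>F s in at_right 0. (0::real) < s" by (rule eventually_at_right_less)
  ultimately have "\<forall>\<^sub>F s in at_right 0. ?T (X s) = 0"
  proof eventually_elim
    case (elim s)
    have "X s i < X s k" if ik: "(i, k) \<in> v.E" for i k
    proof (cases "Suc i div 2 < Suc k div 2")
      case True
      then have "(i, k) \<in> E1" using ik PQ by (auto simp: E1_def cross_iff pairs_on_def J_mem)
      then show ?thesis using elim(1) by (auto simp: config_def)
    next
      case False
      then have "odd i" "k = Suc i" using ik by (auto simp: pairs_on_def; presburger)+
      then show ?thesis using elim(2) by (simp add: X_def diag_def)
    qed
    then have "X s \<in> config v.E" by (auto simp: config_def)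
    then show ?case by (rule v.nullvecD[OF hat_null])
  qed
  then have "((\<lambda>s. ?T (X s)) \<longlongrightarrow> 0) (at_right 0)" by (rule tendsto_eventually)
  moreover have "((\<lambda>s. ?T (X s)) \<longlongrightarrow> ?T (diag y)) (at_right 0)"
    by (rule smooth_tendsto[OF sm e1.E diag_E1[OF y] X])
  ultimately show ?thesis using tendsto_unique[OF trivial_limit_at_right_real] by blast
qed

lemma fiber:
  assumes "l \<in> {1..M} - {j}"
  shows "{i \<in> insert P J. Suc i div 2 = l} = {2 * l - 1, 2 * l}" "{i \<in> J. Suc i div 2 = l} = {2 * l - 1, 2 * l}"
proof -
  have l: "0 < l" "l \<le> M" "l \<noteq> j" "0 < j" using assms j by auto
  have *: "Suc i div 2 = l \<longleftrightarrow> i = 2 * l - 1 \<or> i = 2 * l" for i using l(1) by presburger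
  have "2 * l - 1 \<noteq> 2 * j - 1" "2 * l \<noteq> 2 * j" using l by linarith+
  moreover have "2 * l - 1 \<noteq> 2 * j" "2 * l \<noteq> 2 * j - 1" using l(1,4) by presburger+
  ultimately have "2 * l - 1 \<in> J" "2 * l \<in> J" using l by (auto simp: J_mem P_def Q_def)
  then show "{i \<in> J. Suc i div 2 = l} = {2 * l - 1, 2 * l}" unfolding * by blast
  moreover have "{i \<in> insert P J. Suc i div 2 = l} = {i \<in> J. Suc i div 2 = l}" using PQ(7) assms by auto
  ultimately show "{i \<in> insert P J. Suc i div 2 = l} = {2 * l - 1, 2 * l}" by simp
qed

lemma pderiv_diag:
  assumes f: "smooth (insert P J) E1 f" and y: "y \<in> config (pairs M)"
  shows "pderiv_at l (\<lambda>y. f (diag y)) y = (\<Sum>i\<in>{i \<in> insert P J. Suc i div 2 = l}. pderiv_at i f (diag y))"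
proof -
  have "(Suc i div 2, Suc k div 2) \<in> pairs M" if "(i, k) \<in> E1" for i k
    using that by (auto simp: E1_def cross_def pairs_def)
  from pderiv_substitute[OF smooth_config_E1 f this y]
  show ?thesis unfolding diag_def .
qed

lemma pderiv_diag_j:
  assumes "smooth (insert P J) E1 f" "y \<in> config (pairs M)"
  shows "pderiv_at j (\<lambda>y. f (diag y)) y = pderiv_at P f (diag y)"
proof -
  have "{i \<in> insert P J. Suc i div 2 = j} = {P}"
  proof -
    show ?thesis using PQ(7) parent_j by (auto simp: J_mem)
  qed
  then show ?thesis unfolding pderiv_diag[OF assms] by simp
qed

text \<open>On the diagonal the two points of a pair have the same coefficient, and their partial
  derivatives add up to the derivative in \<open>y l\<close>.\<close>

lemma sum_J_diag:
  assumes f: "smooth (insert P J) E1 f" and y: "y \<in> config (pairs M)"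
  shows "(\<Sum>i\<in>J. (v.a i (diag y)) ^ m * pderiv_at i f (diag y)) =
    (\<Sum>l\<in>{1..M} - {j}. (1 / (y l - y j)) ^ m * pderiv_at l (\<lambda>y. f (diag y)) y)"
    and "(\<Sum>i\<in>J. G (Suc i div 2)) = (\<Sum>l\<in>{1..M} - {j}. 2 * G l :: real)"
proof -
  have img: "(\<lambda>i. Suc i div 2) ` J \<subseteq> {1..M} - {j}"
  proof
    fix l assume "l \<in> (\<lambda>i. Suc i div 2) ` J"
    then obtain i where i: "i \<in> J" "l = Suc i div 2" by blast
    have "i = 2 * l - 1 \<or> i = 2 * l" using i(2) by presburger
    then show "l \<in> {1..M} - {j}" using i(1) by (auto simp: J_mem P_def Q_def)
  qed
  have grp: "(\<Sum>i\<in>J. h i) = (\<Sum>l\<in>{1..M} - {j}. \<Sum>i\<in>{i \<in> J. Suc i div 2 = l}. h i)" for h :: "nat \<Rightarrow> real"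
    by (rule sum.group[OF v.J _ img, symmetric]) simp
  have a: "v.a i (diag y) = 1 / (y (Suc i div 2) - y j)" for i
    using PQ(7) by (simp add: v.a_def diag_def)
  show "(\<Sum>i\<in>J. (v.a i (diag y)) ^ m * pderiv_at i f (diag y)) =
    (\<Sum>l\<in>{1..M} - {j}. (1 / (y l - y j)) ^ m * pderiv_at l (\<lambda>y. f (diag y)) y)"
    unfolding grp
  proof (rule sum.cong[OF refl])
    fix l assume l: "l \<in> {1..M} - {j}"
    show "(\<Sum>i\<in>{i \<in> J. Suc i div 2 = l}. (v.a i (diag y)) ^ m * pderiv_at i f (diag y)) =
      (1 / (y l - y j)) ^ m * pderiv_at l (\<lambda>y. f (diag y)) y"
      unfolding pderiv_diag[OF f y] fiber(1)[OF l] fiber(2)[OF l, symmetric] sum_distrib_left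
      by (rule sum.cong[OF refl]) (simp add: a)
  qed
  show "(\<Sum>i\<in>J. G (Suc i div 2)) = (\<Sum>l\<in>{1..M} - {j}. 2 * G l)"
    unfolding grp
  proof (rule sum.cong[OF refl])
    fix l assume l: "l \<in> {1..M} - {j}"
    have "(\<Sum>i\<in>{i \<in> J. Suc i div 2 = l}. G (Suc i div 2)) = (\<Sum>i\<in>{i \<in> J. Suc i div 2 = l}. G l)"
      by (rule sum.cong) auto
    also have "\<dots> = 2 * G l"
    proof -
      have "2 * l - 1 \<noteq> 2 * l" using l by auto
      then show ?thesis unfolding fiber(2)[OF l] by simp
    qed
    finally show "(\<Sum>i\<in>{i \<in> J. Suc i div 2 = l}. G (Suc i div 2)) = 2 * G l" .
  qed
qed

text \<open>Each pair has two points with two equal terms each: four quarters in \<open>W2\<close>,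
  four halves in \<open>W3\<close>. These are the weights \<open>H\<close> and \<open>2 * H\<close>
  for \<open>H = 1\<close>.\<close>

lemma W_diag:
  assumes y: "y \<in> config (pairs M)"
  shows "v.W2 (diag y) = (\<Sum>l\<in>{1..M} - {j}. 1 / (y l - y j)\<^sup>2)"
    and "v.W3 (diag y) = (\<Sum>l\<in>{1..M} - {j}. 2 / (y l - y j) ^ 3)"
proof -
  have a: "v.a i (diag y) = 1 / (y (Suc i div 2) - y j)" for i
    using PQ(7) by (simp add: v.a_def diag_def)
  have par: "Suc (partner i) div 2 = Suc i div 2" if "i \<in> J" for i
    using that by (auto simp: J_mem partner_def elim!: evenE oddE)
  have "v.W2 (diag y) = (\<Sum>i\<in>J. (\<lambda>l. (1 / (y l - y j)\<^sup>2) / 2) (Suc i div 2))"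
    unfolding v.W2_def sum_divide_distrib
    by (rule sum.cong[OF refl]) (simp add: a par power2_eq_square add_divide_distrib[symmetric])
  also have "\<dots> = (\<Sum>l\<in>{1..M} - {j}. 1 / (y l - y j)\<^sup>2)"
    by (subst sum_J_diag(2)[OF smooth_hat y]) simp
  finally show "v.W2 (diag y) = (\<Sum>l\<in>{1..M} - {j}. 1 / (y l - y j)\<^sup>2)" .
  have "v.W3 (diag y) = (\<Sum>i\<in>J. (\<lambda>l. 1 / (y l - y j) ^ 3) (Suc i div 2))"
    unfolding v.W3_def sum_divide_distrib
    by (rule sum.cong[OF refl]) (simp add: a par power2_eq_square power3_eq_cube add_divide_distrib[symmetric])
  also have "\<dots> = (\<Sum>l\<in>{1..M} - {j}. 2 / (y l - y j) ^ 3)"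
    by (subst sum_J_diag(2)[OF smooth_hat y]) simp
  finally show "v.W3 (diag y) = (\<Sum>l\<in>{1..M} - {j}. 2 / (y l - y j) ^ 3)" .
qed

lemma third_order_pde:
  assumes Z: "\<And>y. y \<in> config (pairs M) \<Longrightarrow> Z y = fused_g M web (diag y)" and y: "y \<in> config (pairs M)"
  shows "pdifferentiable i Z y" "pdifferentiable i (pderiv_at j Z) y"
    "pdifferentiable i (pderiv_at j (pderiv_at j Z)) y"
    "(pderiv_at j ^^ 3) Z y - 4 * L_minus2 1 M j (pderiv_at j Z) y + 2 * L_minus3 1 M j Z y = 0"
proof -
  interpret c: smooth_config "{0<..M}" "pairs M"
    by standard (auto simp: finite_pairs, auto simp: pairs_def)
  let ?F1 = "pderiv_at P hat"
  let ?F2 = "pderiv_at P ?F1"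
  note F = smooth_hat e1.smooth_pderiv[OF smooth_hat, of P] e1.smooth_pderiv[OF e1.smooth_pderiv[OF smooth_hat, of P], of P]
  have par: "(Suc i div 2, Suc k div 2) \<in> pairs M" if "(i, k) \<in> E1" for i k
    using that by (auto simp: E1_def cross_def pairs_def)
  have "smooth {0<..M} (pairs M) (\<lambda>y. hat (\<lambda>i. y (Suc i div 2)))"
    by (rule smooth_substitute[OF smooth_hat _ par]) (use PQ in \<open>auto simp: J_mem\<close>)
  moreover have hz: "hat (diag y) = Z y" if "y \<in> config (pairs M)" for y
  proof -
    have "(diag y)(Q := diag y P) = diag y" using PQ(7,8) by (auto simp: diag_def)
    then show ?thesis using Z[OF that] by (simp add: hat_def)
  qed
  ultimately have sZ: "smooth {0<..M} (pairs M) Z"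
    by (elim smooth_cong) (use hz in \<open>simp add: diag_def\<close>)
  note sZ' = c.smooth_pderiv[OF sZ, of j] c.smooth_pderiv[OF c.smooth_pderiv[OF sZ, of j], of j]
  show "pdifferentiable i Z y" "pdifferentiable i (pderiv_at j Z) y" "pdifferentiable i (pderiv_at j (pderiv_at j Z)) y"
    by (rule c.smooth_pdifferentiable[OF _ y], rule sZ sZ')+
  \<comment> \<open>Each of the following identities holds on the whole open chamber, so it may be
    differentiated once more.\<close>
  have z0: "pderiv_at l Z y = pderiv_at l (\<lambda>y. hat (diag y)) y" if "y \<in> config (pairs M)" for l y
    by (rule c.pderiv_cong[OF that]) (simp add: hz)
  have z1: "pderiv_at j Z y = ?F1 (diag y)" if y: "y \<in> config (pairs M)" for y
    unfolding z0[OF y] by (rule pderiv_diag_j[OF F(1) y])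
  have z1': "pderiv_at l (pderiv_at j Z) y = pderiv_at l (\<lambda>y. ?F1 (diag y)) y" if "y \<in> config (pairs M)" for l y
    by (rule c.pderiv_cong[OF that]) (simp add: z1)
  have z2: "pderiv_at j (pderiv_at j Z) y = ?F2 (diag y)" if y: "y \<in> config (pairs M)" for y
    unfolding z1'[OF y] by (rule pderiv_diag_j[OF F(2) y])
  have z3: "pderiv_at j (pderiv_at j (pderiv_at j Z)) y = pderiv_at P ?F2 (diag y)"
    by (rule trans[OF c.pderiv_cong[OF y z2] pderiv_diag_j[OF F(3) y]])
  have 2: "L_minus2 1 M j (pderiv_at j Z) y = v.W2 (diag y) * ?F1 (diag y) - (\<Sum>l\<in>J. v.a l (diag y) * pderiv_at l ?F1 (diag y))"
    unfolding L_minus2_def sum_subtractf W_diag(1)[OF y] sum_distrib_right z1'[OF y] z1[OF y]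
    using sum_J_diag(1)[OF F(2) y, of 1] by simp
  have 3: "L_minus3 1 M j Z y = v.W3 (diag y) * hat (diag y) - (\<Sum>l\<in>J. (v.a l (diag y))\<^sup>2 * pderiv_at l hat (diag y))"
    unfolding L_minus3_def sum_subtractf W_diag(2)[OF y] sum_distrib_right z0[OF y] hz[OF y]
    using sum_J_diag(1)[OF F(1) y, of 2] by (simp add: power_divide)
  show "(pderiv_at j ^^ 3) Z y - 4 * L_minus2 1 M j (pderiv_at j Z) y + 2 * L_minus3 1 M j Z y = 0"
    using diag_null[OF y] unfolding 2 3 by (simp add: numeral_3_eq_3 z3)
qed

end

lemma chamber_config: "chamber m = config (pairs m)"
proof (intro equalityI subsetI)
  fix x assume "x \<in> chamber m"
  then have x: "strict_mono_on {1..m} x" by (simp add: chamber_def)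
  have "x i < x k" if "(i, k) \<in> pairs m" for i k
    using that by (intro strict_mono_onD[OF x]) (auto simp: pairs_def)
  then show "x \<in> config (pairs m)" by (auto simp: config_def)
next
  fix x assume "x \<in> config (pairs m)"
  then show "x \<in> chamber m"
    unfolding chamber_def mem_Collect_eq by (intro strict_mono_onI) (auto simp: config_def pairs_def)
qed

theorem proposition1p2:
  fixes N :: nat and L :: link_pattern and \<kappa> H :: real
  assumes "N \<ge> 1"
    and "L \<in> link_patterns (replicate (2*N) 2)"
    and "\<kappa> = 4" and "H = 1"
  shows
    "(\<forall>y\<in>chamber (2*N).
        (fusion_quotient N L \<longlongrightarrow> Z_fused N L y) (fusion_filter N y) \<and> Z_fused N L y > 0)
     \<and>
     (\<forall>j\<in>{1..2*N}. \<forall>y\<in>chamber (2*N).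
        (\<forall>i\<in>{1..2*N}. pdifferentiable i (Z_fused N L) y \<and>
                       pdifferentiable i (pderiv_at j (Z_fused N L)) y) \<and>
        pdifferentiable j (pderiv_at j (pderiv_at j (Z_fused N L))) y \<and>
        (pderiv_at j ^^ 3) (Z_fused N L) y
          - 16 / \<kappa> * L_minus2 H (2*N) j (pderiv_at j (Z_fused N L)) y
          + 8 * (8 - \<kappa>) / \<kappa>^2 * L_minus3 H (2*N) j (Z_fused N L) y = 0)
     \<and>
     (\<forall>a b c d. a * d - b * c > 0 \<longrightarrow>
        (\<forall>y\<in>chamber (2*N).
          (\<forall>i\<in>{1..2*N}. c * y i + d \<noteq> 0) \<longrightarrow>
          (\<lambda>i. moebius_map a b c d (y i)) \<in> chamber (2*N) \<longrightarrow>
          Z_fused N L y =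
            (\<Prod>i=1..2*N. deriv (moebius_map a b c d) (y i) powr H) *
            Z_fused N L (\<lambda>i. moebius_map a b c d (y i))))"
proof -
  obtain p where p: "p \<in> webs {0<..2 * (2 * N)}" "split_pattern (replicate (2 * N) 2) L = pattern p" "unlinked p"
    using split_pattern_two[OF assms(2)] by blast
  note Z = Z_fused_eq[OF assms(1) p(1,3,2)]
  have N: "0 < 2 * N" using assms(1) by simp
  have "(\<forall>y\<in>chamber (2*N).
        (fusion_quotient N L \<longlongrightarrow> Z_fused N L y) (fusion_filter N y) \<and> Z_fused N L y > 0)"
  proof (intro ballI conjI)
    fix y assume y: "y \<in> chamber (2*N)"
    show "(fusion_quotient N L \<longlongrightarrow> Z_fused N L y) (fusion_filter N y)" unfolding Z(2)[OF y] by (rule Z(1)[OF y])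
    show "Z_fused N L y > 0" unfolding Z(2)[OF y]
      by (rule fused_g_diag_pos[OF _ N p(1,3)]) (use y in \<open>simp add: chamber_def\<close>)
  qed
  moreover have "(\<forall>j\<in>{1..2*N}. \<forall>y\<in>chamber (2*N).
        (\<forall>i\<in>{1..2*N}. pdifferentiable i (Z_fused N L) y \<and>
                       pdifferentiable i (pderiv_at j (Z_fused N L)) y) \<and>
        pdifferentiable j (pderiv_at j (pderiv_at j (Z_fused N L))) y \<and>
        (pderiv_at j ^^ 3) (Z_fused N L) y
          - 16 / \<kappa> * L_minus2 H (2*N) j (pderiv_at j (Z_fused N L)) y
          + 8 * (8 - \<kappa>) / \<kappa>^2 * L_minus3 H (2*N) j (Z_fused N L) y = 0)"
  proof (intro ballI)
    fix j y assume j: "j \<in> {1..2*N}" and y: "y \<in> chamber (2*N)"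
    interpret fused_point "2 * N" j p by standard (use j p in auto)
    have y': "y \<in> config (pairs (2 * N))" using y by (simp add: chamber_config)
    have Z': "Z_fused N L y = fused_g (2 * N) p (diag y)" if "y \<in> config (pairs (2 * N))" for y
      using Z(2) that by (simp add: chamber_config)
    have pde: "pdifferentiable i (Z_fused N L) y" "pdifferentiable i (pderiv_at j (Z_fused N L)) y"
      "pdifferentiable i (pderiv_at j (pderiv_at j (Z_fused N L))) y"
      "(pderiv_at j ^^ 3) (Z_fused N L) y - 4 * L_minus2 1 (2 * N) j (pderiv_at j (Z_fused N L)) y +
         2 * L_minus3 1 (2 * N) j (Z_fused N L) y = 0" for i
      by (rule third_order_pde, erule Z', rule y')+
    show "(\<forall>i\<in>{1..2*N}. pdifferentiable i (Z_fused N L) y \<and>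
                       pdifferentiable i (pderiv_at j (Z_fused N L)) y) \<and>
        pdifferentiable j (pderiv_at j (pderiv_at j (Z_fused N L))) y \<and>
        (pderiv_at j ^^ 3) (Z_fused N L) y
          - 16 / \<kappa> * L_minus2 H (2*N) j (pderiv_at j (Z_fused N L)) y
          + 8 * (8 - \<kappa>) / \<kappa>^2 * L_minus3 H (2*N) j (Z_fused N L) y = 0"
    proof (intro conjI ballI)
      show "(pderiv_at j ^^ 3) (Z_fused N L) y
          - 16 / \<kappa> * L_minus2 H (2*N) j (pderiv_at j (Z_fused N L)) y
          + 8 * (8 - \<kappa>) / \<kappa>^2 * L_minus3 H (2*N) j (Z_fused N L) y = 0"
        \<comment> \<open>At \<open>\<kappa> = 4\<close> the constants are \<open>16 / 4 = 4\<close>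
          and \<open>8 * 4 / 16 = 2\<close>.\<close>
        using pde(4) unfolding assms(3,4) by (simp del: funpow.simps)
    qed (rule pde)+
  qed
  moreover have "(\<forall>a b c d. a * d - b * c > 0 \<longrightarrow>
        (\<forall>y\<in>chamber (2*N).
          (\<forall>i\<in>{1..2*N}. c * y i + d \<noteq> 0) \<longrightarrow>
          (\<lambda>i. moebius_map a b c d (y i)) \<in> chamber (2*N) \<longrightarrow>
          Z_fused N L y =
            (\<Prod>i=1..2*N. deriv (moebius_map a b c d) (y i) powr H) *
            Z_fused N L (\<lambda>i. moebius_map a b c d (y i))))"
  proof (intro allI impI ballI)
    fix a b c d y
    assume D: "a * d - b * c > (0::real)" and y: "y \<in> chamber (2*N)" and nz: "\<forall>i\<in>{1..2*N}. c * y i + d \<noteq> 0"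
      and my: "(\<lambda>i. moebius_map a b c d (y i)) \<in> chamber (2*N)"
    show "Z_fused N L y =
            (\<Prod>i=1..2*N. deriv (moebius_map a b c d) (y i) powr H) *
            Z_fused N L (\<lambda>i. moebius_map a b c d (y i))"
      unfolding Z(2)[OF y] Z(2)[OF my] assms(4)
      by (rule fused_g_moebius[OF N p(1,3)]) (use D y nz my in \<open>auto simp: chamber_def\<close>)
  qed
  ultimately show ?thesis by (intro conjI)
qed

end
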